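(* Let $k$ be a field with $\mathbb{Q}\subseteq k$, $C$ a coalgebra over $k$, $B\subseteq P$ a principal $C$-extension, and $\ell:C\to P\otimes P$, $\ell(c)=:c^{\langle 1\rangle}\otimes c^{\langle 2\rangle}$ (summation understood), a strong connection. Let $\varphi:V_\varphi\to V_\varphi\otimes C$ be a finite-dimensional corepresentation (right $C$-comodule) with character $c_\varphi:=\sum_{i=1}^{\dim V_\varphi}e_{ii}\in C$, where $\{e_i\}_i$ is a basis of $V_\varphi$ and $\varphi(e_j)=\sum_i e_i\otimes e_{ij}$. Then for all $n\in\mathbb{N}$ the Chern-Galois character $chg_{2n}:R_f(C)\to HC_{2n}(B)$ is given by $$chg_{2n}([\varphi])=(-1)^n\Bigl[c_{\varphi\,(2n+1)}{}^{\langle 2\rangle}c_{\varphi\,(1)}{}^{\langle 1\rangle}\otimes c_{\varphi\,(1)}{}^{\langle 2\rangle}c_{\varphi\,(2)}{}^{\langle 1\rangle}\otimes\cdots\otimes c_{\varphi\,(2n)}{}^{\langle 2\rangle}c_{\varphi\,(2n+1)}{}^{\langle 1\rangle}\Bigr],$$ where $c_{\varphi\,(1)}\otimes\cdots\otimes c_{\varphi\,(2n+1)}\in C^{\otimes(2n+1)}$ is the $2n$-fold iterated coproduct of $c_\varphi$, and the bracket denotes the class in $HC_{2n}(B)$ of the element of $B^{\otimes(2n+1)}$ inside it (for $n=0$ this reads $[c_\varphi{}^{\langle 2\rangle}c_\varphi{}^{\langle 1\rangle}]$).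
   Context: Algebras are associative and unital, coalgebras coassociative and counital, all over the field $k$; $\otimes=\otimes_k$. $\Delta$ is the coproduct of $C$, $\Delta c=c_{(1)}\otimes c_{(2)}$. $C$-extension: let $C$ be a coalgebra and let $P$ be an algebra that is also a right $C$-comodule via $\Delta_P:P\to P\otimes C$. Put $B=P^{co\,C}:=\{b\in P \mid \Delta_P(bp)=b\,\Delta_P(p)\ \text{for all } p\in P\}$. The inclusion $B\subseteq P$ is called a $C$-extension. A $C$-extension $B\subseteq P$ is principal if: (1) $can_R: P\otimes_B P\to P\otimes C$, $p\otimes_B p'\mapsto p\,\Delta_P(p')$, is bijective; (2) $\psi:C\otimes P\to P\otimes C$, $c\otimes p\mapsto can_R(can_R^{-1}(1\otimes c)\,p)$, is bijective; (3) there is a group-like element $e\in C$ such that $\Delta_P(p)=\psi(e\otimes p)$ for all $p\in P$; (4) $P$ is $C$-equivariantly projective as a left $B$-module: for all left $B$-modules $M,N$ that are right $C$-comodules with $B$-linear coactions, every $B$-linear $C$-colinear epimorphism $\pi:M\to N$ split as a $C$-comodule map, and every $B$-linear $C$-colinear $f:P\to N$, there is a $B$-linear $C$-colinear $g:P\to M$ with $\pi\circ g=f$. Left coaction: ${}_P\Delta:P\to C\otimes P$, ${}_P\Delta(p)=\psi^{-1}(p\otimes e)$. Translation map: $\tau:C\to P\otimes_B P$, $\tau(c)=can_R^{-1}(1\otimes c)$. Let $\pi_B:P\otimes P\to P\otimes_B P$ be the canonical surjection. Strong connection (in the form used here): a linear map $\ell:C\to P\otimes P$ such that $\pi_B\circ\ell=\tau$,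 $(\mathrm{id}\otimes\Delta_P)\circ\ell=(\ell\otimes\mathrm{id})\circ\Delta$, $({}_P\Delta\otimes\mathrm{id})\circ\ell=(\mathrm{id}\otimes\ell)\circ\Delta$, and $\ell(e)=1\otimes 1$. Cyclic homology: since $\mathbb{Q}\subseteq k$, $HC_m(B)$ is the homology of Connes' complex $C^\lambda_m(B)=B^{\otimes(m+1)}/\mathrm{im}(1-t)$, $t(b_0\otimes\cdots\otimes b_m)=(-1)^m b_m\otimes b_0\otimes\cdots\otimes b_{m-1}$, with differential induced by the Hochschild boundary. Chern character: $K_0(B)$ is the Grothendieck group of finitely generated projective left $B$-modules. For an idempotent $E\in M_N(B)$ representing the module $B^NE$, $ch_{2n}:K_0(B)\to HC_{2n}(B)$ is $ch_{2n}([B^NE])=(-1)^n\bigl[\sum_{i_0,\dots,i_{2n}}E_{i_0i_1}\otimes E_{i_1i_2}\otimes\cdots\otimes E_{i_{2n}i_0}\bigr]$. Chern-Galois character: $R_f(C)$ is the Grothendieck group of the semigroup (under direct sum) of isomorphism classes of finite-dimensional corepresentations of $C$. For such $\varphi$, the space $\mathrm{Hom}^C(V_\varphi,P)$ of right $C$-colinear maps is a left $B$-module via $(bf)(v)=b\,f(v)$ and is finitely generated projective, and $[\varphi]\mapsto[\mathrm{Hom}^C(V_\varphi,P)]$ defines a homomorphism of Abelian groups $R_f(C)\to K_0(B)$. Then $chg_{2n}:R_f(C)\to HC_{2n}(B)$ is the composition of this homomorphism with $ch_{2n}$. *)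

theory Defs
  imports Complex_Main "HOL-Algebra.Module" "HOL-Algebra.Free_Abelian_Groups"
begin

section \<open>Abelian groups given by generators and relations\<close>

definition presented_group :: "'x set \<Rightarrow> ('x \<Rightarrow>\<^sub>0 int) set \<Rightarrow> ('x \<Rightarrow>\<^sub>0 int) set monoid" where
  "presented_group X R = free_Abelian_group X Mod generate (free_Abelian_group X) R"

definition presented_class :: "'x set \<Rightarrow> ('x \<Rightarrow>\<^sub>0 int) set \<Rightarrow> ('x \<Rightarrow>\<^sub>0 int) \<Rightarrow> ('x \<Rightarrow>\<^sub>0 int) set" where
  "presented_class X R z = generate (free_Abelian_group X) R #>\<^bsub>free_Abelian_group X\<^esub> z"

text \<open>The homomorphism into \<open>G\<close> induced by a map \<open>f\<close> on generators, evaluated at the class \<open>A\<close>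
  through a representing formal sum. It is only used for maps \<open>f\<close> that respect the relations,
  so the choice of the representative is immaterial.\<close>

definition rep :: "('x \<Rightarrow>\<^sub>0 int) set \<Rightarrow> ('x \<Rightarrow>\<^sub>0 int)" where
  "rep A = (SOME z. z \<in> A)"

definition lift_hom :: "('g, 'z) monoid_scheme \<Rightarrow> ('x \<Rightarrow> 'g) \<Rightarrow> ('x \<Rightarrow>\<^sub>0 int) set \<Rightarrow> 'g" where
  "lift_hom G f A =
     finprod G (\<lambda>x. f x [^]\<^bsub>G\<^esub> Poly_Mapping.lookup (rep A) x) (Poly_Mapping.keys (rep A))"

section \<open>Modules over a ring, not necessarily commutative\<close>

text \<open>The scalars form a unital subring \<open>R\<close> of a type. The class \<open>ring_1\<close> is avoided because it
  excludes the zero ring; the multiplicative fields of a \<open>module\<close> record are not used.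
  A vector space over the field \<open>'k\<close> is a left module over \<open>UNIV :: 'k set\<close>.\<close>

definition left_module :: "'r::{ring,monoid_mult} set \<Rightarrow> ('r, 'm, 'z) module_scheme \<Rightarrow> bool" where
  "left_module R M \<longleftrightarrow> abelian_group M \<and>
     (\<forall>r\<in>R. \<forall>x\<in>carrier M. r \<odot>\<^bsub>M\<^esub> x \<in> carrier M) \<and>
     (\<forall>r\<in>R. \<forall>x\<in>carrier M. \<forall>y\<in>carrier M. r \<odot>\<^bsub>M\<^esub> (x \<oplus>\<^bsub>M\<^esub> y) = r \<odot>\<^bsub>M\<^esub> x \<oplus>\<^bsub>M\<^esub> r \<odot>\<^bsub>M\<^esub> y) \<and>
     (\<forall>r\<in>R. \<forall>s\<in>R. \<forall>x\<in>carrier M. (r + s) \<odot>\<^bsub>M\<^esub> x = r \<odot>\<^bsub>M\<^esub> x \<oplus>\<^bsub>M\<^esub> s \<odot>\<^bsub>M\<^esub> x) \<and>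
     (\<forall>r\<in>R. \<forall>s\<in>R. \<forall>x\<in>carrier M. (r * s) \<odot>\<^bsub>M\<^esub> x = r \<odot>\<^bsub>M\<^esub> (s \<odot>\<^bsub>M\<^esub> x)) \<and>
     (\<forall>x\<in>carrier M. 1 \<odot>\<^bsub>M\<^esub> x = x)"

definition lin_map ::
  "'r set \<Rightarrow> ('r, 'm, 'y) module_scheme \<Rightarrow> ('r, 'n, 'z) module_scheme \<Rightarrow> ('m \<Rightarrow> 'n) \<Rightarrow> bool" where
  "lin_map R M N f \<longleftrightarrow> f \<in> carrier M \<rightarrow> carrier N \<and>
     (\<forall>x\<in>carrier M. \<forall>y\<in>carrier M. f (x \<oplus>\<^bsub>M\<^esub> y) = f x \<oplus>\<^bsub>N\<^esub> f y) \<and>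
     (\<forall>r\<in>R. \<forall>x\<in>carrier M. f (r \<odot>\<^bsub>M\<^esub> x) = r \<odot>\<^bsub>N\<^esub> f x)"

definition module_iso ::
  "'r set \<Rightarrow> ('r, 'm, 'y) module_scheme \<Rightarrow> ('r, 'n, 'z) module_scheme \<Rightarrow> bool" where
  "module_iso R M N \<longleftrightarrow> (\<exists>f. lin_map R M N f \<and> bij_betw f (carrier M) (carrier N))"

definition module_of :: "('r \<Rightarrow> 'a \<Rightarrow> 'a) \<Rightarrow> 'a::ab_group_add set \<Rightarrow> ('r, 'a) module" where
  "module_of s A =
     \<lparr>carrier = A, monoid.mult = undefined, one = undefined, ring.zero = 0, ring.add = (+), smult = s\<rparr>"

definition direct_sum ::
  "('r, 'm, 'y) module_scheme \<Rightarrow> ('r, 'n, 'z) module_scheme \<Rightarrow> ('r, 'm \<times> 'n) module" where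
  "direct_sum M N =
     \<lparr>carrier = carrier M \<times> carrier N, monoid.mult = undefined, one = undefined,
      ring.zero = (\<zero>\<^bsub>M\<^esub>, \<zero>\<^bsub>N\<^esub>),
      ring.add = (\<lambda>(x, y) (x', y'). (x \<oplus>\<^bsub>M\<^esub> x', y \<oplus>\<^bsub>N\<^esub> y')),
      smult = (\<lambda>r (x, y). (r \<odot>\<^bsub>M\<^esub> x, r \<odot>\<^bsub>N\<^esub> y))\<rparr>"

definition is_basis :: "('k::field, 'v, 'z) module_scheme \<Rightarrow> nat \<Rightarrow> (nat \<Rightarrow> 'v) \<Rightarrow> bool" where
  "is_basis V d e \<longleftrightarrow> e \<in> {..<d} \<rightarrow> carrier V \<and>
     (\<forall>v\<in>carrier V. \<exists>!a. a \<in> {..<d} \<rightarrow>\<^sub>E UNIV \<and> v = (\<Oplus>\<^bsub>V\<^esub>i\<in>{..<d}. a i \<odot>\<^bsub>V\<^esub> e i))"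

definition finite_dimensional :: "('k::field, 'v, 'z) module_scheme \<Rightarrow> bool" where
  "finite_dimensional V \<longleftrightarrow> (\<exists>d e. is_basis V d e)"

section \<open>Tensor products\<close>

text \<open>\<open>V \<otimes>\<^sub>R W\<close> for a right action \<open>\<rho>\<close> of \<open>R\<close> on \<open>V\<close> and a left action \<open>lam\<close> of \<open>R\<close> on \<open>W\<close>.\<close>

definition balanced_rel ::
  "'r set \<Rightarrow> ('a, 'y) ring_scheme \<Rightarrow> ('a \<Rightarrow> 'r \<Rightarrow> 'a) \<Rightarrow> ('b, 'z) ring_scheme \<Rightarrow> ('r \<Rightarrow> 'b \<Rightarrow> 'b)
     \<Rightarrow> (('a \<times> 'b) \<Rightarrow>\<^sub>0 int) set" where
  "balanced_rel R V \<rho> W lam =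
     {frag_of (x \<oplus>\<^bsub>V\<^esub> x', y) - frag_of (x, y) - frag_of (x', y) | x x' y.
        x \<in> carrier V \<and> x' \<in> carrier V \<and> y \<in> carrier W} \<union>
     {frag_of (x, y \<oplus>\<^bsub>W\<^esub> y') - frag_of (x, y) - frag_of (x, y') | x y y'.
        x \<in> carrier V \<and> y \<in> carrier W \<and> y' \<in> carrier W} \<union>
     {frag_of (\<rho> x r, y) - frag_of (x, lam r y) | x r y.
        x \<in> carrier V \<and> r \<in> R \<and> y \<in> carrier W}"

definition pure_over ::
  "'r set \<Rightarrow> ('a, 'y) ring_scheme \<Rightarrow> ('a \<Rightarrow> 'r \<Rightarrow> 'a) \<Rightarrow> ('b, 'z) ring_scheme \<Rightarrow> ('r \<Rightarrow> 'b \<Rightarrow> 'b)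
     \<Rightarrow> 'a \<Rightarrow> 'b \<Rightarrow> (('a \<times> 'b) \<Rightarrow>\<^sub>0 int) set" where
  "pure_over R V \<rho> W lam x y =
     presented_class (carrier V \<times> carrier W) (balanced_rel R V \<rho> W lam) (frag_of (x, y))"

definition tensor_over ::
  "'r set \<Rightarrow> ('k, 'a, 'y) module_scheme \<Rightarrow> ('a \<Rightarrow> 'r \<Rightarrow> 'a)
     \<Rightarrow> ('k, 'b, 'z) module_scheme \<Rightarrow> ('r \<Rightarrow> 'b \<Rightarrow> 'b)
     \<Rightarrow> ('k, (('a \<times> 'b) \<Rightarrow>\<^sub>0 int) set) module" where
  "tensor_over R V \<rho> W lam =
     (let Q = presented_group (carrier V \<times> carrier W) (balanced_rel R V \<rho> W lam)
      in \<lparr>carrier = carrier Q, monoid.mult = undefined, one = undefined,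
          ring.zero = one Q, ring.add = monoid.mult Q,
          smult = (\<lambda>r. lift_hom Q (\<lambda>(x, y). pure_over R V \<rho> W lam (r \<odot>\<^bsub>V\<^esub> x) y))\<rparr>)"

abbreviation tensor ::
  "('k::field, 'a, 'y) module_scheme \<Rightarrow> ('k, 'b, 'z) module_scheme
     \<Rightarrow> ('k, (('a \<times> 'b) \<Rightarrow>\<^sub>0 int) set) module" where
  "tensor V W \<equiv> tensor_over UNIV V (\<lambda>x r. r \<odot>\<^bsub>V\<^esub> x) W (\<lambda>r y. r \<odot>\<^bsub>W\<^esub> y)"

abbreviation pure ::
  "('k::field, 'a, 'y) module_scheme \<Rightarrow> ('k, 'b, 'z) module_scheme \<Rightarrow> 'a \<Rightarrow> 'b
     \<Rightarrow> (('a \<times> 'b) \<Rightarrow>\<^sub>0 int) set" where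
  "pure V W \<equiv> pure_over UNIV V (\<lambda>x r. r \<odot>\<^bsub>V\<^esub> x) W (\<lambda>r y. r \<odot>\<^bsub>W\<^esub> y)"

text \<open>\<open>tensor_lift T f\<close> is the additive map into \<open>T\<close> determined by \<open>x \<otimes> y \<mapsto> f (x, y)\<close>.\<close>

abbreviation tensor_lift ::
  "('g, 'z) ring_scheme \<Rightarrow> ('x \<Rightarrow> 'g) \<Rightarrow> ('x \<Rightarrow>\<^sub>0 int) set \<Rightarrow> 'g" where
  "tensor_lift T \<equiv> lift_hom (add_monoid T)"

definition tensor_map ::
  "('k::field, 'c, 'y) module_scheme \<Rightarrow> ('k, 'd, 'z) module_scheme \<Rightarrow> ('a \<Rightarrow> 'c) \<Rightarrow> ('b \<Rightarrow> 'd)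
     \<Rightarrow> (('a \<times> 'b) \<Rightarrow>\<^sub>0 int) set \<Rightarrow> (('c \<times> 'd) \<Rightarrow>\<^sub>0 int) set" where
  "tensor_map V W f g = tensor_lift (tensor V W) (\<lambda>(x, y). pure V W (f x) (g y))"

text \<open>The canonical isomorphism \<open>(U \<otimes> V) \<otimes> W \<rightarrow> U \<otimes> (V \<otimes> W)\<close>.\<close>

definition tensor_assoc ::
  "('k::field, 'a, 'x) module_scheme \<Rightarrow> ('k, 'b, 'y) module_scheme \<Rightarrow> ('k, 'c, 'z) module_scheme
     \<Rightarrow> (((('a \<times> 'b) \<Rightarrow>\<^sub>0 int) set \<times> 'c) \<Rightarrow>\<^sub>0 int) set
     \<Rightarrow> (('a \<times> (('b \<times> 'c) \<Rightarrow>\<^sub>0 int) set) \<Rightarrow>\<^sub>0 int) set" where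
  "tensor_assoc U V W =
     (let T = tensor U (tensor V W)
      in tensor_lift T (\<lambda>(A, w).
           tensor_lift T (\<lambda>(u, v). pure U (tensor V W) u (pure V W v w)) A))"

text \<open>The \<open>m\<close>-fold tensor power over the ground field, for \<open>m \<ge> 1\<close>, generated by the words of
  length \<open>m\<close>; the word \<open>[v\<^sub>1, \<dots>, v\<^sub>m]\<close> stands for \<open>v\<^sub>1 \<otimes> \<dots> \<otimes> v\<^sub>m\<close>.\<close>

definition words :: "('k, 'v, 'z) module_scheme \<Rightarrow> nat \<Rightarrow> 'v list set" where
  "words V m = {xs. length xs = m \<and> set xs \<subseteq> carrier V}"

definition multilinear_rel :: "('k, 'v, 'z) module_scheme \<Rightarrow> nat \<Rightarrow> ('v list \<Rightarrow>\<^sub>0 int) set" where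
  "multilinear_rel V m =
     {frag_of (xs[i := x \<oplus>\<^bsub>V\<^esub> y]) - frag_of (xs[i := x]) - frag_of (xs[i := y]) | xs i x y.
        xs \<in> words V m \<and> i < m \<and> x \<in> carrier V \<and> y \<in> carrier V} \<union>
     {frag_of (xs[i := r \<odot>\<^bsub>V\<^esub> (xs ! i)]) - frag_of (xs[j := r \<odot>\<^bsub>V\<^esub> (xs ! j)]) | xs i j r.
        xs \<in> words V m \<and> i < m \<and> j < m}"

definition tensor_power :: "('k, 'v, 'z) module_scheme \<Rightarrow> nat \<Rightarrow> ('v list \<Rightarrow>\<^sub>0 int) set monoid" where
  "tensor_power V m = presented_group (words V m) (multilinear_rel V m)"

definition power_class ::
  "('k, 'v, 'z) module_scheme \<Rightarrow> nat \<Rightarrow> ('v list \<Rightarrow>\<^sub>0 int) \<Rightarrow> ('v list \<Rightarrow>\<^sub>0 int) set" where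
  "power_class V m z = presented_class (words V m) (multilinear_rel V m) z"

section \<open>Coalgebras, comodules and principal extensions\<close>

text \<open>The underlying vector spaces of the coalgebra \<open>C\<close> and of the algebra \<open>P\<close> are full types.\<close>

record ('k, 'c) coalg =
  coalg_scale :: "'k \<Rightarrow> 'c \<Rightarrow> 'c"
  comult :: "'c \<Rightarrow> (('c \<times> 'c) \<Rightarrow>\<^sub>0 int) set"
  counit :: "'c \<Rightarrow> 'k"

record ('k, 'v, 'c) comod = "('k, 'v) module" +
  coact :: "'v \<Rightarrow> (('v \<times> 'c) \<Rightarrow>\<^sub>0 int) set"

record ('k, 'p, 'c) comod_alg =
  alg_scale :: "'k \<Rightarrow> 'p \<Rightarrow> 'p"
  alg_coact :: "'p \<Rightarrow> (('p \<times> 'c) \<Rightarrow>\<^sub>0 int) set"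

abbreviation coalg_space :: "('k, 'c::ab_group_add) coalg \<Rightarrow> ('k, 'c) module" where
  "coalg_space C \<equiv> module_of (coalg_scale C) UNIV"

abbreviation alg_space :: "('k, 'p::ab_group_add, 'c) comod_alg \<Rightarrow> ('k, 'p) module" where
  "alg_space P \<equiv> module_of (alg_scale P) UNIV"

definition ground_space :: "('k::field, 'k) module" where
  "ground_space = module_of (*) UNIV"

definition coalgebra :: "('k::field, 'c::ab_group_add) coalg \<Rightarrow> bool" where
  "coalgebra C \<longleftrightarrow>
     (let S = coalg_space C; \<Delta> = comult C; \<epsilon> = counit C in
      vector_space (coalg_scale C) \<and>
      lin_map UNIV S (tensor S S) \<Delta> \<and>
      lin_map UNIV S ground_space \<epsilon> \<and>
      (\<forall>c. tensor_assoc S S S (tensor_map (tensor S S) S \<Delta> id (\<Delta> c))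
           = tensor_map S (tensor S S) id \<Delta> (\<Delta> c)) \<and>
      (\<forall>c. tensor_lift S (\<lambda>(a, b). coalg_scale C (\<epsilon> a) b) (\<Delta> c) = c) \<and>
      (\<forall>c. tensor_lift S (\<lambda>(a, b). coalg_scale C (\<epsilon> b) a) (\<Delta> c) = c))"

definition group_like :: "('k::field, 'c::ab_group_add) coalg \<Rightarrow> 'c \<Rightarrow> bool" where
  "group_like C g \<longleftrightarrow>
     comult C g = pure (coalg_space C) (coalg_space C) g g \<and> counit C g = 1"

definition comodule ::
  "('k::field, 'c::ab_group_add) coalg \<Rightarrow> ('k, 'v, 'c, 'z) comod_scheme \<Rightarrow> bool" where
  "comodule C V \<longleftrightarrow>
     (let S = coalg_space C in
      left_module UNIV V \<and>
      lin_map UNIV V (tensor V S) (coact V) \<and>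
      (\<forall>v\<in>carrier V.
         tensor_assoc V S S (tensor_map (tensor V S) S (coact V) id (coact V v))
         = tensor_map V (tensor S S) id (comult C) (coact V v)) \<and>
      (\<forall>v\<in>carrier V. tensor_lift V (\<lambda>(x, c). counit C c \<odot>\<^bsub>V\<^esub> x) (coact V v) = v))"

definition colinear ::
  "('k::field, 'c::ab_group_add) coalg \<Rightarrow> ('k, 'v, 'c, 'y) comod_scheme
     \<Rightarrow> ('k, 'w, 'c, 'z) comod_scheme \<Rightarrow> ('v \<Rightarrow> 'w) \<Rightarrow> bool" where
  "colinear C V W f \<longleftrightarrow> lin_map UNIV V W f \<and>
     (\<forall>v\<in>carrier V. coact W (f v) = tensor_map W (coalg_space C) f id (coact V v))"

definition alg_comod :: "('k, 'p::ab_group_add, 'c) comod_alg \<Rightarrow> ('k, 'p, 'c) comod" where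
  "alg_comod P =
     \<lparr>carrier = UNIV, monoid.mult = undefined, one = undefined, ring.zero = 0, ring.add = (+),
      smult = alg_scale P, coact = alg_coact P\<rparr>"

text \<open>\<open>P\<close> is an algebra and a right \<open>C\<close>-comodule; the coaction is not assumed multiplicative.\<close>

definition algebra_comodule ::
  "('k::field, 'c::ab_group_add) coalg \<Rightarrow> ('k, 'p::{ring,monoid_mult}, 'c) comod_alg \<Rightarrow> bool" where
  "algebra_comodule C P \<longleftrightarrow>
     vector_space (alg_scale P) \<and>
     (\<forall>r x y. alg_scale P r (x * y) = alg_scale P r x * y) \<and>
     (\<forall>r x y. alg_scale P r (x * y) = x * alg_scale P r y) \<and>
     comodule C (alg_comod P)"

text \<open>Left multiplication \<open>b (q \<otimes> c) = b q \<otimes> c\<close> on \<open>P \<otimes> C\<close>.\<close>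

definition left_mult ::
  "('k::field, 'c::ab_group_add) coalg \<Rightarrow> ('k, 'p::{ring,monoid_mult}, 'c) comod_alg \<Rightarrow> 'p
     \<Rightarrow> (('p \<times> 'c) \<Rightarrow>\<^sub>0 int) set \<Rightarrow> (('p \<times> 'c) \<Rightarrow>\<^sub>0 int) set" where
  "left_mult C P b = tensor_map (alg_space P) (coalg_space C) (\<lambda>q. b * q) id"

definition coinvariants ::
  "('k::field, 'c::ab_group_add) coalg \<Rightarrow> ('k, 'p::{ring,monoid_mult}, 'c) comod_alg \<Rightarrow> 'p set" where
  "coinvariants C P = {b. \<forall>p. alg_coact P (b * p) = left_mult C P b (alg_coact P p)}"

abbreviation tensorB ::
  "('k::field, 'c::ab_group_add) coalg \<Rightarrow> ('k, 'p::{ring,monoid_mult}, 'c) comod_alg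
     \<Rightarrow> ('k, (('p \<times> 'p) \<Rightarrow>\<^sub>0 int) set) module" where
  "tensorB C P \<equiv> tensor_over (coinvariants C P) (alg_space P) (*) (alg_space P) (*)"

abbreviation pureB ::
  "('k::field, 'c::ab_group_add) coalg \<Rightarrow> ('k, 'p::{ring,monoid_mult}, 'c) comod_alg
     \<Rightarrow> 'p \<Rightarrow> 'p \<Rightarrow> (('p \<times> 'p) \<Rightarrow>\<^sub>0 int) set" where
  "pureB C P \<equiv> pure_over (coinvariants C P) (alg_space P) (*) (alg_space P) (*)"

definition canR ::
  "('k::field, 'c::ab_group_add) coalg \<Rightarrow> ('k, 'p::{ring,monoid_mult}, 'c) comod_alg
     \<Rightarrow> (('p \<times> 'p) \<Rightarrow>\<^sub>0 int) set \<Rightarrow> (('p \<times> 'c) \<Rightarrow>\<^sub>0 int) set" where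
  "canR C P = tensor_lift (tensor (alg_space P) (coalg_space C))
                (\<lambda>(p, p'). left_mult C P p (alg_coact P p'))"

definition translation ::
  "('k::field, 'c::ab_group_add) coalg \<Rightarrow> ('k, 'p::{ring,monoid_mult}, 'c) comod_alg
     \<Rightarrow> 'c \<Rightarrow> (('p \<times> 'p) \<Rightarrow>\<^sub>0 int) set" where
  "translation C P c =
     the_inv_into (carrier (tensorB C P)) (canR C P) (pure (alg_space P) (coalg_space C) 1 c)"

definition entwining ::
  "('k::field, 'c::ab_group_add) coalg \<Rightarrow> ('k, 'p::{ring,monoid_mult}, 'c) comod_alg
     \<Rightarrow> (('c \<times> 'p) \<Rightarrow>\<^sub>0 int) set \<Rightarrow> (('p \<times> 'c) \<Rightarrow>\<^sub>0 int) set" where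
  "entwining C P = tensor_lift (tensor (alg_space P) (coalg_space C))
     (\<lambda>(c, p). canR C P
        (tensor_lift (tensorB C P) (\<lambda>(q, q'). pureB C P q (q' * p)) (translation C P c)))"

text \<open>A left module over \<open>B = P\<^sup>c\<^sup>o\<^sup>C\<close> is a vector space through \<open>r x = (r 1) x\<close>.\<close>

definition base_comod ::
  "('k, 'p::{ring,monoid_mult}, 'c) comod_alg \<Rightarrow> ('p, 'm, 'c, 'z) comod_scheme \<Rightarrow> ('k, 'm, 'c) comod" where
  "base_comod P M =
     \<lparr>carrier = carrier M, monoid.mult = undefined, one = undefined,
      ring.zero = \<zero>\<^bsub>M\<^esub>, ring.add = add M,
      smult = (\<lambda>r x. alg_scale P r 1 \<odot>\<^bsub>M\<^esub> x), coact = coact M\<rparr>"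

definition equivariant_module ::
  "('k::field, 'c::ab_group_add) coalg \<Rightarrow> ('k, 'p::{ring,monoid_mult}, 'c) comod_alg
     \<Rightarrow> ('p, 'm, 'c, 'z) comod_scheme \<Rightarrow> bool" where
  "equivariant_module C P M \<longleftrightarrow>
     left_module (coinvariants C P) M \<and>
     comodule C (base_comod P M) \<and>
     (\<forall>b\<in>coinvariants C P. \<forall>x\<in>carrier M.
        coact M (b \<odot>\<^bsub>M\<^esub> x)
        = tensor_map (base_comod P M) (coalg_space C) (\<lambda>y. b \<odot>\<^bsub>M\<^esub> y) id (coact M x))"

definition equivariant_map ::
  "('k::field, 'c::ab_group_add) coalg \<Rightarrow> ('k, 'p::{ring,monoid_mult}, 'c) comod_alg
     \<Rightarrow> ('p, 'm, 'c, 'y) comod_scheme \<Rightarrow> ('p, 'n, 'c, 'z) comod_scheme \<Rightarrow> ('m \<Rightarrow> 'n) \<Rightarrow> bool" where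
  "equivariant_map C P M N f \<longleftrightarrow>
     lin_map (coinvariants C P) M N f \<and> colinear C (base_comod P M) (base_comod P N) f"

definition regular_comod ::
  "('k, 'p::{ring,monoid_mult}, 'c) comod_alg \<Rightarrow> ('p, 'p, 'c) comod" where
  "regular_comod P =
     \<lparr>carrier = UNIV, monoid.mult = undefined, one = undefined, ring.zero = 0, ring.add = (+),
      smult = (*), coact = alg_coact P\<rparr>"

text \<open>\<open>M\<close> and \<open>N\<close> range over all structures carried by subsets of the element type \<open>'u\<close>.\<close>

definition equivariantly_projective ::
  "'u itself \<Rightarrow> ('k::field, 'c::ab_group_add) coalg
     \<Rightarrow> ('k, 'p::{ring,monoid_mult}, 'c) comod_alg \<Rightarrow> bool" where
  "equivariantly_projective U C P \<longleftrightarrow>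
     (\<forall>(M :: ('p, 'u, 'c) comod) (N :: ('p, 'u, 'c) comod) \<pi> f.
        equivariant_module C P M \<and> equivariant_module C P N \<and>
        equivariant_map C P M N \<pi> \<and> \<pi> ` carrier M = carrier N \<and>
        (\<exists>\<sigma>. colinear C (base_comod P N) (base_comod P M) \<sigma> \<and>
             (\<forall>x\<in>carrier N. \<pi> (\<sigma> x) = x)) \<and>
        equivariant_map C P (regular_comod P) N f \<longrightarrow>
        (\<exists>g. equivariant_map C P (regular_comod P) M g \<and> (\<forall>p. \<pi> (g p) = f p)))"

text \<open>Equivariant projectivity is tested on the element type of \<open>P \<otimes> P\<close>. This loses nothing: that
  type can hold \<open>P\<close> and \<open>B \<otimes> P\<close>, so the multiplication \<open>B \<otimes> P \<rightarrow> P\<close>, split by \<open>p \<mapsto> 1 \<otimes> p\<close>,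
  is among the tested epimorphisms. A lift \<open>s\<close> of the identity of \<open>P\<close> along it yields a lift of
  every \<open>f : P \<rightarrow> N\<close> along every \<open>\<pi> : M \<rightarrow> N\<close> split by \<open>\<sigma>\<close>, whatever the types of \<open>M\<close> and \<open>N\<close>:
  compose \<open>s\<close> with \<open>b \<otimes> p \<mapsto> b \<sigma> (f p)\<close>. The group-like element \<open>g\<close> with
  \<open>\<Delta>\<^sub>P p = \<psi> (g \<otimes> p)\<close> is a parameter.\<close>

definition principal_extension ::
  "('k::field, 'c::ab_group_add) coalg \<Rightarrow> ('k, 'p::{ring,monoid_mult}, 'c) comod_alg \<Rightarrow> 'c \<Rightarrow> bool" where
  "principal_extension C P g \<longleftrightarrow>
     bij_betw (canR C P) (carrier (tensorB C P))
       (carrier (tensor (alg_space P) (coalg_space C))) \<and>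
     bij_betw (entwining C P) (carrier (tensor (coalg_space C) (alg_space P)))
       (carrier (tensor (alg_space P) (coalg_space C))) \<and>
     group_like C g \<and>
     (\<forall>p. alg_coact P p = entwining C P (pure (coalg_space C) (alg_space P) g p)) \<and>
     equivariantly_projective TYPE((('p \<times> 'p) \<Rightarrow>\<^sub>0 int) set) C P"

definition left_coact ::
  "('k::field, 'c::ab_group_add) coalg \<Rightarrow> ('k, 'p::{ring,monoid_mult}, 'c) comod_alg \<Rightarrow> 'c
     \<Rightarrow> 'p \<Rightarrow> (('c \<times> 'p) \<Rightarrow>\<^sub>0 int) set" where
  "left_coact C P g p =
     the_inv_into (carrier (tensor (coalg_space C) (alg_space P))) (entwining C P)
       (pure (alg_space P) (coalg_space C) p g)"

definition strong_connection ::
  "('k::field, 'c::ab_group_add) coalg \<Rightarrow> ('k, 'p::{ring,monoid_mult}, 'c) comod_alg \<Rightarrow> 'c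
     \<Rightarrow> ('c \<Rightarrow> (('p \<times> 'p) \<Rightarrow>\<^sub>0 int) set) \<Rightarrow> bool" where
  "strong_connection C P g l \<longleftrightarrow>
     (let S = coalg_space C; A = alg_space P in
      lin_map UNIV S (tensor A A) l \<and>
      (\<forall>c. tensor_lift (tensorB C P) (\<lambda>(p, q). pureB C P p q) (l c) = translation C P c) \<and>
      (\<forall>c. tensor_map A (tensor A S) id (alg_coact P) (l c)
           = tensor_assoc A A S (tensor_map (tensor A A) S l id (comult C c))) \<and>
      (\<forall>c. tensor_assoc S A A (tensor_map (tensor S A) A (left_coact C P g) id (l c))
           = tensor_map S (tensor A A) id l (comult C c)) \<and>
      l g = pure A A 1 1)"

section \<open>Cyclic homology\<close>

text \<open>\<open>B\<close> is a subalgebra of an algebra type, with scalar multiplication \<open>s\<close>.\<close>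

definition cyclic_op ::
  "('k \<Rightarrow> 'p::{ring,monoid_mult} \<Rightarrow> 'p) \<Rightarrow> 'p set \<Rightarrow> nat
     \<Rightarrow> ('p list \<Rightarrow>\<^sub>0 int) set \<Rightarrow> ('p list \<Rightarrow>\<^sub>0 int) set" where
  "cyclic_op s B m = lift_hom (tensor_power (module_of s B) (m + 1))
     (\<lambda>xs. power_class (module_of s B) (m + 1)
        (frag_cmul ((- 1) ^ m) (frag_of (last xs # butlast xs))))"

definition cyclic_image ::
  "('k \<Rightarrow> 'p::{ring,monoid_mult} \<Rightarrow> 'p) \<Rightarrow> 'p set \<Rightarrow> nat \<Rightarrow> ('p list \<Rightarrow>\<^sub>0 int) set set" where
  "cyclic_image s B m =
     (let T = tensor_power (module_of s B) (m + 1)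
      in (\<lambda>x. x \<otimes>\<^bsub>T\<^esub> inv\<^bsub>T\<^esub> (cyclic_op s B m x)) ` carrier T)"

definition connes_group ::
  "('k \<Rightarrow> 'p::{ring,monoid_mult} \<Rightarrow> 'p) \<Rightarrow> 'p set \<Rightarrow> nat \<Rightarrow> ('p list \<Rightarrow>\<^sub>0 int) set set monoid" where
  "connes_group s B m = tensor_power (module_of s B) (m + 1) Mod cyclic_image s B m"

definition connes_class ::
  "('k \<Rightarrow> 'p::{ring,monoid_mult} \<Rightarrow> 'p) \<Rightarrow> 'p set \<Rightarrow> nat
     \<Rightarrow> ('p list \<Rightarrow>\<^sub>0 int) set \<Rightarrow> ('p list \<Rightarrow>\<^sub>0 int) set set" where
  "connes_class s B m x = cyclic_image s B m #>\<^bsub>tensor_power (module_of s B) (m + 1)\<^esub> x"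

text \<open>The Hochschild boundary \<open>B\<^sup>\<otimes>\<^sup>(\<^sup>m\<^sup>+\<^sup>1\<^sup>) \<rightarrow> B\<^sup>\<otimes>\<^sup>m\<close>, for \<open>m \<ge> 1\<close>.\<close>

definition hochschild ::
  "('k \<Rightarrow> 'p::{ring,monoid_mult} \<Rightarrow> 'p) \<Rightarrow> 'p set \<Rightarrow> nat
     \<Rightarrow> ('p list \<Rightarrow>\<^sub>0 int) set \<Rightarrow> ('p list \<Rightarrow>\<^sub>0 int) set" where
  "hochschild s B m = lift_hom (tensor_power (module_of s B) m)
     (\<lambda>xs. power_class (module_of s B) m
        ((\<Sum>i<m. frag_cmul ((- 1) ^ i)
            (frag_of (take i xs @ (xs ! i * xs ! (i + 1)) # drop (i + 2) xs)))
         + frag_cmul ((- 1) ^ m) (frag_of ((last xs * hd xs) # tl (butlast xs)))))"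

definition connes_diff ::
  "('k \<Rightarrow> 'p::{ring,monoid_mult} \<Rightarrow> 'p) \<Rightarrow> 'p set \<Rightarrow> nat
     \<Rightarrow> ('p list \<Rightarrow>\<^sub>0 int) set set \<Rightarrow> ('p list \<Rightarrow>\<^sub>0 int) set set" where
  "connes_diff s B m X = connes_class s B (m - 1) (hochschild s B m (SOME x. x \<in> X))"

definition connes_cycles ::
  "('k \<Rightarrow> 'p::{ring,monoid_mult} \<Rightarrow> 'p) \<Rightarrow> 'p set \<Rightarrow> nat \<Rightarrow> ('p list \<Rightarrow>\<^sub>0 int) set set set" where
  "connes_cycles s B m =
     {X \<in> carrier (connes_group s B m). m = 0 \<or> connes_diff s B m X = \<one>\<^bsub>connes_group s B (m - 1)\<^esub>}"

definition connes_boundaries ::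
  "('k \<Rightarrow> 'p::{ring,monoid_mult} \<Rightarrow> 'p) \<Rightarrow> 'p set \<Rightarrow> nat \<Rightarrow> ('p list \<Rightarrow>\<^sub>0 int) set set set" where
  "connes_boundaries s B m = connes_diff s B (m + 1) ` carrier (connes_group s B (m + 1))"

definition HC ::
  "('k \<Rightarrow> 'p::{ring,monoid_mult} \<Rightarrow> 'p) \<Rightarrow> 'p set \<Rightarrow> nat \<Rightarrow> ('p list \<Rightarrow>\<^sub>0 int) set set set monoid" where
  "HC s B m = (connes_group s B m)\<lparr>carrier := connes_cycles s B m\<rparr> Mod connes_boundaries s B m"

definition HC_class ::
  "('k \<Rightarrow> 'p::{ring,monoid_mult} \<Rightarrow> 'p) \<Rightarrow> 'p set \<Rightarrow> nat
     \<Rightarrow> ('p list \<Rightarrow>\<^sub>0 int) set \<Rightarrow> ('p list \<Rightarrow>\<^sub>0 int) set set set" where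
  "HC_class s B m x =
     connes_boundaries s B m
       #>\<^bsub>(connes_group s B m)\<lparr>carrier := connes_cycles s B m\<rparr>\<^esub> connes_class s B m x"

section \<open>The Chern character\<close>

definition free_module :: "'r::{ring,monoid_mult} set \<Rightarrow> nat \<Rightarrow> ('r, nat \<Rightarrow> 'r) module" where
  "free_module R N =
     \<lparr>carrier = {x. (\<forall>i<N. x i \<in> R) \<and> (\<forall>i\<ge>N. x i = 0)},
      monoid.mult = undefined, one = undefined,
      ring.zero = (\<lambda>i. 0), ring.add = (\<lambda>x y i. x i + y i), smult = (\<lambda>r x i. r * x i)\<rparr>"

text \<open>Finitely generated projective: a direct summand (retract) of some \<open>R\<^sup>N\<close>.\<close>

definition fg_projective ::
  "'r::{ring,monoid_mult} set \<Rightarrow> ('r, 'm, 'z) module_scheme \<Rightarrow> bool" where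
  "fg_projective R M \<longleftrightarrow> left_module R M \<and>
     (\<exists>N i q. lin_map R M (free_module R N) i \<and> lin_map R (free_module R N) M q \<and>
        (\<forall>x\<in>carrier M. q (i x) = x))"

text \<open>Every finitely generated projective module is isomorphic to one carried by a subset of
  \<open>nat \<Rightarrow> 'r\<close>, so isomorphism classes are formed inside that type; \<open>M\<close> itself may have any
  element type.\<close>

definition proj_iso_class ::
  "'r::{ring,monoid_mult} set \<Rightarrow> ('r, 'm, 'z) module_scheme \<Rightarrow> ('r, nat \<Rightarrow> 'r) module set" where
  "proj_iso_class R M = {N. fg_projective R N \<and> module_iso R M N}"

definition K0_gens :: "'r::{ring,monoid_mult} set \<Rightarrow> ('r, nat \<Rightarrow> 'r) module set set" where
  "K0_gens R = proj_iso_class R ` {M :: ('r, nat \<Rightarrow> 'r) module. fg_projective R M}"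

definition K0_rels :: "'r::{ring,monoid_mult} set \<Rightarrow> (('r, nat \<Rightarrow> 'r) module set \<Rightarrow>\<^sub>0 int) set" where
  "K0_rels R =
     {frag_of (proj_iso_class R (direct_sum M N))
        - frag_of (proj_iso_class R M) - frag_of (proj_iso_class R N) |
      (M :: ('r, nat \<Rightarrow> 'r) module) (N :: ('r, nat \<Rightarrow> 'r) module).
        fg_projective R M \<and> fg_projective R N}"

definition K0 :: "'r::{ring,monoid_mult} set \<Rightarrow> (('r, nat \<Rightarrow> 'r) module set \<Rightarrow>\<^sub>0 int) set monoid" where
  "K0 R = presented_group (K0_gens R) (K0_rels R)"

definition K0_class ::
  "'r::{ring,monoid_mult} set \<Rightarrow> ('r, 'm, 'z) module_scheme
     \<Rightarrow> (('r, nat \<Rightarrow> 'r) module set \<Rightarrow>\<^sub>0 int) set" where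
  "K0_class R M = presented_class (K0_gens R) (K0_rels R) (frag_of (proj_iso_class R M))"

definition idempotent_matrix ::
  "'r::{ring,monoid_mult} set \<Rightarrow> nat \<Rightarrow> (nat \<Rightarrow> nat \<Rightarrow> 'r) \<Rightarrow> bool" where
  "idempotent_matrix R N E \<longleftrightarrow>
     (\<forall>i<N. \<forall>j<N. E i j \<in> R) \<and> (\<forall>i<N. \<forall>j<N. (\<Sum>k<N. E i k * E k j) = E i j)"

text \<open>The module \<open>R\<^sup>N E\<close> of row vectors.\<close>

definition matrix_module ::
  "'r::{ring,monoid_mult} set \<Rightarrow> nat \<Rightarrow> (nat \<Rightarrow> nat \<Rightarrow> 'r) \<Rightarrow> ('r, nat \<Rightarrow> 'r) module" where
  "matrix_module R N E =
     (free_module R N)\<lparr>carrier :=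
        (\<lambda>x j. if j < N then \<Sum>i<N. x i * E i j else 0) ` carrier (free_module R N)\<rparr>"

definition trace_chain :: "nat \<Rightarrow> (nat \<Rightarrow> nat \<Rightarrow> 'p) \<Rightarrow> nat \<Rightarrow> ('p list \<Rightarrow>\<^sub>0 int)" where
  "trace_chain N E m =
     (\<Sum>is\<in>{is. length is = m + 1 \<and> set is \<subseteq> {..<N}}.
        frag_of (map (\<lambda>j. E (is ! j) (is ! (Suc j mod (m + 1)))) [0..<m + 1]))"

text \<open>The homomorphism with the prescribed values on the classes \<open>[B\<^sup>N E]\<close>. These classes exhaust
  the generators of \<open>K\<^sub>0(B)\<close>, so it is unique on the carrier.\<close>

definition chern ::
  "('k \<Rightarrow> 'p::{ring,monoid_mult} \<Rightarrow> 'p) \<Rightarrow> 'p set \<Rightarrow> nat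
     \<Rightarrow> (('p, nat \<Rightarrow> 'p) module set \<Rightarrow>\<^sub>0 int) set \<Rightarrow> ('p list \<Rightarrow>\<^sub>0 int) set set set" where
  "chern s B n = (SOME h. h \<in> hom (K0 B) (HC s B (2 * n)) \<and>
     (\<forall>N E. idempotent_matrix B N E \<longrightarrow>
        h (K0_class B (matrix_module B N E)) =
          HC_class s B (2 * n) (power_class (module_of s B) (2 * n + 1) (trace_chain N E (2 * n)))
            [^]\<^bsub>HC s B (2 * n)\<^esub> ((- 1) ^ n :: int)))"

section \<open>The Chern-Galois character\<close>

definition corep ::
  "('k::field, 'c::ab_group_add) coalg \<Rightarrow> ('k, 'v, 'c, 'z) comod_scheme \<Rightarrow> bool" where
  "corep C V \<longleftrightarrow> comodule C V \<and> finite_dimensional V"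

definition comod_iso ::
  "('k::field, 'c::ab_group_add) coalg \<Rightarrow> ('k, 'v, 'c, 'y) comod_scheme
     \<Rightarrow> ('k, 'w, 'c, 'z) comod_scheme \<Rightarrow> bool" where
  "comod_iso C V W \<longleftrightarrow> (\<exists>f. colinear C V W f \<and> bij_betw f (carrier V) (carrier W))"

definition comod_sum ::
  "('k::field, 'c::ab_group_add) coalg \<Rightarrow> ('k, 'v, 'c, 'y) comod_scheme
     \<Rightarrow> ('k, 'w, 'c, 'z) comod_scheme \<Rightarrow> ('k, 'v \<times> 'w, 'c) comod" where
  "comod_sum C V W =
     (let D = direct_sum V W; S = coalg_space C in
      \<lparr>carrier = carrier D, monoid.mult = undefined, one = undefined,
       ring.zero = ring.zero D, ring.add = ring.add D, smult = smult D,
       coact = (\<lambda>(v, w).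
         tensor_map D S (\<lambda>x. (x, \<zero>\<^bsub>W\<^esub>)) id (coact V v)
           \<oplus>\<^bsub>tensor D S\<^esub> tensor_map D S (\<lambda>y. (\<zero>\<^bsub>V\<^esub>, y)) id (coact W w))\<rparr>)"

text \<open>As for \<open>K\<^sub>0\<close>, isomorphism classes are formed in a type that contains a copy of every
  finite-dimensional space.\<close>

definition corep_iso_class ::
  "('k::field, 'c::ab_group_add) coalg \<Rightarrow> ('k, 'v, 'c, 'z) comod_scheme
     \<Rightarrow> ('k, nat \<Rightarrow> 'k, 'c) comod set" where
  "corep_iso_class C V = {W. corep C W \<and> comod_iso C V W}"

definition Rf_gens ::
  "('k::field, 'c::ab_group_add) coalg \<Rightarrow> ('k, nat \<Rightarrow> 'k, 'c) comod set set" where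
  "Rf_gens C = corep_iso_class C ` {V :: ('k, nat \<Rightarrow> 'k, 'c) comod. corep C V}"

definition Rf_rels ::
  "('k::field, 'c::ab_group_add) coalg \<Rightarrow> (('k, nat \<Rightarrow> 'k, 'c) comod set \<Rightarrow>\<^sub>0 int) set" where
  "Rf_rels C =
     {frag_of (corep_iso_class C (comod_sum C V W))
        - frag_of (corep_iso_class C V) - frag_of (corep_iso_class C W) |
      (V :: ('k, nat \<Rightarrow> 'k, 'c) comod) (W :: ('k, nat \<Rightarrow> 'k, 'c) comod). corep C V \<and> corep C W}"

definition Rf ::
  "('k::field, 'c::ab_group_add) coalg \<Rightarrow> (('k, nat \<Rightarrow> 'k, 'c) comod set \<Rightarrow>\<^sub>0 int) set monoid" where
  "Rf C = presented_group (Rf_gens C) (Rf_rels C)"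

definition Rf_class ::
  "('k::field, 'c::ab_group_add) coalg \<Rightarrow> ('k, 'v, 'c, 'z) comod_scheme
     \<Rightarrow> (('k, nat \<Rightarrow> 'k, 'c) comod set \<Rightarrow>\<^sub>0 int) set" where
  "Rf_class C V = presented_class (Rf_gens C) (Rf_rels C) (frag_of (corep_iso_class C V))"

text \<open>\<open>Hom\<^sup>C(V, P)\<close>; its elements are functions on \<open>carrier V\<close>, hence the extensionality.\<close>

definition hom_module ::
  "('k::field, 'c::ab_group_add) coalg \<Rightarrow> ('k, 'p::{ring,monoid_mult}, 'c) comod_alg
     \<Rightarrow> ('k, 'v, 'c, 'z) comod_scheme \<Rightarrow> ('p, 'v \<Rightarrow> 'p) module" where
  "hom_module C P V =
     \<lparr>carrier = {f \<in> extensional (carrier V). colinear C V (alg_comod P) f},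
      monoid.mult = undefined, one = undefined,
      ring.zero = (\<lambda>v\<in>carrier V. 0),
      ring.add = (\<lambda>f h. \<lambda>v\<in>carrier V. f v + h v),
      smult = (\<lambda>b f. \<lambda>v\<in>carrier V. b * f v)\<rparr>"

text \<open>The homomorphism \<open>[V] \<mapsto> [Hom\<^sup>C(V, P)]\<close>, unique on the carrier.\<close>

definition assoc_hom ::
  "('k::field, 'c::ab_group_add) coalg \<Rightarrow> ('k, 'p::{ring,monoid_mult}, 'c) comod_alg
     \<Rightarrow> (('k, nat \<Rightarrow> 'k, 'c) comod set \<Rightarrow>\<^sub>0 int) set \<Rightarrow> (('p, nat \<Rightarrow> 'p) module set \<Rightarrow>\<^sub>0 int) set" where
  "assoc_hom C P = (SOME h. h \<in> hom (Rf C) (K0 (coinvariants C P)) \<and>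
     (\<forall>V :: ('k, nat \<Rightarrow> 'k, 'c) comod. corep C V \<longrightarrow>
        h (Rf_class C V) = K0_class (coinvariants C P) (hom_module C P V)))"

definition chern_galois ::
  "('k::field, 'c::ab_group_add) coalg \<Rightarrow> ('k, 'p::{ring,monoid_mult}, 'c) comod_alg \<Rightarrow> nat
     \<Rightarrow> (('k, nat \<Rightarrow> 'k, 'c) comod set \<Rightarrow>\<^sub>0 int) set \<Rightarrow> ('p list \<Rightarrow>\<^sub>0 int) set set set" where
  "chern_galois C P n = chern (alg_scale P) (coinvariants C P) n \<circ> assoc_hom C P"

text \<open>The \<open>m\<close>-fold iterated coproduct, an element of \<open>C\<^sup>\<otimes>\<^sup>(\<^sup>m\<^sup>+\<^sup>1\<^sup>)\<close>.\<close>

fun iter_comult :: "('k, 'c::ab_group_add) coalg \<Rightarrow> nat \<Rightarrow> 'c \<Rightarrow> ('c list \<Rightarrow>\<^sub>0 int) set" where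
  "iter_comult C 0 c = power_class (coalg_space C) 1 (frag_of [c])"
| "iter_comult C (Suc m) c =
     lift_hom (tensor_power (coalg_space C) (m + 2))
       (\<lambda>(a, b). lift_hom (tensor_power (coalg_space C) (m + 2))
          (\<lambda>cs. power_class (coalg_space C) (m + 2) (frag_of (a # cs))) (iter_comult C m b))
       (comult C c)"

text \<open>Expands a list of formal sums multilinearly into a formal sum of lists.\<close>

fun expand :: "('x \<Rightarrow>\<^sub>0 int) list \<Rightarrow> ('x list \<Rightarrow>\<^sub>0 int)" where
  "expand [] = frag_of []"
| "expand (z # zs) = frag_extend (\<lambda>a. frag_extend (\<lambda>w. frag_of (a # w)) (expand zs)) z"

text \<open>\<open>(p\<^sub>0 \<otimes> q\<^sub>0) \<otimes> \<dots> \<otimes> (p\<^sub>m \<otimes> q\<^sub>m) \<mapsto> q\<^sub>m p\<^sub>0 \<otimes> q\<^sub>0 p\<^sub>1 \<otimes> \<dots> \<otimes> q\<^sub>m\<^sub>-\<^sub>1 p\<^sub>m\<close>\<close>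

definition cyclic_mult :: "('p \<times> 'p::times) list \<Rightarrow> 'p list" where
  "cyclic_mult ws = map2 (\<lambda>u w. snd u * fst w) (last ws # butlast ws) ws"

text \<open>The linear map \<open>C\<^sup>\<otimes>\<^sup>(\<^sup>m\<^sup>+\<^sup>1\<^sup>) \<rightarrow> P\<^sup>\<otimes>\<^sup>(\<^sup>m\<^sup>+\<^sup>1\<^sup>)\<close> that applies \<open>l\<close> to every factor and then
  \<open>cyclic_mult\<close>.\<close>

definition connection_map ::
  "('k, 'p::{ring,monoid_mult}, 'c) comod_alg \<Rightarrow> ('c \<Rightarrow> (('p \<times> 'p) \<Rightarrow>\<^sub>0 int) set) \<Rightarrow> nat
     \<Rightarrow> ('c list \<Rightarrow>\<^sub>0 int) set \<Rightarrow> ('p list \<Rightarrow>\<^sub>0 int) set" where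
  "connection_map P l m = lift_hom (tensor_power (alg_space P) (m + 1))
     (\<lambda>cs. power_class (alg_space P) (m + 1)
        (frag_extend (\<lambda>ws. frag_of (cyclic_mult ws)) (expand (map (\<lambda>c. rep (l c)) cs))))"

text \<open>The map \<open>B\<^sup>\<otimes>\<^sup>m \<rightarrow> P\<^sup>\<otimes>\<^sup>m\<close> induced by the inclusion.\<close>

definition power_incl ::
  "('k, 'p::{ring,monoid_mult}, 'c) comod_alg \<Rightarrow> nat \<Rightarrow> ('p list \<Rightarrow>\<^sub>0 int) set \<Rightarrow> ('p list \<Rightarrow>\<^sub>0 int) set" where
  "power_incl P m = lift_hom (tensor_power (alg_space P) m)
     (\<lambda>xs. power_class (alg_space P) m (frag_of xs))"

end

theory Submission
  imports Defs "HOL-Library.Function_Algebras"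
begin

text \<open>Why the formula holds. The module attached to a corepresentation with matrix \<open>e\<^sub>i\<^sub>j\<close> is the space of
tuples \<open>(f\<^sub>j)\<close> in \<open>P\<close> with \<open>\<Delta>\<^sub>P f\<^sub>j = \<Sum>\<^sub>k f\<^sub>k \<otimes> e\<^sub>k\<^sub>j\<close>. Expand \<open>l (e\<^sub>i\<^sub>j) = \<Sum>\<^sub>\<mu> a\<^sub>i\<^sub>\<mu> \<otimes> h\<^sub>\<mu>\<^sub>j\<close>. Right
colinearity of \<open>l\<close> allows the rows \<open>h\<^sub>\<mu>\<close> to be chosen as linearly independent tuples; left colinearity then
gives \<open>a\<^sub>i\<^sub>\<mu>\<close> the left coaction \<open>\<Sum>\<^sub>k e\<^sub>i\<^sub>k \<otimes> a\<^sub>k\<^sub>\<mu>\<close> (\<open>strong_connection_expansion\<close>). Hence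
\<open>\<Sum>\<^sub>j f\<^sub>j a\<^sub>j\<^sub>\<mu>\<close> is coinvariant for every tuple \<open>f\<close> (\<open>coinvariant_sum\<close>). Since
\<open>\<Sum>\<^sub>\<mu> a\<^sub>i\<^sub>\<mu> h\<^sub>\<mu>\<^sub>j = \<epsilon> (e\<^sub>i\<^sub>j)\<close>, the maps \<open>f \<mapsto> (\<Sum>\<^sub>j f\<^sub>j a\<^sub>j\<^sub>\<mu>)\<^sub>\<mu>\<close> and \<open>b \<mapsto> \<Sum>\<^sub>\<mu> b\<^sub>\<mu> h\<^sub>\<mu>\<close> exhibit the
module as a retract of \<open>B\<^sup>M\<close> (\<open>tuple_retract\<close>), with idempotent \<open>E\<^sub>\<mu>\<^sub>\<nu> = \<Sum>\<^sub>i h\<^sub>\<mu>\<^sub>i a\<^sub>i\<^sub>\<nu>\<close>.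

The chain of the Chern character is the sum of the words of entries of \<open>E\<close> over all index cycles. The iterated
coproduct of the character is the same kind of sum for the matrix \<open>e\<close> (\<open>iter_comult_character\<close>).
Applying \<open>l\<close> to each letter and multiplying across neighbouring letters moves the sum over the \<open>e\<close>-indices
inside the entries \<open>E\<^sub>\<mu>\<^sub>\<nu>\<close> and leaves the sum over cycles of the indices \<open>\<mu>\<close> (\<open>connection_map_trace\<close>).

The characters themselves have to be shown to exist. For the Chern character this means that homology classes
of trace chains depend only on the module and are additive. Isomorphic images are joined, inside block
matrices, by three affine lines of idempotents, and along such a line the trace chain changes by an explicit
boundary (\<open>line_homotopy\<close>); the result is \<open>chern_spec\<close>. The homomorphism \<open>R\<^sub>f(C) \<rightarrow> K\<^sub>0(B)\<close> exists because the
isomorphism class of a corepresentation and its module of tuples are both determined by the matrix, with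
direct sums corresponding to block matrices (\<open>assoc_hom_class\<close>).\<close>

section \<open>Abelian groups presented by generators and relations\<close>

abbreviation "supp \<equiv> Poly_Mapping.keys"

abbreviation "rel_span X R \<equiv> generate (free_Abelian_group X) R"

text \<open>The extension of \<open>f\<close> to formal sums. On a chosen representative it is the value of \<open>lift_hom\<close>, which makes the choice harmless once \<open>f\<close> kills the relations.\<close>

definition frag_eval :: "('g, 'z) monoid_scheme => ('x => 'g) => ('x \<Rightarrow>\<^sub>0 int) => 'g" where
 "frag_eval G f z = finprod G (\<lambda>x. f x [^]\<^bsub>G\<^esub> Poly_Mapping.lookup z x) (supp z)"

lemma lift_hom_eq_frag_eval: "lift_hom G f A = frag_eval G f (rep A)"
 by (simp add: lift_hom_def frag_eval_def)

lemma keys_add_subset: "supp a \<subseteq> X ==> supp b \<subseteq> X ==> supp (a + b) \<subseteq> X"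
 using keys_add by fastforce

lemma keys_diff_subset: "supp a \<subseteq> X ==> supp b \<subseteq> X ==> supp (a - b) \<subseteq> X"
 using keys_diff by fastforce

lemma keys_sum_subset:
 fixes f :: "'i => 'x \<Rightarrow>\<^sub>0 int"
 shows "(\<And>i. i \<in> I ==> supp (f i) \<subseteq> X) ==> supp (sum f I) \<subseteq> X"
 using sum_closed_free_Abelian_group[of I f X] by simp

lemma keys_cmul_subset: "supp a \<subseteq> X ==> supp (frag_cmul c a) \<subseteq> X"
 using keys_cmul by blast

lemma keys_frag_of_subset [simp]: "supp (frag_of x) \<subseteq> X \<longleftrightarrow> x \<in> X"
 by simp

lemma keys_frag_extend_subset:
 "supp z \<subseteq> X ==> (\<And>x. x \<in> X ==> supp (F x) \<subseteq> Y) ==> supp (frag_extend F z) \<subseteq> Y"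
 using keys_frag_extend[of F z] by blast

lemma keys_induct [consumes 1, case_names zero gen diff]:
 assumes "supp z \<subseteq> X" "P 0" "\<And>a. a \<in> X ==> P (frag_of a)"
  "\<And>a b. supp a \<subseteq> X ==> supp b \<subseteq> X ==> P a ==> P b ==> P (a - b)"
 shows "P z"
 using free_Abelian_group_induct[of z X P] assms by blast

lemmas keys_subset_intros = keys_add_subset keys_diff_subset keys_sum_subset keys_cmul_subset

context comm_group
begin

lemma frag_eval_superset:
 assumes "f \<in> X \<rightarrow> carrier G" "finite S" "supp z \<subseteq> S" "S \<subseteq> X"
 shows "frag_eval G f z = finprod G (\<lambda>x. f x [^] Poly_Mapping.lookup z x) S"
 unfolding frag_eval_def
proof (rule finprod_mono_neutral_cong_left)
 show "\<And>i. i \<in> S - supp z ==> f i [^] Poly_Mapping.lookup z i = \<one>"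
  by (simp add: in_keys_iff)
qed (use assms in auto)

lemma frag_eval_closed:
 assumes "f \<in> X \<rightarrow> carrier G" "supp z \<subseteq> X"
 shows "frag_eval G f z \<in> carrier G"
 unfolding frag_eval_def using assms by (intro finprod_closed) auto

lemma frag_eval_hom:
 assumes f: "f \<in> X \<rightarrow> carrier G"
 shows "frag_eval G f \<in> hom (free_Abelian_group X) G"
proof (rule homI)
 fix a b assume ab: "a \<in> carrier (free_Abelian_group X)" "b \<in> carrier (free_Abelian_group X)"
 let ?S = "supp a \<union> supp b"
 have S: "finite ?S" "?S \<subseteq> X" using ab by auto
 have k: "supp (a + b) \<subseteq> ?S" by (rule keys_add)
 have fS: "\<And>x. x \<in> ?S ==> f x \<in> carrier G" using f S by auto
 have "frag_eval G f (a + b) = finprod G (\<lambda>x. f x [^] Poly_Mapping.lookup a x \<otimes> f x [^] Poly_Mapping.lookup b x) ?S"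
  unfolding frag_eval_superset[OF f S(1) k S(2)]
  by (intro finprod_cong') (auto simp: lookup_add int_pow_mult fS)
 also have "\<dots> = frag_eval G f a \<otimes> frag_eval G f b"
  using fS by (subst finprod_multf) (auto simp: frag_eval_superset[OF f S(1) _ S(2)])
 finally show "frag_eval G f (a \<otimes>\<^bsub>free_Abelian_group X\<^esub> b) = frag_eval G f a \<otimes> frag_eval G f b"
  by simp
qed (use f in \<open>auto intro: frag_eval_closed\<close>)

lemma frag_eval_of: "f x \<in> carrier G ==> frag_eval G f (frag_of x) = f x"
 by (simp add: frag_eval_def)

lemma frag_eval_zero: "frag_eval G f 0 = \<one>"
 by (simp add: frag_eval_def)

lemma frag_eval_add:
 assumes "f \<in> X \<rightarrow> carrier G" "supp a \<subseteq> X" "supp b \<subseteq> X"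
 shows "frag_eval G f (a + b) = frag_eval G f a \<otimes> frag_eval G f b"
 using hom_mult[OF frag_eval_hom[OF assms(1)], of a b] assms by simp

lemma frag_eval_diff:
 assumes "f \<in> X \<rightarrow> carrier G" "supp a \<subseteq> X" "supp b \<subseteq> X"
 shows "frag_eval G f (a - b) = frag_eval G f a \<otimes> inv (frag_eval G f b)"
proof -
 have c: "frag_eval G f a \<in> carrier G" "frag_eval G f b \<in> carrier G" "frag_eval G f (a - b) \<in> carrier G"
  using assms frag_eval_closed keys_diff_subset by metis+
 have "frag_eval G f (a - b) \<otimes> frag_eval G f b = frag_eval G f a"
  using frag_eval_add[OF assms(1) keys_diff_subset[OF assms(2,3)] assms(3)] by simp
 then show ?thesis using inv_solve_right[OF c(3,1,2)] by simp
qed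

lemma frag_eval_sum_of:
 assumes "f \<in> X \<rightarrow> carrier G" "finite I" "\<And>i. i \<in> I ==> g i \<in> X"
 shows "frag_eval G f (\<Sum>i\<in>I. frag_of (g i)) = finprod G (\<lambda>i. f (g i)) I"
 using assms(2,3)
proof (induction I rule: finite_induct)
 case (insert i I)
 then have "f \<circ> g \<in> I \<rightarrow> carrier G" "f (g i) \<in> carrier G" using assms(1) by auto
 then show ?case using insert
  by (simp add: frag_eval_add[OF assms(1)] keys_sum_subset frag_eval_of Pi_def)
qed (simp add: frag_eval_zero)

lemma frag_eval_triple_one:
 assumes "f a \<in> carrier G" "f b \<in> carrier G" "f c \<in> carrier G" "f a = f b \<otimes> f c"
 shows "frag_eval G f (frag_of a - frag_of b - frag_of c) = \<one>"
proof -
 have f: "f \<in> {a,b,c} \<rightarrow> carrier G" using assms by auto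
 have "frag_eval G f (frag_of a - frag_of b - frag_of c) = f a \<otimes> inv (f b) \<otimes> inv (f c)"
  using assms(1-3) by (subst frag_eval_diff[OF f] | simp add: frag_eval_of keys_diff_subset)+
 also have "\<dots> = f a \<otimes> inv (f b \<otimes> f c)" using assms by (simp only: m_assoc inv_mult inv_closed m_closed)
 also have "\<dots> = \<one>" using assms by simp
 finally show ?thesis .
qed

lemma frag_eval_pair_one:
 assumes "f a \<in> carrier G" "f b \<in> carrier G" "f a = f b"
 shows "frag_eval G f (frag_of a - frag_of b) = \<one>"
proof -
 have f: "f \<in> {a,b} \<rightarrow> carrier G" using assms by auto
 have "frag_eval G f (frag_of a - frag_of b) = f a \<otimes> inv (f b)"
  using assms(1,2) by (subst frag_eval_diff[OF f]) (simp_all add: frag_eval_of)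
 then show ?thesis using assms(2) by (simp add: assms(3))
qed

end

locale presentation =
 fixes X :: "'x set" and R :: "('x \<Rightarrow>\<^sub>0 int) set"
 assumes rels: "r \<in> R ==> supp r \<subseteq> X"
begin

lemma R_carrier: "R \<subseteq> carrier (free_Abelian_group X)"
 using rels by auto

lemma rspan_subgroup: "subgroup (rel_span X R) (free_Abelian_group X)"
 by (rule group.generate_is_subgroup[OF group_free_Abelian_group R_carrier])

lemma rspan_normal: "rel_span X R \<lhd> free_Abelian_group X"
 using comm_group.normal_iff_subgroup[OF abelian_free_Abelian_group] rspan_subgroup by blast

lemma rspan_keys: "z \<in> rel_span X R ==> supp z \<subseteq> X"
 using subgroup.mem_carrier[OF rspan_subgroup, of z] by simp

lemma rspan_zero: "0 \<in> rel_span X R"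
 using subgroup.one_closed[OF rspan_subgroup] by simp

lemma rspan_add: "a \<in> rel_span X R ==> b \<in> rel_span X R ==> a + b \<in> rel_span X R"
 using subgroup.m_closed[OF rspan_subgroup, of a b] by simp

lemma rspan_minus: "a \<in> rel_span X R ==> - a \<in> rel_span X R"
 using subgroup.m_inv_closed[OF rspan_subgroup, of a] rspan_keys by simp

lemma rspan_diff: "a \<in> rel_span X R ==> b \<in> rel_span X R ==> a - b \<in> rel_span X R"
 using rspan_add[of a "- b"] rspan_minus by simp

lemma rspan_sum: "(\<And>i. i \<in> I ==> f i \<in> rel_span X R) ==> sum f I \<in> rel_span X R"
 by (induction I rule: infinite_finite_induct) (auto simp: rspan_zero rspan_add)

lemma rspan_cmul: assumes "a \<in> rel_span X R" shows "frag_cmul n a \<in> rel_span X R"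
proof -
 have *: "frag_cmul (int k) a \<in> rel_span X R" for k
  by (induction k) (simp_all add: rspan_zero rspan_add assms frag_cmul_distrib)
 show ?thesis
  using *[of "nat n"] rspan_minus[OF *[of "nat (- n)"]] by (cases "n \<ge> 0") auto
qed

lemma rspan_gen: "r \<in> R ==> r \<in> rel_span X R"
 by (rule generate.incl)

lemma rspan_trans: "a - b \<in> rel_span X R ==> b - c \<in> rel_span X R ==> a - c \<in> rel_span X R"
 using rspan_add[of "a - b" "b - c"] by simp

lemma rspan_sym: "a - b \<in> rel_span X R ==> b - a \<in> rel_span X R"
 using rspan_minus[of "a - b"] by simp

lemma rspan_induct [consumes 1, case_names zero gen diff]:
 assumes "z \<in> rel_span X R" "P 0" "\<And>r. r \<in> R ==> P r"
  "\<And>a b. P a ==> P b ==> P (a - b)"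
 shows "P z"
 using assms(1)
proof (induction rule: generate.induct)
 case (inv h)
 then show ?case using assms(4)[OF assms(2) assms(3)[OF inv]] rels[OF inv] by simp
next
 case (eng a b)
 then show ?case using assms(4)[OF eng(3) assms(4)[OF assms(2) eng(4)]] by simp
qed (use assms in auto)

lemma class_eq_set: "presented_class X R z = {k + z | k. k \<in> rel_span X R}"
 by (auto simp: presented_class_def r_coset_def)

lemma mem_class: "z' \<in> presented_class X R z \<longleftrightarrow> z' - z \<in> rel_span X R"
 unfolding class_eq_set by (auto intro: exI[of _ "z' - z"])

lemma class_eq_iff: "presented_class X R z = presented_class X R z' \<longleftrightarrow> z - z' \<in> rel_span X R"
proof
 assume "presented_class X R z = presented_class X R z'"
 then show "z - z' \<in> rel_span X R" using mem_class[of z z'] mem_class[of z z] rspan_zero by simp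
next
 assume a: "z - z' \<in> rel_span X R"
 show "presented_class X R z = presented_class X R z'"
  using rspan_trans[OF _ a] rspan_trans[OF _ rspan_sym[OF a]] by (auto simp: mem_class)
qed

lemma rep_class: "rep (presented_class X R z) - z \<in> rel_span X R"
proof -
 have "z \<in> presented_class X R z" by (simp add: mem_class rspan_zero)
 then have "rep (presented_class X R z) \<in> presented_class X R z"
  unfolding rep_def by (rule someI)
 then show ?thesis by (simp add: mem_class)
qed

lemma rep_class_keys: "supp z \<subseteq> X ==> supp (rep (presented_class X R z)) \<subseteq> X"
 using keys_add_subset[OF rspan_keys[OF rep_class[of z]], of z] by simp

lemma class_rep: "presented_class X R (rep (presented_class X R z)) = presented_class X R z"
 using rep_class class_eq_iff by blast

lemma carrier_presented: "carrier (presented_group X R) = presented_class X R ` {z. supp z \<subseteq> X}"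
 unfolding presented_group_def presented_class_def carrier_FactGroup
 by (rule image_cong) (auto simp: free_Abelian_group_def)

lemma class_closed: "supp z \<subseteq> X ==> presented_class X R z \<in> carrier (presented_group X R)"
 by (auto simp: carrier_presented)

lemma presentedE:
 assumes "A \<in> carrier (presented_group X R)"
 obtains z where "supp z \<subseteq> X" "A = presented_class X R z"
 using assms by (auto simp: carrier_presented)

lemma one_presented: "\<one>\<^bsub>presented_group X R\<^esub> = presented_class X R 0"
 by (auto simp: presented_group_def class_eq_set)

lemma mult_class:
 "supp a \<subseteq> X ==> supp b \<subseteq> X ==>
  presented_class X R a \<otimes>\<^bsub>presented_group X R\<^esub> presented_class X R b = presented_class X R (a + b)"
 using normal.rcos_sum[OF rspan_normal, of a b] by (simp add: presented_group_def presented_class_def)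

lemma comm_group_presented: "comm_group (presented_group X R)"
 unfolding presented_group_def
 by (rule comm_group.abelian_FactGroup[OF abelian_free_Abelian_group rspan_subgroup])

sublocale Q: comm_group "presented_group X R"
 by (rule comm_group_presented)

lemma inv_class:
 "supp a \<subseteq> X ==> inv\<^bsub>presented_group X R\<^esub> (presented_class X R a) = presented_class X R (- a)"
 by (rule Q.inv_equality) (auto simp: mult_class one_presented class_closed)

lemma finprod_class:
 assumes "finite I" "\<And>i. i \<in> I ==> supp (f i) \<subseteq> X"
 shows "finprod (presented_group X R) (\<lambda>i. presented_class X R (f i)) I = presented_class X R (sum f I)"
 using assms
proof (induction I rule: finite_induct)
 case (insert i I)
 then show ?case
  by (subst Q.finprod_insert) (auto simp: class_closed mult_class keys_sum_subset)
qed (simp add: one_presented)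

lemma presented_induct [consumes 1, case_names zero gen diff]:
 assumes "A \<in> carrier (presented_group X R)"
  "P \<one>\<^bsub>presented_group X R\<^esub>" "\<And>x. x \<in> X ==> P (presented_class X R (frag_of x))"
  "\<And>A B. A \<in> carrier (presented_group X R) ==> B \<in> carrier (presented_group X R) ==> P A ==> P B
   ==> P (A \<otimes>\<^bsub>presented_group X R\<^esub> inv\<^bsub>presented_group X R\<^esub> B)"
 shows "P A"
proof -
 obtain z where z: "supp z \<subseteq> X" and A: "A = presented_class X R z"
  by (rule presentedE[OF assms(1)])
 show ?thesis unfolding A using z
 proof (induction z rule: keys_induct)
  case (diff a b)
  have "presented_class X R (a - b) = presented_class X R a \<otimes>\<^bsub>presented_group X R\<^esub> inv\<^bsub>presented_group X R\<^esub> (presented_class X R b)"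
   using diff by (simp add: inv_class mult_class)
  then show ?case using assms(4)[of "presented_class X R a" "presented_class X R b"] diff
   by (simp add: class_closed)
 qed (use assms one_presented in auto)
qed

context
 fixes G :: "('g, 'z) monoid_scheme" and f :: "'x => 'g"
 assumes G: "comm_group G" and f: "f \<in> X \<rightarrow> carrier G"
  and kills: "\<And>r. r \<in> R ==> frag_eval G f r = \<one>\<^bsub>G\<^esub>"
begin

interpretation G: comm_group G by (rule G)

lemma frag_eval_span: "z \<in> rel_span X R ==> frag_eval G f z = \<one>\<^bsub>G\<^esub>"
proof -
 have "z \<in> rel_span X R ==> supp z \<subseteq> X \<and> frag_eval G f z = \<one>\<^bsub>G\<^esub>"
  by (induction rule: rspan_induct)
   (auto simp: G.frag_eval_zero kills rels[THEN subsetD] G.frag_eval_diff[OF f] dest!: keys_diff[THEN subsetD])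
 then show "z \<in> rel_span X R ==> frag_eval G f z = \<one>\<^bsub>G\<^esub>" by blast
qed

lemma lift_hom_class:
 assumes "supp z \<subseteq> X"
 shows "lift_hom G f (presented_class X R z) = frag_eval G f z"
proof -
 let ?r = "rep (presented_class X R z)"
 have "?r = z + (?r - z)" by simp
 then have "frag_eval G f ?r = frag_eval G f z \<otimes>\<^bsub>G\<^esub> frag_eval G f (?r - z)"
  using G.frag_eval_add[OF f assms rspan_keys[OF rep_class]] by metis
 then show ?thesis
  using frag_eval_span[OF rep_class] G.frag_eval_closed[OF f assms]
  by (simp add: lift_hom_eq_frag_eval)
qed

lemma lift_hom_gen: "x \<in> X ==> lift_hom G f (presented_class X R (frag_of x)) = f x"
 using f by (subst lift_hom_class) (auto intro!: G.frag_eval_of)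

lemma lift_hom_is_hom: "lift_hom G f \<in> hom (presented_group X R) G"
proof (rule homI)
 fix A assume "A \<in> carrier (presented_group X R)"
 then show "lift_hom G f A \<in> carrier G"
  by (auto elim!: presentedE simp: lift_hom_class G.frag_eval_closed[OF f])
next
 fix A B assume "A \<in> carrier (presented_group X R)" "B \<in> carrier (presented_group X R)"
 then show "lift_hom G f (A \<otimes>\<^bsub>presented_group X R\<^esub> B) = lift_hom G f A \<otimes>\<^bsub>G\<^esub> lift_hom G f B"
  by (auto elim!: presentedE simp: lift_hom_class mult_class keys_add_subset G.frag_eval_add[OF f])
qed

end

lemma lift_hom_cong:
 assumes G: "comm_group G" and f: "f \<in> X \<rightarrow> carrier G" and eq: "\<And>x. x \<in> X ==> f' x = f x"
  and z: "supp z \<subseteq> X"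
 shows "lift_hom G f' (presented_class X R z) = lift_hom G f (presented_class X R z)"
proof -
 interpret G: comm_group G by fact
 have x: "x \<in> X" if "x \<in> supp (rep (presented_class X R z))" for x
  using rep_class_keys[OF z] that by blast
 show ?thesis
  unfolding lift_hom_def using x f eq by (intro G.finprod_cong') auto
qed

end

text \<open>A map between free groups that carries relations to relations descends to the quotients.\<close>

locale presentation_map = dom: presentation X R + cod: presentation Y S
 for X :: "'x set" and R and Y :: "'y set" and S +
 fixes F :: "'x => ('y \<Rightarrow>\<^sub>0 int)"
 assumes gens: "x \<in> X ==> supp (F x) \<subseteq> Y"
  and rels_to_rels: "r \<in> R ==> frag_extend F r \<in> rel_span Y S"
begin

lemma extend_keys: "supp z \<subseteq> X ==> supp (frag_extend F z) \<subseteq> Y"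
 using keys_frag_extend_subset[of z X F Y] gens by blast

lemma frag_eval_eq:
 assumes "supp z \<subseteq> X"
 shows "frag_eval (presented_group Y S) (\<lambda>x. presented_class Y S (F x)) z = presented_class Y S (frag_extend F z)"
 using assms
proof (induction z rule: keys_induct)
 case (diff a b)
 have f: "(\<lambda>x. presented_class Y S (F x)) \<in> X \<rightarrow> carrier (presented_group Y S)"
  using gens cod.class_closed by auto
 show ?case
  using cod.Q.frag_eval_diff[OF f diff(1,2)] diff
  by (simp add: cod.inv_class cod.mult_class extend_keys frag_extend_diff)
next
 case (gen a)
 then show ?case
  using cod.Q.frag_eval_of[of "\<lambda>x. presented_class Y S (F x)" a] cod.class_closed[OF gens] by simp
qed (simp add: cod.Q.frag_eval_zero cod.one_presented)

lemma lift_hom_frag: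
 assumes "supp z \<subseteq> X"
 shows "lift_hom (presented_group Y S) (\<lambda>x. presented_class Y S (F x)) (presented_class X R z)
   = presented_class Y S (frag_extend F z)"
proof -
 have f: "(\<lambda>x. presented_class Y S (F x)) \<in> X \<rightarrow> carrier (presented_group Y S)"
  using gens cod.class_closed by auto
 have kills: "frag_eval (presented_group Y S) (\<lambda>x. presented_class Y S (F x)) r = \<one>\<^bsub>presented_group Y S\<^esub>"
  if r: "r \<in> R" for r
 proof -
  have "presented_class Y S (frag_extend F r) = \<one>\<^bsub>presented_group Y S\<^esub>"
   using rels_to_rels[OF r] unfolding cod.one_presented cod.class_eq_iff by simp
  then show ?thesis using frag_eval_eq[OF dom.rels[OF r]] by metis
 qed
 show ?thesis
  using dom.lift_hom_class[OF cod.comm_group_presented f kills assms] frag_eval_eq[OF assms] by metis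
qed

lemma rspan_to_span: "z \<in> rel_span X R ==> frag_extend F z \<in> rel_span Y S"
 by (induction rule: dom.rspan_induct)
  (auto simp: cod.rspan_zero rels_to_rels frag_extend_diff cod.rspan_diff)

end

section \<open>Linear maps and tensor powers\<close>

lemma left_module_add_closed:
 "left_module R M ==> x \<in> carrier M ==> y \<in> carrier M ==> x \<oplus>\<^bsub>M\<^esub> y \<in> carrier M"
 unfolding left_module_def by (simp add: abelian_monoid.a_closed abelian_group_def)

lemma left_module_smult_closed:
 "left_module R M ==> r \<in> R ==> x \<in> carrier M ==> r \<odot>\<^bsub>M\<^esub> x \<in> carrier M"
 unfolding left_module_def by blast

lemma left_module_group: "left_module R M ==> abelian_group M"
 unfolding left_module_def by blast

lemma module_of_simps [simp]:
 "carrier (module_of s A) = A" "x \<oplus>\<^bsub>module_of s A\<^esub> y = x + y"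
 "r \<odot>\<^bsub>module_of s A\<^esub> x = s r x" "\<zero>\<^bsub>module_of s A\<^esub> = 0"
 by (simp_all add: module_of_def)

lemma left_module_module_of:
 fixes s :: "'k::field => 'a::ab_group_add => 'a"
 assumes "vector_space s" "0 \<in> A" "\<And>x y. x \<in> A ==> y \<in> A ==> x + y \<in> A"
  "\<And>x. x \<in> A ==> - x \<in> A" "\<And>r x. x \<in> A ==> s r x \<in> A"
 shows "left_module UNIV (module_of s A)"
proof -
 interpret vector_space s by fact
 have "abelian_group (module_of s A)"
 proof (rule abelian_groupI)
  fix x assume "x \<in> carrier (module_of s A)"
  then show "\<exists>y\<in>carrier (module_of s A). y \<oplus>\<^bsub>module_of s A\<^esub> x = \<zero>\<^bsub>module_of s A\<^esub>"
   using assms by (auto intro!: bexI[of _ "- x"])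
 qed (use assms in \<open>auto simp: add.assoc add.commute\<close>)
 then show ?thesis
  using assms by (auto simp: left_module_def scale_right_distrib scale_left_distrib)
qed

lemma lin_map_closed: "lin_map R M N f ==> x \<in> carrier M ==> f x \<in> carrier N"
 unfolding lin_map_def by auto

lemma lin_map_add:
 "lin_map R M N f ==> x \<in> carrier M ==> y \<in> carrier M ==> f (x \<oplus>\<^bsub>M\<^esub> y) = f x \<oplus>\<^bsub>N\<^esub> f y"
 unfolding lin_map_def by auto

lemma lin_map_smult:
 "lin_map R M N f ==> r \<in> R ==> x \<in> carrier M ==> f (r \<odot>\<^bsub>M\<^esub> x) = r \<odot>\<^bsub>N\<^esub> f x"
 unfolding lin_map_def by auto

lemma lin_map_id: "lin_map R M M (\<lambda>x. x)"
 unfolding lin_map_def by auto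

lemma lin_map_comp:
 "lin_map R M N f ==> lin_map R N L g ==> lin_map R M L (\<lambda>x. g (f x))"
 unfolding lin_map_def by (auto simp: Pi_def)

abbreviation "pspan V m \<equiv> rel_span (words V m) (multilinear_rel V m)"

lemma words_update: "xs \<in> words V m ==> v \<in> carrier V ==> xs[i := v] \<in> words V m"
 unfolding words_def using set_update_subset_insert[of xs i v] by auto

lemma words_nth: "xs \<in> words V m ==> i < m ==> xs ! i \<in> carrier V"
 unfolding words_def by (auto simp: subset_iff)

lemma words_length: "xs \<in> words V m ==> length xs = m"
 unfolding words_def by auto

lemma words_iff_nth: "xs \<in> words V m \<longleftrightarrow> length xs = m \<and> (\<forall>i<m. xs ! i \<in> carrier V)"
 unfolding words_def by (auto simp: subset_iff in_set_conv_nth)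

lemma presentation_words:
 assumes "left_module UNIV V"
 shows "presentation (words V m) (multilinear_rel V m)"
proof
 fix r assume "r \<in> multilinear_rel V m"
 then show "supp r \<subseteq> words V m"
  unfolding multilinear_rel_def
  by (auto intro!: keys_diff_subset words_update simp del: keys_diff
    simp: keys_frag_of_subset words_nth left_module_add_closed[OF assms] left_module_smult_closed[OF assms]
    dest!: keys_diff[THEN subsetD])
qed

lemma power_class_presented: "power_class V m = presented_class (words V m) (multilinear_rel V m)"
 by (rule ext) (simp add: power_class_def)

lemma word_add_rel:
 assumes "xs \<in> words V m" "i < m" "x \<in> carrier V" "y \<in> carrier V"
 shows "frag_of (xs[i := x \<oplus>\<^bsub>V\<^esub> y]) - frag_of (xs[i := x]) - frag_of (xs[i := y]) \<in> pspan V m"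
 by (rule generate.incl) (unfold multilinear_rel_def, use assms in blast)

lemma word_scale_rel:
 assumes "xs \<in> words V m" "i < m" "j < m"
 shows "frag_of (xs[i := r \<odot>\<^bsub>V\<^esub> (xs ! i)]) - frag_of (xs[j := r \<odot>\<^bsub>V\<^esub> (xs ! j)]) \<in> pspan V m"
 by (rule generate.incl) (unfold multilinear_rel_def, use assms in blast)

text \<open>Additivity in a slot with both summands zero turns \<open>w\<close> into \<open>w + w\<close>.\<close>

lemma word_zero_rel:
 assumes V: "left_module UNIV V" and "xs \<in> words V m" "i < m" "xs ! i = \<zero>\<^bsub>V\<^esub>"
 shows "frag_of xs \<in> pspan V m"
proof -
 interpret presentation "words V m" "multilinear_rel V m" by (rule presentation_words[OF V])
 interpret abelian_group V by (rule left_module_group[OF V])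
 have "xs[i := \<zero>\<^bsub>V\<^esub>] = xs" using assms by (metis list_update_id)
 then have "- frag_of xs \<in> pspan V m"
  using word_add_rel[OF assms(2,3) zero_closed zero_closed] by simp
 then show ?thesis using rspan_minus by fastforce
qed

text \<open>Maps of words that are linear in each slot; these induce maps of tensor powers.\<close>

definition slotwise ::
 "('k, 'v, 'y) module_scheme => nat => ('k, 'w, 'z) module_scheme => nat => ('v list => 'w list) => bool" where
 "slotwise V m W n F \<longleftrightarrow> F \<in> words V m \<rightarrow> words W n \<and>
   (\<forall>xs\<in>words V m. \<forall>i<m. \<exists>j<n. \<exists>\<phi>. lin_map UNIV V W \<phi> \<and>
    (\<forall>v\<in>carrier V. F (xs[i := v]) = (F xs)[j := \<phi> v]))"

lemma slotwise_comp:
 assumes F: "slotwise V m W n F" and G: "slotwise W n U l G"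
 shows "slotwise V m U l (\<lambda>xs. G (F xs))"
 unfolding slotwise_def
proof (intro conjI ballI allI impI)
 show "(\<lambda>xs. G (F xs)) \<in> words V m \<rightarrow> words U l"
  using F G unfolding slotwise_def by auto
 fix xs i assume xs: "xs \<in> words V m" and i: "i < m"
 then obtain j \<phi> where j: "j < n" "lin_map UNIV V W \<phi>" "\<forall>v\<in>carrier V. F (xs[i := v]) = (F xs)[j := \<phi> v]"
  using F unfolding slotwise_def by blast
 have "F xs \<in> words W n" using F xs unfolding slotwise_def by blast
 then obtain h \<psi> where h: "h < l" "lin_map UNIV W U \<psi>" "\<forall>v\<in>carrier W. G ((F xs)[j := v]) = (G (F xs))[h := \<psi> v]"
  using G j(1) unfolding slotwise_def by blast
 show "\<exists>h<l. \<exists>\<phi>. lin_map UNIV V U \<phi> \<and> (\<forall>v\<in>carrier V. G (F (xs[i := v])) = (G (F xs))[h := \<phi> v])"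
  using lin_map_comp[OF j(2) h(2)] j h lin_map_closed[OF j(2)] by (intro exI[of _ h] conjI exI) auto
qed

text \<open>The scaling relations compare two scaled letters, so it matters only that a scaled letter goes to a scaled letter.\<close>

lemma slotwise_scale:
 assumes V: "left_module UNIV V" and F: "slotwise V m W n F" and xs: "xs \<in> words V m" and p: "p < m"
 obtains q where "q < n" "F (xs[p := a \<odot>\<^bsub>V\<^esub> (xs ! p)]) = (F xs)[q := a \<odot>\<^bsub>W\<^esub> (F xs ! q)]"
proof -
 have Fxs: "F xs \<in> words W n" using F xs unfolding slotwise_def by blast
 obtain q \<phi> where q: "q < n" "lin_map UNIV V W \<phi>" "\<forall>v\<in>carrier V. F (xs[p := v]) = (F xs)[q := \<phi> v]"
  using F xs p unfolding slotwise_def by blast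
 have xp: "xs ! p \<in> carrier V" by (rule words_nth[OF xs p])
 have "F xs = (F xs)[q := \<phi> (xs ! p)]" using q(3) xp by (metis list_update_id)
 then have "F xs ! q = \<phi> (xs ! p)" using q(1) words_length[OF Fxs] by (metis nth_list_update_eq)
 then show ?thesis
  using q xp left_module_smult_closed[OF V UNIV_I xp] lin_map_smult[OF q(2) UNIV_I xp] by (intro that[of q]) auto
qed

lemma slotwise_presentation_map:
 assumes V: "left_module UNIV V" and W: "left_module UNIV W" and F: "slotwise V m W n F"
 shows "presentation_map (words V m) (multilinear_rel V m) (words W n) (multilinear_rel W n) (\<lambda>xs. frag_of (F xs))"
proof -
 interpret V: presentation "words V m" "multilinear_rel V m" by (rule presentation_words[OF V])
 interpret W: presentation "words W n" "multilinear_rel W n" by (rule presentation_words[OF W])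
 have slot: "\<exists>j<n. \<exists>\<phi>. lin_map UNIV V W \<phi> \<and> (\<forall>v\<in>carrier V. F (xs[i := v]) = (F xs)[j := \<phi> v])"
  if "xs \<in> words V m" "i < m" for xs i
  using F that unfolding slotwise_def by blast
 show ?thesis
 proof
  fix xs assume "xs \<in> words V m"
  then show "supp (frag_of (F xs)) \<subseteq> words W n"
   using F unfolding slotwise_def by auto
 next
  fix r assume "r \<in> multilinear_rel V m"
  then consider xs i x y where "xs \<in> words V m" "i < m" "x \<in> carrier V" "y \<in> carrier V"
    "r = frag_of (xs[i := x \<oplus>\<^bsub>V\<^esub> y]) - frag_of (xs[i := x]) - frag_of (xs[i := y])"
   | xs i j a where "xs \<in> words V m" "i < m" "j < m"
    "r = frag_of (xs[i := a \<odot>\<^bsub>V\<^esub> (xs ! i)]) - frag_of (xs[j := a \<odot>\<^bsub>V\<^esub> (xs ! j)])"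
   unfolding multilinear_rel_def by auto
  then show "frag_extend (\<lambda>xs. frag_of (F xs)) r \<in> pspan W n"
  proof cases
   case 1
   obtain j \<phi> where j: "j < n" "lin_map UNIV V W \<phi>" "\<forall>v\<in>carrier V. F (xs[i := v]) = (F xs)[j := \<phi> v]"
    using slot[OF 1(1,2)] by blast
   have Fxs: "F xs \<in> words W n" using F 1 unfolding slotwise_def by blast
   show ?thesis
    using word_add_rel[OF Fxs j(1) lin_map_closed[OF j(2) 1(3)] lin_map_closed[OF j(2) 1(4)]]
    by (simp add: 1 frag_extend_diff j left_module_add_closed[OF V] lin_map_add[OF j(2)])
  next
   case 2
   have Fxs: "F xs \<in> words W n" using F 2 unfolding slotwise_def by blast
   obtain q1 where q1: "q1 < n" "F (xs[i := a \<odot>\<^bsub>V\<^esub> (xs ! i)]) = (F xs)[q1 := a \<odot>\<^bsub>W\<^esub> (F xs ! q1)]"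
    using slotwise_scale[OF V F 2(1,2)] .
   obtain q2 where q2: "q2 < n" "F (xs[j := a \<odot>\<^bsub>V\<^esub> (xs ! j)]) = (F xs)[q2 := a \<odot>\<^bsub>W\<^esub> (F xs ! q2)]"
    using slotwise_scale[OF V F 2(1,3)] .
   show ?thesis
    using word_scale_rel[OF Fxs q1(1) q2(1), of a] by (simp add: 2(4) frag_extend_diff q1 q2)
  qed
 qed
qed

lemma frag_extend_fun_add: "frag_extend (\<lambda>x. F x + G x) z = frag_extend F z + frag_extend G z"
 using subset_UNIV by (induction z rule: frag_induction) (auto simp: frag_extend_diff)

lemma frag_cmul_diff: "frag_cmul c (a - b) = frag_cmul c a - frag_cmul c b"
 by (rule poly_mapping_eqI) (simp add: lookup_minus algebra_simps)

lemma frag_extend_fun_cmul: "frag_extend (\<lambda>x. frag_cmul c (F x)) z = frag_cmul c (frag_extend F z)"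
 using subset_UNIV by (induction z rule: frag_induction) (auto simp: frag_extend_diff frag_cmul_diff)

lemma frag_extend_fun_sum: "frag_extend (\<lambda>x. \<Sum>i\<in>I. F i x) z = (\<Sum>i\<in>I. frag_extend (F i) z)"
proof (induction I rule: infinite_finite_induct)
 case (insert i I)
 then show ?case by (simp add: frag_extend_fun_add)
qed (simp_all add: frag_extend_eq_0)

lemma presentation_map_cmul:
 assumes "presentation_map X R Y S F"
 shows "presentation_map X R Y S (\<lambda>x. frag_cmul c (F x))"
proof -
 interpret presentation_map X R Y S F by fact
 show ?thesis
  by unfold_locales (auto simp: frag_extend_fun_cmul cod.rspan_cmul rels_to_rels dest: gens)
qed

lemma presentation_map_add:
 assumes "presentation_map X R Y S F" "presentation_map X R Y S G"
 shows "presentation_map X R Y S (\<lambda>x. F x + G x)"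
proof -
 interpret F: presentation_map X R Y S F by fact
 interpret G: presentation_map X R Y S G by fact
 show ?thesis
  by unfold_locales (simp_all add: frag_extend_fun_add F.cod.rspan_add F.rels_to_rels G.rels_to_rels F.gens G.gens keys_add_subset)
qed

lemma presentation_map_sum:
 assumes "presentation X R" "presentation Y S" "\<And>i. i \<in> I ==> presentation_map X R Y S (F i)"
 shows "presentation_map X R Y S (\<lambda>x. \<Sum>i\<in>I. F i x)"
proof -
 interpret X: presentation X R by fact
 interpret Y: presentation Y S by fact
 show ?thesis
 proof
  show "supp (\<Sum>i\<in>I. F i x) \<subseteq> Y" if "x \<in> X" for x
   using presentation_map.gens[OF assms(3)] that by (intro keys_sum_subset) auto
  show "frag_extend (\<lambda>x. \<Sum>i\<in>I. F i x) r \<in> rel_span Y S" if "r \<in> R" for r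
   unfolding frag_extend_fun_sum
   using presentation_map.rels_to_rels[OF assms(3)] that by (intro Y.rspan_sum) auto
 qed
qed

section \<open>Connes' complex on formal sums\<close>

lemma (in comm_group) rcoset_eq_iff:
 assumes "subgroup H G" "x \<in> carrier G" "y \<in> carrier G"
 shows "H #> x = H #> y \<longleftrightarrow> x \<otimes> inv y \<in> H"
proof -
 interpret subgroup H G by fact
 have "x \<otimes> inv y \<in> H \<longleftrightarrow> x \<in> H #> y"
 proof
  assume "x \<otimes> inv y \<in> H"
  moreover have "x = (x \<otimes> inv y) \<otimes> y" using assms by (simp add: m_assoc)
  ultimately show "x \<in> H #> y" using rcosI[OF _ subset assms(3)] by metis
 next
  assume "x \<in> H #> y"
  then obtain h where "h \<in> H" "x = h \<otimes> y" unfolding r_coset_def by blast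
  then show "x \<otimes> inv y \<in> H" using assms by (simp add: m_assoc)
 qed
 then show ?thesis
  using assms rcos_self[OF assms(2,1)] repr_independence[OF _ assms(3,1)] by metis
qed

definition rot :: "'a list => 'a list" where
 "rot xs = last xs # butlast xs"

definition face :: "nat => 'a::times list => 'a list" where
 "face j xs = take j xs @ (xs ! j * xs ! (j + 1)) # drop (j + 2) xs"

lemma length_rot [simp]: "xs \<noteq> [] ==> length (rot xs) = length xs"
 by (simp add: rot_def)

lemma rot_nth: "p < length xs ==> rot xs ! p = (if p = 0 then xs ! (length xs - 1) else xs ! (p - 1))"
 by (auto simp: rot_def nth_Cons nth_butlast last_conv_nth split: nat.split)

lemma length_face: "j + 1 < length xs ==> length (face j xs) = length xs - 1"
 by (auto simp: face_def)

lemma face_nth: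
 assumes "j + 1 < length xs" "p < length xs - 1"
 shows "face j xs ! p = (if p < j then xs ! p else if p = j then xs ! j * xs ! (j + 1) else xs ! (p + 1))"
 using assms by (auto simp: face_def nth_append nth_Cons min_def split: nat.split intro: arg_cong[where f = "(!) xs"])

lemma rot_update:
 assumes "i < length xs"
 shows "rot (xs[i := v]) = (rot xs)[(if i = length xs - 1 then 0 else Suc i) := v]"
 using assms by (intro nth_equalityI) (auto simp: rot_nth nth_list_update simp flip: length_greater_0_conv)

lemma face_update:
 assumes "j + 1 < length xs" "i < length xs"
 shows "face j (xs[i := v]) = (face j xs)[(if i \<le> j then i else i - 1) :=
  (if i = j then v * xs ! (j + 1) else if i = j + 1 then xs ! j * v else v)]"
 using assms
 by (intro nth_equalityI) (auto simp: face_nth length_face nth_list_update)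

lemma last_face_eq:
 "2 \<le> length xs ==> (last xs * hd xs) # tl (butlast xs) = face 0 (rot xs)"
 by (cases xs; cases "tl xs") (auto simp: face_def rot_def drop_Suc)

lemma face_rot_Suc:
 assumes "j + 2 < length xs"
 shows "face (Suc j) (rot xs) = rot (face j xs)"
proof (rule nth_equalityI)
 have ne: "xs \<noteq> []" "face j xs \<noteq> []" using assms by (auto simp: face_def)
 show "length (face (Suc j) (rot xs)) = length (rot (face j xs))"
  using assms ne by (simp add: length_face)
 fix p assume "p < length (face (Suc j) (rot xs))"
 then have p: "p < length xs - 1" using assms ne by (simp add: length_face)
 have e: "Suc (length xs - Suc (Suc 0)) = length xs - Suc 0" using assms by simp
 show "face (Suc j) (rot xs) ! p = rot (face j xs) ! p"
  using assms ne p e by (auto simp: face_nth rot_nth length_face)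
qed

lemma face_zero_rot_rot:
 assumes "2 \<le> length xs"
 shows "face 0 (rot (rot xs)) = rot (face (length xs - 2) xs)"
proof (rule nth_equalityI)
 have ne: "xs \<noteq> []" "rot xs \<noteq> []" "face (length xs - 2) xs \<noteq> []" using assms by (auto simp: face_def rot_def)
 show "length (face 0 (rot (rot xs))) = length (rot (face (length xs - 2) xs))"
  using assms ne by (simp add: length_face)
 fix p assume "p < length (face 0 (rot (rot xs)))"
 then have p: "p < length xs - 1" using assms ne by (simp add: length_face)
 have e: "Suc (length xs - Suc (Suc 0)) = length xs - Suc 0" using assms by simp
 show "face 0 (rot (rot xs)) ! p = rot (face (length xs - 2) xs) ! p"
  using assms ne p e by (auto simp: face_nth rot_nth length_face)
qed

definition cyc_frag :: "nat => ('a list \<Rightarrow>\<^sub>0 int) => ('a list \<Rightarrow>\<^sub>0 int)" where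
 "cyc_frag m = frag_extend (\<lambda>xs. frag_cmul ((- 1) ^ m) (frag_of (rot xs)))"

definition hoch_frag :: "nat => ('a::times list \<Rightarrow>\<^sub>0 int) => ('a list \<Rightarrow>\<^sub>0 int)" where
 "hoch_frag m = frag_extend (\<lambda>xs.
   (\<Sum>i<m. frag_cmul ((- 1) ^ i) (frag_of (face i xs))) + frag_cmul ((- 1) ^ m) (frag_of (face 0 (rot xs))))"

definition inner_faces_frag :: "nat => ('a::times list \<Rightarrow>\<^sub>0 int) => ('a list \<Rightarrow>\<^sub>0 int)" where
 "inner_faces_frag m = frag_extend (\<lambda>xs. \<Sum>i<m. frag_cmul ((- 1) ^ i) (frag_of (face i xs)))"

lemma hoch_frag_of:
 "hoch_frag m (frag_of xs) =
   (\<Sum>i<m. frag_cmul ((- 1) ^ i) (frag_of (face i xs))) + frag_cmul ((- 1) ^ m) (frag_of (face 0 (rot xs)))"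
 by (simp add: hoch_frag_def)

lemma cyc_frag_diff: "cyc_frag m (a - b) = cyc_frag m a - cyc_frag m b"
 and cyc_frag_add: "cyc_frag m (a + b) = cyc_frag m a + cyc_frag m b"
 and cyc_frag_zero: "cyc_frag m 0 = 0"
 and cyc_frag_cmul: "cyc_frag m (frag_cmul c a) = frag_cmul c (cyc_frag m a)"
 by (simp_all add: cyc_frag_def frag_extend_diff frag_extend_add frag_extend_cmul)

lemma hoch_frag_diff: "hoch_frag m (a - b) = hoch_frag m a - hoch_frag m b"
 and hoch_frag_add: "hoch_frag m (a + b) = hoch_frag m a + hoch_frag m b"
 and hoch_frag_zero: "hoch_frag m 0 = 0"
 and hoch_frag_cmul: "hoch_frag m (frag_cmul c a) = frag_cmul c (hoch_frag m a)"
 by (simp_all add: hoch_frag_def frag_extend_diff frag_extend_add frag_extend_cmul)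

lemma inner_faces_frag_diff: "inner_faces_frag m (a - b) = inner_faces_frag m a - inner_faces_frag m b"
 by (simp only: inner_faces_frag_def frag_extend_diff)

text \<open>The identity \<open>b (1 - t) = (1 - t) b'\<close>, by which the Hochschild boundary descends to Connes' complex.\<close>

lemma hoch_cyc_word:
 fixes xs :: "'a::times list"
 assumes len: "length xs = m + 2"
 shows "hoch_frag (Suc m) (frag_of xs - cyc_frag (Suc m) (frag_of xs))
  = inner_faces_frag (Suc m) (frag_of xs) - cyc_frag m (inner_faces_frag (Suc m) (frag_of xs))"
proof -
 have ne: "xs \<noteq> []" using len by auto
 have "(\<Sum>i<Suc m. frag_cmul ((- 1) ^ i) (frag_of (face i (rot xs))))
   = frag_of (face 0 (rot xs)) + (\<Sum>i<m. frag_cmul ((- 1) ^ Suc i) (frag_of (face (Suc i) (rot xs))))"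
  by (subst sum.lessThan_Suc_shift) simp
 also have "(\<Sum>i<m. frag_cmul ((- 1) ^ Suc i) (frag_of (face (Suc i) (rot xs))))
   = (\<Sum>i<m. frag_cmul ((- 1) ^ Suc i) (frag_of (rot (face i xs))))"
  using len by (intro sum.cong) (auto simp: face_rot_Suc)
 finally have L: "(\<Sum>i<Suc m. frag_cmul ((- 1) ^ i) (frag_of (face i (rot xs))))
   = frag_of (face 0 (rot xs)) + (\<Sum>i<m. frag_cmul ((- 1) ^ Suc i) (frag_of (rot (face i xs))))" .
 have fz: "face 0 (rot (rot xs)) = rot (face m xs)" using face_zero_rot_rot[of xs] len by simp
 have A: "hoch_frag (Suc m) (frag_of (rot xs)) =
   frag_of (face 0 (rot xs)) + (\<Sum>i<Suc m. frag_cmul ((- 1) ^ Suc i) (frag_of (rot (face i xs))))"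
  unfolding hoch_frag_of L fz by (simp add: add.assoc)
 have B: "cyc_frag m (inner_faces_frag (Suc m) (frag_of xs))
   = (\<Sum>i<Suc m. frag_cmul ((- 1) ^ (m + i)) (frag_of (rot (face i xs))))"
  unfolding cyc_frag_def inner_faces_frag_def frag_extend_of
  by (subst frag_extend_sum, simp, intro sum.cong refl) (simp add: frag_extend_cmul power_add mult.commute)
 have "hoch_frag (Suc m) (cyc_frag (Suc m) (frag_of xs))
   = frag_cmul ((- 1) ^ Suc m) (frag_of (face 0 (rot xs)))
    + (\<Sum>i<Suc m. frag_cmul ((- 1) ^ (m + i)) (frag_of (rot (face i xs))))"
  unfolding cyc_frag_def frag_extend_of hoch_frag_cmul A frag_cmul_distrib2
  by (intro arg_cong2[where f = "(+)"] refl, subst frag_cmul_sum)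
   (intro sum.cong refl, simp add: power_add)
 then show ?thesis
  unfolding hoch_frag_diff B by (simp add: hoch_frag_of inner_faces_frag_def)
qed

lemma hoch_cyc_frag:
 fixes z :: "'a::times list \<Rightarrow>\<^sub>0 int"
 assumes "supp z \<subseteq> {xs. length xs = m + 2}"
 shows "hoch_frag (Suc m) (z - cyc_frag (Suc m) z)
  = inner_faces_frag (Suc m) z - cyc_frag m (inner_faces_frag (Suc m) z)"
 using assms
proof (induction z rule: keys_induct)
 case (gen a)
 then show ?case using hoch_cyc_word[of a m] by simp
next
 case (diff a b)
 have "a - b - cyc_frag (Suc m) (a - b) = (a - cyc_frag (Suc m) a) - (b - cyc_frag (Suc m) b)"
  by (simp add: cyc_frag_diff)
 then have "hoch_frag (Suc m) (a - b - cyc_frag (Suc m) (a - b))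
   = hoch_frag (Suc m) (a - cyc_frag (Suc m) a) - hoch_frag (Suc m) (b - cyc_frag (Suc m) b)"
  by (simp only: hoch_frag_diff[symmetric])
 then show ?case
  unfolding diff(3,4) inner_faces_frag_diff cyc_frag_diff by simp
qed (simp add: hoch_frag_zero cyc_frag_zero inner_faces_frag_def)

locale subalgebra =
 fixes s :: "'k::field_char_0 => 'p::{ring,monoid_mult} => 'p" and B :: "'p set"
 assumes vs: "vector_space s"
  and scale_left: "s r (x * y) = s r x * y" and scale_right: "s r (x * y) = x * s r y"
  and zero_mem: "0 \<in> B" and one_mem: "1 \<in> B"
  and add_mem: "x \<in> B ==> y \<in> B ==> x + y \<in> B" and minus_mem: "x \<in> B ==> - x \<in> B"
  and mult_mem: "x \<in> B ==> y \<in> B ==> x * y \<in> B" and scale_mem: "x \<in> B ==> s r x \<in> B"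
begin

sublocale vector_space s by (rule vs)

abbreviation "M \<equiv> module_of s B"

lemma left_module_M: "left_module UNIV M"
 by (rule left_module_module_of) (auto simp: vs zero_mem add_mem minus_mem scale_mem)

lemma sum_mem: "(\<And>i. i \<in> I ==> f i \<in> B) ==> sum f I \<in> B"
 by (induction I rule: infinite_finite_induct) (auto simp: zero_mem add_mem)

sublocale T: presentation "words M m" "multilinear_rel M m" for m
 by (rule presentation_words[OF left_module_M])

lemma tensor_power_M: "tensor_power M m = presented_group (words M m) (multilinear_rel M m)"
 by (simp add: tensor_power_def)

lemma lin_map_mult_left: "a \<in> B ==> lin_map UNIV M M (\<lambda>v. a * v)"
 by (auto simp: lin_map_def mult_mem distrib_left scale_right)

lemma lin_map_mult_right: "a \<in> B ==> lin_map UNIV M M (\<lambda>v. v * a)"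
 by (auto simp: lin_map_def mult_mem distrib_right scale_left)

lemma slotwise_rot: "slotwise M (Suc m) M (Suc m) rot"
 unfolding slotwise_def
proof (intro conjI ballI allI impI)
 show "rot \<in> words M (Suc m) \<rightarrow> words M (Suc m)"
  by (force simp: words_iff_nth rot_nth simp flip: length_greater_0_conv)
 fix xs i assume "xs \<in> words M (Suc m)" "i < Suc m"
 then show "\<exists>j<Suc m. \<exists>\<phi>. lin_map UNIV M M \<phi> \<and> (\<forall>v\<in>carrier M. rot (xs[i := v]) = (rot xs)[j := \<phi> v])"
  by (intro exI[of _ "if i = m then 0 else Suc i"] conjI exI[of _ "\<lambda>v. v"])
   (auto simp: rot_update lin_map_id dest!: words_length)
qed

lemma slotwise_face:
 assumes j: "j < m" shows "slotwise M (Suc m) M m (face j)"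
 unfolding slotwise_def
proof (intro conjI ballI allI impI)
 show "face j \<in> words M (Suc m) \<rightarrow> words M m"
  using j by (auto simp: words_iff_nth face_nth length_face mult_mem)
 fix xs i assume xs: "xs \<in> words M (Suc m)" and i: "i < Suc m"
 let ?\<phi> = "\<lambda>v. if i = j then v * xs ! (j + 1) else if i = j + 1 then xs ! j * v else v"
 have "lin_map UNIV M M ?\<phi>"
  using words_nth[OF xs, of j] words_nth[OF xs, of "j + 1"] j
  by (cases "i = j"; cases "i = j + 1") (auto simp: lin_map_mult_left lin_map_mult_right lin_map_id)
 moreover have "face j (xs[i := v]) = (face j xs)[(if i \<le> j then i else i - 1) := ?\<phi> v]" for v
  using face_update[of j xs i v] words_length[OF xs] i j by simp
 moreover have "(if i \<le> j then i else i - 1) < m" using i j by auto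
 ultimately show "\<exists>h<m. \<exists>\<phi>. lin_map UNIV M M \<phi> \<and> (\<forall>v\<in>carrier M. face j (xs[i := v]) = (face j xs)[h := \<phi> v])"
  by blast
qed

abbreviation "pmap m n F \<equiv> presentation_map (words M m) (multilinear_rel M m) (words M n) (multilinear_rel M n) F"

lemma pmap_cyc: "pmap (Suc m) (Suc m) (\<lambda>xs. frag_cmul ((- 1) ^ m) (frag_of (rot xs)))"
 by (intro presentation_map_cmul slotwise_presentation_map left_module_M slotwise_rot)

lemma pmap_inner_faces: "pmap (Suc m) m (\<lambda>xs. \<Sum>i<m. frag_cmul ((- 1) ^ i) (frag_of (face i xs)))"
 by (intro presentation_map_sum presentation_map_cmul slotwise_presentation_map left_module_M slotwise_face
   presentation_words) auto

lemma pmap_hoch: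
 assumes "0 < m"
 shows "pmap (Suc m) m (\<lambda>xs. (\<Sum>i<m. frag_cmul ((- 1) ^ i) (frag_of (face i xs)))
   + frag_cmul ((- 1) ^ m) (frag_of (face 0 (rot xs))))"
 by (rule presentation_map_add[OF pmap_inner_faces], rule presentation_map_cmul,
   rule slotwise_presentation_map[OF left_module_M left_module_M slotwise_comp[OF slotwise_rot slotwise_face[OF assms]]])

lemma cyc_frag_keys: "supp z \<subseteq> words M (Suc m) ==> supp (cyc_frag m z) \<subseteq> words M (Suc m)"
 unfolding cyc_frag_def by (rule presentation_map.extend_keys[OF pmap_cyc])

lemma hoch_frag_keys:
 "0 < m ==> supp z \<subseteq> words M (Suc m) ==> supp (hoch_frag m z) \<subseteq> words M m"
 unfolding hoch_frag_def by (rule presentation_map.extend_keys[OF pmap_hoch])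

lemma inner_faces_keys:
 "supp z \<subseteq> words M (Suc m) ==> supp (inner_faces_frag m z) \<subseteq> words M m"
 unfolding inner_faces_frag_def by (rule presentation_map.extend_keys[OF pmap_inner_faces])

lemma hoch_frag_span: "0 < m ==> z \<in> pspan M (Suc m) ==> hoch_frag m z \<in> pspan M m"
 unfolding hoch_frag_def by (rule presentation_map.rspan_to_span[OF pmap_hoch])

lemma cyclic_op_class:
 assumes "supp z \<subseteq> words M (Suc m)"
 shows "cyclic_op s B m (power_class M (Suc m) z) = power_class M (Suc m) (cyc_frag m z)"
 using presentation_map.lift_hom_frag[OF pmap_cyc assms]
 by (simp add: cyclic_op_def power_class_presented tensor_power_def cyc_frag_def rot_def)

lemma hochschild_class:
 assumes "0 < m" "supp z \<subseteq> words M (Suc m)"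
 shows "hochschild s B m (power_class M (Suc m) z) = power_class M m (hoch_frag m z)"
proof -
 let ?F = "\<lambda>xs. (\<Sum>i<m. frag_cmul ((- 1) ^ i) (frag_of (face i xs))) + frag_cmul ((- 1) ^ m) (frag_of (face 0 (rot xs)))"
 have eq: "(last xs * hd xs) # tl (butlast xs) = face 0 (rot xs)" if "xs \<in> words M (Suc m)" for xs
  using that assms(1) words_length[OF that] by (intro last_face_eq) simp
 have "hochschild s B m (power_class M (Suc m) z)
   = lift_hom (tensor_power M m) (\<lambda>xs. power_class M m (?F xs)) (power_class M (Suc m) z)"
  unfolding hochschild_def tensor_power_M power_class_presented
 proof (rule T.lift_hom_cong[OF T.comm_group_presented _ _ assms(2)])
  show "(\<lambda>xs. presented_class (words M m) (multilinear_rel M m) (?F xs))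
    \<in> words M (Suc m) \<rightarrow> carrier (presented_group (words M m) (multilinear_rel M m))"
   by (intro Pi_I T.class_closed presentation_map.gens[OF pmap_hoch[OF assms(1)]])
 qed (simp add: eq face_def)
 also have "\<dots> = power_class M m (hoch_frag m z)"
  using presentation_map.lift_hom_frag[OF pmap_hoch[OF assms(1)] assms(2)]
  by (simp add: power_class_presented tensor_power_def hoch_frag_def)
 finally show ?thesis .
qed

subsection \<open>Connes' complex and cyclic homology\<close>

text \<open>The chains that vanish in Connes' complex: the image of \<open>1 - t\<close> modulo the multilinear relations.\<close>

definition "cyc_null m = {z. supp z \<subseteq> words M (Suc m) \<and>
 (\<exists>x. supp x \<subseteq> words M (Suc m) \<and> z - (x - cyc_frag m x) \<in> pspan M (Suc m))}"

definition "ccls m z = connes_class s B m (power_class M (Suc m) z)"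

lemma cyc_null_keys: "z \<in> cyc_null m ==> supp z \<subseteq> words M (Suc m)"
 by (simp add: cyc_null_def)

lemma cyc_null_diff: assumes "a \<in> cyc_null m" "b \<in> cyc_null m" shows "a - b \<in> cyc_null m"
proof -
 obtain x where x: "supp x \<subseteq> words M (Suc m)" "a - (x - cyc_frag m x) \<in> pspan M (Suc m)"
  using assms(1) by (auto simp: cyc_null_def)
 obtain y where y: "supp y \<subseteq> words M (Suc m)" "b - (y - cyc_frag m y) \<in> pspan M (Suc m)"
  using assms(2) by (auto simp: cyc_null_def)
 have "(a - b) - ((x - y) - cyc_frag m (x - y)) = (a - (x - cyc_frag m x)) - (b - (y - cyc_frag m y))"
  by (simp add: cyc_frag_diff)
 then have "(a - b) - ((x - y) - cyc_frag m (x - y)) \<in> pspan M (Suc m)"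
  using T.rspan_diff[OF x(2) y(2)] by metis
 then show ?thesis
  unfolding cyc_null_def using keys_diff_subset[OF x(1) y(1)] keys_diff_subset[OF cyc_null_keys[OF assms(1)] cyc_null_keys[OF assms(2)]]
  by blast
qed

lemma span_cyc_null: "z \<in> pspan M (Suc m) ==> z \<in> cyc_null m"
 using T.rspan_keys[of z] by (auto simp: cyc_null_def cyc_frag_zero intro!: exI[of _ 0])

lemma cyc_null_zero: "0 \<in> cyc_null m"
 by (rule span_cyc_null[OF T.rspan_zero])

lemma cyc_null_minus: "a \<in> cyc_null m ==> - a \<in> cyc_null m"
 using cyc_null_diff[OF cyc_null_zero, of a] by simp

lemma cyc_null_add: "a \<in> cyc_null m ==> b \<in> cyc_null m ==> a + b \<in> cyc_null m"
 using cyc_null_diff[OF _ cyc_null_minus, of a m b] by simp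

lemma cyc_null_coboundary: "supp x \<subseteq> words M (Suc m) ==> x - cyc_frag m x \<in> cyc_null m"
 unfolding cyc_null_def
 by (intro CollectI conjI exI[of _ x] keys_diff_subset cyc_frag_keys) (auto simp: T.rspan_zero)

lemma hoch_frag_cyc_null:
 assumes "z \<in> cyc_null (Suc m)" shows "hoch_frag (Suc m) z \<in> cyc_null m"
proof -
 obtain x where x: "supp x \<subseteq> words M (Suc (Suc m))"
   "z - (x - cyc_frag (Suc m) x) \<in> pspan M (Suc (Suc m))"
  using assms by (auto simp: cyc_null_def)
 have len: "supp x \<subseteq> {xs. length xs = m + 2}" using x(1) by (auto simp: words_def)
 let ?y = "inner_faces_frag (Suc m) x"
 have "hoch_frag (Suc m) (z - (x - cyc_frag (Suc m) x)) \<in> cyc_null m"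
  by (intro span_cyc_null hoch_frag_span x(2)) simp
 moreover have "?y - cyc_frag m ?y \<in> cyc_null m"
  by (intro cyc_null_coboundary inner_faces_keys x(1))
 ultimately have "hoch_frag (Suc m) (z - (x - cyc_frag (Suc m) x)) + hoch_frag (Suc m) (x - cyc_frag (Suc m) x) \<in> cyc_null m"
  unfolding hoch_cyc_frag[OF len] by (rule cyc_null_add)
 then show ?thesis by (simp flip: hoch_frag_add)
qed

lemma power_class_mem_cyclic_image:
 assumes "supp z \<subseteq> words M (Suc m)"
 shows "power_class M (Suc m) z \<in> cyclic_image s B m \<longleftrightarrow> z \<in> cyc_null m"
proof -
 have im: "cyclic_image s B m = {power_class M (Suc m) (x - cyc_frag m x) | x. supp x \<subseteq> words M (Suc m)}"
 proof -
  have "power_class M (Suc m) x \<otimes>\<^bsub>tensor_power M (Suc m)\<^esub> inv\<^bsub>tensor_power M (Suc m)\<^esub> cyclic_op s B m (power_class M (Suc m) x)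
    = power_class M (Suc m) (x - cyc_frag m x)" if "supp x \<subseteq> words M (Suc m)" for x
   using that cyc_frag_keys[OF that] unfolding cyclic_op_class[OF that] unfolding tensor_power_M power_class_presented
   by (simp add: T.inv_class T.mult_class)
  moreover have "carrier (tensor_power M (Suc m)) = power_class M (Suc m) ` {x. supp x \<subseteq> words M (Suc m)}"
   unfolding tensor_power_M power_class_presented by (rule T.carrier_presented)
  ultimately show ?thesis unfolding cyclic_image_def by (auto simp: Let_def image_iff)
 qed
 show ?thesis unfolding im power_class_presented T.class_eq_iff[symmetric] cyc_null_def using assms
  by (auto simp: T.class_eq_iff)
qed

lemma tensor_powerE:
 assumes "A \<in> carrier (tensor_power M m)"
 obtains z where "supp z \<subseteq> words M m" "A = power_class M m z"
 using assms unfolding tensor_power_M power_class_presented by (rule T.presentedE)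

lemma cyclic_image_subset: "cyclic_image s B m \<subseteq> carrier (tensor_power M (Suc m))"
proof -
 have "cyclic_op s B m x \<in> carrier (tensor_power M (Suc m))" if x: "x \<in> carrier (tensor_power M (Suc m))" for x
 proof -
  obtain z where z: "supp z \<subseteq> words M (Suc m)" "x = power_class M (Suc m) z"
   using x by (rule tensor_powerE)
  show ?thesis unfolding z(2) cyclic_op_class[OF z(1)] using T.class_closed[OF cyc_frag_keys[OF z(1)]]
   by (simp add: tensor_power_M power_class_presented)
 qed
 then show ?thesis unfolding cyclic_image_def by (auto simp: Let_def tensor_power_M)
qed

lemma subgroup_cyclic_image: "subgroup (cyclic_image s B m) (tensor_power M (Suc m))"
proof -
 have G: "group (tensor_power M (Suc m))" by (simp add: tensor_power_M T.Q.is_group)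
 show ?thesis
 proof (rule group.subgroupI[OF G cyclic_image_subset])
  have "power_class M (Suc m) 0 \<in> cyclic_image s B m"
   by (simp add: power_class_mem_cyclic_image cyc_null_zero)
  then show "cyclic_image s B m \<noteq> {}" by blast
 next
  fix a assume a: "a \<in> cyclic_image s B m"
  then obtain z where z: "supp z \<subseteq> words M (Suc m)" "a = power_class M (Suc m) z"
   using cyclic_image_subset tensor_powerE by blast
  have "inv\<^bsub>tensor_power M (Suc m)\<^esub> a = power_class M (Suc m) (- z)"
   using z by (simp add: tensor_power_M power_class_presented T.inv_class)
  then show "inv\<^bsub>tensor_power M (Suc m)\<^esub> a \<in> cyclic_image s B m"
   using a z cyc_null_minus by (simp add: power_class_mem_cyclic_image)
  fix b assume b: "b \<in> cyclic_image s B m"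
  then obtain y where y: "supp y \<subseteq> words M (Suc m)" "b = power_class M (Suc m) y"
   using cyclic_image_subset tensor_powerE by blast
  have "a \<otimes>\<^bsub>tensor_power M (Suc m)\<^esub> b = power_class M (Suc m) (z + y)"
   using z y by (simp add: tensor_power_M power_class_presented T.mult_class)
  then show "a \<otimes>\<^bsub>tensor_power M (Suc m)\<^esub> b \<in> cyclic_image s B m"
   using a b z y cyc_null_add by (simp add: power_class_mem_cyclic_image keys_add_subset)
 qed
qed

lemma comm_group_T: "comm_group (tensor_power M m)"
 by (simp add: tensor_power_M T.comm_group_presented)

lemma normal_cyclic_image: "cyclic_image s B m \<lhd> tensor_power M (Suc m)"
 using comm_group.normal_iff_subgroup[OF comm_group_T] subgroup_cyclic_image by blast

lemma power_class_closed: "supp z \<subseteq> words M m ==> power_class M m z \<in> carrier (tensor_power M m)"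
 unfolding tensor_power_M power_class_presented by (rule T.class_closed)

lemma power_class_diff:
 "supp a \<subseteq> words M m ==> supp b \<subseteq> words M m ==>
  power_class M m a \<otimes>\<^bsub>tensor_power M m\<^esub> inv\<^bsub>tensor_power M m\<^esub> power_class M m b = power_class M m (a - b)"
 unfolding tensor_power_M power_class_presented by (simp add: T.inv_class T.mult_class)

lemma connes_class_eq: "connes_class s B m x = cyclic_image s B m #>\<^bsub>tensor_power M (Suc m)\<^esub> x"
 by (simp add: connes_class_def)

lemma ccls_eq_iff:
 assumes "supp a \<subseteq> words M (Suc m)" "supp b \<subseteq> words M (Suc m)"
 shows "ccls m a = ccls m b \<longleftrightarrow> a - b \<in> cyc_null m"
 using comm_group.rcoset_eq_iff[OF comm_group_T subgroup_cyclic_image power_class_closed[OF assms(1)] power_class_closed[OF assms(2)]]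
  power_class_mem_cyclic_image[OF keys_diff_subset[OF assms]]
 by (simp add: ccls_def connes_class_def power_class_diff[OF assms])

lemma connes_group_eq: "connes_group s B m = tensor_power M (Suc m) Mod cyclic_image s B m"
 by (simp add: connes_group_def)

lemma comm_group_connes: "comm_group (connes_group s B m)"
 unfolding connes_group_eq by (rule comm_group.abelian_FactGroup[OF comm_group_T subgroup_cyclic_image])

lemma carrier_connes: "carrier (connes_group s B m) = ccls m ` {z. supp z \<subseteq> words M (Suc m)}"
proof -
 have "carrier (tensor_power M (Suc m)) = power_class M (Suc m) ` {x. supp x \<subseteq> words M (Suc m)}"
  unfolding tensor_power_M power_class_presented by (rule T.carrier_presented)
 then show ?thesis
  by (simp add: connes_group_eq carrier_FactGroup ccls_def connes_class_def image_image)
qed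

lemma ccls_closed: "supp z \<subseteq> words M (Suc m) ==> ccls m z \<in> carrier (connes_group s B m)"
 by (simp add: carrier_connes)

lemma ccls_mult:
 assumes "supp a \<subseteq> words M (Suc m)" "supp b \<subseteq> words M (Suc m)"
 shows "ccls m a \<otimes>\<^bsub>connes_group s B m\<^esub> ccls m b = ccls m (a + b)"
proof -
 have "power_class M (Suc m) a \<otimes>\<^bsub>tensor_power M (Suc m)\<^esub> power_class M (Suc m) b = power_class M (Suc m) (a + b)"
  using assms by (simp add: tensor_power_M power_class_presented T.mult_class)
 then show ?thesis
  using normal.rcos_sum[OF normal_cyclic_image power_class_closed[OF assms(1)] power_class_closed[OF assms(2)]]
  by (simp add: connes_group_eq ccls_def connes_class_def)
qed

lemma ccls_zero: "ccls m 0 = \<one>\<^bsub>connes_group s B m\<^esub>"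
proof -
 have "\<one>\<^bsub>tensor_power M (Suc m)\<^esub> = power_class M (Suc m) 0"
  by (simp add: tensor_power_M power_class_presented T.one_presented)
 then show ?thesis
  unfolding ccls_def connes_class_eq connes_group_eq one_FactGroup
  using group.coset_mult_one[OF comm_group.axioms(2)[OF comm_group_T] subgroup.subset[OF subgroup_cyclic_image]]
  by metis
qed

interpretation CG: comm_group "connes_group s B m" for m by (rule comm_group_connes)

lemma ccls_inv:
 assumes "supp a \<subseteq> words M (Suc m)"
 shows "inv\<^bsub>connes_group s B m\<^esub> ccls m a = ccls m (- a)"
 using assms by (intro CG.inv_equality) (auto simp: ccls_mult ccls_zero ccls_closed)

lemma connes_diff_class:
 assumes "supp z \<subseteq> words M (Suc (Suc m))"
 shows "connes_diff s B (Suc m) (ccls (Suc m) z) = ccls m (hoch_frag (Suc m) z)"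
proof -
 let ?X = "ccls (Suc m) z"
 define x where "x = (SOME x. x \<in> ?X)"
 have "power_class M (Suc (Suc m)) z \<in> ?X"
  unfolding ccls_def connes_class_eq
  by (rule group.rcos_self[OF comm_group.axioms(2)[OF comm_group_T] power_class_closed[OF assms] subgroup_cyclic_image])
 then have x: "x \<in> ?X" unfolding x_def by (rule someI)
 then obtain h where h: "h \<in> cyclic_image s B (Suc m)" "x = h \<otimes>\<^bsub>tensor_power M (Suc (Suc m))\<^esub> power_class M (Suc (Suc m)) z"
  unfolding ccls_def connes_class_eq r_coset_def by blast
 have "h \<in> carrier (tensor_power M (Suc (Suc m)))" using h(1) cyclic_image_subset by blast
 then obtain y where y: "supp y \<subseteq> words M (Suc (Suc m))" "h = power_class M (Suc (Suc m)) y"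
  by (rule tensor_powerE)
 have yn: "y \<in> cyc_null (Suc m)" using h(1) power_class_mem_cyclic_image[OF y(1)] y(2) by simp
 have xe: "x = power_class M (Suc (Suc m)) (y + z)"
  using h(2) y assms by (simp add: tensor_power_M power_class_presented T.mult_class)
 have ks: "supp (y + z) \<subseteq> words M (Suc (Suc m))" by (rule keys_add_subset[OF y(1) assms])
 have "connes_diff s B (Suc m) ?X = connes_class s B m (hochschild s B (Suc m) x)"
  by (simp add: connes_diff_def x_def)
 also have "\<dots> = ccls m (hoch_frag (Suc m) (y + z))"
  unfolding xe hochschild_class[OF zero_less_Suc ks] ccls_def ..
 also have "\<dots> = ccls m (hoch_frag (Suc m) z)"
  using hoch_frag_cyc_null[OF yn] hoch_frag_keys[OF zero_less_Suc ks] hoch_frag_keys[OF zero_less_Suc assms]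
  by (simp add: ccls_eq_iff hoch_frag_add)
 finally show ?thesis .
qed

definition "cycles m = {z. supp z \<subseteq> words M (Suc m) \<and> (m = 0 \<or> hoch_frag m z \<in> cyc_null (m - 1))}"

definition "hom_null m = {z. \<exists>y. supp y \<subseteq> words M (Suc (Suc m)) \<and> z - hoch_frag (Suc m) y \<in> cyc_null m}"

lemma ccls_cycles_iff:
 assumes "supp z \<subseteq> words M (Suc m)"
 shows "ccls m z \<in> connes_cycles s B m \<longleftrightarrow> z \<in> cycles m"
proof (cases m)
 case (Suc n)
 have "ccls n (hoch_frag (Suc n) z) = \<one>\<^bsub>connes_group s B n\<^esub> \<longleftrightarrow> hoch_frag (Suc n) z \<in> cyc_null n"
  using ccls_eq_iff[of "hoch_frag (Suc n) z" n 0] hoch_frag_keys[OF zero_less_Suc] assms Suc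
  by (simp add: ccls_zero)
 then show ?thesis
  using assms Suc connes_diff_class[of z n] by (simp add: connes_cycles_def cycles_def ccls_closed)
qed (use assms in \<open>simp add: connes_cycles_def cycles_def ccls_closed\<close>)

lemma connes_cycles_eq: "connes_cycles s B m = ccls m ` cycles m"
proof -
 have "connes_cycles s B m = {X \<in> carrier (connes_group s B m). X \<in> connes_cycles s B m}"
  unfolding connes_cycles_def by auto
 also have "\<dots> = ccls m ` {z. supp z \<subseteq> words M (Suc m) \<and> ccls m z \<in> connes_cycles s B m}"
  unfolding carrier_connes by auto
 also have "{z. supp z \<subseteq> words M (Suc m) \<and> ccls m z \<in> connes_cycles s B m} = cycles m"
  using ccls_cycles_iff[of _ m] by (auto simp: cycles_def)
 finally show ?thesis .
qed

lemma cycles_diff: "a \<in> cycles m ==> b \<in> cycles m ==> a - b \<in> cycles m"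
 by (auto simp: cycles_def keys_diff_subset hoch_frag_diff cyc_null_diff)

lemma cycles_zero: "0 \<in> cycles m"
 by (simp add: cycles_def hoch_frag_zero cyc_null_zero)

lemma cycles_keys: "z \<in> cycles m ==> supp z \<subseteq> words M (Suc m)"
 by (simp add: cycles_def)

lemma cycles_minus: "a \<in> cycles m ==> - a \<in> cycles m"
 using cycles_diff[OF cycles_zero, of a] by simp

lemma cycles_add: "a \<in> cycles m ==> b \<in> cycles m ==> a + b \<in> cycles m"
 using cycles_diff[OF _ cycles_minus, of a m b] by simp

lemma connes_boundaries_eq:
 "connes_boundaries s B m = (\<lambda>y. ccls m (hoch_frag (Suc m) y)) ` {y. supp y \<subseteq> words M (Suc (Suc m))}"
 unfolding connes_boundaries_def by (simp add: carrier_connes image_image connes_diff_class)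

lemma ccls_boundaries_iff:
 assumes "supp z \<subseteq> words M (Suc m)"
 shows "ccls m z \<in> connes_boundaries s B m \<longleftrightarrow> z \<in> hom_null m"
 unfolding connes_boundaries_eq hom_null_def image_iff
 using ccls_eq_iff[OF assms hoch_frag_keys[OF zero_less_Suc]] by blast

lemma hom_null_diff: assumes "a \<in> hom_null m" "b \<in> hom_null m" shows "a - b \<in> hom_null m"
proof -
 obtain x where x: "supp x \<subseteq> words M (Suc (Suc m))" "a - hoch_frag (Suc m) x \<in> cyc_null m"
  using assms(1) by (auto simp: hom_null_def)
 obtain y where y: "supp y \<subseteq> words M (Suc (Suc m))" "b - hoch_frag (Suc m) y \<in> cyc_null m"
  using assms(2) by (auto simp: hom_null_def)
 have "(a - hoch_frag (Suc m) x) - (b - hoch_frag (Suc m) y) = (a - b) - hoch_frag (Suc m) (x - y)"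
  by (simp add: hoch_frag_diff)
 then have "(a - b) - hoch_frag (Suc m) (x - y) \<in> cyc_null m"
  using cyc_null_diff[OF x(2) y(2)] by metis
 then show ?thesis
  using keys_diff_subset[OF x(1) y(1)] unfolding hom_null_def by blast
qed

lemma cyc_null_hom_null: "z \<in> cyc_null m ==> z \<in> hom_null m"
 unfolding hom_null_def by (intro CollectI exI[of _ 0]) (simp add: hoch_frag_zero)

lemma span_hom_null: "z \<in> pspan M (Suc m) ==> z \<in> hom_null m"
 by (intro cyc_null_hom_null span_cyc_null)

lemma hom_null_zero: "0 \<in> hom_null m"
 by (intro cyc_null_hom_null cyc_null_zero)

lemma hom_null_minus: "a \<in> hom_null m ==> - a \<in> hom_null m"
 using hom_null_diff[OF hom_null_zero, of a] by simp

lemma hom_null_add: "a \<in> hom_null m ==> b \<in> hom_null m ==> a + b \<in> hom_null m"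
 using hom_null_diff[OF _ hom_null_minus, of a m b] by simp

lemma hom_null_sum: "(\<And>i. i \<in> I ==> f i \<in> hom_null m) ==> sum f I \<in> hom_null m"
 by (induction I rule: infinite_finite_induct) (auto simp: hom_null_zero hom_null_add)

lemma hom_null_trans: "a - b \<in> hom_null m ==> b - c \<in> hom_null m ==> a - c \<in> hom_null m"
 using hom_null_add[of "a - b" m "b - c"] by simp

lemma hom_null_sym: "a - b \<in> hom_null m ==> b - a \<in> hom_null m"
 using hom_null_minus[of "a - b" m] by simp

lemma hom_null_boundary: "supp y \<subseteq> words M (Suc (Suc m)) ==> hoch_frag (Suc m) y \<in> hom_null m"
 unfolding hom_null_def by (intro CollectI exI[of _ y]) (simp add: cyc_null_zero)

definition "hcls m z = HC_class s B m (power_class M (Suc m) z)"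

lemma hcls_eq: "hcls m z = connes_boundaries s B m #>\<^bsub>connes_group s B m\<^esub> ccls m z"
 by (simp add: hcls_def HC_class_def ccls_def r_coset_def)

lemma boundaries_subset: "connes_boundaries s B m \<subseteq> carrier (connes_group s B m)"
 unfolding connes_boundaries_eq using hoch_frag_keys[OF zero_less_Suc] by (auto simp: ccls_closed)

lemma subgroup_boundaries: "subgroup (connes_boundaries s B m) (connes_group s B m)"
proof (rule CG.subgroupI[OF boundaries_subset])
 show "connes_boundaries s B m \<noteq> {}"
  unfolding connes_boundaries_eq by (auto intro!: exI[of _ 0])
next
 fix a assume "a \<in> connes_boundaries s B m"
 then obtain x where x: "supp x \<subseteq> words M (Suc (Suc m))" "a = ccls m (hoch_frag (Suc m) x)"
  unfolding connes_boundaries_eq by blast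
 have "inv\<^bsub>connes_group s B m\<^esub> a = ccls m (hoch_frag (Suc m) (0 - x))"
  using x hoch_frag_keys[OF zero_less_Suc x(1)] by (simp only: ccls_inv hoch_frag_diff) (simp add: hoch_frag_zero)
 moreover have "supp (0 - x) \<subseteq> words M (Suc (Suc m))" using x(1) by simp
 ultimately show "inv\<^bsub>connes_group s B m\<^esub> a \<in> connes_boundaries s B m"
  unfolding connes_boundaries_eq by blast
 fix b assume "b \<in> connes_boundaries s B m"
 then obtain y where y: "supp y \<subseteq> words M (Suc (Suc m))" "b = ccls m (hoch_frag (Suc m) y)"
  unfolding connes_boundaries_eq by blast
 have "a \<otimes>\<^bsub>connes_group s B m\<^esub> b = ccls m (hoch_frag (Suc m) (x + y))"
  using x y hoch_frag_keys[OF zero_less_Suc x(1)] hoch_frag_keys[OF zero_less_Suc y(1)]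
  by (simp add: ccls_mult hoch_frag_add)
 then show "a \<otimes>\<^bsub>connes_group s B m\<^esub> b \<in> connes_boundaries s B m"
  unfolding connes_boundaries_eq using keys_add_subset[OF x(1) y(1)] by blast
qed

lemma normal_boundaries: "connes_boundaries s B m \<lhd> connes_group s B m"
 using CG.normal_iff_subgroup subgroup_boundaries by blast

lemma hcls_eq_iff:
 assumes "supp a \<subseteq> words M (Suc m)" "supp b \<subseteq> words M (Suc m)"
 shows "hcls m a = hcls m b \<longleftrightarrow> a - b \<in> hom_null m"
proof -
 have "ccls m a \<otimes>\<^bsub>connes_group s B m\<^esub> inv\<^bsub>connes_group s B m\<^esub> ccls m b = ccls m (a - b)"
  using assms by (simp add: ccls_inv ccls_mult)
 then show ?thesis
  using CG.rcoset_eq_iff[OF subgroup_boundaries ccls_closed[OF assms(1)] ccls_closed[OF assms(2)]]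
   ccls_boundaries_iff[OF keys_diff_subset[OF assms]] by (simp add: hcls_eq)
qed

lemma hcls_mult_set:
 assumes "supp a \<subseteq> words M (Suc m)" "supp b \<subseteq> words M (Suc m)"
 shows "hcls m a <#>\<^bsub>connes_group s B m\<^esub> hcls m b = hcls m (a + b)"
 using normal.rcos_sum[OF normal_boundaries ccls_closed[OF assms(1)] ccls_closed[OF assms(2)]]
 by (simp add: hcls_eq ccls_mult[OF assms])

lemma carrier_HC: "carrier (HC s B m) = hcls m ` cycles m"
 unfolding HC_def carrier_FactGroup by (simp add: connes_cycles_eq image_image hcls_eq r_coset_def)

lemma mult_HC: "a \<in> cycles m ==> b \<in> cycles m ==> hcls m a \<otimes>\<^bsub>HC s B m\<^esub> hcls m b = hcls m (a + b)"
 using hcls_mult_set[OF cycles_keys cycles_keys, of a m b] by (simp add: HC_def set_mult_def)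

lemma one_HC: "\<one>\<^bsub>HC s B m\<^esub> = hcls m 0"
 using CG.coset_mult_one[OF boundaries_subset] by (simp add: HC_def hcls_eq ccls_zero)

lemma comm_group_HC: "comm_group (HC s B m)"
proof (rule comm_groupI)
 fix x assume "x \<in> carrier (HC s B m)"
 then obtain a where a: "a \<in> cycles m" "x = hcls m a" by (auto simp: carrier_HC)
 show "\<exists>y\<in>carrier (HC s B m). y \<otimes>\<^bsub>HC s B m\<^esub> x = \<one>\<^bsub>HC s B m\<^esub>"
  using a cycles_minus[OF a(1)] by (intro bexI[of _ "hcls m (- a)"]) (auto simp: mult_HC one_HC carrier_HC)
qed (auto simp: carrier_HC mult_HC one_HC cycles_add cycles_zero ac_simps)

end

section \<open>Traces of words of matrices\<close>

text \<open>The sum over all index cycles; for a list of copies of \<open>E\<close> this is the chain of the Chern character.\<close>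

definition cword :: "(nat => nat => 'a) list => nat list => 'a list" where
 "cword Ms is = map (\<lambda>j. (Ms ! j) (is ! j) (is ! (Suc j mod length Ms))) [0..<length Ms]"

definition idx :: "nat => nat => nat list set" where
 "idx N m = {is. length is = m \<and> set is \<subseteq> {..<N}}"

definition tr :: "nat => (nat => nat => 'a) list => ('a list \<Rightarrow>\<^sub>0 int)" where
 "tr N Ms = (\<Sum>is\<in>idx N (length Ms). frag_of (cword Ms is))"

definition mmul :: "nat => (nat => nat => 'a::semiring_0) => (nat => nat => 'a) => nat => nat => 'a" where
 "mmul N A A' = (\<lambda>i j. \<Sum>k<N. A i k * A' k j)"

definition madd :: "(nat => nat => 'a::plus) => (nat => nat => 'a) => nat => nat => 'a" where
 "madd A A' = (\<lambda>i j. A i j + A' i j)"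

definition mface :: "nat => nat => (nat => nat => 'a::semiring_0) list => (nat => nat => 'a) list" where
 "mface N j Ms = take j Ms @ mmul N (Ms ! j) (Ms ! (j + 1)) # drop (j + 2) Ms"

lemma trace_chain_eq: "trace_chain N E m = tr N (replicate (Suc m) E)"
 unfolding trace_chain_def tr_def idx_def cword_def
 by (intro sum.cong arg_cong[where f = frag_of] map_cong) (auto simp del: replicate_Suc)

lemma finite_idx [simp]: "finite (idx N m)"
 unfolding idx_def using finite_lists_length_eq[of "{..<N}" m] by (simp add: conj_commute)

lemma idx_nth: "is \<in> idx N m ==> p < m ==> is ! p < N"
 by (force simp: idx_def subset_iff)

lemma idx_next: "is \<in> idx N m ==> p < m ==> is ! (if Suc p = m then 0 else Suc p) < N"
 by (auto intro: idx_nth)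

lemma idx_length: "is \<in> idx N m ==> length is = m"
 by (simp add: idx_def)

lemma idx_iff_nth: "is \<in> idx N m \<longleftrightarrow> length is = m \<and> (\<forall>p<m. is ! p < N)"
 by (auto simp: idx_def subset_iff in_set_conv_nth)

lemma length_cword [simp]: "length (cword Ms is) = length Ms"
 by (simp add: cword_def)

lemma Suc_mod_cases: "p < m ==> Suc p mod m = (if Suc p = m then 0 else Suc p)"
 by auto

lemma cword_nth:
 "p < length Ms ==> cword Ms is ! p = (Ms ! p) (is ! p) (is ! (if Suc p = length Ms then 0 else Suc p))"
 by (simp add: cword_def Suc_mod_cases)

lemma cword_update:
 "i < length Ms ==> cword (Ms[i := A]) is = (cword Ms is)[i := A (is ! i) (is ! (if Suc i = length Ms then 0 else Suc i))]"
 by (rule nth_equalityI) (auto simp: cword_nth nth_list_update)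

lemma cword_rot:
 assumes "Ms \<noteq> []" "length is = length Ms"
 shows "cword (rot Ms) (rot is) = rot (cword Ms is)"
proof (rule nth_equalityI)
 have ne: "is \<noteq> []" "cword Ms is \<noteq> []" using assms by (auto simp flip: length_greater_0_conv)
 show "length (cword (rot Ms) (rot is)) = length (rot (cword Ms is))"
  using assms ne by simp
 fix p assume "p < length (cword (rot Ms) (rot is))"
 then have p: "p < length Ms" using assms by simp
 obtain n where n: "length Ms = Suc n" using assms(1) by (cases Ms) auto
 show "cword (rot Ms) (rot is) ! p = rot (cword Ms is) ! p"
  using assms ne p by (auto simp: cword_nth rot_nth n)
qed

lemma rot_bij_idx:
 assumes "0 < m" shows "bij_betw rot (idx N m) (idx N m)"
proof (rule bij_betwI)
 show "rot \<in> idx N m \<rightarrow> idx N m"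
  using assms by (force simp: idx_iff_nth rot_nth simp flip: length_greater_0_conv)
 show "(\<lambda>xs. tl xs @ [hd xs]) \<in> idx N m \<rightarrow> idx N m"
 proof
  fix xs assume "xs \<in> idx N m"
  then show "tl xs @ [hd xs] \<in> idx N m" using assms by (cases xs) (auto simp: idx_def)
 qed
 fix xs assume "xs \<in> idx N m"
 then have ne: "xs \<noteq> []" using assms by (auto simp: idx_def)
 show "tl (rot xs) @ [hd (rot xs)] = xs" using ne by (simp add: rot_def)
 show "rot (tl xs @ [hd xs]) = xs" using ne by (simp add: rot_def)
qed

lemma tr_rot:
 assumes "Ms \<noteq> []"
 shows "tr N (rot Ms) = frag_extend (\<lambda>xs. frag_of (rot xs)) (tr N Ms)"
proof -
 have "tr N (rot Ms) = (\<Sum>is\<in>idx N (length Ms). frag_of (cword (rot Ms) is))"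
  using assms by (simp add: tr_def)
 also have "\<dots> = (\<Sum>is\<in>idx N (length Ms). frag_of (cword (rot Ms) (rot is)))"
  by (rule sum.reindex_bij_betw[OF rot_bij_idx, symmetric]) (use assms in auto)
 also have "\<dots> = (\<Sum>is\<in>idx N (length Ms). frag_of (rot (cword Ms is)))"
  by (intro sum.cong refl) (simp add: cword_rot assms idx_length)
 finally show ?thesis by (simp add: tr_def frag_extend_sum)
qed

lemma tr_cong:
 assumes "length Ms = length Ms'" "\<And>p i j. p < length Ms ==> i < N ==> j < N ==> (Ms ! p) i j = (Ms' ! p) i j"
 shows "tr N Ms = tr N Ms'"
 unfolding tr_def assms(1)
 by (intro sum.cong refl arg_cong[where f = frag_of] nth_equalityI)
  (auto simp: assms(1) cword_nth intro!: assms(2) idx_nth)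

definition insert_at :: "nat => nat => nat list => nat list" where
 "insert_at p k is = take p is @ k # drop p is"

lemma insert_at_nth:
 "p \<le> length is ==> q \<le> length is ==> insert_at p k is ! q = (if q < p then is ! q else if q = p then k else is ! (q - 1))"
 by (auto simp: insert_at_def nth_append nth_Cons min_def split: nat.split intro: arg_cong[where f = "(!) is"])

lemma length_insert_at: "p \<le> length is ==> length (insert_at p k is) = Suc (length is)"
 by (simp add: insert_at_def)

lemma insert_at_bij:
 assumes "p \<le> m"
 shows "bij_betw (\<lambda>(is, k). insert_at p k is) (idx N m \<times> {..<N}) (idx N (Suc m))"
proof (rule bij_betwI)
 show "(\<lambda>(is, k). insert_at p k is) \<in> idx N m \<times> {..<N} \<rightarrow> idx N (Suc m)"
  using assms by (auto simp: idx_iff_nth insert_at_nth length_insert_at)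
 show "(\<lambda>xs. (take p xs @ drop (Suc p) xs, xs ! p)) \<in> idx N (Suc m) \<rightarrow> idx N m \<times> {..<N}"
  using assms by (auto simp: idx_iff_nth nth_append)
 fix x assume "x \<in> idx N m \<times> {..<N}"
 then show "(\<lambda>xs. (take p xs @ drop (Suc p) xs, xs ! p)) ((\<lambda>(is, k). insert_at p k is) x) = x"
  using assms by (auto simp: insert_at_def idx_def nth_append min_def)
next
 fix xs assume "xs \<in> idx N (Suc m)"
 then show "(\<lambda>(is, k). insert_at p k is) (take p xs @ drop (Suc p) xs, xs ! p) = xs"
  using assms by (auto simp: insert_at_def idx_def min_def id_take_nth_drop[symmetric])
qed

lemma mface_nth:
 assumes "j + 1 < length Ms" "p < length Ms - 1"
 shows "mface N j Ms ! p = (if p < j then Ms ! p else if p = j then mmul N (Ms ! j) (Ms ! (j + 1)) else Ms ! (p + 1))"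
 using assms by (auto simp: mface_def nth_append nth_Cons min_def split: nat.split intro: arg_cong[where f = "(!) Ms"])

lemma length_mface: "j + 1 < length Ms ==> length (mface N j Ms) = length Ms - 1"
 by (auto simp: mface_def)

lemma face_cword_insert:
 fixes Ms :: "(nat => nat => 'a::semiring_0) list"
 assumes "j < m" "length Ms = Suc m" "length is = m"
 shows "face j (cword Ms (insert_at (Suc j) k is)) =
  (cword (mface N j Ms) is)[j := (Ms ! j) (is ! j) k * (Ms ! Suc j) k (is ! (if Suc j = m then 0 else Suc j))]"
proof (rule nth_equalityI)
 show "length (face j (cword Ms (insert_at (Suc j) k is))) =
  length ((cword (mface N j Ms) is)[j := (Ms ! j) (is ! j) k * (Ms ! Suc j) k (is ! (if Suc j = m then 0 else Suc j))])"
  using assms by (simp add: length_face length_mface)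
 fix p assume "p < length (face j (cword Ms (insert_at (Suc j) k is)))"
 then have p: "p < m" using assms by (simp add: length_face)
 show "face j (cword Ms (insert_at (Suc j) k is)) ! p =
  (cword (mface N j Ms) is)[j := (Ms ! j) (is ! j) k * (Ms ! Suc j) k (is ! (if Suc j = m then 0 else Suc j))] ! p"
  using assms p by (auto simp: face_nth cword_nth length_mface mface_nth insert_at_nth nth_list_update)
qed

context subalgebra
begin

definition "mats N = {A. \<forall>i<N. \<forall>j<N. A i j \<in> B}"

definition smat :: "'k => (nat => nat => 'p) => nat => nat => 'p" where
 "smat r A = (\<lambda>i j. s r (A i j))"

lemma mats_mmul: "A \<in> mats N ==> A' \<in> mats N ==> mmul N A A' \<in> mats N"
 by (auto simp: mats_def mmul_def intro!: sum_mem mult_mem)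

lemma mats_madd: "A \<in> mats N ==> A' \<in> mats N ==> madd A A' \<in> mats N"
 by (auto simp: mats_def madd_def intro!: add_mem)

lemma mats_smat: "A \<in> mats N ==> smat r A \<in> mats N"
 by (auto simp: mats_def smat_def intro!: scale_mem)

lemma mats_update: "set Ms \<subseteq> mats N ==> A \<in> mats N ==> set (Ms[i := A]) \<subseteq> mats N"
 using set_update_subset_insert[of Ms i A] by blast

lemma cword_in_words:
 assumes "set Ms \<subseteq> mats N" "is \<in> idx N (length Ms)"
 shows "cword Ms is \<in> words M (length Ms)"
 unfolding words_iff_nth
proof (intro conjI allI impI)
 fix p assume p: "p < length Ms"
 then have "Ms ! p \<in> mats N" using assms by auto
 moreover have "is ! p < N" "is ! (if Suc p = length Ms then 0 else Suc p) < N"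
  using idx_nth[OF assms(2) p] idx_next[OF assms(2) p] by auto
 ultimately show "cword Ms is ! p \<in> carrier M"
  using p by (simp add: cword_nth mats_def)
qed simp

lemma tr_keys: "set Ms \<subseteq> mats N ==> supp (tr N Ms) \<subseteq> words M (length Ms)"
 unfolding tr_def by (intro keys_sum_subset) (auto dest: cword_in_words)

lemma tr_keys': "set Ms \<subseteq> mats N ==> length Ms = m ==> supp (tr N Ms) \<subseteq> words M m"
 using tr_keys by blast

lemma word_sum_rel:
 assumes "xs \<in> words M m" "i < m" "finite I" "\<And>k. k \<in> I ==> f k \<in> B"
 shows "(\<Sum>k\<in>I. frag_of (xs[i := f k])) - frag_of (xs[i := \<Sum>k\<in>I. f k]) \<in> pspan M m"
 using assms(3,4)
proof (induction I rule: finite_induct)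
 case empty
 have "frag_of (xs[i := 0]) \<in> pspan M m"
  using word_zero_rel[OF left_module_M words_update[OF assms(1), of 0 i], of i] assms words_length[OF assms(1)]
  by (simp add: zero_mem)
 then show ?case using T.rspan_minus by fastforce
next
 case (insert k I)
 have "frag_of (xs[i := f k + sum f I]) - frag_of (xs[i := f k]) - frag_of (xs[i := sum f I]) \<in> pspan M m"
  using word_add_rel[OF assms(1,2), of "f k" "sum f I"] insert by (simp add: sum_mem)
 moreover have "(\<Sum>k\<in>I. frag_of (xs[i := f k])) - frag_of (xs[i := sum f I]) \<in> pspan M m"
  using insert by simp
 ultimately have "((\<Sum>k\<in>I. frag_of (xs[i := f k])) - frag_of (xs[i := sum f I]))
   - (frag_of (xs[i := f k + sum f I]) - frag_of (xs[i := f k]) - frag_of (xs[i := sum f I])) \<in> pspan M m"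
  by (rule T.rspan_diff[rotated])
 then show ?case using insert by (simp add: algebra_simps)
qed

lemma tr_sum_slot:
 assumes Ms: "set Ms \<subseteq> mats N" and i: "i < length Ms" and I: "finite I" and A: "\<And>k. k \<in> I ==> A k \<in> mats N"
 shows "(\<Sum>k\<in>I. tr N (Ms[i := A k])) - tr N (Ms[i := (\<lambda>p q. \<Sum>k\<in>I. A k p q)]) \<in> pspan M (length Ms)"
proof -
 let ?n = "\<lambda>is. is ! (if Suc i = length Ms then 0 else Suc i)"
 have "(\<Sum>k\<in>I. tr N (Ms[i := A k])) - tr N (Ms[i := (\<lambda>p q. \<Sum>k\<in>I. A k p q)])
  = (\<Sum>is\<in>idx N (length Ms). (\<Sum>k\<in>I. frag_of ((cword Ms is)[i := A k (is ! i) (?n is)]))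
    - frag_of ((cword Ms is)[i := \<Sum>k\<in>I. A k (is ! i) (?n is)]))"
  by (simp add: tr_def cword_update[OF i] sum_subtractf sum.swap[of _ I] del: if_split_asm)
 also have "\<dots> \<in> pspan M (length Ms)"
 proof (intro T.rspan_sum word_sum_rel I i cword_in_words)
  fix "is" k assume I: "is \<in> idx N (length Ms)" and k: "k \<in> I"
  have "is ! i < N" "?n is < N" using idx_nth[OF I i] idx_next[OF I i] by auto
  then show "A k (is ! i) (?n is) \<in> B" using A[OF k] by (simp add: mats_def)
 qed (use Ms in auto)
 finally show ?thesis .
qed

lemma tr_add_slot:
 assumes "set Ms \<subseteq> mats N" "i < length Ms" "A \<in> mats N" "A' \<in> mats N"
 shows "tr N (Ms[i := A]) + tr N (Ms[i := A']) - tr N (Ms[i := madd A A']) \<in> pspan M (length Ms)"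
 using tr_sum_slot[OF assms(1,2), of "UNIV :: bool set" "\<lambda>b. if b then A else A'"] assms(3,4)
 by (simp add: UNIV_bool madd_def add.commute)

lemma tr_scale_slot:
 assumes "set Ms \<subseteq> mats N" "i < length Ms" "j < length Ms"
 shows "tr N (Ms[i := smat r (Ms ! i)]) - tr N (Ms[j := smat r (Ms ! j)]) \<in> pspan M (length Ms)"
proof -
 have eq: "cword (Ms[p := smat r (Ms ! p)]) is = (cword Ms is)[p := s r (cword Ms is ! p)]" if "p < length Ms" for p "is"
  using that by (simp add: cword_update cword_nth smat_def)
 have "tr N (Ms[i := smat r (Ms ! i)]) - tr N (Ms[j := smat r (Ms ! j)])
  = (\<Sum>is\<in>idx N (length Ms). frag_of ((cword Ms is)[i := s r (cword Ms is ! i)]) - frag_of ((cword Ms is)[j := s r (cword Ms is ! j)]))"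
  by (simp add: tr_def eq[OF assms(2)] eq[OF assms(3)] sum_subtractf)
 also have "\<dots> \<in> pspan M (length Ms)"
  using word_scale_rel[OF cword_in_words[OF assms(1)] assms(2,3), of _ r] by (intro T.rspan_sum) simp
 finally show ?thesis .
qed

lemma tr_zero_slot:
 assumes "set Ms \<subseteq> mats N" "i < length Ms" "\<And>p q. (Ms ! i) p q = 0"
 shows "tr N Ms \<in> pspan M (length Ms)"
 unfolding tr_def
proof (rule T.rspan_sum)
 fix "is" assume "is \<in> idx N (length Ms)"
 then show "frag_of (cword Ms is) \<in> pspan M (length Ms)"
  using word_zero_rel[OF left_module_M cword_in_words[OF assms(1)] assms(2)] assms(2,3) by (simp add: cword_nth)
qed

text \<open>Summing the product of two neighbouring entries over the index they share is matrix multiplication.\<close>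

lemma tr_face:
 assumes Ms: "set Ms \<subseteq> mats N" and j: "j < m" and len: "length Ms = Suc m"
 shows "frag_extend (\<lambda>xs. frag_of (face j xs)) (tr N Ms) - tr N (mface N j Ms) \<in> pspan M m"
proof -
 let ?n = "\<lambda>is. is ! (if Suc j = m then 0 else Suc j)"
 let ?f = "\<lambda>is k. (Ms ! j) (is ! j) k * (Ms ! Suc j) k (?n is)"
 have lenf: "length (mface N j Ms) = m" using j len by (simp add: length_mface)
 have Mj: "Ms ! j \<in> mats N" "Ms ! Suc j \<in> mats N" using Ms j len by auto
 have mf: "set (mface N j Ms) \<subseteq> mats N"
  unfolding mface_def using Ms Mj by (auto simp: mats_mmul dest: in_set_takeD in_set_dropD)
 have "frag_extend (\<lambda>xs. frag_of (face j xs)) (tr N Ms) = (\<Sum>is\<in>idx N (Suc m). frag_of (face j (cword Ms is)))"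
  by (simp add: tr_def len frag_extend_sum)
 also have "\<dots> = (\<Sum>(is, k)\<in>idx N m \<times> {..<N}. frag_of (face j (cword Ms (insert_at (Suc j) k is))))"
  using sum.reindex_bij_betw[OF insert_at_bij[of "Suc j" m N], of "\<lambda>is. frag_of (face j (cword Ms is))"] j
  by (simp add: case_prod_unfold)
 also have "\<dots> = (\<Sum>is\<in>idx N m. \<Sum>k<N. frag_of (face j (cword Ms (insert_at (Suc j) k is))))"
  by (rule sum.cartesian_product[symmetric])
 also have "\<dots> = (\<Sum>is\<in>idx N m. \<Sum>k<N. frag_of ((cword (mface N j Ms) is)[j := ?f is k]))"
  using j len by (intro sum.cong refl) (simp add: face_cword_insert[of j m Ms _ _ N] idx_length)
 finally have A: "frag_extend (\<lambda>xs. frag_of (face j xs)) (tr N Ms) = \<dots>" .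
 have "cword (mface N j Ms) is = (cword (mface N j Ms) is)[j := \<Sum>k<N. ?f is k]" for "is"
 proof -
  have "cword (mface N j Ms) is ! j = (\<Sum>k<N. ?f is k)"
   using j len by (simp add: cword_nth lenf mface_nth mmul_def)
  then show ?thesis using list_update_id[of "cword (mface N j Ms) is" j] by simp
 qed
 then have T: "tr N (mface N j Ms) = (\<Sum>is\<in>idx N m. frag_of ((cword (mface N j Ms) is)[j := \<Sum>k<N. ?f is k]))"
  unfolding tr_def lenf by metis
 have "(\<Sum>k<N. frag_of ((cword (mface N j Ms) is)[j := ?f is k])) - frag_of ((cword (mface N j Ms) is)[j := \<Sum>k<N. ?f is k]) \<in> pspan M m"
  if I: "is \<in> idx N m" for "is"
 proof (rule word_sum_rel)
  show "cword (mface N j Ms) is \<in> words M m" using cword_in_words[OF mf] I lenf by simp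
  fix k assume "k \<in> {..<N}"
  moreover have "is ! j < N" "?n is < N" using idx_nth[OF I j] idx_next[OF I j] by auto
  ultimately show "?f is k \<in> B" using Mj by (simp add: mats_def mult_mem)
 qed (use j in auto)
 then show ?thesis unfolding A T by (simp only: sum_subtractf[symmetric]) (rule T.rspan_sum)
qed

text \<open>Rotating the matrices together with the indices only permutes the sum over index cycles.\<close>

lemma tr_cyc:
 assumes "set Ms \<subseteq> mats N" "length Ms = Suc m"
 shows "tr N Ms - frag_cmul ((- 1) ^ m) (tr N (rot Ms)) \<in> cyc_null m"
proof -
 have ne: "Ms \<noteq> []" using assms by auto
 have "cyc_frag m (tr N Ms) = frag_cmul ((- 1) ^ m) (tr N (rot Ms))"
  by (simp add: cyc_frag_def tr_rot[OF ne] frag_extend_fun_cmul)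
 then show ?thesis using cyc_null_coboundary[OF tr_keys'[OF assms]] by simp
qed

lemma tr_hoch:
 assumes Ms: "set Ms \<subseteq> mats N" and len: "length Ms = Suc m" and m: "0 < m"
 shows "hoch_frag m (tr N Ms) - ((\<Sum>j<m. frag_cmul ((- 1) ^ j) (tr N (mface N j Ms)))
   + frag_cmul ((- 1) ^ m) (tr N (mface N 0 (rot Ms)))) \<in> pspan M m"
proof -
 have ne: "Ms \<noteq> []" using len by auto
 have rot: "set (rot Ms) \<subseteq> mats N" "length (rot Ms) = Suc m"
  using Ms len ne by (auto simp: rot_def dest: in_set_butlastD)
 let ?d = "\<lambda>j Ms. frag_extend (\<lambda>xs. frag_of (face j xs)) (tr N Ms)"
 have "frag_extend (\<lambda>xs. frag_of (face 0 (rot xs))) (tr N Ms) = ?d 0 (rot Ms)"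
  unfolding tr_rot[OF ne] using frag_extend_compose[of "\<lambda>xs. frag_of (face 0 xs)" rot "tr N Ms"] by (simp add: o_def)
 then have "hoch_frag m (tr N Ms) = (\<Sum>j<m. frag_cmul ((- 1) ^ j) (?d j Ms)) + frag_cmul ((- 1) ^ m) (?d 0 (rot Ms))"
  by (simp add: hoch_frag_def frag_extend_fun_add frag_extend_fun_sum frag_extend_fun_cmul)
 then have "hoch_frag m (tr N Ms) - ((\<Sum>j<m. frag_cmul ((- 1) ^ j) (tr N (mface N j Ms)))
   + frag_cmul ((- 1) ^ m) (tr N (mface N 0 (rot Ms))))
  = (\<Sum>j<m. frag_cmul ((- 1) ^ j) (?d j Ms - tr N (mface N j Ms)))
   + frag_cmul ((- 1) ^ m) (?d 0 (rot Ms) - tr N (mface N 0 (rot Ms)))"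
  by (simp add: frag_cmul_diff sum_subtractf)
 also have "\<dots> \<in> pspan M m"
  using tr_face[OF Ms _ len] tr_face[OF rot(1) m rot(2)]
  by (intro T.rspan_add T.rspan_sum T.rspan_cmul) auto
 finally show ?thesis .
qed

end

section \<open>Homotopy invariance of the trace chain of an idempotent\<close>

definition blists :: "nat => bool list set" where
 "blists r = {w. length w = r}"

definition cnt :: "bool list => nat" where
 "cnt w = length (filter (\<lambda>b. b) w)"

lemma finite_blists [simp]: "finite (blists r)"
 unfolding blists_def using finite_lists_length_eq[of "UNIV :: bool set" r] by simp

lemma blists_0: "blists 0 = {[]}"
 by (auto simp: blists_def)

lemma sum_blists_Suc: "(\<Sum>w\<in>blists (Suc r). f w) = (\<Sum>w\<in>blists r. f (False # w)) + (\<Sum>w\<in>blists r. f (True # w))"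
proof -
 have "blists (Suc r) = (\<lambda>w. False # w) ` blists r \<union> (\<lambda>w. True # w) ` blists r"
  unfolding blists_def by (auto simp: length_Suc_conv image_iff)
 then have "(\<Sum>w\<in>blists (Suc r). f w)
   = (\<Sum>w\<in>(\<lambda>w. False # w) ` blists r. f w) + (\<Sum>w\<in>(\<lambda>w. True # w) ` blists r. f w)"
  by (simp only:) (rule sum.union_disjoint, auto)
 then show ?thesis by (simp add: sum.reindex inj_on_def)
qed

lemma sum_blists_add: "(\<Sum>w\<in>blists (i + r). f w) = (\<Sum>u\<in>blists i. \<Sum>v\<in>blists r. f (u @ v))"
proof (induction i arbitrary: f)
 case (Suc i)
 then show ?case by (simp add: sum_blists_Suc)
qed (simp add: blists_0)

lemma sum_blists_snoc:
 "(\<Sum>w\<in>blists (Suc r). f w) = (\<Sum>w\<in>blists r. f (w @ [False])) + (\<Sum>w\<in>blists r. f (w @ [True]))"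
 using sum_blists_add[of f r 1] by (simp add: sum_blists_Suc[of _ 0, simplified] blists_0 sum.distrib)

lemma cnt_simps [simp]: "cnt [] = 0" "cnt (b # w) = (if b then Suc (cnt w) else cnt w)" "cnt (u @ v) = cnt u + cnt v"
 by (simp_all add: cnt_def)

text \<open>In even degree the equal contributions of the inner faces cancel in pairs.\<close>

lemma alternating_sum_even: "even q ==> (\<Sum>i<q. frag_cmul ((- 1) ^ i) a) = 0"
proof (induction q rule: less_induct)
 case (less q)
 show ?case
 proof (cases "q < 2")
  case False
  then obtain p where p: "q = Suc (Suc p)" using less_2_cases_iff by (metis Suc_pred not_less_eq not_less_iff_gr_or_eq zero_less_Suc numeral_2_eq_2 less_Suc_eq gr0_conv_Suc)
  then show ?thesis using less by (simp del: minus_frag_cmul add: minus_frag_cmul[symmetric])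
 qed (use less in \<open>auto simp: less_2_cases_iff\<close>)
qed

lemma hoch_frag_sum: "finite I ==> hoch_frag m (sum f I) = (\<Sum>i\<in>I. hoch_frag m (f i))"
 by (simp add: hoch_frag_def frag_extend_sum o_def)

context subalgebra
begin

text \<open>The integral of \<open>s\<^sup>c\<close> over the unit interval. In the expansion of \<open>F + s D\<close> along a word with \<open>c\<close> letters \<open>D\<close>, integration over \<open>s\<close> amounts to this weight.\<close>

definition \<phi> :: "nat => 'k" where "\<phi> c = 1 / of_nat (Suc c)"

lemma tr_rotate_append:
 assumes "set (xs @ ys) \<subseteq> mats N" "length (xs @ ys) = Suc m" "even m"
 shows "tr N (xs @ ys) - tr N (ys @ xs) \<in> cyc_null m"
 using assms(1,2)
proof (induction ys arbitrary: xs rule: rev_induct)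
 case (snoc y ys)
 have "rot (xs @ ys @ [y]) = y # xs @ ys" by (simp add: rot_def butlast_append)
 then have "tr N (xs @ ys @ [y]) - tr N ((y # xs) @ ys) \<in> cyc_null m"
  using tr_cyc[of "xs @ ys @ [y]" N m] snoc.prems assms(3) by simp
 moreover have "tr N ((y # xs) @ ys) - tr N (ys @ (y # xs)) \<in> cyc_null m"
  by (rule snoc.IH) (use snoc.prems in auto)
 ultimately have "tr N (xs @ ys @ [y]) - tr N (ys @ (y # xs)) \<in> cyc_null m"
  using cyc_null_add[of "tr N (xs @ ys @ [y]) - tr N ((y # xs) @ ys)" m] by fastforce
 then show ?case by simp
qed (simp add: cyc_null_zero)

context
 fixes N :: nat and F D K :: "nat => nat => 'p" and q :: nat
 assumes F: "F \<in> mats N" and D: "D \<in> mats N" and K: "K \<in> mats N"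
  and FF: "mmul N F F = F" and FD: "madd (mmul N F D) (mmul N D F) = D" and DD: "mmul N D D = (\<lambda>i j. 0)"
  and KF: "mmul N K F = madd (mmul N F K) D" and KD: "mmul N K D = mmul N D K"
  and q: "even q"
begin

private definition "ml b = (if b then D else F)"

private abbreviation "mw w \<equiv> map ml w"

private lemma ml: "ml b \<in> mats N"
 by (simp add: ml_def F D)

private lemma mw: "set (mw w) \<subseteq> mats N"
 using ml by auto

private lemma tr_expand:
 assumes "set pre \<subseteq> mats N"
 shows "tr N (pre @ replicate r (madd F D)) - (\<Sum>w\<in>blists r. tr N (pre @ mw w)) \<in> pspan M (length pre + r)"
 using assms
proof (induction r arbitrary: pre)
 case (Suc r)
 let ?G = "madd F D"
 let ?L = "pre @ ?G # replicate r ?G"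
 have G: "?G \<in> mats N" using F D by (rule mats_madd)
 have "tr N (?L[length pre := F]) + tr N (?L[length pre := D]) - tr N (?L[length pre := ?G]) \<in> pspan M (length ?L)"
  using Suc.prems G by (intro tr_add_slot F D) auto
 then have A: "tr N ((pre @ [F]) @ replicate r ?G) + tr N ((pre @ [D]) @ replicate r ?G) - tr N ?L \<in> pspan M (length pre + Suc r)"
  by simp
 have B: "tr N ((pre @ [F]) @ replicate r ?G) - (\<Sum>w\<in>blists r. tr N ((pre @ [F]) @ mw w)) \<in> pspan M (length pre + Suc r)"
  using Suc.IH[of "pre @ [F]"] Suc.prems F by simp
 have C: "tr N ((pre @ [D]) @ replicate r ?G) - (\<Sum>w\<in>blists r. tr N ((pre @ [D]) @ mw w)) \<in> pspan M (length pre + Suc r)"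
  using Suc.IH[of "pre @ [D]"] Suc.prems D by simp
 have S: "(\<Sum>w\<in>blists (Suc r). tr N (pre @ mw w)) = (\<Sum>w\<in>blists r. tr N ((pre @ [F]) @ mw w)) + (\<Sum>w\<in>blists r. tr N ((pre @ [D]) @ mw w))"
  by (simp add: sum_blists_Suc ml_def)
 have e: "tr N ?L - (\<Sum>w\<in>blists (Suc r). tr N (pre @ mw w)) =
   ((tr N ((pre @ [F]) @ replicate r ?G) - (\<Sum>w\<in>blists r. tr N ((pre @ [F]) @ mw w)))
   + (tr N ((pre @ [D]) @ replicate r ?G) - (\<Sum>w\<in>blists r. tr N ((pre @ [D]) @ mw w))))
   - (tr N ((pre @ [F]) @ replicate r ?G) + tr N ((pre @ [D]) @ replicate r ?G) - tr N ?L)"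
  unfolding S by (simp only: algebra_simps)
 show ?case using T.rspan_diff[OF T.rspan_add[OF B C] A] unfolding e[symmetric] by simp
qed (simp add: blists_0 T.rspan_zero)

private definition "Zc = (\<Sum>w\<in>blists q. tr N (smat (\<phi> (cnt w)) D # mw w))"

private definition "Qc = (\<Sum>w\<in>blists q. tr N (smat (\<phi> (cnt w)) K # mw w))"

private lemma inner_face_sum:
 assumes i: "i < q"
 shows "(\<Sum>w\<in>blists (Suc q). tr N (smat (\<phi> (cnt w)) K # mface N i (mw w))) - Qc \<in> pspan M (Suc q)"
proof -
 define r where "r = q - i - 1"
 have qr: "Suc q = i + Suc (Suc r)" "q = i + Suc r" using i by (simp_all add: r_def)
 have mf: "mface N i (mw u @ A # A' # mw v) = mw u @ mmul N A A' # mw v" if "u \<in> blists i" for u v A A'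
  using that by (auto simp: mface_def blists_def nth_append)
 let ?K = "\<lambda>c. smat (\<phi> c) K"
 let ?t = "\<lambda>u v c A. tr N (?K (cnt u + c + cnt v) # mw u @ A # mw v)"
 have L: "(\<Sum>w\<in>blists (Suc q). tr N (?K (cnt w) # mface N i (mw w)))
  = (\<Sum>u\<in>blists i. \<Sum>v\<in>blists r. ?t u v 0 (mmul N F F) + ?t u v (Suc 0) (mmul N F D) + ?t u v (Suc 0) (mmul N D F) + ?t u v (Suc (Suc 0)) (mmul N D D))"
  unfolding qr(1) sum_blists_add
  by (rule sum.cong[OF refl]) (simp add: sum_blists_Suc mf sum.distrib ml_def add.assoc)
 have R: "Qc = (\<Sum>u\<in>blists i. \<Sum>v\<in>blists r. ?t u v 0 F + ?t u v (Suc 0) D)"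
  unfolding Qc_def unfolding qr(2) sum_blists_add
  by (rule sum.cong[OF refl]) (simp add: sum_blists_Suc sum.distrib ml_def)
 have "?t u v 0 (mmul N F F) + ?t u v (Suc 0) (mmul N F D) + ?t u v (Suc 0) (mmul N D F) + ?t u v (Suc (Suc 0)) (mmul N D D) - (?t u v 0 F + ?t u v (Suc 0) D)
   \<in> pspan M (Suc q)" if uv: "u \<in> blists i" "v \<in> blists r" for u v
 proof -
  have len: "length u = i" "length v = r" using uv by (auto simp: blists_def)
  let ?B = "?K (cnt u + Suc 0 + cnt v) # mw u @ D # mw v"
  have Bm: "set ?B \<subseteq> mats N" using mw[of u] mw[of v] D mats_smat[OF K] by auto
  have "tr N (?B[Suc i := mmul N F D]) + tr N (?B[Suc i := mmul N D F]) - tr N (?B[Suc i := madd (mmul N F D) (mmul N D F)]) \<in> pspan M (length ?B)"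
   using len by (intro tr_add_slot Bm mats_mmul F D) simp
  then have A: "?t u v (Suc 0) (mmul N F D) + ?t u v (Suc 0) (mmul N D F) - ?t u v (Suc 0) D \<in> pspan M (Suc q)"
   using len qr by (simp add: FD list_update_append)
  have "?t u v (Suc (Suc 0)) (mmul N D D) \<in> pspan M (length (?K (cnt u + Suc (Suc 0) + cnt v) # mw u @ mmul N D D # mw v))"
   using mw[of u] mw[of v] mats_mmul[OF D D] mats_smat[OF K] len
   by (intro tr_zero_slot[of _ _ "Suc i"]) (auto simp: nth_append DD)
  then have "?t u v (Suc (Suc 0)) (mmul N D D) \<in> pspan M (Suc q)" using len qr by simp
  from T.rspan_add[OF A this] show ?thesis by (simp add: FF algebra_simps)
 qed
 then show ?thesis unfolding L R by (simp only: sum_subtractf[symmetric]) (intro T.rspan_sum)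
qed

private lemma Zc_null: "Zc \<in> hom_null q"
proof -
 let ?K = "\<lambda>c. smat (\<phi> c) K"
 let ?W = "\<lambda>w. ?K (cnt w) # mw w"
 define Y where "Y = (\<Sum>w\<in>blists (Suc q). tr N (?W w))"
 define inner where "inner = (\<lambda>i. \<Sum>w\<in>blists (Suc q). tr N (?K (cnt w) # mface N i (mw w)))"
 define first where "first = (\<Sum>w\<in>blists (Suc q). tr N (mmul N (?K (cnt w)) (hd (mw w)) # tl (mw w)))"
 define lst where "lst = (\<Sum>w\<in>blists (Suc q). tr N (mmul N (last (mw w)) (?K (cnt w)) # butlast (mw w)))"
 have Wm: "set (?W w) \<subseteq> mats N" for w using mw[of w] mats_smat[OF K] by auto
 have Yk: "supp Y \<subseteq> words M (Suc (Suc q))"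
  unfolding Y_def by (intro keys_sum_subset tr_keys' Wm) (simp add: blists_def)
 have faces: "(\<Sum>j<Suc q. frag_cmul ((- 1) ^ j) (tr N (mface N j (?W w)))) + frag_cmul ((- 1) ^ Suc q) (tr N (mface N 0 (rot (?W w))))
  = tr N (mmul N (?K (cnt w)) (hd (mw w)) # tl (mw w))
   - (\<Sum>i<q. frag_cmul ((- 1) ^ i) (tr N (?K (cnt w) # mface N i (mw w))))
   - tr N (mmul N (last (mw w)) (?K (cnt w)) # butlast (mw w))" if w: "w \<in> blists (Suc q)" for w
 proof -
  have ne: "mw w \<noteq> []" using w by (auto simp: blists_def)
  have "mface N 0 (?W w) = mmul N (?K (cnt w)) (hd (mw w)) # tl (mw w)"
   using ne by (cases "mw w") (auto simp: mface_def)
  moreover have "mface N (Suc i) (?W w) = ?K (cnt w) # mface N i (mw w)" for i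
   by (simp add: mface_def)
  moreover have "mface N 0 (rot (?W w)) = mmul N (last (mw w)) (?K (cnt w)) # butlast (mw w)"
   using ne by (simp add: mface_def rot_def)
  ultimately show ?thesis
   unfolding sum.lessThan_Suc_shift using q
   by (simp add: sum_negf flip: minus_frag_cmul)
 qed
 have "hoch_frag (Suc q) Y - (first - (\<Sum>i<q. frag_cmul ((- 1) ^ i) (inner i)) - lst) \<in> pspan M (Suc q)"
 proof -
  have Ysum: "hoch_frag (Suc q) Y = (\<Sum>w\<in>blists (Suc q). hoch_frag (Suc q) (tr N (?W w)))"
   unfolding Y_def by (rule hoch_frag_sum) simp
  have Isum: "(\<Sum>i<q. frag_cmul ((- 1) ^ i) (inner i))
   = (\<Sum>w\<in>blists (Suc q). \<Sum>i<q. frag_cmul ((- 1) ^ i) (tr N (?K (cnt w) # mface N i (mw w))))"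
   unfolding inner_def frag_cmul_sum by (rule sum.swap)
  have "hoch_frag (Suc q) Y - (first - (\<Sum>i<q. frag_cmul ((- 1) ^ i) (inner i)) - lst)
   = (\<Sum>w\<in>blists (Suc q). hoch_frag (Suc q) (tr N (?W w))
     - (tr N (mmul N (?K (cnt w)) (hd (mw w)) # tl (mw w))
      - (\<Sum>i<q. frag_cmul ((- 1) ^ i) (tr N (?K (cnt w) # mface N i (mw w))))
      - tr N (mmul N (last (mw w)) (?K (cnt w)) # butlast (mw w))))"
   unfolding Ysum Isum first_def lst_def by (simp only: sum_subtractf)
  also have "\<dots> = (\<Sum>w\<in>blists (Suc q). hoch_frag (Suc q) (tr N (?W w))
     - ((\<Sum>j<Suc q. frag_cmul ((- 1) ^ j) (tr N (mface N j (?W w)))) + frag_cmul ((- 1) ^ Suc q) (tr N (mface N 0 (rot (?W w))))))"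
   by (intro sum.cong refl) (simp only: faces)
  also have "\<dots> \<in> pspan M (Suc q)"
   by (intro T.rspan_sum tr_hoch Wm) (auto simp: blists_def)
  finally show ?thesis .
 qed
 then have H: "first - (\<Sum>i<q. frag_cmul ((- 1) ^ i) (inner i)) - lst \<in> hom_null q"
  using hom_null_boundary[OF Yk] hom_null_diff[OF _ span_hom_null] by fastforce
 have "(\<Sum>i<q. frag_cmul ((- 1) ^ i) (inner i)) = (\<Sum>i<q. frag_cmul ((- 1) ^ i) (inner i - Qc))"
  using alternating_sum_even[OF q, of Qc] by (simp add: frag_cmul_diff sum_subtractf)
 also have "\<dots> \<in> hom_null q"
  unfolding inner_def by (intro span_hom_null T.rspan_sum T.rspan_cmul inner_face_sum) simp
 finally have "first - lst \<in> hom_null q"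
  using hom_null_add[OF H] by fastforce
 moreover have "(first - lst) - Zc \<in> hom_null q"
 proof -
  have f: "first = (\<Sum>w\<in>blists q. tr N (mmul N (?K (cnt w)) F # mw w)) + (\<Sum>w\<in>blists q. tr N (mmul N (?K (Suc (cnt w))) D # mw w))"
   unfolding first_def by (simp add: sum_blists_Suc ml_def)
  have l: "lst = (\<Sum>w\<in>blists q. tr N (mmul N F (?K (cnt w)) # mw w)) + (\<Sum>w\<in>blists q. tr N (mmul N D (?K (Suc (cnt w))) # mw w))"
   unfolding lst_def by (simp add: sum_blists_snoc ml_def)
  have mK: "mmul N (smat r A) A' = smat r (mmul N A A')" "mmul N A (smat r A') = smat r (mmul N A A')" for r A A'
   by (auto simp: mmul_def smat_def scale_sum_right scale_left[symmetric] scale_right[symmetric])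
  have sm: "smat r (madd A A') = madd (smat r A) (smat r A')" for r A A'
   by (auto simp: smat_def madd_def scale_right_distrib)
  have "(first - lst) - Zc = (\<Sum>w\<in>blists q. - (tr N (smat (\<phi> (cnt w)) (mmul N F K) # mw w) + tr N (smat (\<phi> (cnt w)) D # mw w)
    - tr N (madd (smat (\<phi> (cnt w)) (mmul N F K)) (smat (\<phi> (cnt w)) D) # mw w)))"
   unfolding f l Zc_def by (simp add: mK KD KF sm sum.distrib sum_subtractf algebra_simps)
  also have "\<dots> \<in> hom_null q"
  proof (intro hom_null_sum hom_null_minus span_hom_null)
   fix w assume w: "w \<in> blists q"
   let ?L = "D # mw w"
   have "tr N (?L[0 := smat (\<phi> (cnt w)) (mmul N F K)]) + tr N (?L[0 := smat (\<phi> (cnt w)) D])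
    - tr N (?L[0 := madd (smat (\<phi> (cnt w)) (mmul N F K)) (smat (\<phi> (cnt w)) D)]) \<in> pspan M (length ?L)"
    using mw[of w] D by (intro tr_add_slot mats_smat mats_mmul F D K) auto
   then show "tr N (smat (\<phi> (cnt w)) (mmul N F K) # mw w) + tr N (smat (\<phi> (cnt w)) D # mw w)
    - tr N (madd (smat (\<phi> (cnt w)) (mmul N F K)) (smat (\<phi> (cnt w)) D) # mw w) \<in> pspan M (Suc q)"
    using w by (simp add: blists_def)
  qed
  finally show ?thesis .
 qed
 ultimately show ?thesis
  using hom_null_diff[of "first - lst" q "(first - lst) - Zc"] by simp
qed

private lemma word_spread:
 assumes w: "w \<in> blists (Suc q)" and c: "0 < cnt w"
 shows "tr N (mw w) - (\<Sum>i | i < Suc q \<and> w ! i. tr N ((mw w)[i := smat (\<phi> (cnt w - 1)) D])) \<in> pspan M (Suc q)"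
proof -
 let ?I = "{i. i < Suc q \<and> w ! i}"
 let ?r = "\<phi> (cnt w - 1)"
 have len: "length w = Suc q" using w by (simp add: blists_def)
 have card: "card ?I = cnt w"
  using length_filter_conv_card[of "\<lambda>b. b" w] len by (simp add: cnt_def)
 then have "?I \<noteq> {}" using c by force
 then obtain p where p: "p < Suc q" "w ! p" by auto
 have one: "tr N ((mw w)[i := smat ?r D]) - tr N ((mw w)[p := smat ?r D]) \<in> pspan M (Suc q)" if "i \<in> ?I" for i
  using tr_scale_slot[OF mw, of i w p ?r] that p len by (simp add: ml_def)
 have A: "(\<Sum>i\<in>?I. tr N ((mw w)[i := smat ?r D]) - tr N ((mw w)[p := smat ?r D])) \<in> pspan M (Suc q)"
  by (intro T.rspan_sum one)
 have "(\<Sum>i\<in>?I. tr N ((mw w)[p := smat ?r D])) - tr N ((mw w)[p := (\<lambda>a b. \<Sum>i\<in>?I. smat ?r D a b)]) \<in> pspan M (length (mw w))"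
  using len p by (intro tr_sum_slot mw mats_smat D) auto
 moreover have "(\<lambda>a b. \<Sum>i\<in>?I. smat ?r D a b) = D"
 proof (intro ext)
  fix a b
  have "(\<Sum>i\<in>?I. smat ?r D a b) = s (of_nat (cnt w) * ?r) (D a b)"
   by (simp add: smat_def sum_constant_scale card)
  also have "of_nat (cnt w) * ?r = 1" using c by (simp add: \<phi>_def)
  finally show "(\<Sum>i\<in>?I. smat ?r D a b) = D a b" by simp
 qed
 moreover have "(mw w)[p := D] = mw w"
  using p len by (metis list_update_id ml_def nth_map)
 ultimately have "(\<Sum>i\<in>?I. tr N ((mw w)[p := smat ?r D])) - tr N (mw w) \<in> pspan M (Suc q)"
  using len by simp
 from T.rspan_add[OF A this] have "(\<Sum>i\<in>?I. tr N ((mw w)[i := smat ?r D])) - tr N (mw w) \<in> pspan M (Suc q)"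
  by (simp only: sum_subtractf) simp
 then show ?thesis by (rule T.rspan_sym)
qed

private lemma spread_null:
 assumes i: "i < Suc q"
 shows "(\<Sum>w | w \<in> blists (Suc q) \<and> w ! i. tr N ((mw w)[i := smat (\<phi> (cnt w - 1)) D])) \<in> hom_null q"
proof -
 define r where "r = q - i"
 have qr: "Suc q = i + Suc r" "q = r + i" "q = i + r" using i by (simp_all add: r_def)
 let ?f = "\<lambda>w. if w ! i then tr N ((mw w)[i := smat (\<phi> (cnt w - 1)) D]) else 0"
 have "(\<Sum>w | w \<in> blists (Suc q) \<and> w ! i. tr N ((mw w)[i := smat (\<phi> (cnt w - 1)) D])) = (\<Sum>w\<in>blists (Suc q). ?f w)"
  by (simp add: sum.inter_filter[symmetric])
 also have "\<dots> = (\<Sum>u\<in>blists i. \<Sum>v\<in>blists r. tr N (mw u @ smat (\<phi> (cnt u + cnt v)) D # mw v))"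
  unfolding qr(1) sum_blists_add
 proof (rule sum.cong[OF refl])
  fix u assume "u \<in> blists i"
  then have len: "length u = i" by (simp add: blists_def)
  show "(\<Sum>v\<in>blists (Suc r). ?f (u @ v)) = (\<Sum>v\<in>blists r. tr N (mw u @ smat (\<phi> (cnt u + cnt v)) D # mw v))"
   unfolding sum_blists_Suc by (simp add: nth_append list_update_append len)
 qed
 finally have A: "(\<Sum>w | w \<in> blists (Suc q) \<and> w ! i. tr N ((mw w)[i := smat (\<phi> (cnt w - 1)) D])) = \<dots>" .
 have "Zc = (\<Sum>v\<in>blists r. \<Sum>u\<in>blists i. tr N (smat (\<phi> (cnt u + cnt v)) D # mw v @ mw u))"
  unfolding Zc_def unfolding qr(2) sum_blists_add by (simp add: add.commute)
 also have "\<dots> = (\<Sum>u\<in>blists i. \<Sum>v\<in>blists r. tr N (smat (\<phi> (cnt u + cnt v)) D # mw v @ mw u))"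
  by (rule sum.swap)
 finally have Z: "Zc = \<dots>" .
 have "(\<Sum>u\<in>blists i. \<Sum>v\<in>blists r. tr N (mw u @ smat (\<phi> (cnt u + cnt v)) D # mw v)
   - tr N (smat (\<phi> (cnt u + cnt v)) D # mw v @ mw u)) \<in> hom_null q"
 proof (intro hom_null_sum cyc_null_hom_null)
  fix u v assume uv: "u \<in> blists i" "v \<in> blists r"
  show "tr N (mw u @ smat (\<phi> (cnt u + cnt v)) D # mw v) - tr N (smat (\<phi> (cnt u + cnt v)) D # mw v @ mw u) \<in> cyc_null q"
   using tr_rotate_append[of "mw u" "smat (\<phi> (cnt u + cnt v)) D # mw v" N q] mw[of u] mw[of v] mats_smat[OF D] uv q qr
   by (simp add: blists_def add.commute)
 qed
 then have "(\<Sum>w | w \<in> blists (Suc q) \<and> w ! i. tr N ((mw w)[i := smat (\<phi> (cnt w - 1)) D])) - Zc \<in> hom_null q"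
  unfolding A Z by (simp only: sum_subtractf)
 from hom_null_add[OF this Zc_null] show ?thesis by simp
qed

text \<open>The hypotheses say that \<open>F + s D\<close> is idempotent for every \<open>s\<close> and that its derivative \<open>D\<close> is the commutator of \<open>K\<close> with it. The derivative of the trace chain is a sum of rotations of the chain with a single factor \<open>D\<close>, and in homology that chain vanishes through the Hochschild boundary of the one with \<open>K\<close> inserted; integrating over \<open>s\<close> produces the difference of the end points. The integral is carried out on words in \<open>F\<close> and \<open>D\<close>.\<close>

lemma line_homotopy:
 "tr N (replicate (Suc q) (madd F D)) - tr N (replicate (Suc q) F) \<in> hom_null q"
proof -
 let ?z = "replicate (Suc q) False"
 have z: "?z \<in> blists (Suc q)" by (simp add: blists_def)
 have c: "0 < cnt w" if "w \<in> blists (Suc q) - {?z}" for w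
 proof (rule ccontr)
  assume "\<not> 0 < cnt w"
  then have "\<forall>b\<in>set w. b = False" by (auto simp: cnt_def filter_empty_conv)
  moreover have "length w = Suc q" using that by (simp add: blists_def)
  ultimately have "w = ?z" by (intro replicate_eqI) auto
  then show False using DiffD2[OF that] by simp
 qed
 have "tr N (replicate (Suc q) (madd F D)) - (\<Sum>w\<in>blists (Suc q). tr N (mw w)) \<in> hom_null q"
  using tr_expand[of "[]" "Suc q"] by (intro span_hom_null) simp
 moreover have "(\<Sum>w\<in>blists (Suc q). tr N (mw w)) = tr N (mw ?z) + (\<Sum>w\<in>blists (Suc q) - {?z}. tr N (mw w))"
  by (rule sum.remove) (use z in auto)
 moreover have "mw ?z = replicate (Suc q) F" by (simp add: ml_def map_replicate_const)
 moreover have "(\<Sum>w\<in>blists (Suc q) - {?z}. tr N (mw w)) \<in> hom_null q"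
 proof -
  let ?g = "\<lambda>w i. tr N ((mw w)[i := smat (\<phi> (cnt w - 1)) D])"
  have "(\<Sum>w\<in>blists (Suc q) - {?z}. tr N (mw w) - (\<Sum>i | i < Suc q \<and> w ! i. ?g w i)) \<in> hom_null q"
   by (intro hom_null_sum span_hom_null word_spread c) auto
  moreover have "(\<Sum>w\<in>blists (Suc q) - {?z}. (\<Sum>i | i < Suc q \<and> w ! i. ?g w i)) \<in> hom_null q"
  proof -
   have "(\<Sum>w\<in>blists (Suc q) - {?z}. (\<Sum>i | i < Suc q \<and> w ! i. ?g w i))
     = (\<Sum>w\<in>blists (Suc q). (\<Sum>i | i < Suc q \<and> w ! i. ?g w i))"
    using z by (intro sum.mono_neutral_left) (auto intro!: sum.neutral simp: nth_Cons' simp del: replicate_Suc)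
   also have "\<dots> = (\<Sum>w\<in>blists (Suc q). \<Sum>i<Suc q. if w ! i then ?g w i else 0)"
    by (simp only: sum.inter_filter[OF finite_lessThan, symmetric] lessThan_iff)
   also have "\<dots> = (\<Sum>i<Suc q. \<Sum>w\<in>blists (Suc q). if w ! i then ?g w i else 0)"
    by (rule sum.swap)
   also have "\<dots> = (\<Sum>i<Suc q. \<Sum>w | w \<in> blists (Suc q) \<and> w ! i. ?g w i)"
    by (simp only: sum.inter_filter[OF finite_blists, symmetric])
   also have "\<dots> \<in> hom_null q"
    by (intro hom_null_sum spread_null) simp
   finally show ?thesis .
  qed
  ultimately show ?thesis
   using hom_null_add by (fastforce simp: sum_subtractf)
 qed
 ultimately show ?thesis
  using hom_null_add[of "tr N (replicate (Suc q) (madd F D)) - (\<Sum>w\<in>blists (Suc q). tr N (mw w))" q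
    "\<Sum>w\<in>blists (Suc q) - {?z}. tr N (mw w)"] by (simp add: algebra_simps)
qed

end

end

definition blk :: "nat => nat => nat => nat => (nat => nat => 'a::zero) => nat => nat => 'a" where
 "blk a m b n A = (\<lambda>i j. if a \<le> i \<and> i < a + m \<and> b \<le> j \<and> j < b + n then A (i - a) (j - b) else 0)"

lemma blk_cong:
 "(\<And>i j. i < m ==> j < n ==> A i j = A' i j) ==> blk a m b n A = blk a m b n A'"
 by (auto simp: blk_def fun_eq_iff)

lemma mmul_blk:
 assumes "b + n \<le> L"
 shows "mmul L (blk a m b n A) (blk b n c l A') = blk a m c l (mmul n A (A' :: nat => nat => 'a::semiring_0))"
proof (intro ext)
 fix i j
 let ?f = "\<lambda>k. blk a m b n A i k * blk b n c l A' k j"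
 have "(\<Sum>k<L. ?f k) = (\<Sum>k\<in>{b..<b + n}. ?f k)"
  using assms by (intro sum.mono_neutral_right) (auto simp: blk_def)
 also have "\<dots> = (\<Sum>k<n. ?f (k + b))"
  using sum.shift_bounds_nat_ivl[of ?f 0 b n] by (simp add: atLeast0LessThan add.commute)
 also have "\<dots> = blk a m c l (mmul n A A') i j"
  by (auto simp: blk_def mmul_def)
 finally show "mmul L (blk a m b n A) (blk b n c l A') i j = blk a m c l (mmul n A A') i j"
  by (simp add: mmul_def)
qed

lemma mmul_blk_zero:
 assumes "b + n \<le> b' \<or> b' + n' \<le> b"
 shows "mmul L (blk a m b n A) (blk b' n' c l A') = (\<lambda>i j. 0 :: 'a::semiring_0)"
 using assms unfolding mmul_def by (intro ext sum.neutral) (auto simp: blk_def)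

lemma mmul_madd:
 "mmul L A (madd A1 A2) = madd (mmul L A A1) (mmul L A A2)"
 "mmul L (madd A1 A2) A = madd (mmul L A1 A) (mmul L A2 A)"
 for A :: "nat => nat => 'a::semiring_0"
 by (auto simp: mmul_def madd_def distrib_left distrib_right sum.distrib)

lemma madd_zero: "madd A (\<lambda>i j. 0) = A" "madd (\<lambda>i j. 0) A = A"
 for A :: "nat => nat => 'a::monoid_add"
 by (auto simp: madd_def)

text \<open>A cycle of indices that meets two blocks has to pass from one to the other, where a block diagonal matrix has a zero entry.\<close>

lemma cyclic_crossing:
 assumes "p < m" "P (is ! p)" "p' < m" "\<not> P (is ! p')"
 shows "\<exists>j<m. P (is ! j) \<noteq> P (is ! (if Suc j = m then 0 else Suc j))"
proof (rule ccontr)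
 assume "\<not> ?thesis"
 then have step: "P (is ! j) = P (is ! Suc j)" if "Suc j < m" for j
  using that by (auto split: if_splits)
 have "j < m ==> P (is ! j) = P (is ! 0)" for j
  by (induction j) (auto dest: step)
 then show False using assms by blast
qed

context subalgebra
begin

text \<open>Here \<open>D = G - F\<close> squares to zero, because \<open>F G = F\<close> and \<open>G F = G\<close>, and all \<open>F + s D\<close> are idempotent.\<close>

lemma left_zero_pair:
 assumes "F \<in> mats N" "G \<in> mats N" "mmul N F F = F" "mmul N G G = G" "mmul N F G = F" "mmul N G F = G" "even q"
 shows "tr N (replicate (Suc q) G) - tr N (replicate (Suc q) F) \<in> hom_null q"
proof -
 define D where "D = madd G (smat (- 1) F)"
 have mK: "mmul N (smat r A) A' = smat r (mmul N A A')" "mmul N A (smat r A') = smat r (mmul N A A')" for r A A'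
  by (auto simp: mmul_def smat_def scale_sum_right scale_left[symmetric] scale_right[symmetric])
 have z: "madd A (smat (- 1) A) = (\<lambda>i j. 0)" for A by (auto simp: madd_def smat_def)
 have D: "D \<in> mats N" unfolding D_def by (intro mats_madd mats_smat assms)
 have FD: "mmul N F D = (\<lambda>i j. 0)" "mmul N D F = D" "mmul N D D = (\<lambda>i j. 0)"
  unfolding D_def by (simp_all add: mmul_madd mK assms z) (auto simp: madd_def smat_def)
 have G: "madd F D = G" by (auto simp: D_def madd_def smat_def)
 have "tr N (replicate (Suc q) (madd F D)) - tr N (replicate (Suc q) F) \<in> hom_null q"
  by (rule line_homotopy[where K = D]) (auto simp: assms D FD madd_zero)
 then show ?thesis unfolding G .
qed

lemma right_zero_pair:
 assumes "F \<in> mats N" "G \<in> mats N" "mmul N F F = F" "mmul N G G = G" "mmul N F G = G" "mmul N G F = F" "even q"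
 shows "tr N (replicate (Suc q) G) - tr N (replicate (Suc q) F) \<in> hom_null q"
proof -
 define D where "D = madd G (smat (- 1) F)"
 have mK: "mmul N (smat r A) A' = smat r (mmul N A A')" "mmul N A (smat r A') = smat r (mmul N A A')" for r A A'
  by (auto simp: mmul_def smat_def scale_sum_right scale_left[symmetric] scale_right[symmetric])
 have z: "madd A (smat (- 1) A) = (\<lambda>i j. 0)" "madd (smat (- 1) A) A = (\<lambda>i j. 0)" "smat r (\<lambda>i j. 0) = (\<lambda>i j. 0)" for A r
  by (auto simp: madd_def smat_def)
 have D: "D \<in> mats N" unfolding D_def by (intro mats_madd mats_smat assms)
 have FD: "mmul N F D = D" "mmul N D F = (\<lambda>i j. 0)" "mmul N D D = (\<lambda>i j. 0)"
  unfolding D_def by (simp_all add: mmul_madd mK assms z) (auto simp: madd_def smat_def)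
 have G: "madd F D = G" by (auto simp: D_def madd_def smat_def)
 have "tr N (replicate (Suc q) (madd F D)) - tr N (replicate (Suc q) F) \<in> hom_null q"
  by (rule line_homotopy[where K = "smat (- 1) D"]) (auto simp: assms D FD madd_zero mK z mats_smat)
 then show ?thesis unfolding G .
qed

lemma blk_mats: "(\<And>i j. i < m ==> j < n ==> A i j \<in> B) ==> blk a m b n A \<in> mats L"
 by (auto simp: mats_def blk_def zero_mem)

lemma cword_zero_rel:
 assumes "set Ms \<subseteq> mats N" "is \<in> idx N (length Ms)" "j < length Ms"
  "(Ms ! j) (is ! j) (is ! (if Suc j = length Ms then 0 else Suc j)) = 0"
 shows "frag_of (cword Ms is) \<in> pspan M (length Ms)"
 using word_zero_rel[OF left_module_M cword_in_words[OF assms(1,2)] assms(3)] assms(3,4) by (simp add: cword_nth)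

lemma tr_blk:
 assumes "A \<in> mats N" "a + N \<le> L" "0 < m"
 shows "tr L (replicate m (blk a N a N A)) - tr N (replicate m A) \<in> pspan M m"
proof -
 let ?b = "blk a N a N A"
 let ?S = "{is \<in> idx L m. \<forall>x\<in>set is. a \<le> x \<and> x < a + N}"
 have bm: "?b \<in> mats L" using assms(1) by (intro blk_mats) (auto simp: mats_def)
 have bij: "bij_betw (map (\<lambda>x. x + a)) (idx N m) ?S"
 proof (rule bij_betwI)
  show "map (\<lambda>x. x + a) \<in> idx N m \<rightarrow> ?S" using assms(2) by (force simp: idx_def subset_iff)
  show "map (\<lambda>x. x - a) \<in> ?S \<rightarrow> idx N m" by (fastforce simp: idx_def subset_iff)
 qed (auto simp: idx_def o_def intro!: map_idI)
 have "tr L (replicate m ?b) = (\<Sum>is\<in>?S. frag_of (cword (replicate m ?b) is)) + (\<Sum>is\<in>idx L m - ?S. frag_of (cword (replicate m ?b) is))"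
  unfolding tr_def by (subst sum.subset_diff[of ?S]) (auto simp: add.commute)
 moreover have "(\<Sum>is\<in>?S. frag_of (cword (replicate m ?b) is)) = tr N (replicate m A)"
 proof -
  have "(\<Sum>is\<in>?S. frag_of (cword (replicate m ?b) is)) = (\<Sum>is\<in>idx N m. frag_of (cword (replicate m ?b) (map (\<lambda>x. x + a) is)))"
   by (rule sum.reindex_bij_betw[OF bij, symmetric])
  also have "\<dots> = (\<Sum>is\<in>idx N m. frag_of (cword (replicate m A) is))"
  proof (intro sum.cong refl arg_cong[where f = frag_of] nth_equalityI)
   fix "is" p assume I: "is \<in> idx N m" and p: "p < length (cword (replicate m ?b) (map (\<lambda>x. x + a) is))"
   have l: "length is = m" using I by (simp add: idx_def)
   have pm: "p < m" using p by simp
   have n: "(if Suc p = m then 0 else Suc p) < m" using pm by auto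
   have "is ! p < N" "is ! (if Suc p = m then 0 else Suc p) < N" using idx_nth[OF I pm] idx_next[OF I pm] by auto
   then show "cword (replicate m ?b) (map (\<lambda>x. x + a) is) ! p = cword (replicate m A) is ! p"
    using pm l n by (simp add: cword_nth blk_def)
  qed simp
  finally show ?thesis by (simp add: tr_def)
 qed
 moreover have "(\<Sum>is\<in>idx L m - ?S. frag_of (cword (replicate m ?b) is)) \<in> pspan M m"
 proof (rule T.rspan_sum)
  fix "is" assume I: "is \<in> idx L m - ?S"
  then obtain p where p: "p < m" "\<not> (a \<le> is ! p \<and> is ! p < a + N)"
   by (auto simp: idx_def in_set_conv_nth)
  have "frag_of (cword (replicate m ?b) is) \<in> pspan M (length (replicate m ?b))"
   using p I bm by (intro cword_zero_rel[of _ L _ p]) (auto simp: blk_def)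
  then show "frag_of (cword (replicate m ?b) is) \<in> pspan M m" by simp
 qed
 ultimately show ?thesis by simp
qed

text \<open>Only the index cycles inside one of the two blocks contribute.\<close>

lemma tr_block_sum:
 assumes A: "A \<in> mats N" and A': "A' \<in> mats N'" and m: "0 < m"
 shows "tr (N + N') (replicate m (madd (blk 0 N 0 N A) (blk N N' N N' A')))
  - (tr N (replicate m A) + tr N' (replicate m A')) \<in> pspan M m"
proof -
 let ?L = "N + N'" and ?a = "blk 0 N 0 N A" and ?b = "blk N N' N N' A'"
 have mats: "?a \<in> mats ?L" "?b \<in> mats ?L" using A A' unfolding mats_def[of N] mats_def[of N'] by (blast intro: blk_mats)+
 have ab: "madd ?a ?b \<in> mats ?L" by (intro mats_madd mats)
 have "tr ?L (replicate m (madd ?a ?b)) - (tr ?L (replicate m ?a) + tr ?L (replicate m ?b)) \<in> pspan M m"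
  unfolding tr_def length_replicate sum.distrib[symmetric] sum_subtractf[symmetric]
 proof (rule T.rspan_sum)
  fix "is" assume I: "is \<in> idx ?L m"
  let ?nx = "\<lambda>p. if Suc p = m then 0 else Suc p"
  have len: "length is = m" using I by (simp add: idx_def)
  have zero: "frag_of (cword (replicate m D) is) \<in> pspan M m"
   if "D \<in> mats ?L" "p < m" "D (is ! p) (is ! ?nx p) = 0" for D p
  proof -
   have "frag_of (cword (replicate m D) is) \<in> pspan M (length (replicate m D))"
    using that I by (intro cword_zero_rel[of _ ?L _ p]) auto
   then show ?thesis by simp
  qed
  have eqc: "cword (replicate m D) is = cword (replicate m D') is"
   if "\<And>p. p < m ==> D (is ! p) (is ! ?nx p) = D' (is ! p) (is ! ?nx p)" for D D'
   using that by (intro nth_equalityI) (auto simp: cword_nth)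
  have nx: "?nx p < m" if "p < m" for p using that by auto
  consider "\<forall>p<m. is ! p < N" | "\<forall>p<m. \<not> is ! p < N" | p p' where "p < m" "is ! p < N" "p' < m" "\<not> is ! p' < N"
   by blast
  then show "frag_of (cword (replicate m (madd ?a ?b)) is) - (frag_of (cword (replicate m ?a) is) + frag_of (cword (replicate m ?b) is)) \<in> pspan M m"
  proof cases
   case 1
   have "cword (replicate m (madd ?a ?b)) is = cword (replicate m ?a) is"
    using 1 nx by (intro eqc) (auto simp: madd_def blk_def)
   moreover have "frag_of (cword (replicate m ?b) is) \<in> pspan M m"
    by (rule zero[OF mats(2) m]) (use 1 m in \<open>auto simp: blk_def\<close>)
   ultimately show ?thesis using T.rspan_minus by simp
  next
   case 2
   have "cword (replicate m (madd ?a ?b)) is = cword (replicate m ?b) is"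
    using 2 nx by (intro eqc) (auto simp: madd_def blk_def)
   moreover have "frag_of (cword (replicate m ?a) is) \<in> pspan M m"
    by (rule zero[OF mats(1) m]) (use 2 m in \<open>auto simp: blk_def\<close>)
   ultimately show ?thesis using T.rspan_minus by simp
  next
   case 3
   obtain j where j: "j < m" "(is ! j < N) \<noteq> (is ! ?nx j < N)"
    using cyclic_crossing[of p m "\<lambda>x. x < N" "is" p'] 3 by blast
   have "frag_of (cword (replicate m (madd ?a ?b)) is) \<in> pspan M m"
    by (rule zero[OF ab j(1)]) (use j in \<open>auto simp: madd_def blk_def\<close>)
   moreover have "frag_of (cword (replicate m ?a) is) \<in> pspan M m"
    by (rule zero[OF mats(1) 3(3)]) (use 3 in \<open>auto simp: blk_def\<close>)
   moreover have "frag_of (cword (replicate m ?b) is) \<in> pspan M m"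
    by (rule zero[OF mats(2) 3(1)]) (use 3 in \<open>auto simp: blk_def\<close>)
   ultimately show ?thesis by (intro T.rspan_diff T.rspan_add)
  qed
 qed
 moreover have "tr ?L (replicate m ?a) - tr N (replicate m A) \<in> pspan M m"
  by (intro tr_blk A m) simp
 moreover have "tr ?L (replicate m ?b) - tr N' (replicate m A') \<in> pspan M m"
  by (intro tr_blk A' m) simp
 ultimately have "(tr ?L (replicate m (madd ?a ?b)) - (tr ?L (replicate m ?a) + tr ?L (replicate m ?b)))
   + ((tr ?L (replicate m ?a) - tr N (replicate m A)) + (tr ?L (replicate m ?b) - tr N' (replicate m A'))) \<in> pspan M m"
  by (intro T.rspan_add)
 then show ?thesis by (simp add: algebra_simps)
qed

text \<open>With \<open>X\<close> and \<open>Y\<close> off the diagonal, the corners \<open>E\<close> and \<open>E'\<close> are joined by \<open>E + X\<close> and \<open>Y + E'\<close>: consecutive idempotents in this chain have the same kernel or the same image, so each pair spans a line of idempotents.\<close>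

lemma trace_iso_invariant:
 assumes E: "E \<in> mats N" and E': "E' \<in> mats N'"
  and X: "\<forall>i<N. \<forall>j<N'. X i j \<in> B" and Y: "\<forall>i<N'. \<forall>j<N. Y i j \<in> B"
  and XY: "\<And>i j. i < N ==> j < N ==> mmul N' X Y i j = E i j"
  and YX: "\<And>i j. i < N' ==> j < N' ==> mmul N Y X i j = E' i j"
  and EX: "\<And>i j. i < N ==> j < N' ==> mmul N E X i j = X i j"
  and EY: "\<And>i j. i < N' ==> j < N ==> mmul N' E' Y i j = Y i j"
  and XE: "\<And>i j. i < N ==> j < N' ==> mmul N' X E' i j = X i j"
  and YE: "\<And>i j. i < N' ==> j < N ==> mmul N Y E i j = Y i j"
  and EE: "\<And>i j. i < N ==> j < N ==> mmul N E E i j = E i j"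
  and EE': "\<And>i j. i < N' ==> j < N' ==> mmul N' E' E' i j = E' i j"
  and q: "even q"
 shows "tr N (replicate (Suc q) E) - tr N' (replicate (Suc q) E') \<in> hom_null q"
proof -
 define L where "L = N + N'"
 define e00 where "e00 = blk 0 N 0 N E"
 define e01 where "e01 = blk 0 N N N' X"
 define e10 where "e10 = blk N N' 0 N Y"
 define e11 where "e11 = blk N N' N N' E'"
 note defs = e00_def e01_def e10_def e11_def
 have mats: "e00 \<in> mats L" "e01 \<in> mats L" "e10 \<in> mats L" "e11 \<in> mats L"
  unfolding defs using E E' X Y unfolding mats_def[of N] mats_def[of N'] by (blast intro: blk_mats)+
 have prods:
  "mmul L e00 e00 = e00" "mmul L e00 e01 = e01" "mmul L e01 e10 = e00" "mmul L e01 e11 = e01"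
  "mmul L e10 e00 = e10" "mmul L e10 e01 = e11" "mmul L e11 e10 = e10" "mmul L e11 e11 = e11"
  unfolding defs by (simp_all add: mmul_blk L_def) (intro blk_cong; simp add: assms)+
 have zeros:
  "mmul L e00 e10 = (\<lambda>i j. 0)" "mmul L e00 e11 = (\<lambda>i j. 0)" "mmul L e01 e00 = (\<lambda>i j. 0)" "mmul L e01 e01 = (\<lambda>i j. 0)"
  "mmul L e10 e10 = (\<lambda>i j. 0)" "mmul L e10 e11 = (\<lambda>i j. 0)" "mmul L e11 e00 = (\<lambda>i j. 0)" "mmul L e11 e01 = (\<lambda>i j. 0)"
  unfolding defs by (intro mmul_blk_zero; simp)+
 let ?F = "madd e00 e01" and ?G = "madd e10 e11"
 have m: "?F \<in> mats L" "?G \<in> mats L" by (intro mats_madd mats)+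
 have p: "mmul L ?F ?F = ?F" "mmul L ?G ?G = ?G" "mmul L ?F ?G = ?F" "mmul L ?G ?F = ?G"
  "mmul L e00 ?F = ?F" "mmul L ?F e00 = e00" "mmul L e11 ?G = ?G" "mmul L ?G e11 = e11"
  by (simp_all add: mmul_madd prods zeros madd_zero)
 let ?t = "\<lambda>A. tr L (replicate (Suc q) A)"
 have 1: "?t ?F - ?t e00 \<in> hom_null q" by (intro right_zero_pair mats m q p prods)
 have 2: "?t ?G - ?t ?F \<in> hom_null q" by (intro left_zero_pair m q p)
 have 3: "?t ?G - ?t e11 \<in> hom_null q" by (intro right_zero_pair mats m q p prods)
 have "?t e00 - ?t e11 \<in> hom_null q"
  by (rule hom_null_trans[OF hom_null_sym[OF 1] hom_null_trans[OF hom_null_sym[OF 2] 3]])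
 moreover have "?t e00 - tr N (replicate (Suc q) E) \<in> hom_null q"
  unfolding e00_def by (intro span_hom_null tr_blk E) (simp_all add: L_def)
 moreover have "?t e11 - tr N' (replicate (Suc q) E') \<in> hom_null q"
  unfolding e11_def by (intro span_hom_null tr_blk E') (simp_all add: L_def)
 ultimately show ?thesis by (meson hom_null_trans hom_null_sym)
qed

lemma trace_cycle:
 assumes E: "E \<in> mats N" and EE: "\<And>i j. i < N ==> j < N ==> mmul N E E i j = E i j" and q: "even q"
 shows "tr N (replicate (Suc q) E) \<in> cycles q"
proof (cases q)
 case (Suc p)
 let ?R = "replicate q E"
 have sub: "set (replicate k E) \<subseteq> mats N" for k using E by auto
 have odd: "odd p" using q Suc by simp
 then obtain p' where p': "p = Suc p'" by (cases p) auto
 have face: "tr N (mface N j (replicate (Suc q) E)) = tr N ?R" if "j < q" for j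
  by (rule tr_cong) (use that in \<open>auto simp: length_mface mface_nth EE simp del: replicate_Suc\<close>)
 have rot: "rot (replicate (Suc q) E) = replicate (Suc q) E"
  by (intro nth_equalityI) (auto simp: rot_nth simp del: replicate_Suc)
 have "hoch_frag q (tr N (replicate (Suc q) E)) - ((\<Sum>j<q. frag_cmul ((- 1) ^ j) (tr N (mface N j (replicate (Suc q) E))))
   + frag_cmul ((- 1) ^ q) (tr N (mface N 0 (rot (replicate (Suc q) E))))) \<in> pspan M q"
  by (rule tr_hoch[OF sub]) (use Suc in auto)
 moreover have "(\<Sum>j<q. frag_cmul ((- 1) ^ j) (tr N (mface N j (replicate (Suc q) E)))) = 0"
  using alternating_sum_even[OF q, of "tr N ?R"] by (simp add: face del: replicate_Suc)
 ultimately have H: "hoch_frag q (tr N (replicate (Suc q) E)) - tr N ?R \<in> pspan M (Suc p)"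
  unfolding rot using q face[of 0] Suc by (simp del: replicate_Suc)
 have "tr N ?R \<in> cyc_null p"
 proof -
  let ?h = "smat (1 / 2) E"
  let ?S = "?R[0 := ?h]"
  have S: "set ?S \<subseteq> mats N" by (intro mats_update sub mats_smat E)
  have "tr N ?S - frag_cmul ((- 1) ^ p) (tr N (rot ?S)) \<in> cyc_null p"
   by (rule tr_cyc[OF S]) (simp add: Suc)
  moreover have "rot ?S = ?R[1 := ?h]"
  proof (rule nth_equalityI)
   show "length (rot ?S) = length (?R[1 := ?h])" using Suc by (subst length_rot) (auto simp flip: length_greater_0_conv)
   fix i assume "i < length (rot ?S)"
   then have i: "i < q" using Suc by (subst (asm) length_rot) (auto simp flip: length_greater_0_conv)
   then show "rot ?S ! i = ?R[1 := ?h] ! i" using Suc p' by (subst rot_nth) (auto simp: nth_list_update simp del: replicate_Suc)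
  qed
  ultimately have "tr N ?S + tr N (?R[1 := ?h]) \<in> cyc_null p" using odd by simp
  moreover have "tr N (?R[0 := smat (1 / 2) (?R ! 0)]) - tr N (?R[1 := smat (1 / 2) (?R ! 1)]) \<in> pspan M (length ?R)"
   by (rule tr_scale_slot[OF sub]) (use Suc p' in auto)
  then have "tr N ?S - tr N (?R[1 := ?h]) \<in> cyc_null p"
   using Suc p' by (intro span_cyc_null) simp
  ultimately have A: "(tr N ?S + tr N (?R[1 := ?h])) + (tr N ?S - tr N (?R[1 := ?h])) \<in> cyc_null p"
   by (rule cyc_null_add)
  have "tr N (?R[0 := ?h]) + tr N (?R[0 := ?h]) - tr N (?R[0 := madd ?h ?h]) \<in> pspan M (length ?R)"
   by (rule tr_add_slot[OF sub]) (use Suc in \<open>auto intro: mats_smat E\<close>)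
  moreover have "madd ?h ?h = E"
   by (auto simp: madd_def smat_def scale_left_distrib[symmetric])
  ultimately have "tr N ?S + tr N ?S - tr N ?R \<in> cyc_null p"
   using Suc by (intro span_cyc_null) simp
  from cyc_null_diff[OF A this] show ?thesis by simp
 qed
 with span_cyc_null[OF H] have "hoch_frag q (tr N (replicate (Suc q) E)) \<in> cyc_null p"
  using cyc_null_add[of "hoch_frag q (tr N (replicate (Suc q) E)) - tr N ?R" p "tr N ?R"] by simp
 then show ?thesis using tr_keys'[OF sub[of "Suc q"]] Suc by (simp add: cycles_def del: replicate_Suc)
qed (use assms tr_keys'[of "[E]" N "Suc 0"] in \<open>simp add: cycles_def\<close>)

end

section \<open>Projective modules, \<open>K\<^sub>0\<close> and the Chern character\<close>

lemma module_iso_refl: "module_iso R M M"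
 unfolding module_iso_def by (intro exI[of _ "\<lambda>x. x"] conjI lin_map_id) (simp add: bij_betw_def inj_on_def)

lemma lin_map_inverse:
 assumes M: "left_module R M" and f: "lin_map R M N f" and bij: "bij_betw f (carrier M) (carrier N)"
 shows "lin_map R N M (the_inv_into (carrier M) f)"
proof -
 let ?g = "the_inv_into (carrier M) f"
 have inj: "inj_on f (carrier M)" and im: "f ` carrier M = carrier N" using bij by (auto simp: bij_betw_def)
 have g: "?g x \<in> carrier M" "f (?g x) = x" if "x \<in> carrier N" for x
  using that im the_inv_into_into[OF inj, of x "carrier M"] f_the_inv_into_f[OF inj, of x] by auto
 have u: "?g (f x) = x" if "x \<in> carrier M" for x by (rule the_inv_into_f_f[OF inj that])
 show ?thesis
  unfolding lin_map_def
 proof (intro conjI ballI Pi_I)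
  fix x y assume xy: "x \<in> carrier N" "y \<in> carrier N"
  have "f (?g x \<oplus>\<^bsub>M\<^esub> ?g y) = x \<oplus>\<^bsub>N\<^esub> y" using lin_map_add[OF f] g xy by metis
  then show "?g (x \<oplus>\<^bsub>N\<^esub> y) = ?g x \<oplus>\<^bsub>M\<^esub> ?g y"
   using u[OF left_module_add_closed[OF M g(1)[OF xy(1)] g(1)[OF xy(2)]]] by simp
 next
  fix r x assume rx: "r \<in> R" "x \<in> carrier N"
  have "f (r \<odot>\<^bsub>M\<^esub> ?g x) = r \<odot>\<^bsub>N\<^esub> x" using lin_map_smult[OF f rx(1)] g rx by metis
  then show "?g (r \<odot>\<^bsub>N\<^esub> x) = r \<odot>\<^bsub>M\<^esub> ?g x"
   using u[OF left_module_smult_closed[OF M rx(1) g(1)[OF rx(2)]]] by simp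
 qed (use g in auto)
qed

lemma module_iso_sym: "left_module R M ==> module_iso R M N ==> module_iso R N M"
 unfolding module_iso_def using lin_map_inverse bij_betw_the_inv_into by blast

lemma module_iso_trans: "module_iso R M N ==> module_iso R N L ==> module_iso R M L"
 unfolding module_iso_def
proof clarify
 fix f g assume "lin_map R M N f" "bij_betw f (carrier M) (carrier N)" "lin_map R N L g" "bij_betw g (carrier N) (carrier L)"
 then show "\<exists>h. lin_map R M L h \<and> bij_betw h (carrier M) (carrier L)"
  using bij_betw_trans[of f "carrier M" "carrier N" g "carrier L"] by (intro exI[of _ "\<lambda>x. g (f x)"]) (auto simp: lin_map_comp o_def)
qed

lemma proj_iso_class_cong:
 assumes "left_module R M" "module_iso R M M'"
 shows "proj_iso_class R M = proj_iso_class R M'"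
 unfolding proj_iso_class_def
 using module_iso_trans[OF module_iso_sym[OF assms]] module_iso_trans[OF assms(2)] by blast

definition row_mult :: "nat => (nat => nat => 'r::semiring_0) => (nat => 'r) => nat => 'r" where
 "row_mult N E x = (\<lambda>j. if j < N then \<Sum>i<N. x i * E i j else 0)"

definition unit_row :: "nat => nat => 'r::{zero,one}" where
 "unit_row p = (\<lambda>j. if j = p then 1 else 0)"

definition retract ::
 "'r::{ring,monoid_mult} set => ('r, 'm, 'z) module_scheme => nat => ('m => nat => 'r) => ((nat => 'r) => 'm) => bool" where
 "retract R M N i q \<longleftrightarrow> left_module R M \<and> lin_map R M (free_module R N) i \<and> lin_map R (free_module R N) M q \<and>
   (\<forall>x\<in>carrier M. q (i x) = x)"

definition retract_matrix :: "('m => nat => 'r::{zero,one}) => ((nat => 'r) => 'm) => nat => nat => 'r" where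
 "retract_matrix i q = (\<lambda>p j. i (q (unit_row p)) j)"

lemma fg_projective_retract: "fg_projective R M \<longleftrightarrow> (\<exists>N i q. retract R M N i q)"
 unfolding fg_projective_def retract_def by blast

lemma free_module_simps [simp]:
 "x \<in> carrier (free_module R N) \<longleftrightarrow> (\<forall>i<N. x i \<in> R) \<and> (\<forall>i\<ge>N. x i = 0)"
 "x \<oplus>\<^bsub>free_module R N\<^esub> y = (\<lambda>i. x i + y i)" "r \<odot>\<^bsub>free_module R N\<^esub> x = (\<lambda>i. r * x i)"
 "\<zero>\<^bsub>free_module R N\<^esub> = (\<lambda>i. 0)"
 by (simp_all add: free_module_def)

lemma matrix_module_simps [simp]:
 "carrier (matrix_module R N E) = row_mult N E ` carrier (free_module R N)"
 "x \<oplus>\<^bsub>matrix_module R N E\<^esub> y = (\<lambda>i. x i + y i)" "r \<odot>\<^bsub>matrix_module R N E\<^esub> x = (\<lambda>i. r * x i)"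
 "\<zero>\<^bsub>matrix_module R N E\<^esub> = (\<lambda>i. 0)"
 by (simp_all add: matrix_module_def free_module_def row_mult_def)

lemma row_mult_add: "row_mult N E (\<lambda>i. x i + y i) = (\<lambda>j. row_mult N E x j + row_mult N E y j)"
 by (auto simp: row_mult_def distrib_right sum.distrib)

lemma row_mult_smult: "row_mult N E (\<lambda>i. r * x i) = (\<lambda>j. r * row_mult N E x j)"
 by (auto simp: row_mult_def sum_distrib_left mult.assoc)

lemma row_mult_unit: "p < N ==> row_mult N E (unit_row p) = (\<lambda>j. if j < N then E p j else 0)"
 for E :: "nat => nat => 'r::{ring,monoid_mult}"
 by (auto simp: row_mult_def unit_row_def if_distrib[of "\<lambda>x. x * _"] sum.delta cong: if_cong)

lemma direct_sum_simps [simp]: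
 "carrier (direct_sum M N) = carrier M \<times> carrier N"
 "(x, y) \<oplus>\<^bsub>direct_sum M N\<^esub> (x', y') = (x \<oplus>\<^bsub>M\<^esub> x', y \<oplus>\<^bsub>N\<^esub> y')"
 "r \<odot>\<^bsub>direct_sum M N\<^esub> (x, y) = (r \<odot>\<^bsub>M\<^esub> x, r \<odot>\<^bsub>N\<^esub> y)"
 "\<zero>\<^bsub>direct_sum M N\<^esub> = (\<zero>\<^bsub>M\<^esub>, \<zero>\<^bsub>N\<^esub>)"
 by (simp_all add: direct_sum_def)

lemma left_module_direct_sum:
 assumes M: "left_module R M" and N: "left_module R N"
 shows "left_module R (direct_sum M N)"
proof -
 interpret M: abelian_group M by (rule left_module_group[OF M])
 interpret N: abelian_group N by (rule left_module_group[OF N])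
 have "abelian_group (direct_sum M N)"
 proof (rule abelian_groupI)
  fix x assume "x \<in> carrier (direct_sum M N)"
  then show "\<exists>y\<in>carrier (direct_sum M N). y \<oplus>\<^bsub>direct_sum M N\<^esub> x = \<zero>\<^bsub>direct_sum M N\<^esub>"
   by (cases x) (auto intro!: bexI[of _ "(\<ominus>\<^bsub>M\<^esub> fst x, \<ominus>\<^bsub>N\<^esub> snd x)"] simp: M.l_neg N.l_neg)
 qed (auto simp: M.a_ac N.a_ac)
 then show ?thesis
  using M N unfolding left_module_def by auto
qed

lemma lin_map_zero:
 assumes "left_module R M" "left_module R N" "lin_map R M N f"
 shows "f \<zero>\<^bsub>M\<^esub> = \<zero>\<^bsub>N\<^esub>"
proof -
 interpret M: abelian_group M by (rule left_module_group[OF assms(1)])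
 interpret N: abelian_group N by (rule left_module_group[OF assms(2)])
 have c: "f \<zero>\<^bsub>M\<^esub> \<in> carrier N" by (rule lin_map_closed[OF assms(3) M.zero_closed])
 have "f \<zero>\<^bsub>M\<^esub> \<oplus>\<^bsub>N\<^esub> f \<zero>\<^bsub>M\<^esub> = f \<zero>\<^bsub>M\<^esub>"
  using lin_map_add[OF assms(3) M.zero_closed M.zero_closed] by simp
 then show ?thesis using c by simp
qed

context subalgebra
begin

lemma left_module_free: "left_module B (free_module B N)"
proof -
 have "abelian_group (free_module B N)"
 proof (rule abelian_groupI)
  fix x assume "x \<in> carrier (free_module B N)"
  then show "\<exists>y\<in>carrier (free_module B N). y \<oplus>\<^bsub>free_module B N\<^esub> x = \<zero>\<^bsub>free_module B N\<^esub>"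
   by (intro bexI[of _ "\<lambda>i. - x i"]) (auto simp: minus_mem)
 qed (auto simp: add_mem zero_mem add.assoc add.commute)
 then show ?thesis
  by (auto simp: left_module_def mult_mem distrib_left distrib_right mult.assoc)
qed

lemma unit_row_free: "p < N ==> unit_row p \<in> carrier (free_module B N)"
 by (auto simp: unit_row_def zero_mem one_mem)

lemma lin_map_rows:
 assumes f: "lin_map B (free_module B N) (free_module B N') f" and x: "x \<in> carrier (free_module B N)"
 shows "f x j = (\<Sum>p<N. x p * f (unit_row p) j)"
proof -
 define tx where "tx = (\<lambda>k j. if j < k then x j else 0)"
 have tx: "tx k \<in> carrier (free_module B N)" for k using x by (auto simp: tx_def zero_mem)
 have "k \<le> N ==> f (tx k) j = (\<Sum>p<k. x p * f (unit_row p) j)" for k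
 proof (induction k)
  case 0
  have "tx 0 = (\<lambda>i. 0)" by (simp add: tx_def)
  then show ?case using lin_map_zero[OF left_module_free left_module_free f] by simp
 next
  case (Suc k)
  have "tx (Suc k) = tx k \<oplus>\<^bsub>free_module B N\<^esub> (x k \<odot>\<^bsub>free_module B N\<^esub> unit_row k)"
   by (auto simp: fun_eq_iff tx_def unit_row_def less_Suc_eq)
  moreover have "x k \<odot>\<^bsub>free_module B N\<^esub> unit_row k \<in> carrier (free_module B N)"
   using x Suc.prems by (intro left_module_smult_closed[OF left_module_free] unit_row_free) auto
  ultimately have "f (tx (Suc k)) = f (tx k) \<oplus>\<^bsub>free_module B N'\<^esub> x k \<odot>\<^bsub>free_module B N'\<^esub> f (unit_row k)"
   using lin_map_add[OF f tx] lin_map_smult[OF f _ unit_row_free] x Suc.prems by auto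
  then show ?case using Suc by simp
 qed
 from this[of N] have "f (tx N) j = (\<Sum>p<N. x p * f (unit_row p) j)" by simp
 moreover have "tx N = x" using x by (auto simp: tx_def)
 ultimately show ?thesis by simp
qed

lemma retract_row_mult:
 assumes r: "retract B L N i q" and x: "x \<in> carrier (free_module B N)"
 shows "i (q x) = row_mult N (retract_matrix i q) x"
proof
 fix j
 have f: "lin_map B (free_module B N) (free_module B N) (\<lambda>x. i (q x))"
  using r by (auto simp: retract_def intro: lin_map_comp)
 show "i (q x) j = row_mult N (retract_matrix i q) x j"
  using lin_map_rows[OF f x, of j] lin_map_closed[OF f x] by (auto simp: row_mult_def retract_matrix_def)
qed

lemma retract_idempotent:
 assumes r: "retract B L N i q"
 shows "idempotent_matrix B N (retract_matrix i q)"
 unfolding idempotent_matrix_def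
proof (intro conjI allI impI)
 fix p j assume p: "p < N" and j: "j < N"
 have li: "lin_map B L (free_module B N) i" and lq: "lin_map B (free_module B N) L q"
  using r by (simp_all add: retract_def)
 have q: "q (unit_row p) \<in> carrier L" by (rule lin_map_closed[OF lq unit_row_free[OF p]])
 have iq: "i (q (unit_row p)) \<in> carrier (free_module B N)" by (rule lin_map_closed[OF li q])
 show "retract_matrix i q p j \<in> B" using iq j by (simp add: retract_matrix_def)
 have "i (q (i (q (unit_row p)))) = i (q (unit_row p))" using r q by (simp add: retract_def)
 then show "(\<Sum>k<N. retract_matrix i q p k * retract_matrix i q k j) = retract_matrix i q p j"
  using fun_cong[OF retract_row_mult[OF r iq], of j] j by (simp add: row_mult_def retract_matrix_def)
qed

text \<open>On the image of \<open>i\<close> the idempotent \<open>i q\<close> acts as the identity.\<close>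

lemma retract_iso:
 assumes r: "retract B L N i q"
 shows "module_iso B L (matrix_module B N (retract_matrix i q))"
 unfolding module_iso_def
proof (intro exI conjI)
 have L: "left_module B L" and li: "lin_map B L (free_module B N) i" and lq: "lin_map B (free_module B N) L q"
  and qi: "\<And>x. x \<in> carrier L ==> q (i x) = x"
  using r by (auto simp: retract_def)
 have "carrier (matrix_module B N (retract_matrix i q)) = (\<lambda>x. i (q x)) ` carrier (free_module B N)"
  unfolding matrix_module_simps using retract_row_mult[OF r] by (intro image_cong) auto
 also have "\<dots> = i ` carrier L"
  using lin_map_closed[OF lq] lin_map_closed[OF li] qi by (force simp: image_iff simp del: free_module_simps)
 finally have im: "carrier (matrix_module B N (retract_matrix i q)) = i ` carrier L" .
 show "bij_betw i (carrier L) (carrier (matrix_module B N (retract_matrix i q)))"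
  unfolding bij_betw_def im using qi by (metis inj_on_def)
 show "lin_map B L (matrix_module B N (retract_matrix i q)) i"
  unfolding lin_map_def im using lin_map_add[OF li] lin_map_smult[OF li] by auto
qed

lemma idempotent_row_mult:
 assumes E: "idempotent_matrix B N E" and x: "x \<in> carrier (free_module B N)"
 shows "row_mult N E x \<in> carrier (free_module B N)" "row_mult N E (row_mult N E x) = row_mult N E x"
proof -
 show "row_mult N E x \<in> carrier (free_module B N)"
  using E x by (auto simp: row_mult_def idempotent_matrix_def intro!: sum_mem mult_mem)
 have "(\<Sum>i<N. (\<Sum>k<N. x k * E k i) * E i j) = (\<Sum>k<N. x k * E k j)" if "j < N" for j
 proof -
  have "(\<Sum>i<N. (\<Sum>k<N. x k * E k i) * E i j) = (\<Sum>k<N. \<Sum>i<N. x k * (E k i * E i j))"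
   by (subst sum.swap) (simp add: sum_distrib_right mult.assoc)
  also have "\<dots> = (\<Sum>k<N. x k * E k j)"
   using E that by (intro sum.cong refl) (simp add: sum_distrib_left[symmetric] idempotent_matrix_def)
  finally show ?thesis .
 qed
 then show "row_mult N E (row_mult N E x) = row_mult N E x" by (auto simp: row_mult_def)
qed

lemma left_module_matrix:
 assumes E: "idempotent_matrix B N E"
 shows "left_module B (matrix_module B N E)"
proof -
 let ?F = "free_module B N" and ?r = "row_mult N E"
 note F = left_module_free[of N]
 interpret F: abelian_group ?F by (rule left_module_group[OF F])
 have sub: "x \<in> carrier ?F" if "x \<in> carrier (matrix_module B N E)" for x
  using that idempotent_row_mult(1)[OF E] by (auto simp del: free_module_simps)
 have closed: "(\<lambda>i. x i + y i) \<in> carrier (matrix_module B N E)" "(\<lambda>i. b * x i) \<in> carrier (matrix_module B N E)"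
  if xy: "x \<in> carrier (matrix_module B N E)" "y \<in> carrier (matrix_module B N E)" "b \<in> B" for x y b
 proof -
  obtain x' y' where x': "x' \<in> carrier ?F" "x = ?r x'" and y': "y' \<in> carrier ?F" "y = ?r y'"
   using xy by auto
  have "(\<lambda>i. x i + y i) = ?r (\<lambda>i. x' i + y' i)" "(\<lambda>i. b * x i) = ?r (\<lambda>i. b * x' i)"
   by (simp_all add: x' y' row_mult_add row_mult_smult)
  moreover have "(\<lambda>i. x' i + y' i) \<in> carrier ?F" "(\<lambda>i. b * x' i) \<in> carrier ?F"
   using x' y' xy(3) by (auto simp: add_mem mult_mem)
  ultimately show "(\<lambda>i. x i + y i) \<in> carrier (matrix_module B N E)" "(\<lambda>i. b * x i) \<in> carrier (matrix_module B N E)"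
   unfolding matrix_module_simps by (metis imageI)+
 qed
 have zero: "(\<lambda>i. 0) \<in> carrier (matrix_module B N E)"
  unfolding matrix_module_simps
  by (rule image_eqI[of _ _ "\<lambda>i. 0"]) (auto simp: row_mult_def zero_mem)
 have "abelian_group (matrix_module B N E)"
 proof (rule abelian_groupI)
  fix x assume x: "x \<in> carrier (matrix_module B N E)"
  have "(\<lambda>i. (- 1) * x i) \<in> carrier (matrix_module B N E)"
   using closed(2)[OF x x] minus_mem[OF one_mem] by blast
  moreover have "(\<lambda>i. (- 1) * x i) \<oplus>\<^bsub>matrix_module B N E\<^esub> x = \<zero>\<^bsub>matrix_module B N E\<^esub>" by auto
  ultimately show "\<exists>y\<in>carrier (matrix_module B N E). y \<oplus>\<^bsub>matrix_module B N E\<^esub> x = \<zero>\<^bsub>matrix_module B N E\<^esub>" by blast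
 qed (use closed(1) one_mem zero in \<open>auto simp: add.assoc add.commute simp del: matrix_module_simps(1)\<close>)
 then show ?thesis
  using closed(2) unfolding left_module_def
  by (auto simp: distrib_left distrib_right mult.assoc simp del: matrix_module_simps(1))
qed

lemma retract_matrix_module:
 assumes E: "idempotent_matrix B N E"
 shows "retract B (matrix_module B N E) N (\<lambda>x. x) (row_mult N E)"
  "p < N ==> j < N ==> retract_matrix (\<lambda>x. x) (row_mult N E) p j = E p j"
proof -
 show "retract B (matrix_module B N E) N (\<lambda>x. x) (row_mult N E)"
  unfolding retract_def lin_map_def
  using left_module_matrix[OF E] idempotent_row_mult[OF E]
  by (auto simp: row_mult_add row_mult_smult simp del: free_module_simps(1))
 show "p < N ==> j < N ==> retract_matrix (\<lambda>x. x) (row_mult N E) p j = E p j"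
  by (simp add: retract_matrix_def row_mult_unit)
qed

lemma fg_projective_matrix: "idempotent_matrix B N E ==> fg_projective B (matrix_module B N E)"
 using retract_matrix_module(1) fg_projective_retract by blast

lemma fg_projective_iso_matrix:
 assumes "fg_projective B L"
 obtains N E where "idempotent_matrix B N E" "module_iso B L (matrix_module B N E)"
 using assms unfolding fg_projective_retract using retract_idempotent retract_iso by blast

lemma retract_direct_sum:
 assumes r: "retract B L N i q" and r': "retract B L' N' i' q'"
 defines "I \<equiv> \<lambda>(x, y) j. if j < N then i x j else i' y (j - N)"
  and "Q \<equiv> \<lambda>z. (q (\<lambda>j. if j < N then z j else 0), q' (\<lambda>j. if j < N' then z (j + N) else 0))"
 shows "retract B (direct_sum L L') (N + N') I Q"
  "p < N + N' ==> j < N + N' ==> retract_matrix I Q p j =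
   madd (blk 0 N 0 N (retract_matrix i q)) (blk N N' N N' (retract_matrix i' q')) p j"
proof -
 have L: "left_module B L" "left_module B L'" and i: "lin_map B L (free_module B N) i" "lin_map B L' (free_module B N') i'"
  and q: "lin_map B (free_module B N) L q" "lin_map B (free_module B N') L' q'"
  and qi: "\<And>x. x \<in> carrier L ==> q (i x) = x" "\<And>x. x \<in> carrier L' ==> q' (i' x) = x"
  using r r' by (auto simp: retract_def)
 note ic = lin_map_closed[OF i(1)] lin_map_closed[OF i(2)]
 let ?h = "\<lambda>z j. if j < N then z j else 0" and ?t = "\<lambda>z j. if j < N' then z (j + N) else 0"
 have ht: "?h z \<in> carrier (free_module B N)" "?t z \<in> carrier (free_module B N')" if "z \<in> carrier (free_module B (N + N'))" for z
  using that by auto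
 have hadd: "?h (\<lambda>j. z j + z' j) = ?h z \<oplus>\<^bsub>free_module B N\<^esub> ?h z'" "?t (\<lambda>j. z j + z' j) = ?t z \<oplus>\<^bsub>free_module B N'\<^esub> ?t z'"
  and hsm: "?h (\<lambda>j. b * z j) = b \<odot>\<^bsub>free_module B N\<^esub> ?h z" "?t (\<lambda>j. b * z j) = b \<odot>\<^bsub>free_module B N'\<^esub> ?t z" for z z' :: "nat => 'p" and b
  by auto
 show "retract B (direct_sum L L') (N + N') I Q"
  unfolding retract_def
 proof (intro conjI left_module_direct_sum L ballI)
  show "lin_map B (direct_sum L L') (free_module B (N + N')) I"
   unfolding lin_map_def
  proof (intro conjI ballI Pi_I)
   fix z assume "z \<in> carrier (direct_sum L L')"
   then show "I z \<in> carrier (free_module B (N + N'))"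
    using ic by (cases z) (auto simp: I_def)
  next
   fix z z' assume "z \<in> carrier (direct_sum L L')" "z' \<in> carrier (direct_sum L L')"
   then show "I (z \<oplus>\<^bsub>direct_sum L L'\<^esub> z') = I z \<oplus>\<^bsub>free_module B (N + N')\<^esub> I z'"
    by (cases z; cases z') (auto simp: I_def lin_map_add[OF i(1)] lin_map_add[OF i(2)])
  next
   fix b z assume "b \<in> B" "z \<in> carrier (direct_sum L L')"
   then show "I (b \<odot>\<^bsub>direct_sum L L'\<^esub> z) = b \<odot>\<^bsub>free_module B (N + N')\<^esub> I z"
    by (cases z) (auto simp: I_def lin_map_smult[OF i(1)] lin_map_smult[OF i(2)])
  qed
  show "lin_map B (free_module B (N + N')) (direct_sum L L') Q"
   unfolding lin_map_def
  proof (intro conjI ballI Pi_I)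
   fix z assume z: "z \<in> carrier (free_module B (N + N'))"
   show "Q z \<in> carrier (direct_sum L L')"
    using lin_map_closed[OF q(1) ht(1)[OF z]] lin_map_closed[OF q(2) ht(2)[OF z]] by (simp add: Q_def)
   fix z' assume z': "z' \<in> carrier (free_module B (N + N'))"
   show "Q (z \<oplus>\<^bsub>free_module B (N + N')\<^esub> z') = Q z \<oplus>\<^bsub>direct_sum L L'\<^esub> Q z'"
   proof -
    have "Q (z \<oplus>\<^bsub>free_module B (N + N')\<^esub> z') = (q (?h (\<lambda>j. z j + z' j)), q' (?t (\<lambda>j. z j + z' j)))"
     by (simp only: Q_def free_module_simps(2))
    also have "\<dots> = Q z \<oplus>\<^bsub>direct_sum L L'\<^esub> Q z'"
     unfolding hadd lin_map_add[OF q(1) ht(1)[OF z] ht(1)[OF z']] lin_map_add[OF q(2) ht(2)[OF z] ht(2)[OF z']]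
     by (simp add: Q_def)
    finally show ?thesis .
   qed
  next
   fix b z assume b: "b \<in> B" and z: "z \<in> carrier (free_module B (N + N'))"
   show "Q (b \<odot>\<^bsub>free_module B (N + N')\<^esub> z) = b \<odot>\<^bsub>direct_sum L L'\<^esub> Q z"
   proof -
    have "Q (b \<odot>\<^bsub>free_module B (N + N')\<^esub> z) = (q (?h (\<lambda>j. b * z j)), q' (?t (\<lambda>j. b * z j)))"
     by (simp only: Q_def free_module_simps(3))
    also have "\<dots> = b \<odot>\<^bsub>direct_sum L L'\<^esub> Q z"
     unfolding hsm lin_map_smult[OF q(1) b ht(1)[OF z]] lin_map_smult[OF q(2) b ht(2)[OF z]]
     by (simp add: Q_def)
    finally show ?thesis .
   qed
  qed
  fix z assume "z \<in> carrier (direct_sum L L')"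
  then obtain x y where z: "z = (x, y)" "x \<in> carrier L" "y \<in> carrier L'" by (cases z) auto
  have "?h (I (x, y)) = i x" "?t (I (x, y)) = i' y"
   using ic z(2,3) by (auto simp: I_def)
  then show "Q (I z) = z" using qi z by (simp add: Q_def)
 qed
 have q0: "q (\<lambda>j. 0) = \<zero>\<^bsub>L\<^esub>" "q' (\<lambda>j. 0) = \<zero>\<^bsub>L'\<^esub>"
  using lin_map_zero[OF left_module_free L(1) q(1)] lin_map_zero[OF left_module_free L(2) q(2)] by simp_all
 have i0: "i \<zero>\<^bsub>L\<^esub> = (\<lambda>j. 0)" "i' \<zero>\<^bsub>L'\<^esub> = (\<lambda>j. 0)"
  using lin_map_zero[OF L(1) left_module_free i(1)] lin_map_zero[OF L(2) left_module_free i(2)] by simp_all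
 assume pj: "p < N + N'" "j < N + N'"
 show "retract_matrix I Q p j = madd (blk 0 N 0 N (retract_matrix i q)) (blk N N' N N' (retract_matrix i' q')) p j"
 proof (cases "p < N")
  case True
  have "?h (unit_row p) = (unit_row p :: nat => 'p)" "?t (unit_row p) = (\<lambda>j. 0 :: 'p)"
   using True by (auto simp: unit_row_def fun_eq_iff)
  then show ?thesis using True pj by (simp add: retract_matrix_def Q_def I_def q0 i0 madd_def blk_def)
 next
  case False
  have "?h (unit_row p) = (\<lambda>j. 0 :: 'p)" "?t (unit_row p) = (unit_row (p - N) :: nat => 'p)"
   using False pj by (auto simp: unit_row_def fun_eq_iff)
  then show ?thesis using False pj by (simp add: retract_matrix_def Q_def I_def q0 i0 madd_def blk_def)
 qed
qed

lemma idempotent_mats: "idempotent_matrix B N E ==> E \<in> mats N"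
 by (simp add: idempotent_matrix_def mats_def)

lemma idempotent_mmul: "idempotent_matrix B N E ==> i < N ==> j < N ==> mmul N E E i j = E i j"
 by (simp add: idempotent_matrix_def mmul_def)

lemma trace_chain_cycle: "idempotent_matrix B N E ==> trace_chain N E (2 * n) \<in> cycles (2 * n)"
 unfolding trace_chain_eq by (rule trace_cycle) (auto simp: idempotent_mats idempotent_mmul)

text \<open>An isomorphism \<open>R\<^sup>N E \<rightarrow> R\<^sup>N\<^sup>' E'\<close> and its inverse are right multiplications by matrices \<open>X\<close>, \<open>Y\<close>.\<close>

lemma iso_matrix_row:
 assumes E: "idempotent_matrix B N E" and E': "idempotent_matrix B N' E'"
  and f: "lin_map B (matrix_module B N E) (matrix_module B N' E') f"
 defines "X \<equiv> \<lambda>i. f (row_mult N E (unit_row i))"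
 shows "\<And>i. i < N ==> X i \<in> carrier (matrix_module B N' E')"
  and "\<And>i j. i < N ==> j < N' ==> X i j \<in> B"
  and "\<And>x j. x \<in> carrier (matrix_module B N E) ==> (\<Sum>k<N. x k * X k j) = f x j"
  and "\<And>i j. i < N ==> j < N' ==> mmul N E X i j = X i j"
  and "\<And>i j. i < N ==> j < N' ==> mmul N' X E' i j = X i j"
proof -
 note ret = retract_matrix_module(1)[OF E] and ret' = retract_matrix_module(1)[OF E']
 have row: "row_mult N E (unit_row i) \<in> carrier (matrix_module B N E)" if "i < N" for i
  using unit_row_free[OF that] by simp
 show X: "X i \<in> carrier (matrix_module B N' E')" if "i < N" for i
  unfolding X_def by (rule lin_map_closed[OF f row[OF that]])
 have inB: "x \<in> carrier (free_module B N')" "row_mult N' E' x = x" if "x \<in> carrier (matrix_module B N' E')" for x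
  using that idempotent_row_mult[OF E'] by (auto simp del: free_module_simps(1))
 have inB0: "x \<in> carrier (free_module B N)" "row_mult N E x = x" if "x \<in> carrier (matrix_module B N E)" for x
  using that idempotent_row_mult[OF E] by (auto simp del: free_module_simps(1))
 show "X i j \<in> B" if "i < N" "j < N'" for i j
  using inB(1)[OF X[OF that(1)]] that by simp
 have F: "lin_map B (free_module B N) (free_module B N') (\<lambda>x. f (row_mult N E x))"
 proof -
  have inc: "lin_map B (matrix_module B N' E') (free_module B N') (\<lambda>x. x)"
   and pr: "lin_map B (free_module B N) (matrix_module B N E) (row_mult N E)"
   using ret ret' by (simp_all add: retract_def)
  show ?thesis using lin_map_comp[OF pr lin_map_comp[OF f inc]] .
 qed
 show sum: "(\<Sum>k<N. x k * X k j) = f x j" if "x \<in> carrier (matrix_module B N E)" for x j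
  using lin_map_rows[OF F inB0(1)[OF that], of j] inB0(2)[OF that] by (simp add: X_def)
 show "mmul N E X i j = X i j" if "i < N" "j < N'" for i j
  using sum[OF row[OF that(1)], of j] that by (simp add: mmul_def row_mult_unit X_def)
 show "mmul N' X E' i j = X i j" if "i < N" "j < N'" for i j
  using fun_cong[OF inB(2)[OF X[OF that(1)]], of j] that by (simp add: mmul_def row_mult_def)
qed

lemma trace_chain_iso:
 assumes E: "idempotent_matrix B N E" and E': "idempotent_matrix B N' E'"
  and iso: "module_iso B (matrix_module B N E) (matrix_module B N' E')"
 shows "trace_chain N E (2 * n) - trace_chain N' E' (2 * n) \<in> hom_null (2 * n)"
proof -
 obtain f where f: "lin_map B (matrix_module B N E) (matrix_module B N' E') f"
  and bij: "bij_betw f (carrier (matrix_module B N E)) (carrier (matrix_module B N' E'))"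
  using iso unfolding module_iso_def by blast
 define g where "g = the_inv_into (carrier (matrix_module B N E)) f"
 have g: "lin_map B (matrix_module B N' E') (matrix_module B N E) g"
  unfolding g_def by (rule lin_map_inverse[OF left_module_matrix[OF E] f bij])
 have inj: "inj_on f (carrier (matrix_module B N E))" using bij by (simp add: bij_betw_def)
 have gf: "g (f x) = x" if "x \<in> carrier (matrix_module B N E)" for x
  unfolding g_def by (rule the_inv_into_f_f[OF inj that])
 have fg: "f (g x) = x" if "x \<in> carrier (matrix_module B N' E')" for x
  unfolding g_def by (rule f_the_inv_into_f_bij_betw[OF bij]) (use that in auto)
 define X where "X = (\<lambda>i. f (row_mult N E (unit_row i)))"
 define Y where "Y = (\<lambda>i. g (row_mult N' E' (unit_row i)))"
 have Xi: "f (row_mult N E (unit_row i)) = X i" and Yi: "g (row_mult N' E' (unit_row i)) = Y i" for i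
  by (simp_all add: X_def Y_def)
 note x = iso_matrix_row[OF E E' f, unfolded Xi] and y = iso_matrix_row[OF E' E g, unfolded Yi]
 have row: "row_mult N E (unit_row i) \<in> carrier (matrix_module B N E)" if "i < N" for i
  using unit_row_free[OF that] by simp
 have row': "row_mult N' E' (unit_row i) \<in> carrier (matrix_module B N' E')" if "i < N'" for i
  using unit_row_free[OF that] by simp
 have XY: "mmul N' X Y i j = E i j" if "i < N" "j < N" for i j
  using y(3)[OF x(1)[OF that(1)], of j] gf[OF row[OF that(1)], unfolded Xi] that by (simp add: mmul_def row_mult_unit)
 have YX: "mmul N Y X i j = E' i j" if "i < N'" "j < N'" for i j
  using x(3)[OF y(1)[OF that(1)], of j] fg[OF row'[OF that(1)], unfolded Yi] that by (simp add: mmul_def row_mult_unit)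
 show ?thesis
  unfolding trace_chain_eq
  by (rule trace_iso_invariant[of E N E' N' X Y])
   (simp_all add: idempotent_mats idempotent_mmul E E' XY YX x(2,4,5) y(2,4,5))
qed

definition chern_value :: "nat => nat => (nat => nat => 'p) => ('p list \<Rightarrow>\<^sub>0 int) set set set" where
 "chern_value n N E = hcls (2 * n) (trace_chain N E (2 * n)) [^]\<^bsub>HC s B (2 * n)\<^esub> ((- 1) ^ n :: int)"

interpretation HCG: comm_group "HC s B m" for m by (rule comm_group_HC)

lemma hcls_trace_closed: "idempotent_matrix B N E ==> hcls (2 * n) (trace_chain N E (2 * n)) \<in> carrier (HC s B (2 * n))"
 using trace_chain_cycle by (simp add: carrier_HC)

lemma chern_value_closed: "idempotent_matrix B N E ==> chern_value n N E \<in> carrier (HC s B (2 * n))"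
 unfolding chern_value_def by (intro HCG.int_pow_closed hcls_trace_closed)

lemma chern_value_iso:
 assumes "idempotent_matrix B N E" "idempotent_matrix B N' E'" "module_iso B (matrix_module B N E) (matrix_module B N' E')"
 shows "chern_value n N E = chern_value n N' E'"
 using hcls_eq_iff[OF cycles_keys[OF trace_chain_cycle[OF assms(1)]] cycles_keys[OF trace_chain_cycle[OF assms(2)]]]
  trace_chain_iso[OF assms] by (simp add: chern_value_def)

lemma chern_value_sum:
 assumes E: "idempotent_matrix B N E" and E': "idempotent_matrix B N' E'"
  and D: "idempotent_matrix B (N + N') D"
  and DE: "\<And>p j. p < N + N' ==> j < N + N' ==> D p j = madd (blk 0 N 0 N E) (blk N N' N N' E') p j"
 shows "chern_value n (N + N') D = chern_value n N E \<otimes>\<^bsub>HC s B (2 * n)\<^esub> chern_value n N' E'"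
proof -
 have "trace_chain (N + N') D (2 * n) = trace_chain (N + N') (madd (blk 0 N 0 N E) (blk N N' N N' E')) (2 * n)"
  unfolding trace_chain_eq by (rule tr_cong) (auto simp: DE simp del: replicate_Suc)
 then have "trace_chain (N + N') D (2 * n) - (trace_chain N E (2 * n) + trace_chain N' E' (2 * n)) \<in> hom_null (2 * n)"
  unfolding trace_chain_eq
  using tr_block_sum[OF idempotent_mats[OF E] idempotent_mats[OF E'], of "Suc (2 * n)"] by (intro span_hom_null) (simp del: replicate_Suc)
 then have "hcls (2 * n) (trace_chain (N + N') D (2 * n)) = hcls (2 * n) (trace_chain N E (2 * n) + trace_chain N' E' (2 * n))"
  using cycles_keys[OF trace_chain_cycle[OF D]] cycles_keys[OF cycles_add[OF trace_chain_cycle[OF E] trace_chain_cycle[OF E']]]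
  by (simp add: hcls_eq_iff)
 also have "\<dots> = hcls (2 * n) (trace_chain N E (2 * n)) \<otimes>\<^bsub>HC s B (2 * n)\<^esub> hcls (2 * n) (trace_chain N' E' (2 * n))"
  by (rule mult_HC[symmetric]) (rule trace_chain_cycle E E')+
 finally show ?thesis
  unfolding chern_value_def using hcls_trace_closed[OF E] hcls_trace_closed[OF E'] by (simp add: HCG.int_pow_distrib)
qed

lemma proj_class_mem: "fg_projective B L ==> proj_iso_class B L \<in> K0_gens B"
proof -
 assume L: "fg_projective B L"
 obtain N E where NE: "idempotent_matrix B N E" "module_iso B L (matrix_module B N E)"
  using fg_projective_iso_matrix[OF L] .
 have "proj_iso_class B L = proj_iso_class B (matrix_module B N E)"
  using L NE(2) by (intro proj_iso_class_cong) (auto simp: fg_projective_def)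
 then show ?thesis using fg_projective_matrix[OF NE(1)] unfolding K0_gens_def by blast
qed

lemma fg_projective_direct_sum:
 assumes "fg_projective B L" "fg_projective B L'"
 shows "fg_projective B (direct_sum L L')"
 using assms unfolding fg_projective_retract using retract_direct_sum(1) by blast

lemma K0_relE:
 assumes "r \<in> K0_rels B"
 obtains L L' :: "('p, nat => 'p) module" where "fg_projective B L" "fg_projective B L'"
  "r = frag_of (proj_iso_class B (direct_sum L L')) - frag_of (proj_iso_class B L) - frag_of (proj_iso_class B L')"
 using assms unfolding K0_rels_def by blast

lemma presentation_K0: "presentation (K0_gens B) (K0_rels B)"
proof
 fix r assume "r \<in> K0_rels B"
 then obtain L L' :: "('p, nat => 'p) module" where L: "fg_projective B L" "fg_projective B L'"
  and r: "r = frag_of (proj_iso_class B (direct_sum L L')) - frag_of (proj_iso_class B L) - frag_of (proj_iso_class B L')"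
  by (rule K0_relE)
 show "supp r \<subseteq> K0_gens B"
  unfolding r by (intro keys_diff_subset) (simp_all add: proj_class_mem L fg_projective_direct_sum)
qed

text \<open>Any matrix module in the class may be used, by \<open>chern_value_iso\<close>.\<close>

definition chern_gen :: "nat => ('p, nat => 'p) module set => ('p list \<Rightarrow>\<^sub>0 int) set set set" where
 "chern_gen n c = (let (N, E) = SOME (N, E). idempotent_matrix B N E \<and> matrix_module B N E \<in> c in chern_value n N E)"

lemma chern_gen_class:
 assumes L: "left_module B L" and E: "idempotent_matrix B N E" and iso: "module_iso B L (matrix_module B N E)"
 shows "chern_gen n (proj_iso_class B L) = chern_value n N E"
proof -
 define NE where "NE = (SOME (N, E). idempotent_matrix B N E \<and> matrix_module B N E \<in> proj_iso_class B L)"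
 have "case (N, E) of (N, E) => idempotent_matrix B N E \<and> matrix_module B N E \<in> proj_iso_class B L"
  using E iso fg_projective_matrix by (simp add: proj_iso_class_def)
 then have "case NE of (N, E) => idempotent_matrix B N E \<and> matrix_module B N E \<in> proj_iso_class B L"
  unfolding NE_def by (rule someI)
 then obtain N' E' where NE': "NE = (N', E')" "idempotent_matrix B N' E'" "module_iso B L (matrix_module B N' E')"
  by (cases NE) (auto simp: proj_iso_class_def)
 have "chern_gen n (proj_iso_class B L) = chern_value n N' E'"
  by (simp add: chern_gen_def NE_def[symmetric] NE'(1))
 also have "\<dots> = chern_value n N E"
  by (rule chern_value_iso[OF NE'(2) E module_iso_trans[OF module_iso_sym[OF L NE'(3)] iso]])
 finally show ?thesis .
qed

lemma chern_gen_sum: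
 assumes L: "fg_projective B L" and L': "fg_projective B L'"
 shows "chern_gen n (proj_iso_class B (direct_sum L L')) =
  chern_gen n (proj_iso_class B L) \<otimes>\<^bsub>HC s B (2 * n)\<^esub> chern_gen n (proj_iso_class B L')"
proof -
 obtain N i q N' i' q' where r: "retract B L N i q" and r': "retract B L' N' i' q'"
  using L L' unfolding fg_projective_retract by blast
 note ds = retract_direct_sum[OF r r']
 have lm: "left_module B L" "left_module B L'" using L L' by (simp_all add: fg_projective_def)
 show ?thesis
  unfolding chern_gen_class[OF lm(1) retract_idempotent[OF r] retract_iso[OF r]]
   chern_gen_class[OF lm(2) retract_idempotent[OF r'] retract_iso[OF r']]
   chern_gen_class[OF left_module_direct_sum[OF lm] retract_idempotent[OF ds(1)] retract_iso[OF ds(1)]]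
  by (rule chern_value_sum[OF retract_idempotent[OF r] retract_idempotent[OF r'] retract_idempotent[OF ds(1)] ds(2)])
qed

lemma chern_gen_closed: "c \<in> K0_gens B ==> chern_gen n c \<in> carrier (HC s B (2 * n))"
proof -
 assume "c \<in> K0_gens B"
 then obtain L :: "('p, nat => 'p) module" where L: "fg_projective B L" "c = proj_iso_class B L"
  unfolding K0_gens_def by blast
 obtain N E where NE: "idempotent_matrix B N E" "module_iso B L (matrix_module B N E)"
  using fg_projective_iso_matrix[OF L(1)] .
 have "left_module B L" using L(1) by (simp add: fg_projective_def)
 from chern_gen_class[OF this NE] show ?thesis using chern_value_closed[OF NE(1)] L(2) by simp
qed

lemma chern_spec:
 "chern s B n \<in> hom (K0 B) (HC s B (2 * n))"
 "idempotent_matrix B N E ==> chern s B n (K0_class B (matrix_module B N E)) = chern_value n N E"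
proof -
 interpret K: presentation "K0_gens B" "K0_rels B" by (rule presentation_K0)
 let ?G = "HC s B (2 * n)"
 let ?h = "lift_hom ?G (chern_gen n)"
 have f: "chern_gen n \<in> K0_gens B \<rightarrow> carrier ?G" using chern_gen_closed by blast
 have kills: "frag_eval ?G (chern_gen n) r = \<one>\<^bsub>?G\<^esub>" if rr: "r \<in> K0_rels B" for r
 proof -
  obtain L L' :: "('p, nat => 'p) module" where L: "fg_projective B L" "fg_projective B L'"
   and r: "r = frag_of (proj_iso_class B (direct_sum L L')) - frag_of (proj_iso_class B L) - frag_of (proj_iso_class B L')"
   by (rule K0_relE[OF rr])
  show ?thesis unfolding r
   by (intro HCG.frag_eval_triple_one chern_gen_closed proj_class_mem fg_projective_direct_sum L chern_gen_sum)
 qed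
 have hom: "?h \<in> hom (K0 B) ?G"
  unfolding K0_def by (rule K.lift_hom_is_hom[OF comm_group_HC f kills])
 have val: "?h (K0_class B (matrix_module B N E)) = chern_value n N E" if E: "idempotent_matrix B N E" for N E
  unfolding K0_class_def
  using K.lift_hom_gen[OF comm_group_HC f kills proj_class_mem[OF fg_projective_matrix[OF E]]]
   chern_gen_class[OF left_module_matrix[OF E] E module_iso_refl] by simp
 have cv: "chern_value n N E = HC_class s B (2 * n) (power_class (module_of s B) (2 * n + 1) (trace_chain N E (2 * n)))
      [^]\<^bsub>HC s B (2 * n)\<^esub> ((- 1) ^ n :: int)" for N E
  by (simp add: chern_value_def hcls_def)
 have "chern s B n \<in> hom (K0 B) ?G \<and> (\<forall>N E. idempotent_matrix B N E \<longrightarrow>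
    chern s B n (K0_class B (matrix_module B N E)) = chern_value n N E)"
  unfolding chern_def cv[symmetric] by (rule someI[of _ ?h]) (use hom val in blast)
 then show "chern s B n \<in> hom (K0 B) (HC s B (2 * n))"
  "idempotent_matrix B N E ==> chern s B n (K0_class B (matrix_module B N E)) = chern_value n N E" by blast+
qed

end

section \<open>Tensor products\<close>

lemma lin_map_additive: "lin_map R M N f ==> lin_map {} M N f"
 unfolding lin_map_def by auto

lemma lin_map_finsum:
 assumes M: "abelian_group M" and N: "abelian_group N" and f: "lin_map R M N f"
  and g: "g \<in> I \<rightarrow> carrier M" and I: "finite I"
 shows "f (finsum M g I) = (\<Oplus>\<^bsub>N\<^esub>i\<in>I. f (g i))"
proof -
 interpret M: abelian_group M by fact
 interpret N: abelian_group N by fact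
 have f0: "f \<zero>\<^bsub>M\<^esub> = \<zero>\<^bsub>N\<^esub>"
 proof -
  have c: "f \<zero>\<^bsub>M\<^esub> \<in> carrier N" by (rule lin_map_closed[OF f M.zero_closed])
  have "f \<zero>\<^bsub>M\<^esub> \<oplus>\<^bsub>N\<^esub> f \<zero>\<^bsub>M\<^esub> = f \<zero>\<^bsub>M\<^esub>" using lin_map_add[OF f M.zero_closed M.zero_closed] by simp
  then show ?thesis using c by simp
 qed
 show ?thesis
  using I g
 proof (induction I rule: finite_induct)
  case (insert i I)
  then have "g i \<in> carrier M" "g \<in> I \<rightarrow> carrier M" by auto
  moreover have "(\<lambda>i. f (g i)) \<in> I \<rightarrow> carrier N" using lin_map_closed[OF f] insert.prems by auto
  ultimately show ?case
   using insert lin_map_closed[OF f] by (simp add: lin_map_add[OF f])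
 qed (simp add: f0)
qed

lemma finsum_module_of:
 assumes "abelian_group (module_of s A)" "finite I" "\<And>i. i \<in> I ==> f i \<in> A"
 shows "(\<Oplus>\<^bsub>module_of s A\<^esub>i\<in>I. f i) = sum f I"
proof -
 interpret abelian_group "module_of s A" by fact
 show ?thesis using assms(2,3)
 proof (induction I rule: finite_induct)
  case (insert i I)
  then show ?case by (subst finsum_insert) auto
 qed simp
qed

lemma ground_space_simps [simp]:
 "carrier ground_space = UNIV" "x \<oplus>\<^bsub>ground_space\<^esub> y = x + y" "r \<odot>\<^bsub>ground_space\<^esub> x = r * x"
 by (simp_all add: ground_space_def)

lemma lift_hom_cong_group:
 assumes eq: "carrier G = carrier G'" "monoid.mult G = monoid.mult G'" "\<one>\<^bsub>G\<^esub> = \<one>\<^bsub>G'\<^esub>"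
 shows "lift_hom G f A = lift_hom G' f A"
proof -
 have e: "m_inv G = m_inv G'" by (rule ext) (simp add: m_inv_def eq)
 show ?thesis by (simp add: lift_hom_def finprod_def int_pow_def nat_pow_def eq e cong: if_cong)
qed

text \<open>The hypotheses under which \<open>V \<otimes>\<^sub>R W\<close> is a quotient by relations between existing elements.\<close>

locale tensor_data =
 fixes R :: "'r set" and V :: "('k, 'a, 'y) module_scheme" and \<rho> :: "'a => 'r => 'a"
  and W :: "('k, 'b, 'z) module_scheme" and lam :: "'r => 'b => 'b"
 assumes V: "abelian_group V" and W: "abelian_group W"
  and \<rho>: "x \<in> carrier V ==> r \<in> R ==> \<rho> x r \<in> carrier V"
  and lam: "y \<in> carrier W ==> r \<in> R ==> lam r y \<in> carrier W"
begin

abbreviation "T \<equiv> tensor_over R V \<rho> W lam"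

abbreviation "pr \<equiv> pure_over R V \<rho> W lam"

sublocale V: abelian_group V by (rule V)

sublocale W: abelian_group W by (rule W)

sublocale pres: presentation "carrier V \<times> carrier W" "balanced_rel R V \<rho> W lam"
proof
 fix r assume "r \<in> balanced_rel R V \<rho> W lam"
 then consider x x' y where "x \<in> carrier V" "x' \<in> carrier V" "y \<in> carrier W"
   "r = frag_of (x \<oplus>\<^bsub>V\<^esub> x', y) - frag_of (x, y) - frag_of (x', y)"
  | x y y' where "x \<in> carrier V" "y \<in> carrier W" "y' \<in> carrier W"
   "r = frag_of (x, y \<oplus>\<^bsub>W\<^esub> y') - frag_of (x, y) - frag_of (x, y')"
  | x b y where "x \<in> carrier V" "b \<in> R" "y \<in> carrier W" "r = frag_of (\<rho> x b, y) - frag_of (x, lam b y)"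
  unfolding balanced_rel_def by auto
 then show "supp r \<subseteq> carrier V \<times> carrier W"
  by cases (simp_all add: keys_diff_subset \<rho> lam)
qed

abbreviation "Q \<equiv> presented_group (carrier V \<times> carrier W) (balanced_rel R V \<rho> W lam)"

lemma T_fields: "carrier T = carrier Q" "add T = monoid.mult Q" "\<zero>\<^bsub>T\<^esub> = \<one>\<^bsub>Q\<^esub>"
 by (simp_all add: tensor_over_def Let_def)

lemma abelian_T: "abelian_group T"
proof (rule abelian_groupI)
 fix x assume x: "x \<in> carrier T"
 then show "\<exists>y\<in>carrier T. y \<oplus>\<^bsub>T\<^esub> x = \<zero>\<^bsub>T\<^esub>"
  by (intro bexI[of _ "inv\<^bsub>Q\<^esub> x"]) (simp_all add: T_fields)
qed (simp_all add: T_fields pres.Q.m_ac)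

lemma minus_T: "\<ominus>\<^bsub>T\<^esub> x = inv\<^bsub>Q\<^esub> x"
 by (simp add: a_inv_def m_inv_def T_fields)

lemma lift_hom_T: "lift_hom Q f A = tensor_lift T f A"
 by (rule lift_hom_cong_group) (simp_all add: T_fields)

sublocale T: abelian_group T by (rule abelian_T)

lemma pure_closed: "x \<in> carrier V ==> y \<in> carrier W ==> pr x y \<in> carrier T"
 unfolding T_fields pure_over_def by (rule pres.class_closed) simp

lemma add_class:
 "supp a \<subseteq> carrier V \<times> carrier W ==> supp b \<subseteq> carrier V \<times> carrier W ==>
  presented_class (carrier V \<times> carrier W) (balanced_rel R V \<rho> W lam) a \<oplus>\<^bsub>T\<^esub>
  presented_class (carrier V \<times> carrier W) (balanced_rel R V \<rho> W lam) b =
  presented_class (carrier V \<times> carrier W) (balanced_rel R V \<rho> W lam) (a + b)"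
 using pres.mult_class[of a b] by (simp add: T_fields)

lemma pure_add_left:
 assumes "x \<in> carrier V" "x' \<in> carrier V" "y \<in> carrier W"
 shows "pr (x \<oplus>\<^bsub>V\<^esub> x') y = pr x y \<oplus>\<^bsub>T\<^esub> pr x' y"
proof -
 have "frag_of (x \<oplus>\<^bsub>V\<^esub> x', y) - frag_of (x, y) - frag_of (x', y) \<in> balanced_rel R V \<rho> W lam"
  unfolding balanced_rel_def using assms by blast
 from pres.rspan_gen[OF this] show ?thesis
  unfolding pure_over_def using assms by (subst add_class) (simp_all add: pres.class_eq_iff algebra_simps)
qed

lemma pure_add_right:
 assumes "x \<in> carrier V" "y \<in> carrier W" "y' \<in> carrier W"
 shows "pr x (y \<oplus>\<^bsub>W\<^esub> y') = pr x y \<oplus>\<^bsub>T\<^esub> pr x y'"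
proof -
 have "frag_of (x, y \<oplus>\<^bsub>W\<^esub> y') - frag_of (x, y) - frag_of (x, y') \<in> balanced_rel R V \<rho> W lam"
  unfolding balanced_rel_def using assms by blast
 from pres.rspan_gen[OF this] show ?thesis
  unfolding pure_over_def using assms by (subst add_class) (simp_all add: pres.class_eq_iff algebra_simps)
qed

lemma pure_balanced:
 assumes "x \<in> carrier V" "b \<in> R" "y \<in> carrier W"
 shows "pr (\<rho> x b) y = pr x (lam b y)"
proof -
 have "frag_of (\<rho> x b, y) - frag_of (x, lam b y) \<in> balanced_rel R V \<rho> W lam"
  unfolding balanced_rel_def using assms by blast
 from pres.rspan_gen[OF this] show ?thesis by (simp add: pure_over_def pres.class_eq_iff)
qed

lemma pure_lin_left: "y \<in> carrier W ==> lin_map {} V T (\<lambda>x. pr x y)"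
 by (auto simp: lin_map_def pure_closed pure_add_left)

lemma pure_lin_right: "x \<in> carrier V ==> lin_map {} W T (\<lambda>y. pr x y)"
 by (auto simp: lin_map_def pure_closed pure_add_right)

lemma pure_finsum_left:
 "finite I ==> f \<in> I \<rightarrow> carrier V ==> y \<in> carrier W ==> pr (finsum V f I) y = (\<Oplus>\<^bsub>T\<^esub>i\<in>I. pr (f i) y)"
 by (rule lin_map_finsum[OF V abelian_T pure_lin_left])

lemma pure_finsum_right:
 "finite I ==> f \<in> I \<rightarrow> carrier W ==> x \<in> carrier V ==> pr x (finsum W f I) = (\<Oplus>\<^bsub>T\<^esub>i\<in>I. pr x (f i))"
 by (rule lin_map_finsum[OF W abelian_T pure_lin_right])

lemma pure_zero_left: "y \<in> carrier W ==> pr \<zero>\<^bsub>V\<^esub> y = \<zero>\<^bsub>T\<^esub>"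
 using pure_finsum_left[of "{}"] by simp

lemma pure_zero_right: "x \<in> carrier V ==> pr x \<zero>\<^bsub>W\<^esub> = \<zero>\<^bsub>T\<^esub>"
 using pure_finsum_right[of "{}"] by simp

lemma pure_neg: "x \<in> carrier V ==> y \<in> carrier W ==> \<ominus>\<^bsub>T\<^esub> pr x y = pr (\<ominus>\<^bsub>V\<^esub> x) y"
 by (rule T.minus_equality) (auto simp: pure_add_left[symmetric] V.l_neg pure_zero_left pure_closed)

text \<open>A negative of a pure tensor is a pure tensor, so sums of pure tensors exhaust the product.\<close>

lemma tensor_induct [consumes 1, case_names pure add]:
 assumes X: "X \<in> carrier T" and pure: "\<And>x y. x \<in> carrier V ==> y \<in> carrier W ==> P (pr x y)"
  and add: "\<And>X Y. X \<in> carrier T ==> Y \<in> carrier T ==> P X ==> P Y ==> P (X \<oplus>\<^bsub>T\<^esub> Y)"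
 shows "P X"
proof -
 have zero: "P \<zero>\<^bsub>T\<^esub>" using pure[OF V.zero_closed W.zero_closed] by (simp add: pure_zero_left)
 from X have "P X \<and> P (\<ominus>\<^bsub>T\<^esub> X)"
  unfolding T_fields(1)
 proof (induction rule: pres.presented_induct)
  case zero
  then show ?case
   using \<open>P \<zero>\<^bsub>T\<^esub>\<close> T.minus_equality[of "\<zero>\<^bsub>T\<^esub>" "\<zero>\<^bsub>T\<^esub>"] T.zero_closed by (simp add: T_fields(3))
 next
  case (gen z)
  then obtain x y where z: "z = (x, y)" "x \<in> carrier V" "y \<in> carrier W" by (cases z) auto
  then show ?case using pure pure_neg[OF z(2,3)] by (simp add: pure_over_def[symmetric])
 next
  case (diff X Y)
  then have c: "X \<in> carrier T" "Y \<in> carrier T" by (simp_all add: T_fields)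
  have "X \<otimes>\<^bsub>Q\<^esub> inv\<^bsub>Q\<^esub> Y = X \<oplus>\<^bsub>T\<^esub> \<ominus>\<^bsub>T\<^esub> Y"
   by (simp add: T_fields minus_T)
  moreover have "\<ominus>\<^bsub>T\<^esub> (X \<oplus>\<^bsub>T\<^esub> \<ominus>\<^bsub>T\<^esub> Y) = \<ominus>\<^bsub>T\<^esub> X \<oplus>\<^bsub>T\<^esub> Y"
   using c by (simp add: T.minus_add)
  ultimately show ?case using diff c add[of X "\<ominus>\<^bsub>T\<^esub> Y"] add[of "\<ominus>\<^bsub>T\<^esub> X" Y] by simp
 qed
 then show ?thesis ..
qed

lemma additive_eqI:
 assumes "lin_map A T G h" "lin_map A' T G h'"
  and "\<And>x y. x \<in> carrier V ==> y \<in> carrier W ==> h (pr x y) = h' (pr x y)" and X: "X \<in> carrier T"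
 shows "h X = h' X"
 using X by (induction rule: tensor_induct) (simp_all add: assms lin_map_add[OF assms(1)] lin_map_add[OF assms(2)])

text \<open>A biadditive balanced map kills the defining relations, so it factors through \<open>V \<otimes>\<^sub>R W\<close>.\<close>

lemma
 assumes G: "abelian_group G"
  and closed: "\<And>x y. x \<in> carrier V ==> y \<in> carrier W ==> f x y \<in> carrier G"
  and addl: "\<And>x x' y. x \<in> carrier V ==> x' \<in> carrier V ==> y \<in> carrier W ==> f (x \<oplus>\<^bsub>V\<^esub> x') y = f x y \<oplus>\<^bsub>G\<^esub> f x' y"
  and addr: "\<And>x y y'. x \<in> carrier V ==> y \<in> carrier W ==> y' \<in> carrier W ==> f x (y \<oplus>\<^bsub>W\<^esub> y') = f x y \<oplus>\<^bsub>G\<^esub> f x y'"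
  and bal: "\<And>x r y. x \<in> carrier V ==> r \<in> R ==> y \<in> carrier W ==> f (\<rho> x r) y = f x (lam r y)"
 shows tensor_lift_additive: "lin_map {} T G (tensor_lift G (\<lambda>(x, y). f x y))"
  and tensor_lift_pure: "\<And>x y. x \<in> carrier V ==> y \<in> carrier W ==> tensor_lift G (\<lambda>(x, y). f x y) (pr x y) = f x y"
proof -
 interpret G: abelian_group G by (rule G)
 have cg: "comm_group (add_monoid G)" by (rule G.a_comm_group)
 have fc: "(\<lambda>(x, y). f x y) \<in> carrier V \<times> carrier W \<rightarrow> carrier (add_monoid G)" using closed by auto
 have kills: "frag_eval (add_monoid G) (\<lambda>(x, y). f x y) r = \<one>\<^bsub>add_monoid G\<^esub>" if "r \<in> balanced_rel R V \<rho> W lam" for r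
 proof -
  from that consider x x' y where "x \<in> carrier V" "x' \<in> carrier V" "y \<in> carrier W"
    "r = frag_of (x \<oplus>\<^bsub>V\<^esub> x', y) - frag_of (x, y) - frag_of (x', y)"
   | x y y' where "x \<in> carrier V" "y \<in> carrier W" "y' \<in> carrier W"
    "r = frag_of (x, y \<oplus>\<^bsub>W\<^esub> y') - frag_of (x, y) - frag_of (x, y')"
   | x b y where "x \<in> carrier V" "b \<in> R" "y \<in> carrier W" "r = frag_of (\<rho> x b, y) - frag_of (x, lam b y)"
   unfolding balanced_rel_def by auto
  then show ?thesis
  proof cases
   case 1
   show ?thesis unfolding 1(4) by (rule comm_group.frag_eval_triple_one[OF cg]) (simp_all add: 1 closed addl)
  next
   case 2
   show ?thesis unfolding 2(4) by (rule comm_group.frag_eval_triple_one[OF cg]) (simp_all add: 2 closed addr)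
  next
   case 3
   show ?thesis unfolding 3(4) by (rule comm_group.frag_eval_pair_one[OF cg]) (simp_all add: 3 closed bal \<rho> lam)
  qed
 qed
 show "lin_map {} T G (tensor_lift G (\<lambda>(x, y). f x y))"
  using pres.lift_hom_is_hom[OF cg fc kills] by (auto simp: lin_map_def hom_def T_fields)
 show "tensor_lift G (\<lambda>(x, y). f x y) (pr x y) = f x y" if "x \<in> carrier V" "y \<in> carrier W" for x y
  using pres.lift_hom_gen[OF cg fc kills, of "(x, y)"] that by (simp add: pure_over_def)
qed

end

lemma smult_linear:
 fixes V :: "('k::field, 'a, 'v) module_scheme"
 assumes "left_module UNIV V"
 shows "lin_map UNIV V V ((\<odot>\<^bsub>V\<^esub>) r)" "x \<in> carrier V ==> lin_map UNIV ground_space V (\<lambda>r. r \<odot>\<^bsub>V\<^esub> x)"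
proof -
 have "r \<odot>\<^bsub>V\<^esub> (a \<odot>\<^bsub>V\<^esub> x) = a \<odot>\<^bsub>V\<^esub> (r \<odot>\<^bsub>V\<^esub> x)" if "x \<in> carrier V" for a x
  using assms that unfolding left_module_def by (metis UNIV_I mult.commute)
 then show "lin_map UNIV V V ((\<odot>\<^bsub>V\<^esub>) r)"
  using assms unfolding lin_map_def left_module_def by auto
 show "x \<in> carrier V ==> lin_map UNIV ground_space V (\<lambda>r. r \<odot>\<^bsub>V\<^esub> x)"
  using assms unfolding lin_map_def left_module_def by auto
qed

lemma tensor_data_field:
 assumes "left_module UNIV V" "left_module UNIV W"
 shows "tensor_data UNIV V (\<lambda>x r. r \<odot>\<^bsub>V\<^esub> x) W (\<lambda>r y. r \<odot>\<^bsub>W\<^esub> y)"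
 using assms by (intro tensor_data.intro) (auto simp: left_module_def)

definition bilinear ::
 "('k::field, 'a, 'x) module_scheme => ('k, 'b, 'y) module_scheme => ('k, 'g, 'z) module_scheme => ('a => 'b => 'g) => bool" where
 "bilinear V W G f \<longleftrightarrow> (\<forall>x\<in>carrier V. lin_map UNIV W G (f x)) \<and> (\<forall>y\<in>carrier W. lin_map UNIV V G (\<lambda>x. f x y))"

locale tensor_field =
 fixes V :: "('k::field, 'a, 'y) module_scheme" and W :: "('k, 'b, 'z) module_scheme"
 assumes Vm: "left_module UNIV V" and Wm: "left_module UNIV W"
begin

sublocale tensor_data UNIV V "\<lambda>x r. r \<odot>\<^bsub>V\<^esub> x" W "\<lambda>r y. r \<odot>\<^bsub>W\<^esub> y"
 by (rule tensor_data_field[OF Vm Wm])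

lemma Vsmult: "x \<in> carrier V ==> r \<odot>\<^bsub>V\<^esub> x \<in> carrier V"
 by (rule left_module_smult_closed[OF Vm UNIV_I])

lemma Wsmult: "y \<in> carrier W ==> r \<odot>\<^bsub>W\<^esub> y \<in> carrier W"
 by (rule left_module_smult_closed[OF Wm UNIV_I])

lemma smult_T: "smult T r = tensor_lift T (\<lambda>(x, y). pr (r \<odot>\<^bsub>V\<^esub> x) y)"
 unfolding lift_hom_T[symmetric] by (simp add: tensor_over_def Let_def)

lemma
 shows smult_additive: "lin_map {} T T (smult T r)"
  and smult_pure: "\<And>x y. x \<in> carrier V ==> y \<in> carrier W ==> r \<odot>\<^bsub>T\<^esub> pr x y = pr (r \<odot>\<^bsub>V\<^esub> x) y"
proof -
 have comm: "r \<odot>\<^bsub>V\<^esub> (a \<odot>\<^bsub>V\<^esub> x) = a \<odot>\<^bsub>V\<^esub> (r \<odot>\<^bsub>V\<^esub> x)" if "x \<in> carrier V" for a x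
  using Vm that unfolding left_module_def by (metis UNIV_I mult.commute)
 have dist: "r \<odot>\<^bsub>V\<^esub> (x \<oplus>\<^bsub>V\<^esub> x') = r \<odot>\<^bsub>V\<^esub> x \<oplus>\<^bsub>V\<^esub> r \<odot>\<^bsub>V\<^esub> x'" if "x \<in> carrier V" "x' \<in> carrier V" for x x'
  using Vm that unfolding left_module_def by blast
 show "lin_map {} T T (smult T r)"
  unfolding smult_T
  by (rule tensor_lift_additive[OF abelian_T])
   (simp_all add: pure_closed Vsmult Wsmult dist pure_add_left pure_add_right comm pure_balanced)
 show "r \<odot>\<^bsub>T\<^esub> pr x y = pr (r \<odot>\<^bsub>V\<^esub> x) y" if "x \<in> carrier V" "y \<in> carrier W" for x y
  unfolding smult_T
  by (rule tensor_lift_pure[OF abelian_T])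
   (simp_all add: pure_closed Vsmult Wsmult dist pure_add_left pure_add_right comm pure_balanced that)
qed

lemma smult_pure_right: "x \<in> carrier V ==> y \<in> carrier W ==> r \<odot>\<^bsub>T\<^esub> pr x y = pr x (r \<odot>\<^bsub>W\<^esub> y)"
 by (simp add: smult_pure pure_balanced)

lemma left_module_T: "left_module UNIV T"
 unfolding left_module_def
proof (intro conjI ballI abelian_T)
 fix r :: 'k and X assume X: "X \<in> carrier T"
 show "r \<odot>\<^bsub>T\<^esub> X \<in> carrier T" by (rule lin_map_closed[OF smult_additive X])
 show "r \<odot>\<^bsub>T\<^esub> (X \<oplus>\<^bsub>T\<^esub> Y) = r \<odot>\<^bsub>T\<^esub> X \<oplus>\<^bsub>T\<^esub> r \<odot>\<^bsub>T\<^esub> Y" if "Y \<in> carrier T" for Y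
  by (rule lin_map_add[OF smult_additive X that])
 fix a :: 'k
 have c: "b \<odot>\<^bsub>T\<^esub> Y \<in> carrier T" if "Y \<in> carrier T" for b Y by (rule lin_map_closed[OF smult_additive that])
 have "lin_map {} T T (\<lambda>X. r \<odot>\<^bsub>T\<^esub> X \<oplus>\<^bsub>T\<^esub> a \<odot>\<^bsub>T\<^esub> X)"
  by (auto simp: lin_map_def c lin_map_add[OF smult_additive] T.a_ac)
 then show "(r + a) \<odot>\<^bsub>T\<^esub> X = r \<odot>\<^bsub>T\<^esub> X \<oplus>\<^bsub>T\<^esub> a \<odot>\<^bsub>T\<^esub> X"
 proof (rule additive_eqI[OF smult_additive _ _ X])
  fix x y assume xy: "x \<in> carrier V" "y \<in> carrier W"
  then have "(r + a) \<odot>\<^bsub>V\<^esub> x = r \<odot>\<^bsub>V\<^esub> x \<oplus>\<^bsub>V\<^esub> a \<odot>\<^bsub>V\<^esub> x" using Vm unfolding left_module_def by blast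
  then show "(r + a) \<odot>\<^bsub>T\<^esub> pr x y = r \<odot>\<^bsub>T\<^esub> pr x y \<oplus>\<^bsub>T\<^esub> a \<odot>\<^bsub>T\<^esub> pr x y"
   using xy by (simp add: smult_pure pure_add_left Vsmult)
 qed
 show "(r * a) \<odot>\<^bsub>T\<^esub> X = r \<odot>\<^bsub>T\<^esub> (a \<odot>\<^bsub>T\<^esub> X)"
 proof (rule additive_eqI[OF smult_additive lin_map_comp[OF smult_additive smult_additive] _ X])
  fix x y assume xy: "x \<in> carrier V" "y \<in> carrier W"
  then have "(r * a) \<odot>\<^bsub>V\<^esub> x = r \<odot>\<^bsub>V\<^esub> (a \<odot>\<^bsub>V\<^esub> x)" using Vm unfolding left_module_def by blast
  then show "(r * a) \<odot>\<^bsub>T\<^esub> pr x y = r \<odot>\<^bsub>T\<^esub> (a \<odot>\<^bsub>T\<^esub> pr x y)" using xy by (simp add: smult_pure Vsmult)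
 qed
next
 fix X assume X: "X \<in> carrier T"
 show "1 \<odot>\<^bsub>T\<^esub> X = X"
 proof (rule additive_eqI[OF smult_additive lin_map_id _ X])
  fix x y assume xy: "x \<in> carrier V" "y \<in> carrier W"
  then have "1 \<odot>\<^bsub>V\<^esub> x = x" using Vm unfolding left_module_def by blast
  then show "1 \<odot>\<^bsub>T\<^esub> pr x y = pr x y" using xy by (simp add: smult_pure)
 qed
qed

lemma bilinear_pure: "bilinear V W T pr"
 by (auto simp: bilinear_def lin_map_def pure_closed pure_add_left pure_add_right smult_pure smult_pure_right[symmetric])

lemma pure_linear_right: "x \<in> carrier V ==> lin_map UNIV W T (\<lambda>y. pr x y)"
 and pure_linear_left: "y \<in> carrier W ==> lin_map UNIV V T (\<lambda>x. pr x y)"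
 using bilinear_pure by (simp_all add: bilinear_def)

lemma
 assumes G: "left_module UNIV G" and f: "bilinear V W G f"
 shows tensor_lift_linear: "lin_map UNIV T G (tensor_lift G (\<lambda>(x, y). f x y))"
  and lift_pure: "\<And>x y. x \<in> carrier V ==> y \<in> carrier W ==> tensor_lift G (\<lambda>(x, y). f x y) (pr x y) = f x y"
proof -
 have Ga: "abelian_group G" by (rule left_module_group[OF G])
 have fl: "\<And>x. x \<in> carrier V ==> lin_map UNIV W G (f x)" and fr: "\<And>y. y \<in> carrier W ==> lin_map UNIV V G (\<lambda>x. f x y)"
  using f by (auto simp: bilinear_def)
 have closed: "f x y \<in> carrier G" if "x \<in> carrier V" "y \<in> carrier W" for x y
  by (rule lin_map_closed[OF fl]) (use that in auto)
 have addl: "f (x \<oplus>\<^bsub>V\<^esub> x') y = f x y \<oplus>\<^bsub>G\<^esub> f x' y" if "x \<in> carrier V" "x' \<in> carrier V" "y \<in> carrier W" for x x' y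
  by (rule lin_map_add[OF fr]) (use that in auto)
 have addr: "f x (y \<oplus>\<^bsub>W\<^esub> y') = f x y \<oplus>\<^bsub>G\<^esub> f x y'" if "x \<in> carrier V" "y \<in> carrier W" "y' \<in> carrier W" for x y y'
  by (rule lin_map_add[OF fl]) (use that in auto)
 have sml: "f (r \<odot>\<^bsub>V\<^esub> x) y = r \<odot>\<^bsub>G\<^esub> f x y" if "x \<in> carrier V" "y \<in> carrier W" for r x y
  by (rule lin_map_smult[OF fr]) (use that in auto)
 have smr: "f x (r \<odot>\<^bsub>W\<^esub> y) = r \<odot>\<^bsub>G\<^esub> f x y" if "x \<in> carrier V" "y \<in> carrier W" for r x y
  by (rule lin_map_smult[OF fl]) (use that in auto)
 have bal: "f (r \<odot>\<^bsub>V\<^esub> x) y = f x (r \<odot>\<^bsub>W\<^esub> y)" if "x \<in> carrier V" "y \<in> carrier W" for r x y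
  by (simp add: sml[OF that] smr[OF that])
 let ?h = "tensor_lift G (\<lambda>(x, y). f x y)"
 have h: "lin_map {} T G ?h" by (rule tensor_lift_additive[OF Ga closed addl addr bal])
 have hp: "?h (pr x y) = f x y" if "x \<in> carrier V" "y \<in> carrier W" for x y
  by (rule tensor_lift_pure[OF Ga closed addl addr bal that])
 show "?h (pr x y) = f x y" if "x \<in> carrier V" "y \<in> carrier W" for x y by (rule hp[OF that])
 have "?h (r \<odot>\<^bsub>T\<^esub> X) = r \<odot>\<^bsub>G\<^esub> ?h X" if X: "X \<in> carrier T" for r X
 proof (rule additive_eqI[OF lin_map_comp[OF smult_additive h] lin_map_comp[OF h] _ X])
  show "lin_map {} G G ((\<odot>\<^bsub>G\<^esub>) r)" using G by (auto simp: lin_map_def left_module_def)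
  show "?h (r \<odot>\<^bsub>T\<^esub> pr x y) = r \<odot>\<^bsub>G\<^esub> ?h (pr x y)" if "x \<in> carrier V" "y \<in> carrier W" for x y
   using that by (simp add: smult_pure hp Vsmult sml)
 qed
 then show "lin_map UNIV T G ?h" using h by (auto simp: lin_map_def)
qed

end

lemma
 fixes V :: "('k::field, 'a, 'v) module_scheme" and W :: "('k, 'b, 'w) module_scheme"
  and V' :: "('k, 'c, 'x) module_scheme" and W' :: "('k, 'd, 'y) module_scheme"
 assumes m: "left_module UNIV V" "left_module UNIV W" "left_module UNIV V'" "left_module UNIV W'"
  and f: "lin_map UNIV V V' f" and h: "lin_map UNIV W W' h"
 shows tensor_map_linear: "lin_map UNIV (tensor V W) (tensor V' W') (tensor_map V' W' f h)"
  and tensor_map_pure: "\<And>x y. x \<in> carrier V ==> y \<in> carrier W ==> tensor_map V' W' f h (pure V W x y) = pure V' W' (f x) (h y)"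
proof -
 interpret T: tensor_field V W by unfold_locales (rule m)+
 interpret T': tensor_field V' W' by unfold_locales (rule m)+
 have "bilinear V W (tensor V' W') (\<lambda>x y. pure V' W' (f x) (h y))"
  unfolding bilinear_def
 proof (intro conjI ballI)
  show "lin_map UNIV W (tensor V' W') (\<lambda>y. pure V' W' (f x) (h y))" if "x \<in> carrier V" for x
   by (rule lin_map_comp[OF h T'.pure_linear_right[OF lin_map_closed[OF f that]]])
  show "lin_map UNIV V (tensor V' W') (\<lambda>x. pure V' W' (f x) (h y))" if "y \<in> carrier W" for y
   by (rule lin_map_comp[OF f T'.pure_linear_left[OF lin_map_closed[OF h that]]])
 qed
 from T.tensor_lift_linear[OF T'.left_module_T this] T.lift_pure[OF T'.left_module_T this]
 show "lin_map UNIV (tensor V W) (tensor V' W') (tensor_map V' W' f h)"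
  "\<And>x y. x \<in> carrier V ==> y \<in> carrier W ==> tensor_map V' W' f h (pure V W x y) = pure V' W' (f x) (h y)"
  unfolding tensor_map_def by simp_all
qed

lemma
 fixes U :: "('k::field, 'a, 'v) module_scheme" and V :: "('k, 'b, 'w) module_scheme" and W :: "('k, 'c, 'x) module_scheme"
 assumes m: "left_module UNIV U" "left_module UNIV V" "left_module UNIV W"
 shows tensor_assoc_linear: "lin_map UNIV (tensor (tensor U V) W) (tensor U (tensor V W)) (tensor_assoc U V W)"
  and tensor_assoc_pure: "\<And>u v w. u \<in> carrier U ==> v \<in> carrier V ==> w \<in> carrier W ==>
   tensor_assoc U V W (pure (tensor U V) W (pure U V u v) w) = pure U (tensor V W) u (pure V W v w)"
proof -
 interpret UV: tensor_field U V by unfold_locales (rule m)+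
 interpret VW: tensor_field V W by unfold_locales (rule m)+
 interpret UVW: tensor_field U "tensor V W" by unfold_locales (rule m VW.left_module_T)+
 interpret UV_W: tensor_field "tensor U V" W by unfold_locales (rule m UV.left_module_T)+
 let ?T = "tensor U (tensor V W)"
 define f where "f = (\<lambda>A w. tensor_lift ?T (\<lambda>(u, v). pure U (tensor V W) u (pure V W v w)) A)"
 have b: "bilinear U V ?T (\<lambda>u v. pure U (tensor V W) u (pure V W v w))" if w: "w \<in> carrier W" for w
  unfolding bilinear_def
 proof (intro conjI ballI)
  show "lin_map UNIV V ?T (\<lambda>v. pure U (tensor V W) u (pure V W v w))" if "u \<in> carrier U" for u
   by (rule lin_map_comp[OF VW.pure_linear_left[OF w] UVW.pure_linear_right[OF that]])
  show "lin_map UNIV U ?T (\<lambda>u. pure U (tensor V W) u (pure V W v w))" if "v \<in> carrier V" for v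
   by (rule UVW.pure_linear_left[OF VW.pure_closed[OF that w]])
 qed
 have fl: "lin_map UNIV (tensor U V) ?T (\<lambda>A. f A w)" if "w \<in> carrier W" for w
  unfolding f_def by (rule UV.tensor_lift_linear[OF UVW.left_module_T b[OF that]])
 have fp: "f (pure U V u v) w = pure U (tensor V W) u (pure V W v w)" if "u \<in> carrier U" "v \<in> carrier V" "w \<in> carrier W" for u v w
  unfolding f_def by (rule UV.lift_pure[OF UVW.left_module_T b[OF that(3)] that(1,2)])
 have fc: "f A w \<in> carrier ?T" if "A \<in> carrier (tensor U V)" "w \<in> carrier W" for A w
  by (rule lin_map_closed[OF fl]) (use that in auto)
 have fr: "lin_map UNIV W ?T (f A)" if A: "A \<in> carrier (tensor U V)" for A
  unfolding lin_map_def
 proof (intro conjI ballI Pi_I)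
  show "f A w \<in> carrier ?T" if "w \<in> carrier W" for w by (rule fc[OF A that])
  fix w w' assume w: "w \<in> carrier W" "w' \<in> carrier W"
  have "lin_map {} (tensor U V) ?T (\<lambda>A. f A w \<oplus>\<^bsub>?T\<^esub> f A w')"
   using fc w by (auto simp: lin_map_def lin_map_add[OF fl] UVW.T.a_ac)
  then show "f A (w \<oplus>\<^bsub>W\<^esub> w') = f A w \<oplus>\<^bsub>?T\<^esub> f A w'"
   by (rule UV.additive_eqI[OF fl[OF VW.W.a_closed[OF w]] _ _ A])
    (use w in \<open>simp_all add: fp VW.pure_add_right UVW.pure_add_right VW.pure_closed\<close>)
 next
  fix r :: 'k and w assume w: "w \<in> carrier W"
  from lin_map_comp[OF fl[OF w] smult_linear(1)[OF UVW.left_module_T, of r]]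
  show "f A (r \<odot>\<^bsub>W\<^esub> w) = r \<odot>\<^bsub>?T\<^esub> f A w"
   by (rule UV.additive_eqI[OF fl[OF VW.Wsmult[OF w]] _ _ A])
    (use w in \<open>simp_all add: fp VW.Wsmult VW.smult_pure_right[symmetric] UVW.smult_pure_right VW.pure_closed\<close>)
 qed
 have "bilinear (tensor U V) W ?T f" unfolding bilinear_def using fl fr by blast
 from UV_W.tensor_lift_linear[OF UVW.left_module_T this] UV_W.lift_pure[OF UVW.left_module_T this]
 have l: "lin_map UNIV (tensor (tensor U V) W) ?T (tensor_assoc U V W)"
  and p: "\<And>A w. A \<in> carrier (tensor U V) ==> w \<in> carrier W ==> tensor_assoc U V W (pure (tensor U V) W A w) = f A w"
  unfolding tensor_assoc_def Let_def f_def by simp_all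
 show "lin_map UNIV (tensor (tensor U V) W) ?T (tensor_assoc U V W)" by (rule l)
 show "tensor_assoc U V W (pure (tensor U V) W (pure U V u v) w) = pure U (tensor V W) u (pure V W v w)"
  if "u \<in> carrier U" "v \<in> carrier V" "w \<in> carrier W" for u v w
  using that by (simp add: p UV.pure_closed fp)
qed

section \<open>Slices\<close>

definition left_slice where
 "left_slice W \<phi> = tensor_lift W (\<lambda>(x, y). \<phi> x \<odot>\<^bsub>W\<^esub> y)"

definition right_slice where
 "right_slice V \<phi> = tensor_lift V (\<lambda>(x, y). \<phi> y \<odot>\<^bsub>V\<^esub> x)"

lemma (in tensor_field)
 assumes \<phi>: "lin_map UNIV V ground_space \<phi>"
 shows left_slice_linear: "lin_map UNIV T W (left_slice W \<phi>)"
  and left_slice_pure: "\<And>x y. x \<in> carrier V ==> y \<in> carrier W ==> left_slice W \<phi> (pr x y) = \<phi> x \<odot>\<^bsub>W\<^esub> y"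
proof -
 have "bilinear V W W (\<lambda>x y. \<phi> x \<odot>\<^bsub>W\<^esub> y)"
  unfolding bilinear_def using smult_linear[OF Wm] lin_map_comp[OF \<phi> smult_linear(2)[OF Wm]] by auto
 from tensor_lift_linear[OF Wm this] lift_pure[OF Wm this]
 show "lin_map UNIV T W (left_slice W \<phi>)"
  "\<And>x y. x \<in> carrier V ==> y \<in> carrier W ==> left_slice W \<phi> (pr x y) = \<phi> x \<odot>\<^bsub>W\<^esub> y"
  unfolding left_slice_def by simp_all
qed

lemma (in tensor_field)
 assumes \<phi>: "lin_map UNIV W ground_space \<phi>"
 shows right_slice_linear: "lin_map UNIV T V (right_slice V \<phi>)"
  and right_slice_pure: "\<And>x y. x \<in> carrier V ==> y \<in> carrier W ==> right_slice V \<phi> (pr x y) = \<phi> y \<odot>\<^bsub>V\<^esub> x"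
proof -
 have "bilinear V W V (\<lambda>x y. \<phi> y \<odot>\<^bsub>V\<^esub> x)"
  unfolding bilinear_def using smult_linear[OF Vm] lin_map_comp[OF \<phi> smult_linear(2)[OF Vm]] by auto
 from tensor_lift_linear[OF Vm this] lift_pure[OF Vm this]
 show "lin_map UNIV T V (right_slice V \<phi>)"
  "\<And>x y. x \<in> carrier V ==> y \<in> carrier W ==> right_slice V \<phi> (pr x y) = \<phi> y \<odot>\<^bsub>V\<^esub> x"
  unfolding right_slice_def by simp_all
qed

section \<open>Principal extensions\<close>

text \<open>These congruences keep the simplifier out of the parameters of tensor products, whose terms
 have to stay syntactically equal.\<close>

lemma tensor_over_opaque [cong]: "tensor_over R V \<rho> W lam = tensor_over R V \<rho> W lam"
 by (rule refl)

lemma pure_over_opaque [cong]: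
 "x = x' ==> y = y' ==> pure_over R V \<rho> W lam x y = pure_over R V \<rho> W lam x' y'"
 by simp

lemma lift_hom_opaque [cong]: "X = X' ==> lift_hom G f X = lift_hom G f X'"
 by simp

lemma (in abelian_monoid) finsum_swap:
 assumes "finite I" "finite J" "\<And>i j. i \<in> I ==> j \<in> J ==> f i j \<in> carrier G"
 shows "(\<Oplus>i\<in>I. \<Oplus>j\<in>J. f i j) = (\<Oplus>j\<in>J. \<Oplus>i\<in>I. f i j)"
 using assms(1,3)
proof (induction I rule: finite_induct)
 case (insert i I)
 have c: "(\<lambda>j. f i j) \<in> J \<rightarrow> carrier G" "(\<lambda>j. \<Oplus>i\<in>I. f i j) \<in> J \<rightarrow> carrier G" "(\<lambda>i. \<Oplus>j\<in>J. f i j) \<in> I \<rightarrow> carrier G"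
  "(\<Oplus>j\<in>J. f i j) \<in> carrier G"
  using insert.prems by (auto intro!: finsum_closed)
 have "(\<Oplus>i\<in>insert i I. \<Oplus>j\<in>J. f i j) = (\<Oplus>j\<in>J. f i j) \<oplus> (\<Oplus>j\<in>J. \<Oplus>i\<in>I. f i j)"
  using insert c by (subst finsum_insert) auto
 also have "\<dots> = (\<Oplus>j\<in>J. f i j \<oplus> (\<Oplus>i\<in>I. f i j))"
  using c by (subst finsum_addf) auto
 also have "\<dots> = (\<Oplus>j\<in>J. \<Oplus>i\<in>insert i I. f i j)"
 proof (rule finsum_cong'[OF refl])
  show "(\<lambda>j. \<Oplus>i\<in>insert i I. f i j) \<in> J \<rightarrow> carrier G" using insert.prems by (auto intro!: finsum_closed)
  show "f i j \<oplus> (\<Oplus>i\<in>I. f i j) = (\<Oplus>i\<in>insert i I. f i j)" if "j \<in> J" for j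
   using insert that by (subst finsum_insert) auto
 qed
 finally show ?case .
qed simp

lemma tensor_alg_comod: "tensor (alg_comod P) W = tensor (alg_space P) W"
 by (simp add: tensor_over_def balanced_rel_def pure_over_def alg_comod_def module_of_def lift_hom_def cong del: lift_hom_opaque pure_over_opaque)

lemma alg_comod_fields [simp]:
 "carrier (alg_comod P) = UNIV" "add (alg_comod P) = (+)" "smult (alg_comod P) = alg_scale P" "\<zero>\<^bsub>alg_comod P\<^esub> = 0"
 "coact (alg_comod P) = alg_coact P"
 by (simp_all add: alg_comod_def)

locale galois_extension =
 fixes C :: "('k::field_char_0, 'c::ab_group_add) coalg"
  and P :: "('k, 'p::{ring,monoid_mult}, 'c) comod_alg" and g :: 'c
  and l :: "'c => (('p \<times> 'p) \<Rightarrow>\<^sub>0 int) set"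
 assumes coalgebra: "coalgebra C" and algebra_comodule: "algebra_comodule C P"
  and principal: "principal_extension C P g" and strong: "strong_connection C P g l"
begin

abbreviation "sc \<equiv> alg_scale P"

abbreviation "A \<equiv> alg_space P"

abbreviation "S \<equiv> coalg_space C"

abbreviation "Bc \<equiv> coinvariants C P"

abbreviation "\<Delta> \<equiv> alg_coact P"

abbreviation "pAS \<equiv> pure A S"

abbreviation "L \<equiv> left_mult C P"

lemma vsP: "vector_space sc" and scl: "sc r (x * y) = sc r x * y" and scr: "sc r (x * y) = x * sc r y"
 using algebra_comodule by (auto simp: algebra_comodule_def)

lemma vsC: "vector_space (coalg_scale C)"
 using coalgebra by (simp add: coalgebra_def Let_def)

sublocale P: vector_space sc by (rule vsP)

lemma A_module: "left_module UNIV A" by (rule left_module_module_of[OF vsP]) auto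

lemma S_module: "left_module UNIV S" by (rule left_module_module_of[OF vsC]) auto

sublocale AS: tensor_field A S by unfold_locales (rule A_module S_module)+

sublocale AA: tensor_field A A by unfold_locales (rule A_module)+

sublocale SA: tensor_field S A by unfold_locales (rule A_module S_module)+

sublocale SS: tensor_field S S by unfold_locales (rule S_module)+

lemma counit_linear: "lin_map UNIV S ground_space (counit C)" and comult_linear: "lin_map UNIV S (tensor S S) (comult C)"
 using coalgebra by (auto simp: coalgebra_def Let_def)

lemma \<Delta>_linear: "lin_map UNIV A (tensor A S) \<Delta>"
 using algebra_comodule unfolding algebra_comodule_def comodule_def
 by (auto simp: Let_def lin_map_def tensor_alg_comod)

lemma \<Delta>_closed: "\<Delta> p \<in> carrier AS.T"
 by (rule lin_map_closed[OF \<Delta>_linear]) simp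

lemma \<Delta>_add: "\<Delta> (p + q) = \<Delta> p \<oplus>\<^bsub>AS.T\<^esub> \<Delta> q"
 using lin_map_add[OF \<Delta>_linear, of p q] by simp

lemma \<Delta>_scale: "\<Delta> (sc r p) = r \<odot>\<^bsub>AS.T\<^esub> \<Delta> p"
 using lin_map_smult[OF \<Delta>_linear, of r p] by simp

lemma \<Delta>_sum: "finite I ==> \<Delta> (sum f I) = (\<Oplus>\<^bsub>AS.T\<^esub>i\<in>I. \<Delta> (f i))"
 using lin_map_finsum[OF AS.V AS.abelian_T \<Delta>_linear, of f I] finsum_module_of[OF AS.V, of I f] by simp

abbreviation "\<E> \<equiv> right_slice A (counit C)"

lemma counit_\<Delta>: "\<E> (\<Delta> p) = p"
proof -
 have lift: "tensor_lift A f X = tensor_lift (alg_comod P) f X" for f :: "'p \<times> 'c => 'p" and X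
  by (rule lift_hom_cong_group) (simp_all add: module_of_def)
 have fe: "(\<lambda>(x, c). counit C c \<odot>\<^bsub>A\<^esub> x) = (\<lambda>(x, c). counit C c \<odot>\<^bsub>alg_comod P\<^esub> x)"
  by (simp add: fun_eq_iff)
 have "\<forall>v\<in>carrier (alg_comod P). tensor_lift (alg_comod P) (\<lambda>(x, c). counit C c \<odot>\<^bsub>alg_comod P\<^esub> x) (coact (alg_comod P) v) = v"
  using algebra_comodule unfolding algebra_comodule_def comodule_def Let_def by blast
 then have "tensor_lift (alg_comod P) (\<lambda>(x, c). counit C c \<odot>\<^bsub>alg_comod P\<^esub> x) (\<Delta> p) = p"
  unfolding alg_comod_fields by blast
 then show ?thesis unfolding right_slice_def fe lift .
qed

lemma mult_linear: "lin_map UNIV A A (\<lambda>q. b * q)"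
 by (simp add: lin_map_def distrib_left scr)

lemma L_linear: "lin_map UNIV AS.T AS.T (L b)"
 and L_pure: "L b (pAS q c) = pAS (b * q) c"
 using tensor_map_linear[OF A_module S_module A_module S_module mult_linear lin_map_id]
  tensor_map_pure[OF A_module S_module A_module S_module mult_linear lin_map_id]
 by (simp_all add: left_mult_def id_def)

lemma L_closed: "X \<in> carrier AS.T ==> L b X \<in> carrier AS.T"
 by (rule lin_map_closed[OF L_linear])

lemma L_mult: "X \<in> carrier AS.T ==> L (b * b') X = L b (L b' X)"
 by (rule AS.additive_eqI[OF L_linear lin_map_comp[OF L_linear L_linear]]) (simp_all add: L_pure mult.assoc)

lemma L_one: "X \<in> carrier AS.T ==> L 1 X = X"
 by (rule AS.additive_eqI[OF L_linear lin_map_id]) (simp_all add: L_pure)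

lemma L_scale: assumes X: "X \<in> carrier AS.T" shows "L (sc r b) X = r \<odot>\<^bsub>AS.T\<^esub> L b X"
proof (rule AS.additive_eqI[OF L_linear lin_map_comp[OF L_linear smult_linear(1)[OF AS.left_module_T]] _ X])
 show "L (sc r b) (pAS x y) = r \<odot>\<^bsub>AS.T\<^esub> L b (pAS x y)" for x y
  using AS.smult_pure[of "b * x" y r] by (simp add: L_pure scl)
qed

lemma L_additive: assumes X: "X \<in> carrier AS.T" shows "lin_map {} A AS.T (\<lambda>b. L b X)"
proof -
 have "L (b + b') X = L b X \<oplus>\<^bsub>AS.T\<^esub> L b' X" for b b'
 proof (rule AS.additive_eqI[OF L_linear _ _ X])
  show "lin_map {} AS.T AS.T (\<lambda>X. L b X \<oplus>\<^bsub>AS.T\<^esub> L b' X)"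
   by (auto simp: lin_map_def L_closed lin_map_add[OF L_linear] AS.T.a_ac)
  show "L (b + b') (pAS x y) = L b (pAS x y) \<oplus>\<^bsub>AS.T\<^esub> L b' (pAS x y)" for x y
   using AS.pure_add_left[of "b * x" "b' * x" y] by (simp add: L_pure distrib_right)
 qed
 then show ?thesis using L_closed[OF X] by (simp add: lin_map_def)
qed

lemma L_add: "X \<in> carrier AS.T ==> L (b + b') X = L b X \<oplus>\<^bsub>AS.T\<^esub> L b' X"
 using lin_map_add[OF L_additive, of X b b'] by simp

lemma L_sum: "X \<in> carrier AS.T ==> finite I ==> L (sum f I) X = (\<Oplus>\<^bsub>AS.T\<^esub>i\<in>I. L (f i) X)"
 using lin_map_finsum[OF AS.V AS.abelian_T L_additive, of X f I] finsum_module_of[OF AS.V, of I f] by simp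

lemma coinvariant_iff: "b \<in> Bc \<longleftrightarrow> (\<forall>p. \<Delta> (b * p) = L b (\<Delta> p))"
 by (simp add: coinvariants_def)

lemma coinvariant_scale: "b \<in> Bc ==> sc r b \<in> Bc"
 unfolding coinvariant_iff by (simp add: scl[symmetric] \<Delta>_scale L_scale \<Delta>_closed)

lemma coinvariant_one: "1 \<in> Bc"
 by (simp add: coinvariant_iff L_one \<Delta>_closed)

sublocale SB: subalgebra sc Bc
proof
 show "x + y \<in> Bc" if "x \<in> Bc" "y \<in> Bc" for x y
  using that by (simp add: coinvariant_iff distrib_right \<Delta>_add L_add \<Delta>_closed)
 show "x * y \<in> Bc" if "x \<in> Bc" "y \<in> Bc" for x y
  using that by (simp add: coinvariant_iff mult.assoc L_mult \<Delta>_closed)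
 show "sc r x \<in> Bc" if "x \<in> Bc" for r x by (rule coinvariant_scale[OF that])
 show "0 \<in> Bc" using coinvariant_scale[OF coinvariant_one, of 0] by simp
 show "- x \<in> Bc" if "x \<in> Bc" for x using coinvariant_scale[OF that, of "- 1"] by simp
qed (simp_all add: coinvariant_one scl, simp add: scl[symmetric] scr)

subsection \<open>The canonical map and the right action on \<open>P \<otimes> C\<close>\<close>

sublocale TB: tensor_data Bc A "(*)" A "(*)"
 by unfold_locales (use left_module_group[OF A_module] in \<open>simp_all add: abelian_group_def abelian_group_axioms_def abelian_monoid_def\<close>)

abbreviation "pB \<equiv> pureB C P"

abbreviation "can \<equiv> canR C P"

lemma can_additive: "lin_map {} TB.T AS.T can"
 and can_pure: "can (pB p p') = L p (\<Delta> p')"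
proof -
 have add: "L p (\<Delta> (y + y')) = L p (\<Delta> y) \<oplus>\<^bsub>AS.T\<^esub> L p (\<Delta> y')" for p y y'
  using lin_map_add[OF L_linear \<Delta>_closed \<Delta>_closed] by (simp add: \<Delta>_add)
 have bal: "L (p * b) (\<Delta> y) = L p (\<Delta> (b * y))" if "b \<in> Bc" for p b y
  using that by (simp add: L_mult \<Delta>_closed coinvariant_iff)
 show "lin_map {} TB.T AS.T can" unfolding canR_def
  by (rule TB.tensor_lift_additive[OF AS.abelian_T]) (simp_all add: L_closed \<Delta>_closed L_add add bal)
 show "can (pB p p') = L p (\<Delta> p')" unfolding canR_def
  by (rule TB.tensor_lift_pure[OF AS.abelian_T]) (simp_all add: L_closed \<Delta>_closed L_add add bal)
qed

lemma can_bij: "bij_betw can (carrier TB.T) (carrier AS.T)"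
 and ent_bij: "bij_betw (entwining C P) (carrier SA.T) (carrier AS.T)"
 and coact_ent: "\<Delta> p = entwining C P (pure S A g p)"
 using principal by (auto simp: principal_extension_def)

definition "cinv = the_inv_into (carrier TB.T) can"

lemma cinv_closed: "X \<in> carrier AS.T ==> cinv X \<in> carrier TB.T"
 and can_cinv: "X \<in> carrier AS.T ==> can (cinv X) = X"
 and cinv_can: "Y \<in> carrier TB.T ==> cinv (can Y) = Y"
 unfolding cinv_def using can_bij
 by (auto simp: bij_betw_def the_inv_into_into f_the_inv_into_f the_inv_into_f_f)

lemma cinv_additive: "lin_map {} AS.T TB.T cinv"
proof -
 have "cinv (X \<oplus>\<^bsub>AS.T\<^esub> Y) = cinv X \<oplus>\<^bsub>TB.T\<^esub> cinv Y" if "X \<in> carrier AS.T" "Y \<in> carrier AS.T" for X Y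
  using cinv_can[of "cinv X \<oplus>\<^bsub>TB.T\<^esub> cinv Y"] lin_map_add[OF can_additive, of "cinv X" "cinv Y"] that
  by (simp add: cinv_closed can_cinv)
 then show ?thesis by (simp add: lin_map_def cinv_closed)
qed

definition "LB p = tensor_lift TB.T (\<lambda>(q, q'). pB (p * q) q')"

definition "RB p = tensor_lift TB.T (\<lambda>(q, q'). pB q (q' * p))"

lemma pB_add: "pB (x + x') y = pB x y \<oplus>\<^bsub>TB.T\<^esub> pB x' y" "pB x (y + y') = pB x y \<oplus>\<^bsub>TB.T\<^esub> pB x y'"
 using TB.pure_add_left[of x x' y] TB.pure_add_right[of x y y'] by simp_all

lemma pB_bal: "b \<in> Bc ==> pB (x * b) y = pB x (b * y)"
 using TB.pure_balanced[of x b y] by simp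

lemma pB_closed: "pB x y \<in> carrier TB.T"
 using TB.pure_closed[of x y] by simp

lemma LB_additive: "lin_map {} TB.T TB.T (LB p)" and LB_pure: "LB p (pB q q') = pB (p * q) q'"
proof -
 show "lin_map {} TB.T TB.T (LB p)" unfolding LB_def
  by (rule TB.tensor_lift_additive[OF TB.abelian_T]) (simp_all add: pB_closed pB_add distrib_left pB_bal flip: mult.assoc)
 show "LB p (pB q q') = pB (p * q) q'" unfolding LB_def
  by (rule TB.tensor_lift_pure[OF TB.abelian_T]) (simp_all add: pB_closed pB_add distrib_left pB_bal flip: mult.assoc)
qed

lemma RB_additive: "lin_map {} TB.T TB.T (RB p)" and RB_pure: "RB p (pB q q') = pB q (q' * p)"
proof -
 show "lin_map {} TB.T TB.T (RB p)" unfolding RB_def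
  by (rule TB.tensor_lift_additive[OF TB.abelian_T]) (simp_all add: pB_closed pB_add distrib_right pB_bal mult.assoc)
 show "RB p (pB q q') = pB q (q' * p)" unfolding RB_def
  by (rule TB.tensor_lift_pure[OF TB.abelian_T]) (simp_all add: pB_closed pB_add distrib_right pB_bal mult.assoc)
qed

lemma LB_closed: "Y \<in> carrier TB.T ==> LB p Y \<in> carrier TB.T" and RB_closed: "Y \<in> carrier TB.T ==> RB p Y \<in> carrier TB.T"
 by (rule lin_map_closed[OF LB_additive], assumption, rule lin_map_closed[OF RB_additive])

lemma can_LB: "Y \<in> carrier TB.T ==> can (LB p Y) = L p (can Y)"
 by (rule TB.additive_eqI[OF lin_map_comp[OF LB_additive can_additive] lin_map_comp[OF can_additive lin_map_additive[OF L_linear]]])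
  (simp_all add: LB_pure can_pure L_mult \<Delta>_closed)

lemma RB_RB: "Y \<in> carrier TB.T ==> RB q (RB p Y) = RB (p * q) Y"
 by (rule TB.additive_eqI[OF lin_map_comp[OF RB_additive RB_additive] RB_additive]) (simp_all add: RB_pure mult.assoc)

lemma RB_LB: "Y \<in> carrier TB.T ==> RB q (LB p Y) = LB p (RB q Y)"
 by (rule TB.additive_eqI[OF lin_map_comp[OF LB_additive RB_additive] lin_map_comp[OF RB_additive LB_additive]])
  (simp_all add: RB_pure LB_pure)

lemma RB_add: assumes Y: "Y \<in> carrier TB.T" shows "RB (p + q) Y = RB p Y \<oplus>\<^bsub>TB.T\<^esub> RB q Y"
proof (rule TB.additive_eqI[OF RB_additive _ _ Y])
 show "lin_map {} TB.T TB.T (\<lambda>Y. RB p Y \<oplus>\<^bsub>TB.T\<^esub> RB q Y)"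
  by (auto simp: lin_map_def RB_closed lin_map_add[OF RB_additive] TB.T.a_ac)
qed (simp add: RB_pure distrib_left pB_add)

lemma RB_scalar: assumes Y: "Y \<in> carrier TB.T" shows "RB (sc r 1) Y = LB (sc r 1) Y"
proof (rule TB.additive_eqI[OF RB_additive LB_additive _ Y])
 have c: "x * sc r 1 = sc r 1 * x" for x using scl[of r 1 x] scr[of r x 1] by simp
 show "RB (sc r 1) (pB x y) = LB (sc r 1) (pB x y)" for x y
  using pB_bal[OF coinvariant_scale[OF coinvariant_one], of x r y] by (simp add: RB_pure LB_pure c)
qed

text \<open>The action of \<open>P\<close> on \<open>P \<otimes> C\<close> transported along \<open>can\<close> from right multiplication on \<open>P \<otimes>\<^sub>B P\<close>; the entwining is its value on \<open>1 \<otimes> c\<close>.\<close>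

definition "act X p = can (RB p (cinv X))"

lemma act_additive: "lin_map {} AS.T AS.T (\<lambda>X. act X p)"
 unfolding act_def by (rule lin_map_comp[OF cinv_additive lin_map_comp[OF RB_additive can_additive]])

lemma act_closed: "X \<in> carrier AS.T ==> act X p \<in> carrier AS.T"
 by (rule lin_map_closed[OF act_additive])

lemma cinv_L: "X \<in> carrier AS.T ==> cinv (L p X) = LB p (cinv X)"
 using cinv_can[OF LB_closed[OF cinv_closed], of X p] by (simp add: can_LB cinv_closed can_cinv)

lemma act_L: "X \<in> carrier AS.T ==> act (L q X) p = L q (act X p)"
 unfolding act_def by (simp add: cinv_L RB_LB can_LB cinv_closed RB_closed)

lemma act_act: "X \<in> carrier AS.T ==> act (act X p) q = act X (p * q)"
 unfolding act_def by (simp add: cinv_can RB_closed cinv_closed RB_RB)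

lemma act_add_right: "X \<in> carrier AS.T ==> act X (p + q) = act X p \<oplus>\<^bsub>AS.T\<^esub> act X q"
 unfolding act_def by (simp add: RB_add cinv_closed RB_closed lin_map_add[OF can_additive])

lemma smult_L: "X \<in> carrier AS.T ==> r \<odot>\<^bsub>AS.T\<^esub> X = L (sc r 1) X"
 by (simp add: L_scale L_one)

lemma act_smult_left: "X \<in> carrier AS.T ==> act (r \<odot>\<^bsub>AS.T\<^esub> X) p = r \<odot>\<^bsub>AS.T\<^esub> act X p"
 by (simp add: smult_L act_L act_closed)

lemma act_smult_right: "X \<in> carrier AS.T ==> act X (sc r p) = r \<odot>\<^bsub>AS.T\<^esub> act X p"
proof -
 assume X: "X \<in> carrier AS.T"
 have "act X (sc r 1) = L (sc r 1) X"
  unfolding act_def using X by (simp add: RB_scalar cinv_closed can_LB can_cinv)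
 moreover have "act X (sc r p) = act (act X (sc r 1)) p"
  using act_act[OF X, of "sc r 1" p] scl[of r 1 p] by simp
 ultimately show ?thesis using X by (simp add: act_L smult_L act_closed)
qed

text \<open>\<open>\<Delta> p = can (1 \<otimes> p)\<close>, and acting by \<open>q\<close> gives \<open>can (1 \<otimes> p q)\<close>.\<close>

lemma act_\<Delta>: "act (\<Delta> p) q = \<Delta> (p * q)"
proof -
 have "cinv (\<Delta> p) = pB 1 p" using cinv_can[OF pB_closed, of 1 p] by (simp add: can_pure L_one \<Delta>_closed)
 then show ?thesis by (simp add: act_def RB_pure can_pure L_one \<Delta>_closed)
qed

lemma pAS_closed: "pAS x c \<in> carrier AS.T"
 using AS.pure_closed[of x c] by simp

lemma pAS_L: "pAS p c = L p (pAS 1 c)"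
 by (simp add: L_pure)

lemma entwining_eq: "entwining C P = tensor_lift AS.T (\<lambda>(c, p). act (pAS 1 c) p)"
 by (simp add: entwining_def act_def RB_def translation_def cinv_def)

lemma ent_bilinear: "bilinear S A AS.T (\<lambda>c p. act (pAS 1 c) p)"
proof -
 have "pAS 1 (c + c') = pAS 1 c \<oplus>\<^bsub>AS.T\<^esub> pAS 1 c'" "pAS 1 (coalg_scale C r c) = r \<odot>\<^bsub>AS.T\<^esub> pAS 1 c" for c c' r
  using AS.pure_add_right[of 1 c c'] AS.smult_pure_right[of 1 c r] by simp_all
 then show ?thesis
  by (auto simp: bilinear_def lin_map_def act_closed pAS_closed act_add_right act_smult_right act_smult_left
    lin_map_add[OF act_additive])
qed

lemma ent_linear: "lin_map UNIV SA.T AS.T (entwining C P)" and ent_pure: "entwining C P (pure S A c p) = act (pAS 1 c) p"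
 unfolding entwining_eq using SA.tensor_lift_linear[OF AS.left_module_T ent_bilinear] SA.lift_pure[OF AS.left_module_T ent_bilinear]
 by simp_all

lemma \<Delta>_act: "\<Delta> p = act (pAS 1 g) p"
 by (simp add: coact_ent ent_pure)

abbreviation "lc \<equiv> left_coact C P g"

lemma lc_closed: "lc p \<in> carrier SA.T" and ent_lc: "entwining C P (lc p) = pAS p g"
 using ent_bij pAS_closed unfolding left_coact_def bij_betw_def
 by (auto simp: the_inv_into_into f_the_inv_into_f)

lemma lc_linear: "lin_map UNIV A SA.T lc"
proof -
 have inj: "X = Y" if "X \<in> carrier SA.T" "Y \<in> carrier SA.T" "entwining C P X = entwining C P Y" for X Y
  using ent_bij that unfolding bij_betw_def inj_on_def by blast
 have "lc (p + q) = lc p \<oplus>\<^bsub>SA.T\<^esub> lc q" for p q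
  by (rule inj) (use AS.pure_add_left[of p q g] in \<open>simp_all add: lc_closed lin_map_add[OF ent_linear] ent_lc\<close>)
 moreover have "lc (sc r p) = r \<odot>\<^bsub>SA.T\<^esub> lc p" for r p
  by (rule inj) (use AS.smult_pure[of p g r] in \<open>simp_all add: lc_closed lin_map_smult[OF ent_linear] ent_lc left_module_smult_closed[OF SA.left_module_T]\<close>)
 ultimately show ?thesis by (simp add: lin_map_def lc_closed)
qed

lemma \<E>_linear: "lin_map UNIV AS.T A \<E>" and \<E>_pure: "\<E> (pAS x c) = sc (counit C c) x"
 using AS.right_slice_linear[OF counit_linear] AS.right_slice_pure[OF counit_linear, of x c] by simp_all

definition "multAA = tensor_lift A (\<lambda>(p, q). p * q)"

lemma multAA_linear: "lin_map UNIV AA.T A multAA" and multAA_pure: "multAA (pure A A p q) = p * q"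
proof -
 have "bilinear A A A (\<lambda>p q. p * q)"
  by (auto simp: bilinear_def lin_map_def distrib_left distrib_right scr[symmetric] scl[symmetric])
 from AA.tensor_lift_linear[OF A_module this] AA.lift_pure[OF A_module this]
 show "lin_map UNIV AA.T A multAA" "multAA (pure A A p q) = p * q" unfolding multAA_def by simp_all
qed

lemma l_linear: "lin_map UNIV S AA.T l"
 and l_translation: "tensor_lift TB.T (\<lambda>(p, q). pB p q) (l c) = translation C P c"
 and l_right: "tensor_map A AS.T id \<Delta> (l c) = tensor_assoc A A S (tensor_map AA.T S l id (comult C c))"
 and l_left: "tensor_assoc S A A (tensor_map SA.T A lc id (l c)) = tensor_map S AA.T id l (comult C c)"
 using strong by (auto simp: strong_connection_def Let_def)

lemma l_closed: "l c \<in> carrier AA.T"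
 by (rule lin_map_closed[OF l_linear]) simp

text \<open>Applying \<open>id \<otimes> \<epsilon>\<close> to \<open>can (\<tau> c) = 1 \<otimes> c\<close>.\<close>

lemma mult_l: "multAA (l c) = sc (counit C c) 1"
proof -
 let ?\<pi> = "tensor_lift TB.T (\<lambda>(p, q). pB p q)"
 have bal: "pB (sc r x) y = pB x (sc r y)" for r x y
  using pB_bal[OF coinvariant_scale[OF coinvariant_one], of x r y] scr[of r x 1] scl[of r 1 y] by simp
 have \<pi>: "lin_map {} AA.T TB.T ?\<pi>"
  by (rule AA.tensor_lift_additive[OF TB.abelian_T]) (simp_all add: pB_closed pB_add bal)
 have \<pi>p: "?\<pi> (pure A A x y) = pB x y" for x y
  by (rule AA.tensor_lift_pure[OF TB.abelian_T]) (simp_all add: pB_closed pB_add bal)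
 have EL: "\<E> (L p X) = p * \<E> X" if X: "X \<in> carrier AS.T" for p X
  by (rule AS.additive_eqI[OF lin_map_comp[OF L_linear \<E>_linear] lin_map_comp[OF \<E>_linear mult_linear] _ X])
   (simp add: L_pure \<E>_pure scr)
 have "\<E> (can (?\<pi> X)) = multAA X" if X: "X \<in> carrier AA.T" for X
  by (rule AA.additive_eqI[OF lin_map_comp[OF \<pi> lin_map_comp[OF can_additive lin_map_additive[OF \<E>_linear]]] multAA_linear _ X])
   (simp add: \<pi>p can_pure EL \<Delta>_closed counit_\<Delta> multAA_pure)
 from this[OF l_closed[of c]] have "multAA (l c) = \<E> (can (translation C P c))" by (simp add: l_translation)
 also have "\<dots> = \<E> (pAS 1 c)"
  using can_cinv[OF pAS_closed] by (simp add: translation_def cinv_def)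
 finally show ?thesis by (simp add: \<E>_pure)
qed

end

context galois_extension
begin

subsection \<open>Slicing the strong connection\<close>

lemma slice_right_colinear:
 assumes \<phi>: "lin_map UNIV A ground_space \<phi>"
  and c: "comult C c = (\<Oplus>\<^bsub>SS.T\<^esub>k\<in>I. pure S S (u k) (v k))" and I: "finite I"
 shows "\<Delta> (left_slice A \<phi> (l c)) = (\<Oplus>\<^bsub>AS.T\<^esub>k\<in>I. pAS (left_slice A \<phi> (l (u k))) (v k))"
proof -
 interpret AT: tensor_field A AS.T by unfold_locales (rule A_module AS.left_module_T)+
 interpret AAS: tensor_field AA.T S by unfold_locales (rule S_module AA.left_module_T)+
 note s = AA.left_slice_linear[OF \<phi>] and sp = AA.left_slice_pure[OF \<phi>]
 note t = AT.left_slice_linear[OF \<phi>] and tp = AT.left_slice_pure[OF \<phi>]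
 note id\<Delta> = tensor_map_linear[OF A_module A_module A_module AS.left_module_T lin_map_id \<Delta>_linear, folded id_def]
  and id\<Delta>p = tensor_map_pure[OF A_module A_module A_module AS.left_module_T lin_map_id \<Delta>_linear, folded id_def]
 note lid = tensor_map_linear[OF S_module S_module AA.left_module_T S_module l_linear lin_map_id, folded id_def]
  and lidp = tensor_map_pure[OF S_module S_module AA.left_module_T S_module l_linear lin_map_id, folded id_def]
 note as = tensor_assoc_linear[OF A_module A_module S_module] and asp = tensor_assoc_pure[OF A_module A_module S_module]
 have 1: "left_slice AS.T \<phi> (tensor_map A AS.T id \<Delta> X) = \<Delta> (left_slice A \<phi> X)" if X: "X \<in> carrier AA.T" for X
  by (rule AA.additive_eqI[OF lin_map_comp[OF id\<Delta> t] lin_map_comp[OF s \<Delta>_linear] _ X])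
   (simp add: id\<Delta>p tp sp \<Delta>_closed \<Delta>_scale)
 have 2: "left_slice AS.T \<phi> (tensor_assoc A A S (pure AA.T S X w)) = pAS (left_slice A \<phi> X) w" if X: "X \<in> carrier AA.T" for X w
 proof (rule AA.additive_eqI[OF _ _ _ X])
  show "lin_map UNIV AA.T AS.T (\<lambda>X. left_slice AS.T \<phi> (tensor_assoc A A S (pure AA.T S X w)))"
   by (rule lin_map_comp[OF AAS.pure_linear_left lin_map_comp[OF as t]]) simp
  show "lin_map UNIV AA.T AS.T (\<lambda>X. pAS (left_slice A \<phi> X) w)"
   by (rule lin_map_comp[OF s AS.pure_linear_left]) simp
  show "left_slice AS.T \<phi> (tensor_assoc A A S (pure AA.T S (pure A A x y) w)) = pAS (left_slice A \<phi> (pure A A x y)) w" for x y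
   using AS.smult_pure[of y w "\<phi> x"] by (simp add: asp tp sp pAS_closed)
 qed
 have "\<Delta> (left_slice A \<phi> (l c)) = left_slice AS.T \<phi> (tensor_assoc A A S (tensor_map AA.T S l id (comult C c)))"
  by (simp add: 1[symmetric] l_closed l_right)
 also have "\<dots> = (\<Oplus>\<^bsub>AS.T\<^esub>k\<in>I. left_slice AS.T \<phi> (tensor_assoc A A S (tensor_map AA.T S l id (pure S S (u k) (v k)))))"
  unfolding c
  by (rule lin_map_finsum[OF SS.abelian_T AS.abelian_T lin_map_comp[OF lid lin_map_comp[OF as t]] _ I])
   (use SS.pure_closed in auto)
 also have "\<dots> = (\<Oplus>\<^bsub>AS.T\<^esub>k\<in>I. pAS (left_slice A \<phi> (l (u k))) (v k))"
  by (simp add: lidp 2 l_closed)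
 finally show ?thesis .
qed

lemma slice_left_colinear:
 assumes \<phi>: "lin_map UNIV A ground_space \<phi>"
  and c: "comult C c = (\<Oplus>\<^bsub>SS.T\<^esub>k\<in>I. pure S S (u k) (v k))" and I: "finite I"
 shows "lc (right_slice A \<phi> (l c)) = (\<Oplus>\<^bsub>SA.T\<^esub>k\<in>I. pure S A (u k) (right_slice A \<phi> (l (v k))))"
proof -
 interpret SAA: tensor_field S AA.T by unfold_locales (rule S_module AA.left_module_T)+
 interpret SA_A: tensor_field SA.T A by unfold_locales (rule A_module SA.left_module_T)+
 note s = AA.right_slice_linear[OF \<phi>] and sp = AA.right_slice_pure[OF \<phi>]
 note t = tensor_map_linear[OF S_module AA.left_module_T S_module A_module lin_map_id s, folded id_def]
  and tp = tensor_map_pure[OF S_module AA.left_module_T S_module A_module lin_map_id s, folded id_def]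
 note lcid = tensor_map_linear[OF A_module A_module SA.left_module_T A_module lc_linear lin_map_id, folded id_def]
  and lcidp = tensor_map_pure[OF A_module A_module SA.left_module_T A_module lc_linear lin_map_id, folded id_def]
 note idl = tensor_map_linear[OF S_module S_module S_module AA.left_module_T lin_map_id l_linear, folded id_def]
  and idlp = tensor_map_pure[OF S_module S_module S_module AA.left_module_T lin_map_id l_linear, folded id_def]
 note as = tensor_assoc_linear[OF S_module A_module A_module] and asp = tensor_assoc_pure[OF S_module A_module A_module]
 let ?t = "tensor_map S A id (right_slice A \<phi>)"
 have 2: "?t (tensor_assoc S A A (pure SA.T A Y q)) = \<phi> q \<odot>\<^bsub>SA.T\<^esub> Y" if Y: "Y \<in> carrier SA.T" for Y q
 proof (rule SA.additive_eqI[OF _ _ _ Y])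
  show "lin_map UNIV SA.T SA.T (\<lambda>Y. ?t (tensor_assoc S A A (pure SA.T A Y q)))"
   by (rule lin_map_comp[OF SA_A.pure_linear_left lin_map_comp[OF as t]]) simp
  show "lin_map UNIV SA.T SA.T (\<lambda>Y. \<phi> q \<odot>\<^bsub>SA.T\<^esub> Y)" by (rule smult_linear(1)[OF SA.left_module_T])
  show "?t (tensor_assoc S A A (pure SA.T A (pure S A x y) q)) = \<phi> q \<odot>\<^bsub>SA.T\<^esub> pure S A x y" for x y
   using SA.smult_pure_right[of x y "\<phi> q"] AA.pure_closed[of y q] by (simp add: asp tp sp)
 qed
 have 1: "?t (tensor_assoc S A A (tensor_map SA.T A lc id X)) = lc (right_slice A \<phi> X)" if X: "X \<in> carrier AA.T" for X
  by (rule AA.additive_eqI[OF lin_map_comp[OF lcid lin_map_comp[OF as t]] lin_map_comp[OF s lc_linear] _ X])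
   (use lin_map_smult[OF lc_linear] in \<open>simp add: lcidp 2 lc_closed sp\<close>)
 have "lc (right_slice A \<phi> (l c)) = ?t (tensor_map S AA.T id l (comult C c))"
  by (simp add: 1[symmetric] l_closed l_left)
 also have "\<dots> = (\<Oplus>\<^bsub>SA.T\<^esub>k\<in>I. ?t (tensor_map S AA.T id l (pure S S (u k) (v k))))"
  unfolding c
  by (rule lin_map_finsum[OF SS.abelian_T SA.abelian_T lin_map_comp[OF idl t] _ I])
   (use SS.pure_closed in auto)
 also have "\<dots> = (\<Oplus>\<^bsub>SA.T\<^esub>k\<in>I. pure S A (u k) (right_slice A \<phi> (l (v k))))"
  by (simp add: idlp tp l_closed)
 finally show ?thesis .
qed

definition "basis_P = P.extend_basis {}"

lemma basis_P: "P.independent basis_P" "P.span basis_P = UNIV"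
 unfolding basis_P_def using P.independent_extend_basis[OF P.independent_empty] P.span_extend_basis[OF P.independent_empty] by auto

abbreviation "coord v p \<equiv> P.representation basis_P v p"

lemma coord_linear: "lin_map UNIV A ground_space (\<lambda>v. coord v p)"
 using basis_P by (simp add: lin_map_def P.representation_add P.representation_scale)

text \<open>Only finitely many coordinate functionals see the left legs of \<open>X\<close>. The set is left open above, so that several elements can be expanded over one common set.\<close>

lemma slice_expansion:
 assumes "X \<in> carrier AA.T"
 shows "\<exists>F. finite F \<and> (\<forall>F'. finite F' \<longrightarrow> F \<subseteq> F' \<longrightarrow> X = (\<Oplus>\<^bsub>AA.T\<^esub>p\<in>F'. pure A A p (left_slice A (\<lambda>v. coord v p) X)))"
 using assms
proof (induction rule: AA.tensor_induct)
 case (pure x y)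
 let ?F = "{p. coord x p \<noteq> 0}"
 have "pure A A x y = (\<Oplus>\<^bsub>AA.T\<^esub>p\<in>F'. pure A A p (left_slice A (\<lambda>v. coord v p) (pure A A x y)))"
  if F': "finite F'" "?F \<subseteq> F'" for F'
 proof -
  have "x = (\<Sum>p\<in>F'. sc (coord x p) p)"
   using P.sum_nonzero_representation_eq[OF basis_P(1), of x] basis_P(2) F'
   by (subst sum.mono_neutral_right[of F' ?F]) auto
  then have "pure A A x y = pure A A (\<Oplus>\<^bsub>A\<^esub>p\<in>F'. sc (coord x p) p) y"
   using finsum_module_of[OF AA.V F'(1), of "\<lambda>p. sc (coord x p) p"] by simp
  also have "\<dots> = (\<Oplus>\<^bsub>AA.T\<^esub>p\<in>F'. pure A A (sc (coord x p) p) y)"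
   by (rule AA.pure_finsum_left[OF F'(1)]) auto
  also have "\<dots> = (\<Oplus>\<^bsub>AA.T\<^esub>p\<in>F'. pure A A p (left_slice A (\<lambda>v. coord v p) (pure A A x y)))"
   using AA.pure_balanced[of _ _ y] AA.left_slice_pure[OF coord_linear, of x y] by simp
  finally show ?thesis .
 qed
 then show ?case using P.finite_representation by (intro exI[of _ ?F]) blast
next
 case (add X Y)
 from add.IH(1) obtain F where F0: "finite F" and F1: "\<forall>F'. finite F' \<longrightarrow> F \<subseteq> F' \<longrightarrow> X = (\<Oplus>\<^bsub>AA.T\<^esub>p\<in>F'. pure A A p (left_slice A (\<lambda>v. coord v p) X))"
  by (elim exE conjE)
 from add.IH(2) obtain G where G0: "finite G" and G1: "\<forall>F'. finite F' \<longrightarrow> G \<subseteq> F' \<longrightarrow> Y = (\<Oplus>\<^bsub>AA.T\<^esub>p\<in>F'. pure A A p (left_slice A (\<lambda>v. coord v p) Y))"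
  by (elim exE conjE)
 let ?f = "\<lambda>X p. pure A A p (left_slice A (\<lambda>v. coord v p) X)"
 have c: "?f Z \<in> F' \<rightarrow> carrier AA.T" for Z F' using AA.pure_closed by auto
 have "X \<oplus>\<^bsub>AA.T\<^esub> Y = (\<Oplus>\<^bsub>AA.T\<^esub>p\<in>F'. ?f (X \<oplus>\<^bsub>AA.T\<^esub> Y) p)" if F': "finite F'" "F \<union> G \<subseteq> F'" for F'
 proof -
  have "X \<oplus>\<^bsub>AA.T\<^esub> Y = (\<Oplus>\<^bsub>AA.T\<^esub>p\<in>F'. ?f X p) \<oplus>\<^bsub>AA.T\<^esub> (\<Oplus>\<^bsub>AA.T\<^esub>p\<in>F'. ?f Y p)"
   using F1[rule_format, OF F'(1)] G1[rule_format, OF F'(1)] F'(2) by (intro arg_cong2[where f="ring.add AA.T"]) auto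
  also have "\<dots> = (\<Oplus>\<^bsub>AA.T\<^esub>p\<in>F'. ?f X p \<oplus>\<^bsub>AA.T\<^esub> ?f Y p)"
   by (rule AA.T.finsum_addf[OF c c, symmetric])
  also have "\<dots> = (\<Oplus>\<^bsub>AA.T\<^esub>p\<in>F'. ?f (X \<oplus>\<^bsub>AA.T\<^esub> Y) p)"
  proof (rule AA.T.finsum_cong'[OF refl c])
   fix p
   show "?f X p \<oplus>\<^bsub>AA.T\<^esub> ?f Y p = ?f (X \<oplus>\<^bsub>AA.T\<^esub> Y) p"
    using lin_map_add[OF AA.left_slice_linear[OF coord_linear] add(1,2), of p]
     AA.pure_add_right[of p "left_slice A (\<lambda>v. coord v p) X" "left_slice A (\<lambda>v. coord v p) Y"] by simp
  qed
  finally show ?thesis .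
 qed
 then show ?case using F0 G0 by (intro exI[of _ "F \<union> G"] conjI allI impI finite_UnI)
qed

end

text \<open>A matrix corepresentation: the coefficients of a comodule with respect to a basis.\<close>

definition matrix_corep :: "('k::field, 'c::ab_group_add) coalg => nat => (nat => nat => 'c) => bool" where
 "matrix_corep C d ec \<longleftrightarrow> (\<forall>i<d. \<forall>j<d.
   comult C (ec i j) = (\<Oplus>\<^bsub>tensor (coalg_space C) (coalg_space C)\<^esub>k\<in>{..<d}.
    pure (coalg_space C) (coalg_space C) (ec i k) (ec k j)) \<and>
   counit C (ec i j) = (if i = j then 1 else 0))"

locale galois_corep = galois_extension C P g l
 for C :: "('k::field_char_0, 'c::ab_group_add) coalg"
  and P :: "('k, 'p::{ring,monoid_mult}, 'c) comod_alg" and g :: 'c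
  and l :: "'c => (('p \<times> 'p) \<Rightarrow>\<^sub>0 int) set" +
 fixes d :: nat and ec :: "nat => nat => 'c"
 assumes corep: "matrix_corep C d ec"
begin

lemma comult_ec: "i < d ==> j < d ==> comult C (ec i j) = (\<Oplus>\<^bsub>SS.T\<^esub>k\<in>{..<d}. pure S S (ec i k) (ec k j))"
 and counit_ec: "i < d ==> j < d ==> counit C (ec i j) = (if i = j then 1 else 0)"
 using corep by (auto simp: matrix_corep_def)

text \<open>The colinear maps from the corepresentation to \<open>P\<close>, described by the images of the basis.\<close>

definition "tuples = {h. (\<forall>j\<ge>d. h j = 0) \<and> (\<forall>j<d. \<Delta> (h j) = (\<Oplus>\<^bsub>AS.T\<^esub>k\<in>{..<d}. pAS (h k) (ec k j)))}"

lemma pAS_Pi: "(\<lambda>k. pAS (f k) (c k)) \<in> I \<rightarrow> carrier AS.T"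
 using pAS_closed by auto

lemma tuples_add: assumes "h \<in> tuples" "h' \<in> tuples" shows "(\<lambda>j. h j + h' j) \<in> tuples"
proof -
 have "\<Delta> (h j + h' j) = (\<Oplus>\<^bsub>AS.T\<^esub>k\<in>{..<d}. pAS (h k + h' k) (ec k j))" if j: "j < d" for j
 proof -
  have "\<Delta> (h j + h' j) = (\<Oplus>\<^bsub>AS.T\<^esub>k\<in>{..<d}. pAS (h k) (ec k j)) \<oplus>\<^bsub>AS.T\<^esub> (\<Oplus>\<^bsub>AS.T\<^esub>k\<in>{..<d}. pAS (h' k) (ec k j))"
   using assms j by (simp add: \<Delta>_add tuples_def)
  also have "\<dots> = (\<Oplus>\<^bsub>AS.T\<^esub>k\<in>{..<d}. pAS (h k) (ec k j) \<oplus>\<^bsub>AS.T\<^esub> pAS (h' k) (ec k j))"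
   by (rule AS.T.finsum_addf[OF pAS_Pi pAS_Pi, symmetric])
  also have "\<dots> = (\<Oplus>\<^bsub>AS.T\<^esub>k\<in>{..<d}. pAS (h k + h' k) (ec k j))"
   using AS.pure_add_left by simp
  finally show ?thesis .
 qed
 then show ?thesis using assms by (simp add: tuples_def)
qed

lemma tuples_mult: assumes b: "b \<in> Bc" and h: "h \<in> tuples" shows "(\<lambda>j. b * h j) \<in> tuples"
proof -
 have "\<Delta> (b * h j) = (\<Oplus>\<^bsub>AS.T\<^esub>k\<in>{..<d}. pAS (b * h k) (ec k j))" if j: "j < d" for j
 proof -
  have "\<Delta> (b * h j) = L b (\<Oplus>\<^bsub>AS.T\<^esub>k\<in>{..<d}. pAS (h k) (ec k j))"
   using b h j by (simp add: coinvariant_iff tuples_def)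
  also have "\<dots> = (\<Oplus>\<^bsub>AS.T\<^esub>k\<in>{..<d}. L b (pAS (h k) (ec k j)))"
   by (rule lin_map_finsum[OF AS.abelian_T AS.abelian_T L_linear pAS_Pi]) simp
  finally show ?thesis by (simp add: L_pure)
 qed
 then show ?thesis using h by (simp add: tuples_def)
qed

lemma tuples_zero: "(\<lambda>j. 0) \<in> tuples"
proof -
 have "\<Delta> 0 = \<zero>\<^bsub>AS.T\<^esub>" using \<Delta>_sum[of "{}" "\<lambda>i. 0"] by simp
 moreover have "pAS 0 c = \<zero>\<^bsub>AS.T\<^esub>" for c using AS.pure_zero_left[of c] by simp
 ultimately show ?thesis by (simp add: tuples_def)
qed

abbreviation "fsc r h \<equiv> (\<lambda>j. sc r (h j))"

sublocale F: vector_space "\<lambda>r (h :: nat => 'p) j. sc r (h j)"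
 by unfold_locales (simp_all add: fun_eq_iff P.scale_right_distrib P.scale_left_distrib)

lemma sum_fun_apply: "(\<Sum>i\<in>I. f i) j = (\<Sum>i\<in>I. f i (j :: nat) :: 'p)"
 by (induction I rule: infinite_finite_induct) auto

text \<open>Both legs of the strong connection can be adapted at once: right colinearity makes the right legs
 colinear maps, and left colinearity then governs the left legs.\<close>

lemma strong_connection_expansion:
 obtains M :: nat and a h :: "nat => nat => 'p" where "\<And>i j. i < d ==> j < d ==> l (ec i j) = (\<Oplus>\<^bsub>AA.T\<^esub>\<mu>\<in>{..<M}. pure A A (a i \<mu>) (h \<mu> j))"
  and "\<And>\<mu>. \<mu> < M ==> h \<mu> \<in> tuples"
  and "\<And>i \<mu>. i < d ==> \<mu> < M ==> lc (a i \<mu>) = (\<Oplus>\<^bsub>SA.T\<^esub>k\<in>{..<d}. pure S A (ec i k) (a k \<mu>))"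
proof -
 define r where "r p i j = left_slice A (\<lambda>v. coord v p) (l (ec i j))" for p i j
 define row where "row p i = (\<lambda>j. if j < d then r p i j else 0)" for p i
 have "\<exists>F. finite F \<and> (\<forall>i<d. \<forall>j<d. l (ec i j) = (\<Oplus>\<^bsub>AA.T\<^esub>p\<in>F. pure A A p (r p i j)))"
 proof -
  define good where "good ij F \<longleftrightarrow> finite F \<and> (\<forall>F'. finite F' \<longrightarrow> F \<subseteq> F' \<longrightarrow>
    l (ec (fst ij) (snd ij)) = (\<Oplus>\<^bsub>AA.T\<^esub>p\<in>F'. pure A A p (r p (fst ij) (snd ij))))" for ij F
  have "\<forall>ij. \<exists>F. good ij F"
   unfolding good_def r_def by (intro allI slice_expansion l_closed)
  then have "\<exists>Fn. \<forall>ij. good ij (Fn ij)" by (rule choice)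
  then obtain Fn where good: "\<forall>ij. good ij (Fn ij)" by (elim exE)
  have Fn: "finite (Fn ij)" "\<And>F'. finite F' ==> Fn ij \<subseteq> F' ==>
    l (ec (fst ij) (snd ij)) = (\<Oplus>\<^bsub>AA.T\<^esub>p\<in>F'. pure A A p (r p (fst ij) (snd ij)))" for ij
   using good[rule_format, of ij] unfolding good_def by simp_all
  let ?F = "\<Union>(Fn ` ({..<d} \<times> {..<d}))"
  have "l (ec i j) = (\<Oplus>\<^bsub>AA.T\<^esub>p\<in>?F. pure A A p (r p i j))" if "i < d" "j < d" for i j
  proof -
   have "finite ?F" "Fn (i, j) \<subseteq> ?F" using Fn(1) that by auto
   from Fn(2)[OF this] show ?thesis unfolding fst_conv snd_conv .
  qed
  moreover have "finite ?F" using Fn(1) by auto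
  ultimately show ?thesis by (intro exI[of _ ?F]) simp
 qed
 then obtain F where F: "finite F" "\<And>i j. i < d ==> j < d ==> l (ec i j) = (\<Oplus>\<^bsub>AA.T\<^esub>p\<in>F. pure A A p (r p i j))"
  by (elim exE conjE) simp
 have row: "row p i \<in> tuples" if i: "i < d" for p i
 proof -
  have "\<Delta> (r p i j) = (\<Oplus>\<^bsub>AS.T\<^esub>k\<in>{..<d}. pAS (r p i k) (ec k j))" if j: "j < d" for j
   unfolding r_def by (rule slice_right_colinear[OF coord_linear comult_ec[OF i j] finite_lessThan])
  moreover have "(\<Oplus>\<^bsub>AS.T\<^esub>k\<in>{..<d}. pAS (r p i k) (ec k j)) = (\<Oplus>\<^bsub>AS.T\<^esub>k\<in>{..<d}. pAS (row p i k) (ec k j))" for j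
   by (rule AS.T.finsum_cong'[OF refl pAS_Pi]) (simp add: row_def)
  ultimately show ?thesis by (simp add: tuples_def row_def)
 qed
 obtain BH where BH: "BH \<subseteq> tuples" "F.independent BH" "tuples \<subseteq> F.span BH"
  using F.maximal_independent_subset[of tuples] .
 define full where "full = F.extend_basis BH"
 have full: "F.independent full" "F.span full = UNIV" "BH \<subseteq> full"
  unfolding full_def using F.independent_extend_basis[OF BH(2)] F.span_extend_basis[OF BH(2)] F.extend_basis_superset[OF BH(2)] by auto
 define t where "t p i \<nu> = F.representation full (row p i) \<nu>" for p i \<nu>
 define NS where "NS = (\<Union>p\<in>F. \<Union>i\<in>{..<d}. {\<nu>. t p i \<nu> \<noteq> 0})"
 have NS: "finite NS" "NS \<subseteq> BH"
 proof -
  show "finite NS" unfolding NS_def t_def using F(1) F.finite_representation by (intro finite_UN_I) auto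
  show "NS \<subseteq> BH"
  proof
   fix \<nu> assume "\<nu> \<in> NS"
   then obtain p i where pi: "i < d" "t p i \<nu> \<noteq> 0" by (auto simp: NS_def)
   have "row p i \<in> F.span BH" using row[OF pi(1)] BH(3) by blast
   from F.representation_extend[OF full(1) this full(3)] pi(2)
   show "\<nu> \<in> BH" using F.representation_ne_zero by (metis t_def)
  qed
 qed
 have row_sum: "r p i j = (\<Sum>\<nu>\<in>NS. sc (t p i \<nu>) (\<nu> j))" if "p \<in> F" "i < d" "j < d" for p i j
 proof -
  have "row p i = (\<Sum>\<nu> | t p i \<nu> \<noteq> 0. fsc (t p i \<nu>) \<nu>)"
   unfolding t_def by (rule F.sum_nonzero_representation_eq[OF full(1), symmetric]) (simp add: full(2))
  also have "\<dots> = (\<Sum>\<nu>\<in>NS. fsc (t p i \<nu>) \<nu>)"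
   using that NS(1) by (intro sum.mono_neutral_left) (auto simp: NS_def zero_fun_def)
  finally have "row p i j = (\<Sum>\<nu>\<in>NS. fsc (t p i \<nu>) \<nu>) j" by simp
  then show ?thesis using that by (simp add: row_def sum_fun_apply)
 qed
 define \<psi> where "\<psi> \<nu> j q = F.representation full (\<lambda>k. if k = j then q else 0) \<nu>" for \<nu> j q
 have \<psi>: "lin_map UNIV A ground_space (\<psi> \<nu> j)" for \<nu> j
 proof -
  have "(\<lambda>k. if k = j then x + y else 0) = (\<lambda>k. if k = j then x else 0) + (\<lambda>k. if k = j then y else 0 :: 'p)"
   "(\<lambda>k. if k = j then sc c x else 0) = fsc c (\<lambda>k. if k = j then x else 0)" for x y c
   by (auto simp: fun_eq_iff)
  then show ?thesis using full
   by (simp add: lin_map_def \<psi>_def F.representation_add F.representation_scale)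
 qed
 define a where "a i \<nu> = (\<Sum>j<d. right_slice A (\<psi> \<nu> j) (l (ec i j)))" for i \<nu>
 have a_eq: "a i \<nu> = (\<Sum>p\<in>F. sc (t p i \<nu>) p)" if i: "i < d" for i \<nu>
 proof -
  have "right_slice A (\<psi> \<nu> j) (l (ec i j)) = (\<Sum>p\<in>F. sc (\<psi> \<nu> j (r p i j)) p)" if j: "j < d" for j
  proof -
   have "right_slice A (\<psi> \<nu> j) (l (ec i j)) = (\<Oplus>\<^bsub>A\<^esub>p\<in>F. right_slice A (\<psi> \<nu> j) (pure A A p (r p i j)))"
    unfolding F(2)[OF i j]
    by (rule lin_map_finsum[OF AA.abelian_T AA.V AA.right_slice_linear[OF \<psi>] _ F(1)]) (use AA.pure_closed in auto)
   then show ?thesis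
    using finsum_module_of[OF AA.V F(1), of "\<lambda>p. sc (\<psi> \<nu> j (r p i j)) p"] AA.right_slice_pure[OF \<psi>] by simp
  qed
  then have "a i \<nu> = (\<Sum>j<d. \<Sum>p\<in>F. sc (\<psi> \<nu> j (r p i j)) p)" by (simp add: a_def)
  also have "\<dots> = (\<Sum>p\<in>F. sc (\<Sum>j<d. \<psi> \<nu> j (r p i j)) p)"
   by (subst sum.swap) (simp add: P.scale_sum_left)
  also have "\<dots> = (\<Sum>p\<in>F. sc (t p i \<nu>) p)"
  proof -
   have "(\<Sum>j<d. \<psi> \<nu> j (r p i j)) = t p i \<nu>" for p
   proof -
    have "row p i = (\<Sum>j<d. (\<lambda>k. if k = j then r p i j else 0))"
     by (auto simp: fun_eq_iff sum_fun_apply row_def sum.delta)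
    then show ?thesis unfolding t_def \<psi>_def using full by (simp add: F.representation_sum)
   qed
   then show ?thesis by simp
  qed
  finally show ?thesis .
 qed
 have expand: "l (ec i j) = (\<Oplus>\<^bsub>AA.T\<^esub>\<nu>\<in>NS. pure A A (a i \<nu>) (\<nu> j))" if i: "i < d" and j: "j < d" for i j
 proof -
  have "l (ec i j) = (\<Oplus>\<^bsub>AA.T\<^esub>p\<in>F. \<Oplus>\<^bsub>AA.T\<^esub>\<nu>\<in>NS. pure A A (sc (t p i \<nu>) p) (\<nu> j))"
   unfolding F(2)[OF i j]
  proof (rule AA.T.finsum_cong'[OF refl])
   show "(\<lambda>p. \<Oplus>\<^bsub>AA.T\<^esub>\<nu>\<in>NS. pure A A (sc (t p i \<nu>) p) (\<nu> j)) \<in> F \<rightarrow> carrier AA.T"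
    using AA.pure_closed by (auto intro!: AA.T.finsum_closed)
   fix p assume p: "p \<in> F"
   have "pure A A p (r p i j) = pure A A p (\<Oplus>\<^bsub>A\<^esub>\<nu>\<in>NS. sc (t p i \<nu>) (\<nu> j))"
    using finsum_module_of[OF AA.V NS(1), of "\<lambda>\<nu>. sc (t p i \<nu>) (\<nu> j)"] by (simp add: row_sum[OF p i j])
   also have "\<dots> = (\<Oplus>\<^bsub>AA.T\<^esub>\<nu>\<in>NS. pure A A p (sc (t p i \<nu>) (\<nu> j)))"
    by (rule AA.pure_finsum_right[OF NS(1)]) auto
   also have "\<dots> = (\<Oplus>\<^bsub>AA.T\<^esub>\<nu>\<in>NS. pure A A (sc (t p i \<nu>) p) (\<nu> j))"
    using AA.pure_balanced by simp
   finally show "pure A A p (r p i j) = (\<Oplus>\<^bsub>AA.T\<^esub>\<nu>\<in>NS. pure A A (sc (t p i \<nu>) p) (\<nu> j))" .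
  qed
  also have "\<dots> = (\<Oplus>\<^bsub>AA.T\<^esub>\<nu>\<in>NS. \<Oplus>\<^bsub>AA.T\<^esub>p\<in>F. pure A A (sc (t p i \<nu>) p) (\<nu> j))"
   by (rule AA.T.finsum_swap[OF F(1) NS(1)]) (use AA.pure_closed in auto)
  also have "\<dots> = (\<Oplus>\<^bsub>AA.T\<^esub>\<nu>\<in>NS. pure A A (a i \<nu>) (\<nu> j))"
  proof (rule AA.T.finsum_cong'[OF refl])
   show "(\<lambda>\<nu>. pure A A (a i \<nu>) (\<nu> j)) \<in> NS \<rightarrow> carrier AA.T" using AA.pure_closed by auto
   fix \<nu>
   show "(\<Oplus>\<^bsub>AA.T\<^esub>p\<in>F. pure A A (sc (t p i \<nu>) p) (\<nu> j)) = pure A A (a i \<nu>) (\<nu> j)"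
    using AA.pure_finsum_left[OF F(1), of "\<lambda>p. sc (t p i \<nu>) p" "\<nu> j"]
     finsum_module_of[OF AA.V F(1), of "\<lambda>p. sc (t p i \<nu>) p"] by (simp add: a_eq[OF i])
  qed
  finally show ?thesis .
 qed
 have left: "lc (a i \<nu>) = (\<Oplus>\<^bsub>SA.T\<^esub>k\<in>{..<d}. pure S A (ec i k) (a k \<nu>))" if i: "i < d" for i \<nu>
 proof -
  let ?s = "\<lambda>k j. right_slice A (\<psi> \<nu> j) (l (ec k j))"
  have sum: "a i \<nu> = (\<Oplus>\<^bsub>A\<^esub>j\<in>{..<d}. ?s i j)" for i
   using finsum_module_of[OF AA.V finite_lessThan, of d "?s i"] by (simp add: a_def)
  have "lc (a i \<nu>) = (\<Oplus>\<^bsub>SA.T\<^esub>j\<in>{..<d}. lc (?s i j))"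
   unfolding sum by (rule lin_map_finsum[OF AA.V SA.abelian_T lc_linear]) auto
  also have "\<dots> = (\<Oplus>\<^bsub>SA.T\<^esub>j\<in>{..<d}. \<Oplus>\<^bsub>SA.T\<^esub>k\<in>{..<d}. pure S A (ec i k) (?s k j))"
   by (rule SA.T.finsum_cong'[OF refl])
    (use SA.pure_closed in \<open>auto intro!: SA.T.finsum_closed slice_left_colinear[OF \<psi> comult_ec[OF i] finite_lessThan]\<close>)
  also have "\<dots> = (\<Oplus>\<^bsub>SA.T\<^esub>k\<in>{..<d}. \<Oplus>\<^bsub>SA.T\<^esub>j\<in>{..<d}. pure S A (ec i k) (?s k j))"
   by (rule SA.T.finsum_swap) (use SA.pure_closed in auto)
  also have "\<dots> = (\<Oplus>\<^bsub>SA.T\<^esub>k\<in>{..<d}. pure S A (ec i k) (a k \<nu>))"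
  proof (rule SA.T.finsum_cong'[OF refl])
   show "(\<lambda>k. pure S A (ec i k) (a k \<nu>)) \<in> {..<d} \<rightarrow> carrier SA.T" using SA.pure_closed by auto
   fix k
   show "(\<Oplus>\<^bsub>SA.T\<^esub>j\<in>{..<d}. pure S A (ec i k) (?s k j)) = pure S A (ec i k) (a k \<nu>)"
    unfolding sum by (rule SA.pure_finsum_right[symmetric]) auto
  qed
  finally show ?thesis .
 qed
 obtain en where en: "bij_betw en {..<card NS} NS"
  using ex_bij_betw_nat_finite[OF NS(1)] by (auto simp: atLeast0LessThan)
 show ?thesis
 proof (rule that[of "\<lambda>i \<mu>. a i (en \<mu>)" en "card NS"])
  fix i j assume ij: "i < d" "j < d"
  have "(\<Oplus>\<^bsub>AA.T\<^esub>\<nu>\<in>NS. pure A A (a i \<nu>) (\<nu> j)) = (\<Oplus>\<^bsub>AA.T\<^esub>\<mu>\<in>{..<card NS}. pure A A (a i (en \<mu>)) (en \<mu> j))"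
   using AA.T.add.finprod_reindex[of "\<lambda>\<nu>. pure A A (a i \<nu>) (\<nu> j)" en "{..<card NS}"] en AA.pure_closed
   by (auto simp: bij_betw_def finsum_def)
  then show "l (ec i j) = (\<Oplus>\<^bsub>AA.T\<^esub>\<mu>\<in>{..<card NS}. pure A A (a i (en \<mu>)) (en \<mu> j))"
   using expand[OF ij] by simp
 next
  fix \<mu> assume "\<mu> < card NS"
  then show "en \<mu> \<in> tuples" using en NS(2) BH(1) by (auto simp: bij_betw_def)
 next
  fix i \<mu> assume "i < d"
  then show "lc (a i (en \<mu>)) = (\<Oplus>\<^bsub>SA.T\<^esub>k\<in>{..<d}. pure S A (ec i k) (a k (en \<mu>)))" by (rule left)
 qed
qed

text \<open>The coaction of \<open>f\<^sub>j a\<^sub>j q\<close> is \<open>\<Delta> f\<^sub>j\<close> acted on by \<open>a\<^sub>j q\<close>. The coaction of \<open>f\<close> produces \<open>e\<^sub>k\<^sub>j\<close>, and the sum over \<open>j\<close> of \<open>\<psi> (e\<^sub>k\<^sub>j \<otimes> a\<^sub>j)\<close> is \<open>a\<^sub>k \<otimes> g\<close> by the left coaction of \<open>a\<close>; acting on it by \<open>q\<close> yields \<open>a\<^sub>k \<Delta> q\<close>.\<close>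

lemma coinvariant_sum:
 assumes f: "f \<in> tuples" and a: "\<And>i. i < d ==> lc (a i) = (\<Oplus>\<^bsub>SA.T\<^esub>k\<in>{..<d}. pure S A (ec i k) (a k))"
 shows "(\<Sum>j<d. f j * a j) \<in> Bc"
 unfolding coinvariant_iff
proof
 fix q
 have ent: "pAS (a k) g = (\<Oplus>\<^bsub>AS.T\<^esub>j\<in>{..<d}. act (pAS 1 (ec k j)) (a j))" if "k < d" for k
 proof -
  have "pAS (a k) g = entwining C P (\<Oplus>\<^bsub>SA.T\<^esub>j\<in>{..<d}. pure S A (ec k j) (a j))"
   using ent_lc[of "a k"] a[OF that] by simp
  also have "\<dots> = (\<Oplus>\<^bsub>AS.T\<^esub>j\<in>{..<d}. entwining C P (pure S A (ec k j) (a j)))"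
   by (rule lin_map_finsum[OF SA.abelian_T AS.abelian_T ent_linear]) (use SA.pure_closed in auto)
  finally show ?thesis by (simp add: ent_pure)
 qed
 have cl: "(\<lambda>k. act (X k) p) \<in> I \<rightarrow> carrier AS.T" if "\<And>k. X k \<in> carrier AS.T" for X p and I :: "nat set"
  using act_closed that by auto
 have "\<Delta> ((\<Sum>j<d. f j * a j) * q) = (\<Oplus>\<^bsub>AS.T\<^esub>j\<in>{..<d}. \<Delta> (f j * (a j * q)))"
  by (simp add: sum_distrib_right \<Delta>_sum mult.assoc)
 also have "\<dots> = (\<Oplus>\<^bsub>AS.T\<^esub>j\<in>{..<d}. \<Oplus>\<^bsub>AS.T\<^esub>k\<in>{..<d}. L (f k) (act (pAS 1 (ec k j)) (a j * q)))"
 proof (rule AS.T.finsum_cong'[OF refl])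
  show "(\<lambda>j. \<Oplus>\<^bsub>AS.T\<^esub>k\<in>{..<d}. L (f k) (act (pAS 1 (ec k j)) (a j * q))) \<in> {..<d} \<rightarrow> carrier AS.T"
   by (auto intro!: AS.T.finsum_closed L_closed act_closed pAS_closed)
  fix j assume j: "j \<in> {..<d}"
  have "\<Delta> (f j * (a j * q)) = act (\<Oplus>\<^bsub>AS.T\<^esub>k\<in>{..<d}. pAS (f k) (ec k j)) (a j * q)"
   using f j by (simp add: act_\<Delta>[symmetric] tuples_def)
  also have "\<dots> = (\<Oplus>\<^bsub>AS.T\<^esub>k\<in>{..<d}. act (pAS (f k) (ec k j)) (a j * q))"
   by (rule lin_map_finsum[OF AS.abelian_T AS.abelian_T act_additive pAS_Pi]) simp
  also have "\<dots> = (\<Oplus>\<^bsub>AS.T\<^esub>k\<in>{..<d}. L (f k) (act (pAS 1 (ec k j)) (a j * q)))"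
   using act_L[OF pAS_closed] by (subst pAS_L) simp
  finally show "\<Delta> (f j * (a j * q)) = (\<Oplus>\<^bsub>AS.T\<^esub>k\<in>{..<d}. L (f k) (act (pAS 1 (ec k j)) (a j * q)))" .
 qed
 also have "\<dots> = (\<Oplus>\<^bsub>AS.T\<^esub>k\<in>{..<d}. \<Oplus>\<^bsub>AS.T\<^esub>j\<in>{..<d}. L (f k) (act (pAS 1 (ec k j)) (a j * q)))"
  by (rule AS.T.finsum_swap) (auto intro!: L_closed act_closed pAS_closed)
 also have "\<dots> = (\<Oplus>\<^bsub>AS.T\<^esub>k\<in>{..<d}. L (f k * a k) (\<Delta> q))"
 proof (rule AS.T.finsum_cong'[OF refl])
  show "(\<lambda>k. L (f k * a k) (\<Delta> q)) \<in> {..<d} \<rightarrow> carrier AS.T" by (auto intro!: L_closed \<Delta>_closed)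
  fix k assume k: "k \<in> {..<d}"
  have "(\<Oplus>\<^bsub>AS.T\<^esub>j\<in>{..<d}. L (f k) (act (pAS 1 (ec k j)) (a j * q)))
    = (\<Oplus>\<^bsub>AS.T\<^esub>j\<in>{..<d}. L (f k) (act (act (pAS 1 (ec k j)) (a j)) q))"
   by (simp add: act_act pAS_closed)
  also have "\<dots> = L (f k) (act (\<Oplus>\<^bsub>AS.T\<^esub>j\<in>{..<d}. act (pAS 1 (ec k j)) (a j)) q)"
   by (rule lin_map_finsum[OF AS.abelian_T AS.abelian_T lin_map_comp[OF act_additive lin_map_additive[OF L_linear]], symmetric])
    (auto intro!: act_closed pAS_closed)
  also have "\<dots> = L (f k) (act (pAS (a k) g) q)" using ent k by simp
  also have "\<dots> = L (f k) (L (a k) (\<Delta> q))"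
   using act_L[OF pAS_closed, of "a k" 1 g q] by (subst pAS_L) (simp add: \<Delta>_act[symmetric])
  finally show "(\<Oplus>\<^bsub>AS.T\<^esub>j\<in>{..<d}. L (f k) (act (pAS 1 (ec k j)) (a j * q))) = L (f k * a k) (\<Delta> q)"
   by (simp add: L_mult \<Delta>_closed)
 qed
 also have "\<dots> = L (\<Sum>j<d. f j * a j) (\<Delta> q)" by (simp add: L_sum \<Delta>_closed)
 finally show "\<Delta> ((\<Sum>j<d. f j * a j) * q) = L (\<Sum>j<d. f j * a j) (\<Delta> q)" .
qed

lemma tuple_counit:
 assumes f: "f \<in> tuples" and j: "j < d"
 shows "f j = (\<Sum>i<d. f i * sc (counit C (ec i j)) 1)"
 using counit_ec[OF _ j] j by (simp add: if_distrib[of "\<lambda>r. sc r 1"] if_distrib[of "\<lambda>x. _ * x"] sum.delta cong: if_cong)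

definition "tuple_module = \<lparr>carrier = tuples, monoid.mult = undefined, one = undefined,
 ring.zero = (\<lambda>j. 0), ring.add = (\<lambda>h h' j. h j + h' j), smult = (\<lambda>b h j. b * h j)\<rparr>"

lemma tuple_module_simps [simp]:
 "carrier tuple_module = tuples" "h \<oplus>\<^bsub>tuple_module\<^esub> h' = (\<lambda>j. h j + h' j)"
 "b \<odot>\<^bsub>tuple_module\<^esub> h = (\<lambda>j. b * h j)" "\<zero>\<^bsub>tuple_module\<^esub> = (\<lambda>j. 0)"
 by (simp_all add: tuple_module_def)

lemma left_module_tuples: "left_module Bc tuple_module"
proof -
 have "abelian_group tuple_module"
 proof (rule abelian_groupI)
  fix h assume "h \<in> carrier tuple_module"
  then have "(\<lambda>j. (- 1) * h j) \<in> tuples" using tuples_mult[OF SB.minus_mem[OF coinvariant_one]] by simp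
  then show "\<exists>y\<in>carrier tuple_module. y \<oplus>\<^bsub>tuple_module\<^esub> h = \<zero>\<^bsub>tuple_module\<^esub>"
   by (intro bexI[of _ "\<lambda>j. (- 1) * h j"]) auto
 qed (auto simp: tuples_add tuples_zero add.assoc add.commute)
 then show ?thesis
  by (auto simp: left_module_def tuples_mult distrib_left distrib_right mult.assoc)
qed

text \<open>The composite is the identity because multiplying the two legs of the strong connection gives the counit.\<close>

lemma tuple_retract:
 obtains M :: nat and a h :: "nat => nat => 'p" where "\<And>i j. i < d ==> j < d ==> l (ec i j) = (\<Oplus>\<^bsub>AA.T\<^esub>\<mu>\<in>{..<M}. pure A A (a i \<mu>) (h \<mu> j))"
  and "retract Bc tuple_module M (\<lambda>f \<mu>. if \<mu> < M then \<Sum>j<d. f j * a j \<mu> else 0) (\<lambda>b j. \<Sum>\<mu><M. b \<mu> * h \<mu> j)"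
proof -
 obtain M :: nat and a h :: "nat => nat => 'p" where l: "\<And>i j. i < d ==> j < d ==> l (ec i j) = (\<Oplus>\<^bsub>AA.T\<^esub>\<mu>\<in>{..<M}. pure A A (a i \<mu>) (h \<mu> j))"
  and h: "\<And>\<mu>. \<mu> < M ==> h \<mu> \<in> tuples"
  and a: "\<And>i \<mu>. i < d ==> \<mu> < M ==> lc (a i \<mu>) = (\<Oplus>\<^bsub>SA.T\<^esub>k\<in>{..<d}. pure S A (ec i k) (a k \<mu>))"
  by (rule strong_connection_expansion) blast
 let ?i = "\<lambda>f \<mu>. if \<mu> < M then \<Sum>j<d. f j * a j \<mu> else 0" and ?q = "\<lambda>b j. \<Sum>\<mu><M. b \<mu> * h \<mu> j"
 have q: "?q b \<in> tuples" if "\<forall>\<mu><M. b \<mu> \<in> Bc" for b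
 proof -
  have "N \<le> M ==> (\<lambda>j. \<Sum>\<mu><N. b \<mu> * h \<mu> j) \<in> tuples" for N
   by (induction N) (use that in \<open>auto simp: tuples_zero intro!: tuples_add tuples_mult h\<close>)
  then show ?thesis by blast
 qed
 have m: "(\<Sum>\<mu><M. a i \<mu> * h \<mu> j) = sc (counit C (ec i j)) 1" if ij: "i < d" "j < d" for i j
 proof -
  have "sc (counit C (ec i j)) 1 = (\<Oplus>\<^bsub>A\<^esub>\<mu>\<in>{..<M}. multAA (pure A A (a i \<mu>) (h \<mu> j)))"
   unfolding mult_l[symmetric] l[OF ij]
   by (rule lin_map_finsum[OF AA.abelian_T AA.V multAA_linear]) (use AA.pure_closed in auto)
  then show ?thesis
   using finsum_module_of[OF AA.V finite_lessThan, of M "\<lambda>\<mu>. a i \<mu> * h \<mu> j"] by (simp add: multAA_pure)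
 qed
 have "retract Bc tuple_module M ?i ?q"
  unfolding retract_def
 proof (intro conjI left_module_tuples ballI)
  show "lin_map Bc tuple_module (free_module Bc M) ?i"
   unfolding lin_map_def using coinvariant_sum[OF _ a]
   by (auto simp: distrib_right sum.distrib sum_distrib_left mult.assoc fun_eq_iff)
  show "lin_map Bc (free_module Bc M) tuple_module ?q"
   unfolding lin_map_def using q by (auto simp: distrib_right sum.distrib sum_distrib_left mult.assoc fun_eq_iff)
  fix f assume "f \<in> carrier tuple_module"
  then have f: "f \<in> tuples" by simp
  show "?q (?i f) = f"
  proof
   fix j
   show "?q (?i f) j = f j"
   proof (cases "j < d")
    case True
    have "?q (?i f) j = (\<Sum>\<mu><M. \<Sum>i<d. f i * (a i \<mu> * h \<mu> j))"
     by (simp add: sum_distrib_right mult.assoc)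
    also have "\<dots> = (\<Sum>i<d. f i * (\<Sum>\<mu><M. a i \<mu> * h \<mu> j))"
     by (subst sum.swap) (simp add: sum_distrib_left)
    also have "\<dots> = f j" using tuple_counit[OF f True] True by (simp add: m)
    finally show ?thesis .
   next
    case False
    then show ?thesis using f h by (simp add: tuples_def)
   qed
  qed
 qed
 with l show ?thesis by (rule that)
qed

end

section \<open>Finite-dimensional comodules and their matrices\<close>

lemma (in abelian_monoid) finsum_delta:
 fixes j n :: nat
 assumes "j < n" "f j \<in> carrier G"
 shows "(\<Oplus>i\<in>{..<n}. if i = j then f i else \<zero>) = f j"
proof -
 have "(\<Oplus>i\<in>{..<n}. if i = j then f i else \<zero>) = (\<Oplus>i\<in>{..<n}. if j = i then f j else \<zero>)"
  by (rule finsum_cong') (use assms in auto)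
 then show ?thesis using finsum_singleton[of j "{..<n}" "\<lambda>_. f j"] assms by simp
qed

lemma (in abelian_monoid) finsum_append:
 fixes m n :: nat
 assumes "\<And>k. f k \<in> carrier G"
 shows "(\<Oplus>k\<in>{..<m + n}. f k) = (\<Oplus>k\<in>{..<m}. f k) \<oplus> (\<Oplus>k\<in>{..<n}. f (m + k))"
proof (induction n)
 case 0
 show ?case using assms by (simp add: finsum_closed)
next
 case (Suc n)
 have c: "(\<Oplus>k\<in>{..<m}. f k) \<in> carrier G" "(\<Oplus>k\<in>{..<n}. f (m + k)) \<in> carrier G" using assms by (auto intro!: finsum_closed)
 have "(\<Oplus>k\<in>{..<m + Suc n}. f k) = f (m + n) \<oplus> (\<Oplus>k\<in>{..<m + n}. f k)"
  using assms by (simp add: lessThan_Suc)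
 moreover have "(\<Oplus>k\<in>{..<Suc n}. f (m + k)) = f (m + n) \<oplus> (\<Oplus>k\<in>{..<n}. f (m + k))"
  using assms by (simp add: lessThan_Suc)
 ultimately show ?case using assms c by (simp add: Suc a_lcomm)
qed

lemma lin_map_sum:
 assumes N: "left_module R N" and f: "\<And>i. i \<in> I ==> lin_map R M N (f i)" and I: "finite I"
 shows "lin_map R M N (\<lambda>x. \<Oplus>\<^bsub>N\<^esub>i\<in>I. f i x)"
proof -
 interpret abelian_group N by (rule left_module_group[OF N])
 have c: "(\<lambda>i. f i x) \<in> I \<rightarrow> carrier N" if "x \<in> carrier M" for x
  using lin_map_closed[OF f that] by auto
 show ?thesis unfolding lin_map_def
 proof (intro conjI ballI)
  show "(\<lambda>x. \<Oplus>\<^bsub>N\<^esub>i\<in>I. f i x) \<in> carrier M \<rightarrow> carrier N" by (auto intro!: finsum_closed simp: lin_map_closed[OF f])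
 next
  fix x assume x: "x \<in> carrier M"
  show "(\<Oplus>\<^bsub>N\<^esub>i\<in>I. f i (x \<oplus>\<^bsub>M\<^esub> y)) = (\<Oplus>\<^bsub>N\<^esub>i\<in>I. f i x) \<oplus>\<^bsub>N\<^esub> (\<Oplus>\<^bsub>N\<^esub>i\<in>I. f i y)" if y: "y \<in> carrier M" for y
  proof -
   have "(\<Oplus>\<^bsub>N\<^esub>i\<in>I. f i (x \<oplus>\<^bsub>M\<^esub> y)) = (\<Oplus>\<^bsub>N\<^esub>i\<in>I. f i x \<oplus>\<^bsub>N\<^esub> f i y)"
    by (rule finsum_cong'[OF refl]) (use c[OF x] c[OF y] lin_map_add[OF f x y] in \<open>auto intro!: a_closed\<close>)
   then show ?thesis using finsum_addf[OF c[OF x] c[OF y]] by simp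
  qed
 next
  fix r x assume r: "r \<in> R" and x: "x \<in> carrier M"
  show "(\<Oplus>\<^bsub>N\<^esub>i\<in>I. f i (r \<odot>\<^bsub>M\<^esub> x)) = r \<odot>\<^bsub>N\<^esub> (\<Oplus>\<^bsub>N\<^esub>i\<in>I. f i x)"
  proof -
   have s: "lin_map {} N N ((\<odot>\<^bsub>N\<^esub>) r)" using N r by (auto simp: lin_map_def left_module_def)
   have "(\<Oplus>\<^bsub>N\<^esub>i\<in>I. f i (r \<odot>\<^bsub>M\<^esub> x)) = (\<Oplus>\<^bsub>N\<^esub>i\<in>I. r \<odot>\<^bsub>N\<^esub> f i x)"
    by (rule finsum_cong'[OF refl]) (use c[OF x] lin_map_closed[OF s] lin_map_smult[OF f r x] in auto)
   then show ?thesis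
    using lin_map_finsum[OF abelian_group_axioms abelian_group_axioms s c[OF x] I] by simp
  qed
 qed
qed

definition coordinate :: "('k::field, 'v, 'z) module_scheme => nat => (nat => 'v) => 'v => nat => 'k" where
 "coordinate V d e v = (THE a. a \<in> {..<d} \<rightarrow>\<^sub>E UNIV \<and> v = (\<Oplus>\<^bsub>V\<^esub>i\<in>{..<d}. a i \<odot>\<^bsub>V\<^esub> e i))"

lemma kronecker_sum:
 assumes M: "left_module (UNIV :: 'k::field set) M" and m: "\<And>i. i < d ==> m i \<in> carrier M" and j: "j < (d :: nat)"
 shows "(\<Oplus>\<^bsub>M\<^esub>i\<in>{..<d}. (if i = j then 1 else 0 :: 'k) \<odot>\<^bsub>M\<^esub> m i) = m j"
proof -
 interpret abelian_group M by (rule left_module_group[OF M])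
 have z: "0 \<odot>\<^bsub>M\<^esub> x = \<zero>\<^bsub>M\<^esub>" if x: "x \<in> carrier M" for x
 proof -
  have "(0 + 0) \<odot>\<^bsub>M\<^esub> x = 0 \<odot>\<^bsub>M\<^esub> x \<oplus>\<^bsub>M\<^esub> 0 \<odot>\<^bsub>M\<^esub> x" "0 \<odot>\<^bsub>M\<^esub> x \<in> carrier M" using M x unfolding left_module_def by blast+
  then show ?thesis by (simp add: add.r_cancel_one')
 qed
 have "1 \<odot>\<^bsub>M\<^esub> x = x" if "x \<in> carrier M" for x using M that unfolding left_module_def by blast
 then have "(\<Oplus>\<^bsub>M\<^esub>i\<in>{..<d}. (if i = j then 1 else 0) \<odot>\<^bsub>M\<^esub> m i) = (\<Oplus>\<^bsub>M\<^esub>i\<in>{..<d}. if i = j then m i else \<zero>\<^bsub>M\<^esub>)"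
  using m z by (intro finsum_cong') auto
 then show ?thesis using finsum_delta[of j d m] m j by simp
qed

locale based_module =
 fixes V :: "('k::field, 'v, 'z) module_scheme" and d :: nat and e :: "nat => 'v"
 assumes Vm: "left_module UNIV V" and basis: "is_basis V d e"
begin

sublocale V: abelian_group V by (rule left_module_group[OF Vm])

lemma e_closed: "i < d ==> e i \<in> carrier V"
 using basis by (auto simp: is_basis_def)

lemma smult_closed: "v \<in> carrier V ==> r \<odot>\<^bsub>V\<^esub> v \<in> carrier V"
 by (rule left_module_smult_closed[OF Vm]) auto

lemma comb_Pi: "(\<lambda>i. a i \<odot>\<^bsub>V\<^esub> e i) \<in> {..<d} \<rightarrow> carrier V"
 by (auto intro: smult_closed e_closed)

lemma comb_closed: "(\<Oplus>\<^bsub>V\<^esub>i\<in>{..<d}. a i \<odot>\<^bsub>V\<^esub> e i) \<in> carrier V"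
 by (rule V.finsum_closed[OF comb_Pi])

lemma coordinate:
 assumes "v \<in> carrier V"
 shows "v = (\<Oplus>\<^bsub>V\<^esub>i\<in>{..<d}. coordinate V d e v i \<odot>\<^bsub>V\<^esub> e i)"
proof -
 have "\<exists>!a. a \<in> {..<d} \<rightarrow>\<^sub>E UNIV \<and> v = (\<Oplus>\<^bsub>V\<^esub>i\<in>{..<d}. a i \<odot>\<^bsub>V\<^esub> e i)"
  using basis assms unfolding is_basis_def by blast
 from theI'[OF this] show ?thesis unfolding coordinate_def by (elim conjE)
qed

lemma coordinate_unique:
 assumes v: "v = (\<Oplus>\<^bsub>V\<^esub>i\<in>{..<d}. a i \<odot>\<^bsub>V\<^esub> e i)" and i: "i < d"
 shows "coordinate V d e v i = a i"
proof -
 have "v \<in> carrier V" unfolding v by (rule comb_closed)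
 then have ex: "\<exists>!a. a \<in> {..<d} \<rightarrow>\<^sub>E UNIV \<and> v = (\<Oplus>\<^bsub>V\<^esub>i\<in>{..<d}. a i \<odot>\<^bsub>V\<^esub> e i)"
  using basis unfolding is_basis_def by blast
 have "v = (\<Oplus>\<^bsub>V\<^esub>i\<in>{..<d}. restrict a {..<d} i \<odot>\<^bsub>V\<^esub> e i)"
  unfolding v by (rule V.finsum_cong'[OF refl]) (use comb_Pi in auto)
 then have "coordinate V d e v = restrict a {..<d}"
  unfolding coordinate_def by (intro the1_equality[OF ex]) auto
 then show ?thesis using i by simp
qed

lemma coordinate_basis: "j < d ==> i < d ==> coordinate V d e (e j) i = (if i = j then 1 else 0)"
 by (rule coordinate_unique, rule kronecker_sum[OF Vm e_closed, symmetric])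

lemma coordinate_linear:
 assumes i: "i < d"
 shows "lin_map UNIV V ground_space (\<lambda>v. coordinate V d e v i)"
 unfolding lin_map_def
proof (intro conjI ballI)
 fix x y assume x: "x \<in> carrier V" and y: "y \<in> carrier V"
 let ?c = "coordinate V d e"
 have dist: "(?c x i + ?c y i) \<odot>\<^bsub>V\<^esub> e i = ?c x i \<odot>\<^bsub>V\<^esub> e i \<oplus>\<^bsub>V\<^esub> ?c y i \<odot>\<^bsub>V\<^esub> e i" if "i < d" for i
  using Vm e_closed[OF that] unfolding left_module_def by blast
 have "x \<oplus>\<^bsub>V\<^esub> y = (\<Oplus>\<^bsub>V\<^esub>i\<in>{..<d}. ?c x i \<odot>\<^bsub>V\<^esub> e i) \<oplus>\<^bsub>V\<^esub> (\<Oplus>\<^bsub>V\<^esub>i\<in>{..<d}. ?c y i \<odot>\<^bsub>V\<^esub> e i)"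
  using coordinate[OF x] coordinate[OF y] by simp
 also have "\<dots> = (\<Oplus>\<^bsub>V\<^esub>i\<in>{..<d}. ?c x i \<odot>\<^bsub>V\<^esub> e i \<oplus>\<^bsub>V\<^esub> ?c y i \<odot>\<^bsub>V\<^esub> e i)"
  by (rule V.finsum_addf[OF comb_Pi comb_Pi, symmetric])
 also have "\<dots> = (\<Oplus>\<^bsub>V\<^esub>i\<in>{..<d}. (?c x i + ?c y i) \<odot>\<^bsub>V\<^esub> e i)"
  by (rule V.finsum_cong'[OF refl comb_Pi]) (simp add: dist)
 finally show "?c (x \<oplus>\<^bsub>V\<^esub> y) i = ?c x i \<oplus>\<^bsub>ground_space\<^esub> ?c y i"
  using coordinate_unique[OF _ i] by simp
next
 fix r :: 'k and x assume x: "x \<in> carrier V"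
 let ?c = "coordinate V d e"
 have sm: "(r * ?c x i) \<odot>\<^bsub>V\<^esub> e i = r \<odot>\<^bsub>V\<^esub> (?c x i \<odot>\<^bsub>V\<^esub> e i)" if "i < d" for i
  using Vm e_closed[OF that] unfolding left_module_def by blast
 have "r \<odot>\<^bsub>V\<^esub> x = r \<odot>\<^bsub>V\<^esub> (\<Oplus>\<^bsub>V\<^esub>i\<in>{..<d}. ?c x i \<odot>\<^bsub>V\<^esub> e i)" using coordinate[OF x] by simp
 also have "\<dots> = (\<Oplus>\<^bsub>V\<^esub>i\<in>{..<d}. r \<odot>\<^bsub>V\<^esub> (?c x i \<odot>\<^bsub>V\<^esub> e i))"
  by (rule lin_map_finsum[OF V.abelian_group_axioms V.abelian_group_axioms smult_linear(1)[OF Vm] comb_Pi]) simp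
 also have "\<dots> = (\<Oplus>\<^bsub>V\<^esub>i\<in>{..<d}. (r * ?c x i) \<odot>\<^bsub>V\<^esub> e i)"
  by (rule V.finsum_cong'[OF refl comb_Pi]) (simp add: sm)
 finally show "?c (r \<odot>\<^bsub>V\<^esub> x) i = r \<odot>\<^bsub>ground_space\<^esub> ?c x i"
  using coordinate_unique[OF _ i] by simp
qed simp

lemma lin_eqI:
 assumes M: "abelian_group M" and f: "lin_map UNIV V M f" "lin_map UNIV V M f'"
  and eq: "\<And>j. j < d ==> f (e j) = f' (e j)" and v: "v \<in> carrier V"
 shows "f v = f' v"
proof -
 interpret M: abelian_group M by fact
 have s: "h v = (\<Oplus>\<^bsub>M\<^esub>j\<in>{..<d}. coordinate V d e v j \<odot>\<^bsub>M\<^esub> h (e j))" if h: "lin_map UNIV V M h" for h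
 proof -
  have "h v = (\<Oplus>\<^bsub>M\<^esub>j\<in>{..<d}. h (coordinate V d e v j \<odot>\<^bsub>V\<^esub> e j))"
   by (subst coordinate[OF v]) (rule lin_map_finsum[OF V.abelian_group_axioms M h comb_Pi finite_lessThan])
  also have "\<dots> = (\<Oplus>\<^bsub>M\<^esub>j\<in>{..<d}. coordinate V d e v j \<odot>\<^bsub>M\<^esub> h (e j))"
  proof (rule M.finsum_cong'[OF refl])
   have c: "h (coordinate V d e v j \<odot>\<^bsub>V\<^esub> e j) \<in> carrier M" if "j < d" for j
    by (rule lin_map_closed[OF h smult_closed[OF e_closed[OF that]]])
   have e: "h (coordinate V d e v j \<odot>\<^bsub>V\<^esub> e j) = coordinate V d e v j \<odot>\<^bsub>M\<^esub> h (e j)" if "j < d" for j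
    by (rule lin_map_smult[OF h UNIV_I e_closed[OF that]])
   show "(\<lambda>j. coordinate V d e v j \<odot>\<^bsub>M\<^esub> h (e j)) \<in> {..<d} \<rightarrow> carrier M" using c e by auto
   show "h (coordinate V d e v j \<odot>\<^bsub>V\<^esub> e j) = coordinate V d e v j \<odot>\<^bsub>M\<^esub> h (e j)" if "j \<in> {..<d}" for j
    using e that by simp
  qed
  finally show ?thesis .
 qed
 have "(\<Oplus>\<^bsub>M\<^esub>j\<in>{..<d}. coordinate V d e v j \<odot>\<^bsub>M\<^esub> f (e j)) = (\<Oplus>\<^bsub>M\<^esub>j\<in>{..<d}. coordinate V d e v j \<odot>\<^bsub>M\<^esub> f' (e j))"
 proof (rule M.finsum_cong'[OF refl])
  have "f' (coordinate V d e v j \<odot>\<^bsub>V\<^esub> e j) \<in> carrier M" "f' (coordinate V d e v j \<odot>\<^bsub>V\<^esub> e j) = coordinate V d e v j \<odot>\<^bsub>M\<^esub> f' (e j)"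
   if "j < d" for j
   using lin_map_closed[OF f(2) smult_closed[OF e_closed[OF that]]] lin_map_smult[OF f(2) UNIV_I e_closed[OF that]] by auto
  then show "(\<lambda>j. coordinate V d e v j \<odot>\<^bsub>M\<^esub> f' (e j)) \<in> {..<d} \<rightarrow> carrier M" by auto
 qed (simp add: eq)
 then show ?thesis using s[OF f(1)] s[OF f(2)] by simp
qed

lemma
 assumes M: "left_module UNIV M" and m: "\<And>j. j < d ==> m j \<in> carrier M"
 shows extension_linear: "lin_map UNIV V M (\<lambda>v. \<Oplus>\<^bsub>M\<^esub>j\<in>{..<d}. coordinate V d e v j \<odot>\<^bsub>M\<^esub> m j)"
  and extension_basis: "\<And>j. j < d ==> (\<Oplus>\<^bsub>M\<^esub>i\<in>{..<d}. coordinate V d e (e j) i \<odot>\<^bsub>M\<^esub> m i) = m j"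
proof -
 interpret M: abelian_group M by (rule left_module_group[OF M])
 show "lin_map UNIV V M (\<lambda>v. \<Oplus>\<^bsub>M\<^esub>j\<in>{..<d}. coordinate V d e v j \<odot>\<^bsub>M\<^esub> m j)"
  by (rule lin_map_sum[OF M]) (use lin_map_comp[OF coordinate_linear smult_linear(2)[OF M m]] in auto)
 show "(\<Oplus>\<^bsub>M\<^esub>i\<in>{..<d}. coordinate V d e (e j) i \<odot>\<^bsub>M\<^esub> m i) = m j" if j: "j < d" for j
 proof -
  have "(\<Oplus>\<^bsub>M\<^esub>i\<in>{..<d}. coordinate V d e (e j) i \<odot>\<^bsub>M\<^esub> m i) = (\<Oplus>\<^bsub>M\<^esub>i\<in>{..<d}. (if i = j then 1 else 0) \<odot>\<^bsub>M\<^esub> m i)"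
   by (rule M.finsum_cong'[OF refl]) (use left_module_smult_closed[OF M] m j coordinate_basis in auto)
  then show ?thesis using kronecker_sum[OF M m j] by simp
 qed
qed

lemma tensor_coordinates:
 assumes W: "left_module UNIV W" and X: "X \<in> carrier (tensor V W)"
 shows "X = (\<Oplus>\<^bsub>tensor V W\<^esub>i\<in>{..<d}. pure V W (e i) (left_slice W (\<lambda>v. coordinate V d e v i) X))"
proof -
 interpret T: tensor_field V W by unfold_locales (rule Vm W)+
 let ?s = "\<lambda>i. left_slice W (\<lambda>v. coordinate V d e v i)"
 have lin: "lin_map UNIV T.T T.T (\<lambda>X. \<Oplus>\<^bsub>T.T\<^esub>i\<in>{..<d}. T.pr (e i) (?s i X))"
  by (rule lin_map_sum[OF T.left_module_T])
   (use lin_map_comp[OF T.left_slice_linear[OF coordinate_linear] T.pure_linear_right[OF e_closed]] in auto)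
 show ?thesis
 proof (rule T.additive_eqI[OF lin_map_id lin _ X])
  fix x y assume x: "x \<in> carrier V" and y: "y \<in> carrier W"
  have "T.pr x y = T.pr (\<Oplus>\<^bsub>V\<^esub>i\<in>{..<d}. coordinate V d e x i \<odot>\<^bsub>V\<^esub> e i) y" using coordinate[OF x] by simp
  also have "\<dots> = (\<Oplus>\<^bsub>T.T\<^esub>i\<in>{..<d}. T.pr (coordinate V d e x i \<odot>\<^bsub>V\<^esub> e i) y)"
   by (rule T.pure_finsum_left[OF finite_lessThan comb_Pi y])
  also have "\<dots> = (\<Oplus>\<^bsub>T.T\<^esub>i\<in>{..<d}. T.pr (e i) (?s i (T.pr x y)))"
   using T.left_slice_pure[OF coordinate_linear x y] T.pure_closed T.Wsmult[OF y] e_closed y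
   by (intro T.T.finsum_cong'[OF refl]) (auto simp: T.pure_balanced)
  finally show "T.pr x y = (\<Oplus>\<^bsub>T.T\<^esub>i\<in>{..<d}. T.pr (e i) (?s i (T.pr x y)))" .
 qed
qed

end

lemma lin_map_plus:
 assumes N: "left_module R N" and f: "lin_map R M N f" and g: "lin_map R M N g"
 shows "lin_map R M N (\<lambda>x. f x \<oplus>\<^bsub>N\<^esub> g x)"
proof -
 interpret abelian_group N by (rule left_module_group[OF N])
 show ?thesis unfolding lin_map_def
 proof (intro conjI ballI)
  show "(\<lambda>x. f x \<oplus>\<^bsub>N\<^esub> g x) \<in> carrier M \<rightarrow> carrier N" using lin_map_closed[OF f] lin_map_closed[OF g] by auto
 next
  fix x y assume x: "x \<in> carrier M" and y: "y \<in> carrier M"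
  show "f (x \<oplus>\<^bsub>M\<^esub> y) \<oplus>\<^bsub>N\<^esub> g (x \<oplus>\<^bsub>M\<^esub> y) = f x \<oplus>\<^bsub>N\<^esub> g x \<oplus>\<^bsub>N\<^esub> (f y \<oplus>\<^bsub>N\<^esub> g y)"
   using lin_map_closed[OF f x] lin_map_closed[OF g x] lin_map_closed[OF f y] lin_map_closed[OF g y]
   unfolding lin_map_add[OF f x y] lin_map_add[OF g x y] by (simp add: a_ac)
 next
  fix r x assume r: "r \<in> R" and x: "x \<in> carrier M"
  show "f (r \<odot>\<^bsub>M\<^esub> x) \<oplus>\<^bsub>N\<^esub> g (r \<odot>\<^bsub>M\<^esub> x) = r \<odot>\<^bsub>N\<^esub> (f x \<oplus>\<^bsub>N\<^esub> g x)"
   using N r lin_map_closed[OF f x] lin_map_closed[OF g x]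
   unfolding lin_map_smult[OF f r x] lin_map_smult[OF g r x] left_module_def by simp
 qed
qed

lemma (in based_module) slice_sum:
 assumes W: "left_module UNIV W" and Y: "\<And>i. i < d ==> Y i \<in> carrier W" and k: "k < d"
 shows "left_slice W (\<lambda>v. coordinate V d e v k) (\<Oplus>\<^bsub>tensor V W\<^esub>i\<in>{..<d}. pure V W (e i) (Y i)) = Y k"
proof -
 interpret T: tensor_field V W by unfold_locales (rule Vm W)+
 let ?s = "left_slice W (\<lambda>v. coordinate V d e v k)"
 have "?s (\<Oplus>\<^bsub>T.T\<^esub>i\<in>{..<d}. T.pr (e i) (Y i)) = (\<Oplus>\<^bsub>W\<^esub>i\<in>{..<d}. ?s (T.pr (e i) (Y i)))"
  by (rule lin_map_finsum[OF T.abelian_T T.W T.left_slice_linear[OF coordinate_linear[OF k]] _ finite_lessThan])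
   (use T.pure_closed e_closed Y in auto)
 also have "\<dots> = (\<Oplus>\<^bsub>W\<^esub>i\<in>{..<d}. (if i = k then 1 else 0) \<odot>\<^bsub>W\<^esub> Y i)"
  using T.left_slice_pure[OF coordinate_linear[OF k]] e_closed Y k T.Wsmult
  by (intro T.W.finsum_cong'[OF refl]) (auto simp: coordinate_basis)
 also have "\<dots> = Y k" by (rule kronecker_sum[OF W Y k])
 finally show ?thesis .
qed

definition comodule_basis ::
 "('k::field, 'c::ab_group_add) coalg => ('k, 'v, 'c, 'z) comod_scheme => nat => (nat => 'v) => (nat => nat => 'c) => bool" where
 "comodule_basis C V d e ec \<longleftrightarrow> is_basis V d e \<and>
   (\<forall>j<d. coact V (e j) = (\<Oplus>\<^bsub>tensor V (coalg_space C)\<^esub>i\<in>{..<d}. pure V (coalg_space C) (e i) (ec i j)))"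

locale field_coalgebra =
 fixes C :: "('k::field, 'c::ab_group_add) coalg"
 assumes coalg: "coalgebra C"
begin

abbreviation "S \<equiv> coalg_space C"

lemma S_module: "left_module UNIV S"
 using coalg by (intro left_module_module_of) (auto simp: coalgebra_def Let_def)

sublocale SS: tensor_field S S by unfold_locales (rule S_module)+

lemma counit_linear: "lin_map UNIV S ground_space (counit C)" and comult_linear: "lin_map UNIV S (tensor S S) (comult C)"
 using coalg by (auto simp: coalgebra_def Let_def)

end

locale matrix_coaction = field_coalgebra C + based_module V d e
 for C :: "('k::field, 'c::ab_group_add) coalg" and V :: "('k, 'v, 'c, 'z) comod_scheme" and d e +
 fixes ec :: "nat => nat => 'c"
 assumes coact_linear: "lin_map UNIV V (tensor V (coalg_space C)) (coact V)"
  and coact_basis: "j < d ==> coact V (e j) = (\<Oplus>\<^bsub>tensor V (coalg_space C)\<^esub>i\<in>{..<d}. pure V (coalg_space C) (e i) (ec i j))"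
begin

sublocale VS: tensor_field V S by unfold_locales (rule Vm S_module)+

sublocale VSS: tensor_field V SS.T by unfold_locales (rule Vm SS.left_module_T)+

sublocale VS_S: tensor_field VS.T S by unfold_locales (rule S_module VS.left_module_T)+

lemma pVS_Pi: "(\<lambda>i. VS.pr (e i) (c i)) \<in> {..<d} \<rightarrow> carrier VS.T"
 using VS.pure_closed e_closed by auto

lemmas coact_id_linear = tensor_map_linear[OF Vm S_module VS.left_module_T S_module coact_linear lin_map_id, folded id_def]
 and coact_id_pure = tensor_map_pure[OF Vm S_module VS.left_module_T S_module coact_linear lin_map_id, folded id_def]

lemmas id_comult_linear = tensor_map_linear[OF Vm S_module Vm SS.left_module_T lin_map_id comult_linear, folded id_def]
 and id_comult_pure = tensor_map_pure[OF Vm S_module Vm SS.left_module_T lin_map_id comult_linear, folded id_def]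

lemmas assoc_linear = tensor_assoc_linear[OF Vm S_module S_module]
 and assoc_pure = tensor_assoc_pure[OF Vm S_module S_module]

lemma coassoc_left:
 assumes j: "j < d"
 shows "tensor_assoc V S S (tensor_map VS.T S (coact V) id (coact V (e j))) =
  (\<Oplus>\<^bsub>VSS.T\<^esub>k\<in>{..<d}. VSS.pr (e k) (\<Oplus>\<^bsub>SS.T\<^esub>i\<in>{..<d}. SS.pr (ec k i) (ec i j)))"
proof -
 have cl: "VSS.pr (e k) (SS.pr x y) \<in> carrier VSS.T" if "k < d" for k x y
  using VSS.pure_closed[OF e_closed[OF that]] SS.pure_closed by simp
 have "tensor_assoc V S S (tensor_map VS.T S (coact V) id (coact V (e j))) =
   (\<Oplus>\<^bsub>VSS.T\<^esub>i\<in>{..<d}. tensor_assoc V S S (tensor_map VS.T S (coact V) id (VS.pr (e i) (ec i j))))"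
  unfolding coact_basis[OF j]
  by (rule lin_map_finsum[OF VS.abelian_T VSS.abelian_T lin_map_comp[OF coact_id_linear assoc_linear] pVS_Pi finite_lessThan])
 also have "\<dots> = (\<Oplus>\<^bsub>VSS.T\<^esub>i\<in>{..<d}. \<Oplus>\<^bsub>VSS.T\<^esub>k\<in>{..<d}. VSS.pr (e k) (SS.pr (ec k i) (ec i j)))"
 proof (rule VSS.T.finsum_cong'[OF refl])
  show "(\<lambda>i. \<Oplus>\<^bsub>VSS.T\<^esub>k\<in>{..<d}. VSS.pr (e k) (SS.pr (ec k i) (ec i j))) \<in> {..<d} \<rightarrow> carrier VSS.T"
   by (auto intro!: VSS.T.finsum_closed cl)
  fix i assume i: "i \<in> {..<d}"
  have "tensor_assoc V S S (tensor_map VS.T S (coact V) id (VS.pr (e i) (ec i j))) = tensor_assoc V S S (VS_S.pr (coact V (e i)) (ec i j))"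
   using i by (simp add: coact_id_pure e_closed)
  also have "\<dots> = (\<Oplus>\<^bsub>VSS.T\<^esub>k\<in>{..<d}. tensor_assoc V S S (VS_S.pr (VS.pr (e k) (ec k i)) (ec i j)))"
  proof -
   have "lin_map UNIV VS.T VSS.T (\<lambda>X. tensor_assoc V S S (VS_S.pr X (ec i j)))"
    by (rule lin_map_comp[OF VS_S.pure_linear_left assoc_linear]) simp
   from lin_map_finsum[OF VS.abelian_T VSS.abelian_T this pVS_Pi finite_lessThan] i
   show ?thesis by (simp add: coact_basis)
  qed
  also have "\<dots> = (\<Oplus>\<^bsub>VSS.T\<^esub>k\<in>{..<d}. VSS.pr (e k) (SS.pr (ec k i) (ec i j)))"
   by (rule VSS.T.finsum_cong'[OF refl]) (auto simp: assoc_pure e_closed cl)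
  finally show "tensor_assoc V S S (tensor_map VS.T S (coact V) id (VS.pr (e i) (ec i j))) =
   (\<Oplus>\<^bsub>VSS.T\<^esub>k\<in>{..<d}. VSS.pr (e k) (SS.pr (ec k i) (ec i j)))" .
 qed
 also have "\<dots> = (\<Oplus>\<^bsub>VSS.T\<^esub>k\<in>{..<d}. \<Oplus>\<^bsub>VSS.T\<^esub>i\<in>{..<d}. VSS.pr (e k) (SS.pr (ec k i) (ec i j)))"
  by (rule VSS.T.finsum_swap) (auto simp: cl)
 also have "\<dots> = (\<Oplus>\<^bsub>VSS.T\<^esub>k\<in>{..<d}. VSS.pr (e k) (\<Oplus>\<^bsub>SS.T\<^esub>i\<in>{..<d}. SS.pr (ec k i) (ec i j)))"
 proof (rule VSS.T.finsum_cong'[OF refl])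
  have p: "(\<lambda>i. SS.pr (ec k i) (ec i j)) \<in> {..<d} \<rightarrow> carrier SS.T" for k using SS.pure_closed by auto
  show "(\<lambda>k. VSS.pr (e k) (\<Oplus>\<^bsub>SS.T\<^esub>i\<in>{..<d}. SS.pr (ec k i) (ec i j))) \<in> {..<d} \<rightarrow> carrier VSS.T"
   using VSS.pure_closed[OF e_closed SS.T.finsum_closed[OF p]] by auto
  show "(\<Oplus>\<^bsub>VSS.T\<^esub>i\<in>{..<d}. VSS.pr (e k) (SS.pr (ec k i) (ec i j))) = VSS.pr (e k) (\<Oplus>\<^bsub>SS.T\<^esub>i\<in>{..<d}. SS.pr (ec k i) (ec i j))"
   if "k \<in> {..<d}" for k
   using VSS.pure_finsum_right[OF finite_lessThan p e_closed] that by simp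
 qed
 finally show ?thesis .
qed

lemma coassoc_right:
 assumes j: "j < d"
 shows "tensor_map V SS.T id (comult C) (coact V (e j)) = (\<Oplus>\<^bsub>VSS.T\<^esub>k\<in>{..<d}. VSS.pr (e k) (comult C (ec k j)))"
proof -
 have "tensor_map V SS.T id (comult C) (coact V (e j)) = (\<Oplus>\<^bsub>VSS.T\<^esub>k\<in>{..<d}. tensor_map V SS.T id (comult C) (VS.pr (e k) (ec k j)))"
  unfolding coact_basis[OF j]
  by (rule lin_map_finsum[OF VS.abelian_T VSS.abelian_T id_comult_linear pVS_Pi finite_lessThan])
 also have "\<dots> = (\<Oplus>\<^bsub>VSS.T\<^esub>k\<in>{..<d}. VSS.pr (e k) (comult C (ec k j)))"
  using VSS.pure_closed[OF e_closed lin_map_closed[OF comult_linear]]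
  by (intro VSS.T.finsum_cong'[OF refl]) (auto simp: id_comult_pure e_closed)
 finally show ?thesis .
qed

lemma counit_sum:
 assumes j: "j < d"
 shows "right_slice V (counit C) (coact V (e j)) = (\<Oplus>\<^bsub>V\<^esub>i\<in>{..<d}. counit C (ec i j) \<odot>\<^bsub>V\<^esub> e i)"
proof -
 have "right_slice V (counit C) (coact V (e j)) = (\<Oplus>\<^bsub>V\<^esub>i\<in>{..<d}. right_slice V (counit C) (VS.pr (e i) (ec i j)))"
  unfolding coact_basis[OF j]
  by (rule lin_map_finsum[OF VS.abelian_T V.abelian_group_axioms VS.right_slice_linear[OF counit_linear] pVS_Pi finite_lessThan])
 also have "\<dots> = (\<Oplus>\<^bsub>V\<^esub>i\<in>{..<d}. counit C (ec i j) \<odot>\<^bsub>V\<^esub> e i)"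
  using comb_Pi by (intro V.finsum_cong'[OF refl]) (auto simp: VS.right_slice_pure[OF counit_linear] e_closed)
 finally show ?thesis .
qed

text \<open>Slicing coassociativity with the coordinate functionals gives the matrix identities; conversely, both sides of each comodule axiom are linear, so the basis suffices.\<close>

lemma comodule_iff_matrix: "comodule C V \<longleftrightarrow> matrix_corep C d ec"
proof
 assume "comodule C V"
 then have ca: "tensor_assoc V S S (tensor_map VS.T S (coact V) id (coact V v)) = tensor_map V SS.T id (comult C) (coact V v)"
  and cu: "right_slice V (counit C) (coact V v) = v" if "v \<in> carrier V" for v
  using that unfolding comodule_def Let_def right_slice_def by auto
 show "matrix_corep C d ec" unfolding matrix_corep_def
 proof (intro allI impI conjI)
  fix k j assume k: "k < d" and j: "j < d"
  let ?s = "left_slice SS.T (\<lambda>v. coordinate V d e v k)"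
  have p: "(\<Oplus>\<^bsub>SS.T\<^esub>i\<in>{..<d}. SS.pr (ec k i) (ec i j)) \<in> carrier SS.T" for k
   using SS.pure_closed by (intro SS.T.finsum_closed) auto
  have "comult C (ec k j) = ?s (\<Oplus>\<^bsub>VSS.T\<^esub>k\<in>{..<d}. VSS.pr (e k) (comult C (ec k j)))"
   using slice_sum[OF SS.left_module_T _ k, of "\<lambda>k. comult C (ec k j)"] lin_map_closed[OF comult_linear] by simp
  also have "\<dots> = ?s (\<Oplus>\<^bsub>VSS.T\<^esub>k\<in>{..<d}. VSS.pr (e k) (\<Oplus>\<^bsub>SS.T\<^esub>i\<in>{..<d}. SS.pr (ec k i) (ec i j)))"
   using ca[OF e_closed[OF j]] unfolding coassoc_left[OF j] coassoc_right[OF j] by simp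
  also have "\<dots> = (\<Oplus>\<^bsub>SS.T\<^esub>i\<in>{..<d}. SS.pr (ec k i) (ec i j))"
   by (rule slice_sum[OF SS.left_module_T p k])
  finally show "comult C (ec k j) = (\<Oplus>\<^bsub>SS.T\<^esub>i\<in>{..<d}. SS.pr (ec k i) (ec i j))" .
  have "coordinate V d e (e j) k = counit C (ec k j)"
   using coordinate_unique[OF _ k, of "e j" "\<lambda>k. counit C (ec k j)"] cu[OF e_closed[OF j]] counit_sum[OF j] by simp
  then show "counit C (ec k j) = (if k = j then 1 else 0)" using coordinate_basis[OF j k] by simp
 qed
next
 assume m: "matrix_corep C d ec"
 have 1: "tensor_assoc V S S (tensor_map VS.T S (coact V) id (coact V v)) = tensor_map V SS.T id (comult C) (coact V v)" if v: "v \<in> carrier V" for v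
 proof (rule lin_eqI[OF VSS.abelian_T _ _ _ v])
  show "lin_map UNIV V VSS.T (\<lambda>v. tensor_assoc V S S (tensor_map VS.T S (coact V) id (coact V v)))"
   by (rule lin_map_comp[OF coact_linear lin_map_comp[OF coact_id_linear assoc_linear]])
  show "lin_map UNIV V VSS.T (\<lambda>v. tensor_map V SS.T id (comult C) (coact V v))"
   by (rule lin_map_comp[OF coact_linear id_comult_linear])
  show "tensor_assoc V S S (tensor_map VS.T S (coact V) id (coact V (e j))) = tensor_map V SS.T id (comult C) (coact V (e j))" if j: "j < d" for j
   unfolding coassoc_left[OF j] coassoc_right[OF j]
  proof (rule VSS.T.finsum_cong'[OF refl])
   show "(\<lambda>k. VSS.pr (e k) (comult C (ec k j))) \<in> {..<d} \<rightarrow> carrier VSS.T"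
    using VSS.pure_closed[OF e_closed lin_map_closed[OF comult_linear]] by auto
  qed (use m j in \<open>simp add: matrix_corep_def\<close>)
 qed
 have 2: "right_slice V (counit C) (coact V v) = v" if v: "v \<in> carrier V" for v
 proof (rule lin_eqI[OF V.abelian_group_axioms lin_map_comp[OF coact_linear VS.right_slice_linear[OF counit_linear]] lin_map_id _ v])
  fix j assume j: "j < d"
  have "(\<Oplus>\<^bsub>V\<^esub>i\<in>{..<d}. counit C (ec i j) \<odot>\<^bsub>V\<^esub> e i) = (\<Oplus>\<^bsub>V\<^esub>i\<in>{..<d}. (if i = j then 1 else 0) \<odot>\<^bsub>V\<^esub> e i)"
   by (rule V.finsum_cong'[OF refl comb_Pi]) (use m j in \<open>simp add: matrix_corep_def\<close>)
  then show "right_slice V (counit C) (coact V (e j)) = e j"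
   using counit_sum[OF j] kronecker_sum[OF Vm e_closed j] by simp
 qed
 show "comodule C V" unfolding comodule_def Let_def right_slice_def[symmetric]
  using Vm coact_linear 1 2 by (intro conjI ballI)
qed

lemma transported_basis:
 assumes W: "left_module UNIV W" and f: "colinear C V W f" and bij: "bij_betw f (carrier V) (carrier W)"
 shows "comodule_basis C W d (\<lambda>i. f (e i)) ec"
proof -
 interpret W: abelian_group W by (rule left_module_group[OF W])
 interpret WS: tensor_field W S by unfold_locales (rule W S_module)+
 have lf: "lin_map UNIV V W f" and cf: "\<And>v. v \<in> carrier V ==> coact W (f v) = tensor_map W S f id (coact V v)"
  using f by (auto simp: colinear_def)
 note fl = tensor_map_linear[OF Vm S_module W S_module lf lin_map_id, folded id_def]
  and fp = tensor_map_pure[OF Vm S_module W S_module lf lin_map_id, folded id_def]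
 have comb: "f (\<Oplus>\<^bsub>V\<^esub>i\<in>{..<d}. a i \<odot>\<^bsub>V\<^esub> e i) = (\<Oplus>\<^bsub>W\<^esub>i\<in>{..<d}. a i \<odot>\<^bsub>W\<^esub> f (e i))" for a
 proof -
  have "f (\<Oplus>\<^bsub>V\<^esub>i\<in>{..<d}. a i \<odot>\<^bsub>V\<^esub> e i) = (\<Oplus>\<^bsub>W\<^esub>i\<in>{..<d}. f (a i \<odot>\<^bsub>V\<^esub> e i))"
   by (rule lin_map_finsum[OF V.abelian_group_axioms W.abelian_group_axioms lf comb_Pi finite_lessThan])
  also have "\<dots> = (\<Oplus>\<^bsub>W\<^esub>i\<in>{..<d}. a i \<odot>\<^bsub>W\<^esub> f (e i))"
   by (rule W.finsum_cong'[OF refl])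
    (use lin_map_smult[OF lf UNIV_I e_closed] left_module_smult_closed[OF W UNIV_I lin_map_closed[OF lf e_closed]] in auto)
  finally show ?thesis .
 qed
 have "is_basis W d (\<lambda>i. f (e i))" unfolding is_basis_def
 proof (intro conjI ballI)
  show "(\<lambda>i. f (e i)) \<in> {..<d} \<rightarrow> carrier W" using lin_map_closed[OF lf e_closed] by auto
  fix w assume "w \<in> carrier W"
  then obtain v where v: "v \<in> carrier V" "w = f v" using bij by (auto simp: bij_betw_def)
  have "w = (\<Oplus>\<^bsub>W\<^esub>i\<in>{..<d}. a i \<odot>\<^bsub>W\<^esub> f (e i)) \<longleftrightarrow> v = (\<Oplus>\<^bsub>V\<^esub>i\<in>{..<d}. a i \<odot>\<^bsub>V\<^esub> e i)" for a
   unfolding v comb[symmetric] using inj_onD[OF bij_betw_imp_inj_on[OF bij] _ v(1) comb_closed] by auto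
  moreover have "\<exists>!a. a \<in> {..<d} \<rightarrow>\<^sub>E UNIV \<and> v = (\<Oplus>\<^bsub>V\<^esub>i\<in>{..<d}. a i \<odot>\<^bsub>V\<^esub> e i)"
   using basis v(1) unfolding is_basis_def by blast
  ultimately show "\<exists>!a. a \<in> {..<d} \<rightarrow>\<^sub>E UNIV \<and> w = (\<Oplus>\<^bsub>W\<^esub>i\<in>{..<d}. a i \<odot>\<^bsub>W\<^esub> f (e i))" by simp
 qed
 moreover have "coact W (f (e j)) = (\<Oplus>\<^bsub>WS.T\<^esub>i\<in>{..<d}. WS.pr (f (e i)) (ec i j))" if j: "j < d" for j
 proof -
  have "coact W (f (e j)) = (\<Oplus>\<^bsub>WS.T\<^esub>i\<in>{..<d}. tensor_map W S f id (VS.pr (e i) (ec i j)))"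
   unfolding cf[OF e_closed[OF j]] coact_basis[OF j]
   by (rule lin_map_finsum[OF VS.abelian_T WS.abelian_T fl pVS_Pi finite_lessThan])
  also have "\<dots> = (\<Oplus>\<^bsub>WS.T\<^esub>i\<in>{..<d}. WS.pr (f (e i)) (ec i j))"
   by (rule WS.T.finsum_cong'[OF refl]) (use WS.pure_closed lin_map_closed[OF lf e_closed] in \<open>auto simp: fp e_closed\<close>)
  finally show ?thesis .
 qed
 ultimately show ?thesis by (simp add: comodule_basis_def)
qed

end

context field_coalgebra
begin

lemma matrix_coactionI':
 assumes "lin_map UNIV V (tensor V S) (coact V)" "left_module UNIV V" "comodule_basis C V d e ec"
 shows "matrix_coaction C V d e ec"
 using assms coalg by unfold_locales (auto simp: comodule_basis_def)

lemma matrix_coactionI: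
 assumes "comodule C V" "comodule_basis C V d e ec"
 shows "matrix_coaction C V d e ec"
 using assms coalg by unfold_locales (auto simp: comodule_def Let_def comodule_basis_def)

lemma comodule_matrix:
 assumes "comodule C V" "comodule_basis C V d e ec"
 shows "matrix_corep C d ec"
 using matrix_coaction.comodule_iff_matrix[OF matrix_coactionI[OF assms]] assms(1) by simp

lemma comodule_basis_exists:
 assumes "comodule C V" "is_basis V d e"
 obtains ec where "comodule_basis C V d e ec"
proof -
 have V: "left_module UNIV V" and \<delta>: "lin_map UNIV V (tensor V S) (coact V)" using assms(1) by (auto simp: comodule_def Let_def)
 interpret based_module V d e by unfold_locales (rule V assms(2))+
 have "coact V (e j) = (\<Oplus>\<^bsub>tensor V S\<^esub>i\<in>{..<d}. pure V S (e i) (left_slice S (\<lambda>v. coordinate V d e v i) (coact V (e j))))" if "j < d" for j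
  by (rule tensor_coordinates[OF S_module lin_map_closed[OF \<delta> e_closed[OF that]]])
 then show ?thesis using assms(2)
  by (intro that[of "\<lambda>i j. left_slice S (\<lambda>v. coordinate V d e v i) (coact V (e j))"]) (simp add: comodule_basis_def)
qed

lemma corep_comodule_basis:
 assumes "corep C V"
 obtains d e ec where "comodule_basis C V d e ec"
proof -
 from assms obtain d e where "comodule C V" "is_basis V d e" by (auto simp: corep_def finite_dimensional_def)
 then show ?thesis by (rule comodule_basis_exists) (rule that)
qed

lemma comod_iso_if_matrix:
 assumes V: "matrix_coaction C V d e ec" and W: "matrix_coaction C W d e' ec"
 shows "comod_iso C V W"
proof -
 interpret V: matrix_coaction C V d e ec by fact
 interpret W: matrix_coaction C W d e' ec by fact
 define f where "f v = (\<Oplus>\<^bsub>W\<^esub>j\<in>{..<d}. coordinate V d e v j \<odot>\<^bsub>W\<^esub> e' j)" for v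
 define h where "h w = (\<Oplus>\<^bsub>V\<^esub>j\<in>{..<d}. coordinate W d e' w j \<odot>\<^bsub>V\<^esub> e j)" for w
 have f: "lin_map UNIV V W f" unfolding f_def by (rule V.extension_linear[OF W.Vm]) (rule W.e_closed)
 have h: "lin_map UNIV W V h" unfolding h_def by (rule W.extension_linear[OF V.Vm]) (rule V.e_closed)
 have fb: "f (e j) = e' j" if "j < d" for j
  unfolding f_def by (rule V.extension_basis[OF W.Vm _ that]) (rule W.e_closed)
 have hb: "h (e' j) = e j" if "j < d" for j
  unfolding h_def by (rule W.extension_basis[OF V.Vm _ that]) (rule V.e_closed)
 note fl = tensor_map_linear[OF V.Vm S_module W.Vm S_module f lin_map_id, folded id_def]
  and fp = tensor_map_pure[OF V.Vm S_module W.Vm S_module f lin_map_id, folded id_def]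
 have hf: "h (f v) = v" if v: "v \<in> carrier V" for v
  by (rule V.lin_eqI[OF V.V.abelian_group_axioms lin_map_comp[OF f h] lin_map_id _ v]) (simp add: fb hb)
 have fh: "f (h v) = v" if v: "v \<in> carrier W" for v
  by (rule W.lin_eqI[OF W.V.abelian_group_axioms lin_map_comp[OF h f] lin_map_id _ v]) (simp add: fb hb)
 have "bij_betw f (carrier V) (carrier W)"
  by (rule bij_betw_byWitness[where f' = h]) (use hf fh lin_map_closed[OF f] lin_map_closed[OF h] in blast)+
 moreover have "coact W (f v) = tensor_map W S f id (coact V v)" if v: "v \<in> carrier V" for v
 proof (rule V.lin_eqI[OF W.VS.abelian_T lin_map_comp[OF f W.coact_linear] lin_map_comp[OF V.coact_linear fl] _ v])
  fix j assume j: "j < d"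
  have "tensor_map W S f id (coact V (e j)) = (\<Oplus>\<^bsub>W.VS.T\<^esub>i\<in>{..<d}. tensor_map W S f id (V.VS.pr (e i) (ec i j)))"
   unfolding V.coact_basis[OF j]
   by (rule lin_map_finsum[OF V.VS.abelian_T W.VS.abelian_T fl V.pVS_Pi finite_lessThan])
  also have "\<dots> = (\<Oplus>\<^bsub>W.VS.T\<^esub>i\<in>{..<d}. W.VS.pr (e' i) (ec i j))"
   by (rule W.VS.T.finsum_cong'[OF refl W.pVS_Pi]) (use V.e_closed in \<open>simp add: fp fb\<close>)
  also have "\<dots> = coact W (f (e j))" unfolding fb[OF j] W.coact_basis[OF j] ..
  finally show "coact W (f (e j)) = tensor_map W S f id (coact V (e j))" by (rule sym)
 qed
 ultimately show ?thesis using f unfolding comod_iso_def colinear_def by blast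
qed

text \<open>An isomorphism transports a basis without changing the coefficients, and bases with equal coefficients define an isomorphism.\<close>

lemma corep_iso_class_eq:
 assumes V: "comodule C V" "comodule_basis C V d e ec"
 shows "corep_iso_class C V = {W. corep C W \<and> (\<exists>e'. comodule_basis C W d e' ec)}"
proof -
 note m = matrix_coactionI[OF V]
 have "comod_iso C V W \<longleftrightarrow> (\<exists>e'. comodule_basis C W d e' ec)" if W: "corep C W" for W :: "('k, nat => 'k, 'c) comod"
 proof
  have Wm: "comodule C W" "left_module UNIV W" using W by (auto simp: corep_def comodule_def Let_def)
  show "\<exists>e'. comodule_basis C W d e' ec" if "comod_iso C V W"
   using that matrix_coaction.transported_basis[OF m Wm(2)] unfolding comod_iso_def by blast
  show "comod_iso C V W" if "\<exists>e'. comodule_basis C W d e' ec"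
   using that comod_iso_if_matrix[OF m matrix_coactionI[OF Wm(1)]] by blast
 qed
 then show ?thesis by (auto simp: corep_iso_class_def)
qed

end

definition comod_on :: "('k, 'v, 'z) module_scheme => ('v => (('v \<times> 'c) \<Rightarrow>\<^sub>0 int) set) => ('k, 'v, 'c) comod" where
 "comod_on M \<delta> = \<lparr>carrier = carrier M, monoid.mult = undefined, one = undefined,
   ring.zero = ring.zero M, ring.add = ring.add M, smult = smult M, coact = \<delta>\<rparr>"

lemma comod_on_simps [simp]:
 "carrier (comod_on M \<delta>) = carrier M" "add (comod_on M \<delta>) = add M" "smult (comod_on M \<delta>) = smult M"
 "\<zero>\<^bsub>comod_on M \<delta>\<^esub> = \<zero>\<^bsub>M\<^esub>" "coact (comod_on M \<delta>) = \<delta>"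
 by (simp_all add: comod_on_def)

lemma tensor_comod_on: "tensor (comod_on M \<delta>) W = tensor M W" "pure (comod_on M \<delta>) W = pure M W"
 by (simp_all add: tensor_over_def balanced_rel_def pure_over_def fun_eq_iff lift_hom_def cong del: lift_hom_opaque pure_over_opaque tensor_over_opaque)

lemma finsum_comod_on: "finsum (comod_on M \<delta>) = finsum M"
 by (simp add: finsum_def finprod_def fun_eq_iff)

lemma left_module_comod_on: "left_module R (comod_on M \<delta>) = left_module R M"
 by (simp add: left_module_def abelian_group_def abelian_monoid_def abelian_group_axioms_def comm_group_def
   Group.comm_monoid_def group_def group_axioms_def Group.monoid_def comm_monoid_axioms_def Units_def)

lemma lin_map_comod_on: "lin_map R (comod_on M \<delta>) N f = lin_map R M N f"
 by (simp add: lin_map_def)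

lemma is_basis_comod_on: "is_basis (comod_on M \<delta>) d e = is_basis M d e"
 by (simp add: is_basis_def finsum_comod_on)

lemma comodule_basis_comod_on:
 "comodule_basis C (comod_on M \<delta>) d e ec \<longleftrightarrow> is_basis M d e \<and>
   (\<forall>j<d. \<delta> (e j) = (\<Oplus>\<^bsub>tensor M (coalg_space C)\<^esub>i\<in>{..<d}. pure M (coalg_space C) (e i) (ec i j)))"
 unfolding comodule_basis_def tensor_comod_on unfolding is_basis_comod_on comod_on_simps(5) ..

definition row_space :: "nat => ('k::field, nat => 'k) module" where
 "row_space d = module_of (\<lambda>r x j. r * x j) {x. \<forall>j\<ge>d. x j = 0}"

lemma left_module_row_space: "left_module UNIV (row_space d)"
 unfolding row_space_def
 by (rule left_module_module_of) (auto simp: vector_space_def fun_eq_iff algebra_simps)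

lemma row_space_basis: "is_basis (row_space d :: ('k::field, nat => 'k) module) d unit_row"
proof -
 have s: "(\<Oplus>\<^bsub>row_space d\<^esub>i\<in>{..<d}. a i \<odot>\<^bsub>row_space d\<^esub> unit_row i) = (\<lambda>j. if j < d then a j else 0 :: 'k)" for a :: "nat => 'k"
 proof -
  have sa: "(\<Sum>i\<in>I. f i) j = (\<Sum>i\<in>I. f i j :: 'k)" for f :: "nat => nat => 'k" and I j
   by (induction I rule: infinite_finite_induct) auto
  have "(\<Oplus>\<^bsub>row_space d\<^esub>i\<in>{..<d}. a i \<odot>\<^bsub>row_space d\<^esub> unit_row i) = (\<Sum>i<d. (\<lambda>j. a i * unit_row i j))"
   unfolding row_space_def
   by (subst finsum_module_of)
    (use left_module_group[OF left_module_row_space[of d]] in \<open>auto simp: row_space_def unit_row_def\<close>)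
  also have "\<dots> = (\<lambda>j. if j < d then a j else 0)"
   by (auto simp: fun_eq_iff sa unit_row_def if_distrib sum.delta cong: if_cong)
  finally show ?thesis .
 qed
 show ?thesis unfolding is_basis_def
 proof (intro conjI ballI)
  show "unit_row \<in> {..<d} \<rightarrow> carrier (row_space d :: ('k, nat => 'k) module)" by (auto simp: row_space_def unit_row_def)
  fix v :: "nat => 'k" assume v: "v \<in> carrier (row_space d)"
  show "\<exists>!a. a \<in> {..<d} \<rightarrow>\<^sub>E UNIV \<and> v = (\<Oplus>\<^bsub>row_space d\<^esub>i\<in>{..<d}. a i \<odot>\<^bsub>row_space d\<^esub> unit_row i)"
   unfolding s
  proof (rule ex1I[of _ "restrict v {..<d}"])
   show "restrict v {..<d} \<in> {..<d} \<rightarrow>\<^sub>E UNIV \<and> v = (\<lambda>j. if j < d then restrict v {..<d} j else 0)"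
    using v by (auto simp: row_space_def fun_eq_iff)
   show "a = restrict v {..<d}" if "a \<in> {..<d} \<rightarrow>\<^sub>E UNIV \<and> v = (\<lambda>j. if j < d then a j else 0)" for a
    using that by (auto simp: fun_eq_iff PiE_def extensional_def)
  qed
 qed
qed

text \<open>This provides a representative of every isomorphism class in the type where the classes are formed.\<close>

lemma (in field_coalgebra) matrix_comodule_exists:
 assumes "matrix_corep C d ec"
 obtains W :: "('k, nat => 'k, 'c) comod" and e where "corep C W" "comodule_basis C W d e ec"
proof -
 let ?M = "row_space d :: ('k, nat => 'k) module"
 interpret M: based_module ?M d unit_row by unfold_locales (rule left_module_row_space row_space_basis)+
 interpret MS: tensor_field ?M S by unfold_locales (rule left_module_row_space S_module)+
 let ?m = "\<lambda>j. \<Oplus>\<^bsub>MS.T\<^esub>i\<in>{..<d}. MS.pr (unit_row i) (ec i j)"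
 have m: "?m j \<in> carrier MS.T" for j using MS.pure_closed[OF M.e_closed] by (intro MS.T.finsum_closed) auto
 define \<delta> where "\<delta> v = (\<Oplus>\<^bsub>MS.T\<^esub>j\<in>{..<d}. coordinate ?M d unit_row v j \<odot>\<^bsub>MS.T\<^esub> ?m j)" for v
 have \<delta>: "lin_map UNIV ?M MS.T \<delta>" unfolding \<delta>_def by (rule M.extension_linear[OF MS.left_module_T m])
 have \<delta>b: "\<delta> (unit_row j) = ?m j" if "j < d" for j unfolding \<delta>_def by (rule M.extension_basis[OF MS.left_module_T m that])
 let ?W = "comod_on ?M \<delta>"
 have b: "comodule_basis C ?W d unit_row ec"
  unfolding comodule_basis_comod_on using row_space_basis \<delta>b by simp
 have "lin_map UNIV ?W (tensor ?W S) (coact ?W)"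
  unfolding tensor_comod_on unfolding lin_map_comod_on comod_on_simps(5) by (rule \<delta>)
 moreover have "left_module UNIV ?W" unfolding left_module_comod_on by (rule left_module_row_space)
 ultimately have "matrix_coaction C ?W d unit_row ec"
  by (rule matrix_coactionI'[OF _ _ b])
 from matrix_coaction.comodule_iff_matrix[OF this] assms have "comodule C ?W" by simp
 then have "corep C ?W" using b by (auto simp: corep_def finite_dimensional_def comodule_basis_def)
 then show ?thesis using b by (rule that)
qed

definition block_matrix :: "nat => (nat => nat => 'c::zero) => (nat => nat => 'c) => nat => nat => 'c" where
 "block_matrix d ec ec' i j =
   (if i < d \<and> j < d then ec i j else if d \<le> i \<and> d \<le> j then ec' (i - d) (j - d) else 0)"

lemma block_matrix_simps [simp]:
 "i < d ==> j < d ==> block_matrix d ec ec' i j = ec i j"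
 "block_matrix d ec ec' (d + i) (d + j) = ec' i j"
 "i < d ==> block_matrix d ec ec' i (d + j) = 0"
 "j < d ==> block_matrix d ec ec' (d + i) j = 0"
 by (auto simp: block_matrix_def)

lemma (in abelian_monoid) finsum_zero': "(\<And>i. i \<in> I ==> f i = \<zero>) ==> finsum G f I = \<zero>"
 using finsum_cong'[of I I "\<lambda>_. \<zero>" f] by simp

lemma split_index: "(i :: nat) < d + d' ==> (i < d ==> Q) ==> (\<And>k. i = d + k ==> k < d' ==> Q) ==> Q"
 by (cases "i < d") (auto dest: le_Suc_ex simp: not_less)

context field_coalgebra
begin

lemma matrix_corep_block:
 assumes "matrix_corep C d ec" "matrix_corep C d' ec'"
 shows "matrix_corep C (d + d') (block_matrix d ec ec')"
proof -
 let ?b = "block_matrix d ec ec'"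
 have c0: "comult C 0 = \<zero>\<^bsub>SS.T\<^esub>" using lin_map_zero[OF S_module SS.left_module_T comult_linear] by simp
 have e0: "counit C 0 = 0"
 proof -
  have "counit C (0 + 0) = counit C 0 + counit C 0"
   using lin_map_add[OF counit_linear, of 0 0] by (simp only: module_of_simps ground_space_simps UNIV_I simp_thms)
  then show ?thesis by (metis add.right_neutral add_left_cancel)
 qed
 have pl: "SS.pr 0 y = \<zero>\<^bsub>SS.T\<^esub>" and pr: "SS.pr y 0 = \<zero>\<^bsub>SS.T\<^esub>" for y
  using SS.pure_zero_left[of y] SS.pure_zero_right[of y] by simp_all
 have cl: "SS.pr x y \<in> carrier SS.T" for x y using SS.pure_closed by simp
 have split: "(\<Oplus>\<^bsub>SS.T\<^esub>k\<in>{..<d + d'}. SS.pr (?b i k) (?b k j)) =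
   (\<Oplus>\<^bsub>SS.T\<^esub>k\<in>{..<d}. SS.pr (?b i k) (?b k j)) \<oplus>\<^bsub>SS.T\<^esub> (\<Oplus>\<^bsub>SS.T\<^esub>k\<in>{..<d'}. SS.pr (?b i (d + k)) (?b (d + k) j))" for i j
  by (rule SS.T.finsum_append) (rule cl)
 have fc: "(\<Oplus>\<^bsub>SS.T\<^esub>k\<in>I. SS.pr (f k) (h k)) \<in> carrier SS.T" for f h and I :: "nat set"
  by (rule SS.T.finsum_closed) (use cl in auto)
 show ?thesis unfolding matrix_corep_def
 proof (intro allI impI)
  fix i j assume i: "i < d + d'" and j: "j < d + d'"
  have "comult C (?b i j) = (\<Oplus>\<^bsub>SS.T\<^esub>k\<in>{..<d}. SS.pr (?b i k) (?b k j)) \<oplus>\<^bsub>SS.T\<^esub>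
    (\<Oplus>\<^bsub>SS.T\<^esub>k\<in>{..<d'}. SS.pr (?b i (d + k)) (?b (d + k) j)) \<and> counit C (?b i j) = (if i = j then 1 else 0)" (is ?G)
  proof (rule split_index[OF i]; rule split_index[OF j])
   assume j: "j < d" and i: "i < d"
   have "(\<Oplus>\<^bsub>SS.T\<^esub>k\<in>{..<d}. SS.pr (?b i k) (?b k j)) = (\<Oplus>\<^bsub>SS.T\<^esub>k\<in>{..<d}. SS.pr (ec i k) (ec k j))"
    by (rule SS.T.finsum_cong'[OF refl]) (use i j cl in auto)
   moreover have "(\<Oplus>\<^bsub>SS.T\<^esub>k\<in>{..<d'}. SS.pr (?b i (d + k)) (?b (d + k) j)) = \<zero>\<^bsub>SS.T\<^esub>"
    by (rule SS.T.finsum_zero') (use i j in \<open>simp add: pl\<close>)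
   ultimately show ?G using assms(1) i j fc by (simp add: matrix_corep_def)
  next
   fix k' assume i: "i < d" and j: "j = d + k'" "k' < d'"
   have "(\<Oplus>\<^bsub>SS.T\<^esub>k\<in>{..<d}. SS.pr (?b i k) (?b k j)) = \<zero>\<^bsub>SS.T\<^esub>"
    by (rule SS.T.finsum_zero') (use i j in \<open>simp add: pr\<close>)
   moreover have "(\<Oplus>\<^bsub>SS.T\<^esub>k\<in>{..<d'}. SS.pr (?b i (d + k)) (?b (d + k) j)) = \<zero>\<^bsub>SS.T\<^esub>"
    by (rule SS.T.finsum_zero') (use i j in \<open>simp add: pl\<close>)
   ultimately show ?G using i j by (simp add: c0 e0)
  next
   fix k' assume j: "j < d" and i: "i = d + k'" "k' < d'"
   have "(\<Oplus>\<^bsub>SS.T\<^esub>k\<in>{..<d}. SS.pr (?b i k) (?b k j)) = \<zero>\<^bsub>SS.T\<^esub>"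
    by (rule SS.T.finsum_zero') (use i j in \<open>simp add: pl\<close>)
   moreover have "(\<Oplus>\<^bsub>SS.T\<^esub>k\<in>{..<d'}. SS.pr (?b i (d + k)) (?b (d + k) j)) = \<zero>\<^bsub>SS.T\<^esub>"
    by (rule SS.T.finsum_zero') (use i j in \<open>simp add: pr\<close>)
   ultimately show ?G using i j by (simp add: c0 e0)
  next
   fix p q assume i: "i = d + p" "p < d'" and j: "j = d + q" "q < d'"
   have "(\<Oplus>\<^bsub>SS.T\<^esub>k\<in>{..<d}. SS.pr (?b i k) (?b k j)) = \<zero>\<^bsub>SS.T\<^esub>"
    by (rule SS.T.finsum_zero') (use i j in \<open>simp add: pl\<close>)
   moreover have "(\<Oplus>\<^bsub>SS.T\<^esub>k\<in>{..<d'}. SS.pr (?b i (d + k)) (?b (d + k) j)) = (\<Oplus>\<^bsub>SS.T\<^esub>k\<in>{..<d'}. SS.pr (ec' p k) (ec' k q))"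
    by (rule SS.T.finsum_cong'[OF refl]) (use i j cl in auto)
   ultimately show ?G using assms(2) i j fc by (simp add: matrix_corep_def)
  qed
  then show "comult C (?b i j) = (\<Oplus>\<^bsub>SS.T\<^esub>k\<in>{..<d + d'}. SS.pr (?b i k) (?b k j)) \<and> counit C (?b i j) = (if i = j then 1 else 0)"
   unfolding split .
 qed
qed

lemma comod_sum_basis:
 assumes V: "comodule C V" "comodule_basis C V d e ec" and W: "comodule C W" "comodule_basis C W d' e' ec'"
 shows "comodule C (comod_sum C V W)"
  "\<exists>b. comodule_basis C (comod_sum C V W) (d + d') b (block_matrix d ec ec')"
proof -
 interpret V: matrix_coaction C V d e ec by (rule matrix_coactionI[OF V])
 interpret W: matrix_coaction C W d' e' ec' by (rule matrix_coactionI[OF W])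
 let ?D = "direct_sum V W"
 have D: "left_module UNIV ?D" by (rule left_module_direct_sum[OF V.Vm W.Vm])
 interpret D: abelian_group ?D by (rule left_module_group[OF D])
 interpret DS: tensor_field ?D S by unfold_locales (rule D S_module)+
 have z: "r \<odot>\<^bsub>V\<^esub> \<zero>\<^bsub>V\<^esub> = \<zero>\<^bsub>V\<^esub>" "r \<odot>\<^bsub>W\<^esub> \<zero>\<^bsub>W\<^esub> = \<zero>\<^bsub>W\<^esub>" for r
  by (rule lin_map_zero[OF V.Vm V.Vm smult_linear(1)[OF V.Vm]], rule lin_map_zero[OF W.Vm W.Vm smult_linear(1)[OF W.Vm]])
 define inl where "inl = (\<lambda>x. (x, \<zero>\<^bsub>W\<^esub>) :: 'a \<times> 'd)"
 define inr where "inr = (\<lambda>y. (\<zero>\<^bsub>V\<^esub>, y) :: 'a \<times> 'd)"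
 have inl: "lin_map UNIV V ?D inl" and inr: "lin_map UNIV W ?D inr"
  unfolding lin_map_def inl_def inr_def by (simp_all add: z)
 have p1: "lin_map UNIV ?D V fst" and p2: "lin_map UNIV ?D W snd" unfolding lin_map_def by auto
 define b where "b i = (if i < d then inl (e i) else inr (e' (i - d)))" for i
 have bl: "b i = inl (e i)" if "i < d" for i using that by (simp add: b_def)
 have br: "b (d + i) = inr (e' i)" for i by (simp add: b_def)
 define \<delta> where "\<delta> z = tensor_map ?D S inl id (coact V (fst z)) \<oplus>\<^bsub>DS.T\<^esub> tensor_map ?D S inr id (coact W (snd z))" for z
 have co: "comod_sum C V W = comod_on ?D \<delta>"
  by (simp add: comod_sum_def comod_on_def Let_def \<delta>_def inl_def inr_def fun_eq_iff)
 note il = tensor_map_linear[OF V.Vm S_module D S_module inl lin_map_id, folded id_def]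
  and ip = tensor_map_pure[OF V.Vm S_module D S_module inl lin_map_id, folded id_def]
 note rl = tensor_map_linear[OF W.Vm S_module D S_module inr lin_map_id, folded id_def]
  and rp = tensor_map_pure[OF W.Vm S_module D S_module inr lin_map_id, folded id_def]
 have \<delta>: "lin_map UNIV ?D DS.T \<delta>"
  unfolding \<delta>_def by (rule lin_map_plus[OF DS.left_module_T lin_map_comp[OF p1 lin_map_comp[OF V.coact_linear il]]
    lin_map_comp[OF p2 lin_map_comp[OF W.coact_linear rl]]])
 have bc: "b i \<in> carrier ?D" if "i < d + d'" for i
  using that V.e_closed lin_map_closed[OF inl] lin_map_closed[OF inr W.e_closed[of "i - d"]] by (auto simp: b_def)
 have basis: "is_basis ?D (d + d') b"
  unfolding is_basis_def
 proof (intro conjI ballI)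
  show "b \<in> {..<d + d'} \<rightarrow> carrier ?D" using bc by auto
  fix x assume x: "x \<in> carrier ?D"
  let ?c = "\<lambda>i. if i < d then coordinate V d e (fst x) i else coordinate W d' e' (snd x) (i - d)"
  have eq: "x = (\<Oplus>\<^bsub>?D\<^esub>i\<in>{..<d + d'}. a i \<odot>\<^bsub>?D\<^esub> b i) \<longleftrightarrow> (\<forall>i<d + d'. a i = ?c i)" for a
  proof -
   have cD: "a i \<odot>\<^bsub>?D\<^esub> b i \<in> carrier ?D" if "i < d + d'" for i
    by (rule left_module_smult_closed[OF D UNIV_I bc[OF that]])
   let ?X = "\<Oplus>\<^bsub>?D\<^esub>i\<in>{..<d + d'}. a i \<odot>\<^bsub>?D\<^esub> b i"
   let ?f = "\<lambda>i. if i < d + d' then a i \<odot>\<^bsub>?D\<^esub> b i else \<zero>\<^bsub>?D\<^esub>"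
   have "?X = (\<Oplus>\<^bsub>?D\<^esub>i\<in>{..<d + d'}. ?f i)" by (rule D.finsum_cong'[OF refl]) (use cD in auto)
   also have "\<dots> = (\<Oplus>\<^bsub>?D\<^esub>i\<in>{..<d}. ?f i) \<oplus>\<^bsub>?D\<^esub> (\<Oplus>\<^bsub>?D\<^esub>i\<in>{..<d'}. ?f (d + i))"
    by (rule D.finsum_append) (use cD in auto)
   also have "(\<Oplus>\<^bsub>?D\<^esub>i\<in>{..<d}. ?f i) = (\<Oplus>\<^bsub>?D\<^esub>i\<in>{..<d}. inl (a i \<odot>\<^bsub>V\<^esub> e i))"
    by (rule D.finsum_cong'[OF refl])
     (use lin_map_closed[OF inl V.smult_closed[OF V.e_closed]] lin_map_smult[OF inl UNIV_I V.e_closed] in \<open>auto simp: bl\<close>)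
   also have "\<dots> = inl (\<Oplus>\<^bsub>V\<^esub>i\<in>{..<d}. a i \<odot>\<^bsub>V\<^esub> e i)"
    by (rule lin_map_finsum[OF V.V.abelian_group_axioms D.abelian_group_axioms inl V.comb_Pi finite_lessThan, symmetric])
   also have "(\<Oplus>\<^bsub>?D\<^esub>i\<in>{..<d'}. ?f (d + i)) = (\<Oplus>\<^bsub>?D\<^esub>i\<in>{..<d'}. inr (a (d + i) \<odot>\<^bsub>W\<^esub> e' i))"
    by (rule D.finsum_cong'[OF refl])
     (use lin_map_closed[OF inr W.smult_closed[OF W.e_closed]] lin_map_smult[OF inr UNIV_I W.e_closed] in \<open>auto simp: br\<close>)
   also have "\<dots> = inr (\<Oplus>\<^bsub>W\<^esub>i\<in>{..<d'}. a (d + i) \<odot>\<^bsub>W\<^esub> e' i)"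
    by (rule lin_map_finsum[OF W.V.abelian_group_axioms D.abelian_group_axioms inr W.comb_Pi finite_lessThan, symmetric])
   finally have X: "?X = (\<Oplus>\<^bsub>V\<^esub>i\<in>{..<d}. a i \<odot>\<^bsub>V\<^esub> e i, \<Oplus>\<^bsub>W\<^esub>i\<in>{..<d'}. a (d + i) \<odot>\<^bsub>W\<^esub> e' i)"
    using V.comb_closed[of a] W.comb_closed[of "\<lambda>i. a (d + i)"] by (simp add: inl_def inr_def)
   have 1: "fst x = (\<Oplus>\<^bsub>V\<^esub>i\<in>{..<d}. a i \<odot>\<^bsub>V\<^esub> e i) \<longleftrightarrow> (\<forall>i<d. a i = coordinate V d e (fst x) i)"
   proof
    show "\<forall>i<d. a i = coordinate V d e (fst x) i" if "fst x = (\<Oplus>\<^bsub>V\<^esub>i\<in>{..<d}. a i \<odot>\<^bsub>V\<^esub> e i)"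
     using V.coordinate_unique[OF that] by simp
    assume a: "\<forall>i<d. a i = coordinate V d e (fst x) i"
    have "fst x = (\<Oplus>\<^bsub>V\<^esub>i\<in>{..<d}. coordinate V d e (fst x) i \<odot>\<^bsub>V\<^esub> e i)" by (rule V.coordinate) (use x in auto)
    also have "\<dots> = (\<Oplus>\<^bsub>V\<^esub>i\<in>{..<d}. a i \<odot>\<^bsub>V\<^esub> e i)" by (rule V.V.finsum_cong'[OF refl V.comb_Pi]) (use a in simp)
    finally show "fst x = (\<Oplus>\<^bsub>V\<^esub>i\<in>{..<d}. a i \<odot>\<^bsub>V\<^esub> e i)" .
   qed
   have 2: "snd x = (\<Oplus>\<^bsub>W\<^esub>i\<in>{..<d'}. a (d + i) \<odot>\<^bsub>W\<^esub> e' i) \<longleftrightarrow> (\<forall>i<d'. a (d + i) = coordinate W d' e' (snd x) i)"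
   proof
    show "\<forall>i<d'. a (d + i) = coordinate W d' e' (snd x) i" if "snd x = (\<Oplus>\<^bsub>W\<^esub>i\<in>{..<d'}. a (d + i) \<odot>\<^bsub>W\<^esub> e' i)"
     using W.coordinate_unique[OF that] by simp
    assume a: "\<forall>i<d'. a (d + i) = coordinate W d' e' (snd x) i"
    have "snd x = (\<Oplus>\<^bsub>W\<^esub>i\<in>{..<d'}. coordinate W d' e' (snd x) i \<odot>\<^bsub>W\<^esub> e' i)" by (rule W.coordinate) (use x in auto)
    also have "\<dots> = (\<Oplus>\<^bsub>W\<^esub>i\<in>{..<d'}. a (d + i) \<odot>\<^bsub>W\<^esub> e' i)" by (rule W.V.finsum_cong'[OF refl W.comb_Pi]) (use a in simp)
    finally show "snd x = (\<Oplus>\<^bsub>W\<^esub>i\<in>{..<d'}. a (d + i) \<odot>\<^bsub>W\<^esub> e' i)" .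
   qed
   have 3: "(\<forall>i<d + d'. a i = ?c i) \<longleftrightarrow> (\<forall>i<d. a i = coordinate V d e (fst x) i) \<and> (\<forall>i<d'. a (d + i) = coordinate W d' e' (snd x) i)"
   proof (intro iffI conjI allI impI)
    fix i assume a: "\<forall>i<d + d'. a i = ?c i"
    show "a i = coordinate V d e (fst x) i" if "i < d" using a[rule_format, of i] that by simp
    show "a (d + i) = coordinate W d' e' (snd x) i" if "i < d'" using a[rule_format, of "d + i"] that by simp
   next
    fix i assume a: "(\<forall>i<d. a i = coordinate V d e (fst x) i) \<and> (\<forall>i<d'. a (d + i) = coordinate W d' e' (snd x) i)" and i: "i < d + d'"
    show "a i = ?c i" by (rule split_index[OF i]) (use a in auto)
   qed
   show ?thesis unfolding X 3 1[symmetric] 2[symmetric] by (auto simp: prod_eq_iff)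
  qed
  show "\<exists>!a. a \<in> {..<d + d'} \<rightarrow>\<^sub>E UNIV \<and> x = (\<Oplus>\<^bsub>?D\<^esub>i\<in>{..<d + d'}. a i \<odot>\<^bsub>?D\<^esub> b i)"
   unfolding eq
  proof (rule ex1I[of _ "restrict ?c {..<d + d'}"])
   show "restrict ?c {..<d + d'} \<in> {..<d + d'} \<rightarrow>\<^sub>E UNIV \<and> (\<forall>i<d + d'. restrict ?c {..<d + d'} i = ?c i)" by auto
   fix a assume a: "a \<in> {..<d + d'} \<rightarrow>\<^sub>E UNIV \<and> (\<forall>i<d + d'. a i = ?c i)"
   show "a = restrict ?c {..<d + d'}"
   proof
    fix i show "a i = restrict ?c {..<d + d'} i"
     using a by (cases "i < d + d'") (auto simp: PiE_def extensional_def)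
   qed
  qed
 qed
 let ?b = "block_matrix d ec ec'"
 have zero: "coact V \<zero>\<^bsub>V\<^esub> = \<zero>\<^bsub>V.VS.T\<^esub>" "coact W \<zero>\<^bsub>W\<^esub> = \<zero>\<^bsub>W.VS.T\<^esub>"
  "tensor_map ?D S inl id \<zero>\<^bsub>V.VS.T\<^esub> = \<zero>\<^bsub>DS.T\<^esub>" "tensor_map ?D S inr id \<zero>\<^bsub>W.VS.T\<^esub> = \<zero>\<^bsub>DS.T\<^esub>"
  by (rule lin_map_zero[OF V.Vm V.VS.left_module_T V.coact_linear] lin_map_zero[OF W.Vm W.VS.left_module_T W.coact_linear]
    lin_map_zero[OF V.VS.left_module_T DS.left_module_T il] lin_map_zero[OF W.VS.left_module_T DS.left_module_T rl])+
 have coef: "\<delta> (b j) = (\<Oplus>\<^bsub>DS.T\<^esub>i\<in>{..<d + d'}. DS.pr (b i) (?b i j))" if j: "j < d + d'" for j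
 proof -
  let ?g = "\<lambda>i. if i < d + d' then DS.pr (b i) (?b i j) else \<zero>\<^bsub>DS.T\<^esub>"
  have g: "?g i \<in> carrier DS.T" for i using DS.pure_closed[OF bc] by auto
  have "(\<Oplus>\<^bsub>DS.T\<^esub>i\<in>{..<d + d'}. DS.pr (b i) (?b i j)) = (\<Oplus>\<^bsub>DS.T\<^esub>i\<in>{..<d + d'}. ?g i)"
   by (rule DS.T.finsum_cong'[OF refl]) (use g in auto)
  also have "\<dots> = (\<Oplus>\<^bsub>DS.T\<^esub>i\<in>{..<d}. ?g i) \<oplus>\<^bsub>DS.T\<^esub> (\<Oplus>\<^bsub>DS.T\<^esub>i\<in>{..<d'}. ?g (d + i))"
   by (rule DS.T.finsum_append) (rule g)
  finally have s: "(\<Oplus>\<^bsub>DS.T\<^esub>i\<in>{..<d + d'}. DS.pr (b i) (?b i j)) = (\<Oplus>\<^bsub>DS.T\<^esub>i\<in>{..<d}. ?g i) \<oplus>\<^bsub>DS.T\<^esub> (\<Oplus>\<^bsub>DS.T\<^esub>i\<in>{..<d'}. ?g (d + i))" .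
  show ?thesis unfolding s
  proof (rule split_index[OF j])
   assume j: "j < d"
   have "tensor_map ?D S inl id (coact V (e j)) = (\<Oplus>\<^bsub>DS.T\<^esub>i\<in>{..<d}. tensor_map ?D S inl id (V.VS.pr (e i) (ec i j)))"
    unfolding V.coact_basis[OF j]
    by (rule lin_map_finsum[OF V.VS.abelian_T DS.abelian_T il V.pVS_Pi finite_lessThan])
   also have "\<dots> = (\<Oplus>\<^bsub>DS.T\<^esub>i\<in>{..<d}. ?g i)"
    by (rule DS.T.finsum_cong'[OF refl]) (use j g V.e_closed in \<open>auto simp: ip bl\<close>)
   finally have 1: "tensor_map ?D S inl id (coact V (e j)) = (\<Oplus>\<^bsub>DS.T\<^esub>i\<in>{..<d}. ?g i)" .
   have 2: "(\<Oplus>\<^bsub>DS.T\<^esub>i\<in>{..<d'}. ?g (d + i)) = \<zero>\<^bsub>DS.T\<^esub>"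
    by (rule DS.T.finsum_zero') (use j DS.pure_zero_right[OF bc] in simp)
   show "\<delta> (b j) = (\<Oplus>\<^bsub>DS.T\<^esub>i\<in>{..<d}. ?g i) \<oplus>\<^bsub>DS.T\<^esub> (\<Oplus>\<^bsub>DS.T\<^esub>i\<in>{..<d'}. ?g (d + i))"
    unfolding \<delta>_def bl[OF j] inl_def[THEN fun_cong] fst_conv snd_conv unfolding inl_def[symmetric] 1 2 zero ..
  next
   fix q assume j: "j = d + q" and q: "q < d'"
   have "tensor_map ?D S inr id (coact W (e' q)) = (\<Oplus>\<^bsub>DS.T\<^esub>i\<in>{..<d'}. tensor_map ?D S inr id (W.VS.pr (e' i) (ec' i q)))"
    unfolding W.coact_basis[OF q]
    by (rule lin_map_finsum[OF W.VS.abelian_T DS.abelian_T rl W.pVS_Pi finite_lessThan])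
   also have "\<dots> = (\<Oplus>\<^bsub>DS.T\<^esub>i\<in>{..<d'}. ?g (d + i))"
    by (rule DS.T.finsum_cong'[OF refl]) (use j DS.pure_closed[OF lin_map_closed[OF inr W.e_closed]] W.e_closed in \<open>auto simp: rp br\<close>)
   finally have 1: "tensor_map ?D S inr id (coact W (e' q)) = (\<Oplus>\<^bsub>DS.T\<^esub>i\<in>{..<d'}. ?g (d + i))" .
   have 2: "(\<Oplus>\<^bsub>DS.T\<^esub>i\<in>{..<d}. ?g i) = \<zero>\<^bsub>DS.T\<^esub>"
    by (rule DS.T.finsum_zero') (use j DS.pure_zero_right[OF bc] in simp)
   have f: "fst (b j) = \<zero>\<^bsub>V\<^esub>" "snd (b j) = e' q" unfolding j br by (simp_all add: inr_def)
   show "\<delta> (b j) = (\<Oplus>\<^bsub>DS.T\<^esub>i\<in>{..<d}. ?g i) \<oplus>\<^bsub>DS.T\<^esub> (\<Oplus>\<^bsub>DS.T\<^esub>i\<in>{..<d'}. ?g (d + i))"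
    unfolding \<delta>_def f 1 2 zero ..
  qed
 qed
 have cb: "comodule_basis C (comod_sum C V W) (d + d') b ?b"
  unfolding co comodule_basis_comod_on using basis coef by blast
 show "\<exists>b. comodule_basis C (comod_sum C V W) (d + d') b ?b" by (rule exI[of _ b]) (rule cb)
 have "lin_map UNIV (comod_on ?D \<delta>) (tensor (comod_on ?D \<delta>) S) (coact (comod_on ?D \<delta>))"
  unfolding tensor_comod_on unfolding lin_map_comod_on comod_on_simps(5) by (rule \<delta>)
 moreover have "left_module UNIV (comod_on ?D \<delta>)" unfolding left_module_comod_on by (rule D)
 ultimately have "matrix_coaction C (comod_sum C V W) (d + d') b ?b"
  unfolding co by (rule matrix_coactionI'[OF _ _ cb[unfolded co]])
 from matrix_coaction.comodule_iff_matrix[OF this]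
 show "comodule C (comod_sum C V W)"
  using matrix_corep_block[OF comodule_matrix[OF V] comodule_matrix[OF W]] by simp
qed

end

context field_coalgebra
begin

lemma iso_class_matrix:
 assumes "comodule C V" "comodule_basis C V d e ec" "comodule C W" "comodule_basis C W d e' ec"
 shows "corep_iso_class C V = corep_iso_class C W"
 unfolding corep_iso_class_eq[OF assms(1,2)] corep_iso_class_eq[OF assms(3,4)] ..

lemma iso_class_nonempty:
 assumes "comodule C V" "comodule_basis C V d e ec"
 obtains W :: "('k, nat => 'k, 'c) comod" and e' where "corep C W" "comodule_basis C W d e' ec"
  "W \<in> corep_iso_class C V" "corep_iso_class C V = corep_iso_class C W"
proof -
 obtain W :: "('k, nat => 'k, 'c) comod" and e' where W: "corep C W" "comodule_basis C W d e' ec"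
  using matrix_comodule_exists[OF comodule_matrix[OF assms]] .
 then have "W \<in> corep_iso_class C V" unfolding corep_iso_class_eq[OF assms] by blast
 moreover have "corep_iso_class C V = corep_iso_class C W"
  using iso_class_matrix[OF assms _ W(2)] W(1) by (simp add: corep_def)
 ultimately show ?thesis using that W by blast
qed

lemma iso_class_gen: "corep C V ==> corep_iso_class C V \<in> Rf_gens C"
proof -
 assume V: "corep C V"
 then obtain d e ec where b: "comodule_basis C V d e ec" by (rule corep_comodule_basis)
 have "comodule C V" using V by (simp add: corep_def)
 from iso_class_nonempty[OF this b] show ?thesis unfolding Rf_gens_def by blast
qed

lemma corep_comod_sum: "corep C V ==> corep C W ==> corep C (comod_sum C V W)"
proof -
 assume V: "corep C V" and W: "corep C W"
 obtain d e ec where b: "comodule_basis C V d e ec" using corep_comodule_basis[OF V] .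
 obtain d' e' ec' where b': "comodule_basis C W d' e' ec'" using corep_comodule_basis[OF W] .
 have "comodule C V" "comodule C W" using V W by (simp_all add: corep_def)
 from comod_sum_basis[OF this(1) b this(2) b'] show ?thesis
  unfolding corep_def finite_dimensional_def comodule_basis_def by blast
qed

lemma presentation_Rf: "presentation (Rf_gens C) (Rf_rels C)"
proof
 fix r assume "r \<in> Rf_rels C"
 then obtain V W :: "('k, nat => 'k, 'c) comod" where "corep C V" "corep C W"
  "r = frag_of (corep_iso_class C (comod_sum C V W)) - frag_of (corep_iso_class C V) - frag_of (corep_iso_class C W)"
  unfolding Rf_rels_def by blast
 then show "supp r \<subseteq> Rf_gens C"
  by (simp only:) (intro keys_diff_subset, simp_all add: iso_class_gen corep_comod_sum)
qed

end

lemma alg_comod_eq: "alg_comod P = comod_on (alg_space P) (alg_coact P)"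
 by (simp add: alg_comod_def comod_on_def module_of_def)

lemma tensor_map_comod_on: "tensor_map (comod_on M \<delta>) W = tensor_map M W"
 unfolding tensor_map_def tensor_comod_on ..

sublocale galois_extension \<subseteq> K: field_coalgebra C by unfold_locales (rule coalgebra)

context galois_extension
begin

text \<open>Both sides of the colinearity condition are linear in \<open>v\<close>.\<close>

lemma colinear_iff:
 assumes V: "matrix_coaction C V d e ec" and f: "lin_map UNIV V A f"
 shows "colinear C V (alg_comod P) f \<longleftrightarrow> (\<forall>j<d. \<Delta> (f (e j)) = (\<Oplus>\<^bsub>AS.T\<^esub>k\<in>{..<d}. pAS (f (e k)) (ec k j)))"
proof -
 interpret V: matrix_coaction C V d e ec by fact
 note fl = tensor_map_linear[OF V.Vm S_module A_module S_module f lin_map_id, folded id_def]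
  and fp = tensor_map_pure[OF V.Vm S_module A_module S_module f lin_map_id, folded id_def]
 have b: "tensor_map A S f id (coact V (e j)) = (\<Oplus>\<^bsub>AS.T\<^esub>k\<in>{..<d}. pAS (f (e k)) (ec k j))" if j: "j < d" for j
 proof -
  have "tensor_map A S f id (coact V (e j)) = (\<Oplus>\<^bsub>AS.T\<^esub>k\<in>{..<d}. tensor_map A S f id (V.VS.pr (e k) (ec k j)))"
   unfolding V.coact_basis[OF j]
   by (rule lin_map_finsum[OF V.VS.abelian_T AS.abelian_T fl V.pVS_Pi finite_lessThan])
  also have "\<dots> = (\<Oplus>\<^bsub>AS.T\<^esub>k\<in>{..<d}. pAS (f (e k)) (ec k j))"
   by (rule AS.T.finsum_cong'[OF refl]) (use pAS_closed V.e_closed in \<open>auto simp: fp\<close>)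
  finally show ?thesis .
 qed
 have "colinear C V (alg_comod P) f \<longleftrightarrow> (\<forall>v\<in>carrier V. \<Delta> (f v) = tensor_map A S f id (coact V v))"
  using f unfolding colinear_def alg_comod_eq tensor_map_comod_on by (simp add: lin_map_def)
 also have "\<dots> \<longleftrightarrow> (\<forall>j<d. \<Delta> (f (e j)) = tensor_map A S f id (coact V (e j)))"
 proof
  assume a: "\<forall>j<d. \<Delta> (f (e j)) = tensor_map A S f id (coact V (e j))"
  show "\<forall>v\<in>carrier V. \<Delta> (f v) = tensor_map A S f id (coact V v)"
  proof
   fix v assume "v \<in> carrier V"
   from V.lin_eqI[OF AS.abelian_T lin_map_comp[OF f \<Delta>_linear] lin_map_comp[OF V.coact_linear fl] _ this] a
   show "\<Delta> (f v) = tensor_map A S f id (coact V v)" by simp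
  qed
 qed (use V.e_closed in blast)
 finally show ?thesis using b by simp
qed

end

context galois_corep
begin

lemma hom_iso:
 assumes V: "comodule C V" "comodule_basis C V d e ec"
 shows "module_iso Bc tuple_module (hom_module C P V)"
proof -
 interpret V: matrix_coaction C V d e ec by (rule K.matrix_coactionI[OF V])
 define val where "val h v = (\<Sum>j<d. sc (coordinate V d e v j) (h j))" for h v
 have val_eq: "val h v = (\<Oplus>\<^bsub>A\<^esub>j\<in>{..<d}. coordinate V d e v j \<odot>\<^bsub>A\<^esub> h j)" for h v
  unfolding val_def by (subst finsum_module_of[OF AA.V]) simp_all
 have vl: "lin_map UNIV V A (val h)" for h
  unfolding val_eq by (rule V.extension_linear[OF A_module]) simp
 have vb: "val h (e j) = h j" if "j < d" for h j
  unfolding val_eq by (rule V.extension_basis[OF A_module _ that]) simp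
 define \<psi> where "\<psi> h = restrict (val h) (carrier V)" for h
 define \<phi> where "\<phi> f = (\<lambda>j. if j < d then f (e j) else 0)" for f :: "'a => 'p"
 have \<psi>l: "lin_map UNIV V A (\<psi> h)" for h
  using vl[of h] V.V.a_closed V.smult_closed unfolding lin_map_def \<psi>_def by simp
 have \<psi>b: "\<psi> h (e j) = h j" if "j < d" for h j using that by (simp add: \<psi>_def vb V.e_closed)
 have c: "f \<in> carrier (hom_module C P V) \<longleftrightarrow> f \<in> extensional (carrier V) \<and> lin_map UNIV V A f \<and> colinear C V (alg_comod P) f" for f
  by (auto simp: hom_module_def colinear_def lin_map_def)
 have \<psi>c: "\<psi> h \<in> carrier (hom_module C P V)" if h: "h \<in> tuples" for h
 proof -
  have "(\<Oplus>\<^bsub>AS.T\<^esub>k\<in>{..<d}. pAS (\<psi> h (e k)) (ec k j)) = (\<Oplus>\<^bsub>AS.T\<^esub>k\<in>{..<d}. pAS (h k) (ec k j))" for j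
   by (rule AS.T.finsum_cong'[OF refl pAS_Pi]) (simp add: \<psi>b)
  then have "colinear C V (alg_comod P) (\<psi> h)"
   unfolding colinear_iff[OF V.matrix_coaction_axioms \<psi>l] using h by (simp add: \<psi>b tuples_def)
  then show ?thesis unfolding c using \<psi>l by (simp add: \<psi>_def)
 qed
 have \<phi>c: "\<phi> f \<in> tuples" if f: "f \<in> carrier (hom_module C P V)" for f
 proof -
  have "(\<Oplus>\<^bsub>AS.T\<^esub>k\<in>{..<d}. pAS (\<phi> f k) (ec k j)) = (\<Oplus>\<^bsub>AS.T\<^esub>k\<in>{..<d}. pAS (f (e k)) (ec k j))" for j
   by (rule AS.T.finsum_cong'[OF refl pAS_Pi]) (simp add: \<phi>_def)
  moreover have "\<forall>j<d. \<Delta> (f (e j)) = (\<Oplus>\<^bsub>AS.T\<^esub>k\<in>{..<d}. pAS (f (e k)) (ec k j))"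
   using f colinear_iff[OF V.matrix_coaction_axioms, of f] unfolding c by blast
  ultimately show ?thesis by (simp add: tuples_def) (simp add: \<phi>_def)
 qed
 have 1: "\<phi> (\<psi> h) = h" if "h \<in> tuples" for h
  using that by (auto simp: \<phi>_def \<psi>b tuples_def fun_eq_iff)
 have 2: "\<psi> (\<phi> f) = f" if f: "f \<in> carrier (hom_module C P V)" for f
 proof (rule extensionalityI[of _ "carrier V"])
  show "\<psi> (\<phi> f) \<in> extensional (carrier V)" by (simp add: \<psi>_def)
  show "f \<in> extensional (carrier V)" using f c by blast
  have fl: "lin_map UNIV V A f" using f c by blast
  show "\<psi> (\<phi> f) v = f v" if v: "v \<in> carrier V" for v
   by (rule V.lin_eqI[OF AA.V \<psi>l fl _ v]) (simp add: \<psi>b, simp add: \<phi>_def)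
 qed
 have "bij_betw \<psi> (carrier tuple_module) (carrier (hom_module C P V))"
  by (rule bij_betw_byWitness[where f' = \<phi>]) (use 1 2 \<psi>c \<phi>c in auto)
 moreover have "lin_map Bc tuple_module (hom_module C P V) \<psi>"
  unfolding lin_map_def
 proof (intro conjI ballI)
  show "\<psi> \<in> carrier tuple_module \<rightarrow> carrier (hom_module C P V)" using \<psi>c by simp
  show "\<psi> (h \<oplus>\<^bsub>tuple_module\<^esub> h') = \<psi> h \<oplus>\<^bsub>hom_module C P V\<^esub> \<psi> h'" for h h'
   by (auto simp: \<psi>_def val_def hom_module_def fun_eq_iff P.scale_right_distrib sum.distrib)
  show "\<psi> (b \<odot>\<^bsub>tuple_module\<^esub> h) = b \<odot>\<^bsub>hom_module C P V\<^esub> \<psi> h" for b h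
   by (auto simp: \<psi>_def val_def hom_module_def fun_eq_iff sum_distrib_left scr)
 qed
 ultimately show ?thesis unfolding module_iso_def by blast
qed

lemma K0_class_hom:
 assumes "comodule C V" "comodule_basis C V d e ec"
 shows "K0_class Bc (hom_module C P V) = K0_class Bc tuple_module"
 unfolding K0_class_def proj_iso_class_cong[OF left_module_tuples hom_iso[OF assms]] ..

lemma fg_projective_tuples: "fg_projective Bc tuple_module"
proof -
 obtain M :: nat and a h where "retract Bc tuple_module M (\<lambda>f \<mu>. if \<mu> < M then \<Sum>j<d. f j * a j \<mu> else 0) (\<lambda>b j. \<Sum>\<mu><M. b \<mu> * h \<mu> j)"
  by (rule tuple_retract) blast
 then show ?thesis unfolding fg_projective_retract by blast
qed

end

context galois_extension
begin

interpretation K0: presentation "K0_gens Bc" "K0_rels Bc" by (rule SB.presentation_K0)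

lemma K0_class_direct_sum:
 fixes M N :: "('p, nat => 'p) module"
 assumes M: "fg_projective Bc M" and N: "fg_projective Bc N"
 shows "K0_class Bc (direct_sum M N) = K0_class Bc M \<otimes>\<^bsub>K0 Bc\<^esub> K0_class Bc N"
proof -
 have "frag_of (proj_iso_class Bc (direct_sum M N)) - frag_of (proj_iso_class Bc M) - frag_of (proj_iso_class Bc N) \<in> K0_rels Bc"
  unfolding K0_rels_def using M N by blast
 from K0.rspan_gen[OF this] show ?thesis
  unfolding K0_class_def K0_def using SB.proj_class_mem[OF M] SB.proj_class_mem[OF N]
  by (subst K0.mult_class) (simp_all add: K0.class_eq_iff algebra_simps)
qed

lemma tuple_block_iso:
 assumes ec: "matrix_corep C d ec" and ec': "matrix_corep C d' ec'"
 shows "module_iso Bc (direct_sum (galois_corep.tuple_module C P d ec) (galois_corep.tuple_module C P d' ec'))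
  (galois_corep.tuple_module C P (d + d') (block_matrix d ec ec'))"
proof -
 let ?b = "block_matrix d ec ec'"
 interpret X: galois_corep C P g l d ec by unfold_locales (rule ec)
 interpret Y: galois_corep C P g l d' ec' by unfold_locales (rule ec')
 interpret Z: galois_corep C P g l "d + d'" ?b by unfold_locales (rule K.matrix_corep_block[OF ec ec'])
 have pz: "pAS x 0 = \<zero>\<^bsub>AS.T\<^esub>" for x using AS.pure_zero_right[of x] by simp
 have cl: "(\<Oplus>\<^bsub>AS.T\<^esub>k\<in>I. pAS (f k) (c k)) \<in> carrier AS.T" for f c and I :: "nat set"
  by (rule AS.T.finsum_closed[OF X.pAS_Pi])
 have split: "(\<Oplus>\<^bsub>AS.T\<^esub>k\<in>{..<d + d'}. pAS (z k) (?b k j)) =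
   (\<Oplus>\<^bsub>AS.T\<^esub>k\<in>{..<d}. pAS (z k) (?b k j)) \<oplus>\<^bsub>AS.T\<^esub> (\<Oplus>\<^bsub>AS.T\<^esub>k\<in>{..<d'}. pAS (z (d + k)) (?b (d + k) j))" for z j
  by (rule AS.T.finsum_append) (rule pAS_closed)
 have left: "(\<Oplus>\<^bsub>AS.T\<^esub>k\<in>{..<d + d'}. pAS (z k) (?b k j)) = (\<Oplus>\<^bsub>AS.T\<^esub>k\<in>{..<d}. pAS (z k) (ec k j))" if j: "j < d" for z j
 proof -
  have "(\<Oplus>\<^bsub>AS.T\<^esub>k\<in>{..<d}. pAS (z k) (?b k j)) = (\<Oplus>\<^bsub>AS.T\<^esub>k\<in>{..<d}. pAS (z k) (ec k j))"
   by (rule AS.T.finsum_cong'[OF refl X.pAS_Pi]) (use j in simp)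
  moreover have "(\<Oplus>\<^bsub>AS.T\<^esub>k\<in>{..<d'}. pAS (z (d + k)) (?b (d + k) j)) = \<zero>\<^bsub>AS.T\<^esub>"
   by (rule AS.T.finsum_zero') (use j in \<open>simp add: pz\<close>)
  ultimately show ?thesis unfolding split using cl by simp
 qed
 have right: "(\<Oplus>\<^bsub>AS.T\<^esub>k\<in>{..<d + d'}. pAS (z k) (?b k (d + j))) = (\<Oplus>\<^bsub>AS.T\<^esub>k\<in>{..<d'}. pAS (z (d + k)) (ec' k j))" for z j
 proof -
  have "(\<Oplus>\<^bsub>AS.T\<^esub>k\<in>{..<d'}. pAS (z (d + k)) (?b (d + k) (d + j))) = (\<Oplus>\<^bsub>AS.T\<^esub>k\<in>{..<d'}. pAS (z (d + k)) (ec' k j))"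
   by (rule AS.T.finsum_cong'[OF refl X.pAS_Pi]) simp
  moreover have "(\<Oplus>\<^bsub>AS.T\<^esub>k\<in>{..<d}. pAS (z k) (?b k (d + j))) = \<zero>\<^bsub>AS.T\<^esub>"
   by (rule AS.T.finsum_zero') (simp add: pz)
  ultimately show ?thesis unfolding split using cl by simp
 qed
 define f where "f = (\<lambda>(x :: nat => 'p, y :: nat => 'p) j. if j < d then x j else y (j - d))"
 define h where "h z = ((\<lambda>j. if j < d then z j else 0 :: 'p), (\<lambda>j. z (d + j)))" for z
 have f1: "f (x, y) j = x j" if "j < d" for x y j using that by (simp add: f_def)
 have f2: "f (x, y) (d + j) = y j" for x y j by (simp add: f_def)
 have fc: "f (x, y) \<in> Z.tuples" if x: "x \<in> X.tuples" and y: "y \<in> Y.tuples" for x y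
  unfolding Z.tuples_def mem_Collect_eq
 proof (intro conjI allI impI)
  show "f (x, y) j = 0" if "d + d' \<le> j" for j using that y by (auto simp: f_def Y.tuples_def)
  fix j assume j: "j < d + d'"
  show "\<Delta> (f (x, y) j) = (\<Oplus>\<^bsub>AS.T\<^esub>k\<in>{..<d + d'}. pAS (f (x, y) k) (?b k j))"
  proof (rule split_index[OF j])
   assume j: "j < d"
   have "(\<Oplus>\<^bsub>AS.T\<^esub>k\<in>{..<d}. pAS (f (x, y) k) (ec k j)) = (\<Oplus>\<^bsub>AS.T\<^esub>k\<in>{..<d}. pAS (x k) (ec k j))"
    by (rule AS.T.finsum_cong'[OF refl X.pAS_Pi]) (simp add: f1)
   then show "\<Delta> (f (x, y) j) = (\<Oplus>\<^bsub>AS.T\<^esub>k\<in>{..<d + d'}. pAS (f (x, y) k) (?b k j))"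
    unfolding left[OF j] f1[OF j] using x j by (simp add: X.tuples_def)
  next
   fix q assume j: "j = d + q" and q: "q < d'"
   show "\<Delta> (f (x, y) j) = (\<Oplus>\<^bsub>AS.T\<^esub>k\<in>{..<d + d'}. pAS (f (x, y) k) (?b k j))"
    unfolding j right f2 using y q by (simp add: Y.tuples_def)
  qed
 qed
 have hc: "fst (h z) \<in> X.tuples" "snd (h z) \<in> Y.tuples" if z: "z \<in> Z.tuples" for z
 proof -
  have zj: "\<Delta> (z j) = (\<Oplus>\<^bsub>AS.T\<^esub>k\<in>{..<d + d'}. pAS (z k) (?b k j))" if "j < d + d'" for j
   using z that unfolding Z.tuples_def mem_Collect_eq by blast
  have "(\<Oplus>\<^bsub>AS.T\<^esub>k\<in>{..<d}. pAS (if k < d then z k else 0) (ec k j)) = (\<Oplus>\<^bsub>AS.T\<^esub>k\<in>{..<d}. pAS (z k) (ec k j))" for j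
   by (rule AS.T.finsum_cong'[OF refl X.pAS_Pi]) simp
  moreover have "\<Delta> (z j) = (\<Oplus>\<^bsub>AS.T\<^esub>k\<in>{..<d}. pAS (z k) (ec k j))" if "j < d" for j
   using zj[of j] left[OF that] that by simp
  ultimately show "fst (h z) \<in> X.tuples" by (simp add: X.tuples_def h_def)
  have "\<Delta> (z (d + j)) = (\<Oplus>\<^bsub>AS.T\<^esub>k\<in>{..<d'}. pAS (z (d + k)) (ec' k j))" if "j < d'" for j
   using zj[of "d + j"] right[of z j] that by simp
  moreover have "z (d + j) = 0" if "j \<ge> d'" for j using z that by (simp add: Z.tuples_def)
  ultimately show "snd (h z) \<in> Y.tuples" by (simp add: Y.tuples_def h_def)
 qed
 have hf: "h (f (x, y)) = (x, y)" if "x \<in> X.tuples" for x y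
  using that by (auto simp: h_def f_def X.tuples_def fun_eq_iff)
 have fh: "f (h z) = z" for z by (auto simp: h_def f_def fun_eq_iff)
 have "bij_betw f (carrier (direct_sum X.tuple_module Y.tuple_module)) (carrier Z.tuple_module)"
 proof (rule bij_betw_byWitness[where f' = h])
  show "\<forall>p\<in>carrier (direct_sum X.tuple_module Y.tuple_module). h (f p) = p" using hf by auto
  show "\<forall>z\<in>carrier Z.tuple_module. f (h z) = z" using fh by auto
  show "f ` carrier (direct_sum X.tuple_module Y.tuple_module) \<subseteq> carrier Z.tuple_module" using fc by auto
  show "h ` carrier Z.tuple_module \<subseteq> carrier (direct_sum X.tuple_module Y.tuple_module)"
   using hc by (simp add: image_subset_iff mem_Times_iff)
 qed
 moreover have "lin_map Bc (direct_sum X.tuple_module Y.tuple_module) Z.tuple_module f"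
  unfolding lin_map_def using fc by (auto simp: f_def fun_eq_iff)
 ultimately show ?thesis unfolding module_iso_def by blast
qed

lemma K0_class_block:
 assumes ec: "matrix_corep C d ec" and ec': "matrix_corep C d' ec'"
 shows "K0_class Bc (galois_corep.tuple_module C P (d + d') (block_matrix d ec ec')) =
  K0_class Bc (galois_corep.tuple_module C P d ec) \<otimes>\<^bsub>K0 Bc\<^esub> K0_class Bc (galois_corep.tuple_module C P d' ec')"
proof -
 interpret X: galois_corep C P g l d ec by unfold_locales (rule ec)
 interpret Y: galois_corep C P g l d' ec' by unfold_locales (rule ec')
 have "proj_iso_class Bc (direct_sum X.tuple_module Y.tuple_module) =
   proj_iso_class Bc (galois_corep.tuple_module C P (d + d') (block_matrix d ec ec'))"
  by (rule proj_iso_class_cong[OF left_module_direct_sum[OF X.left_module_tuples Y.left_module_tuples] tuple_block_iso[OF ec ec']])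
 then show ?thesis
  using K0_class_direct_sum[OF X.fg_projective_tuples Y.fg_projective_tuples] by (simp add: K0_class_def)
qed

text \<open>The choice inside the class is immaterial, since the module depends only on the matrix.\<close>

definition assoc_gen :: "('k, nat => 'k, 'c) comod set => (('p, nat => 'p) module set \<Rightarrow>\<^sub>0 int) set" where
 "assoc_gen c = K0_class Bc (hom_module C P (SOME W. W \<in> c))"

lemma assoc_gen_class:
 assumes V: "comodule C V" "comodule_basis C V d e ec"
 shows "assoc_gen (corep_iso_class C V) = K0_class Bc (galois_corep.tuple_module C P d ec)"
proof -
 interpret X: galois_corep C P g l d ec by unfold_locales (rule K.comodule_matrix[OF V])
 obtain W0 :: "('k, nat => 'k, 'c) comod" where "W0 \<in> corep_iso_class C V"
  by (rule K.iso_class_nonempty[OF V])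
 then have "(SOME W. W \<in> corep_iso_class C V) \<in> corep_iso_class C V" by (rule someI)
 then obtain e' where "corep C (SOME W. W \<in> corep_iso_class C V)" "comodule_basis C (SOME W. W \<in> corep_iso_class C V) d e' ec"
  unfolding K.corep_iso_class_eq[OF V] by blast
 then show ?thesis unfolding assoc_gen_def by (intro X.K0_class_hom) (simp_all add: corep_def)
qed

lemma tuple_class_closed:
 assumes "matrix_corep C d ec"
 shows "K0_class Bc (galois_corep.tuple_module C P d ec) \<in> carrier (K0 Bc)"
proof -
 interpret X: galois_corep C P g l d ec by unfold_locales (rule assms)
 show ?thesis unfolding K0_class_def K0_def
  by (rule K0.class_closed) (simp add: SB.proj_class_mem[OF X.fg_projective_tuples])
qed

lemma assoc_hom_exists:
 "\<exists>h. h \<in> hom (Rf C) (K0 Bc) \<and>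
   (\<forall>V :: ('k, nat => 'k, 'c) comod. corep C V \<longrightarrow> h (Rf_class C V) = K0_class Bc (hom_module C P V))"
proof -
 interpret R: presentation "Rf_gens C" "Rf_rels C" by (rule K.presentation_Rf)
 have G: "comm_group (K0 Bc)" unfolding K0_def by (rule K0.comm_group_presented)
 have gen: "assoc_gen \<in> Rf_gens C \<rightarrow> carrier (K0 Bc)"
 proof
  fix c assume "c \<in> Rf_gens C"
  then obtain V :: "('k, nat => 'k, 'c) comod" where V: "corep C V" "c = corep_iso_class C V" unfolding Rf_gens_def by blast
  obtain d e ec where b: "comodule_basis C V d e ec" using K.corep_comodule_basis[OF V(1)] .
  have cV: "comodule C V" using V(1) by (simp add: corep_def)
  show "assoc_gen c \<in> carrier (K0 Bc)"
   unfolding V(2) assoc_gen_class[OF cV b] by (rule tuple_class_closed[OF K.comodule_matrix[OF cV b]])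
 qed
 have kills: "frag_eval (K0 Bc) assoc_gen r = \<one>\<^bsub>K0 Bc\<^esub>" if "r \<in> Rf_rels C" for r
 proof -
  from that obtain V W :: "('k, nat => 'k, 'c) comod" where V: "corep C V" and W: "corep C W" and r:
   "r = frag_of (corep_iso_class C (comod_sum C V W)) - frag_of (corep_iso_class C V) - frag_of (corep_iso_class C W)"
   unfolding Rf_rels_def by blast
  obtain d e ec where b: "comodule_basis C V d e ec" using K.corep_comodule_basis[OF V] .
  obtain d' e' ec' where b': "comodule_basis C W d' e' ec'" using K.corep_comodule_basis[OF W] .
  have cV: "comodule C V" "comodule C W" using V W by (simp_all add: corep_def)
  note m = K.comodule_matrix[OF cV(1) b] K.comodule_matrix[OF cV(2) b']
  from K.comod_sum_basis[OF cV(1) b cV(2) b'] obtain bs where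
   s: "comodule C (comod_sum C V W)" "comodule_basis C (comod_sum C V W) (d + d') bs (block_matrix d ec ec')" by blast
  show ?thesis unfolding r
  proof (rule comm_group.frag_eval_triple_one[OF G])
   show "assoc_gen (corep_iso_class C (comod_sum C V W)) =
    assoc_gen (corep_iso_class C V) \<otimes>\<^bsub>K0 Bc\<^esub> assoc_gen (corep_iso_class C W)"
    unfolding assoc_gen_class[OF s] assoc_gen_class[OF cV(1) b] assoc_gen_class[OF cV(2) b'] by (rule K0_class_block[OF m])
  qed (use gen K.iso_class_gen V W K.corep_comod_sum in blast)+
 qed
 have "lift_hom (K0 Bc) assoc_gen \<in> hom (Rf C) (K0 Bc)"
  unfolding Rf_def by (rule R.lift_hom_is_hom[OF G gen kills])
 moreover have "lift_hom (K0 Bc) assoc_gen (Rf_class C V) = K0_class Bc (hom_module C P V)"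
  if V: "corep C V" for V :: "('k, nat => 'k, 'c) comod"
 proof -
  obtain d e ec where b: "comodule_basis C V d e ec" using K.corep_comodule_basis[OF V] .
  have cV: "comodule C V" using V by (simp add: corep_def)
  interpret X: galois_corep C P g l d ec by unfold_locales (rule K.comodule_matrix[OF cV b])
  have "lift_hom (K0 Bc) assoc_gen (Rf_class C V) = assoc_gen (corep_iso_class C V)"
   unfolding Rf_class_def by (rule R.lift_hom_gen[OF G gen kills K.iso_class_gen[OF V]])
  then show ?thesis unfolding assoc_gen_class[OF cV b] X.K0_class_hom[OF cV b] .
 qed
 ultimately show ?thesis by blast
qed

lemma assoc_hom_class:
 assumes V: "comodule C V" "comodule_basis C V d e ec"
 shows "assoc_hom C P (Rf_class C V) = K0_class Bc (galois_corep.tuple_module C P d ec)"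
proof -
 interpret X: galois_corep C P g l d ec by unfold_locales (rule K.comodule_matrix[OF V])
 obtain W :: "('k, nat => 'k, 'c) comod" and e' where W: "corep C W" "comodule_basis C W d e' ec"
  "corep_iso_class C V = corep_iso_class C W"
  by (rule K.iso_class_nonempty[OF V])
 have "assoc_hom C P (Rf_class C W) = K0_class Bc (hom_module C P W)"
  using someI_ex[OF assoc_hom_exists, folded assoc_hom_def] W(1) by blast
 moreover have "K0_class Bc (hom_module C P W) = K0_class Bc X.tuple_module"
  by (rule X.K0_class_hom[OF _ W(2)]) (use W(1) in \<open>simp add: corep_def\<close>)
 ultimately show ?thesis by (simp add: Rf_class_def W(3))
qed

end

section \<open>Tensor powers as vector spaces\<close>

text \<open>A scalar acts on the first letter; by the relations any other letter would do. With this structure, maps out of tensor products into tensor powers come from bilinear maps.\<close>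

definition power_module :: "('k, 'v, 'z) module_scheme => nat => ('k, ('v list \<Rightarrow>\<^sub>0 int) set) module" where
 "power_module V m = \<lparr>carrier = carrier (tensor_power V m), monoid.mult = undefined, one = undefined,
   ring.zero = one (tensor_power V m), ring.add = monoid.mult (tensor_power V m),
   smult = (\<lambda>r. lift_hom (tensor_power V m) (\<lambda>xs. power_class V m (frag_of (xs[0 := r \<odot>\<^bsub>V\<^esub> (xs ! 0)]))))\<rparr>"

lemma slotwise_lift_hom:
 assumes V: "left_module UNIV V" and W: "left_module UNIV W" and F: "slotwise V m W n F"
  and z: "supp z \<subseteq> words V m"
 shows "lift_hom (tensor_power W n) (\<lambda>xs. power_class W n (frag_of (F xs))) (power_class V m z)
  = power_class W n (frag_extend (\<lambda>xs. frag_of (F xs)) z)"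
 unfolding tensor_power_def power_class_presented
 by (rule presentation_map.lift_hom_frag[OF slotwise_presentation_map[OF V W F] z])

lemma frag_extend_fun_diff: "frag_extend (\<lambda>x. F x - G x) z = frag_extend F z - frag_extend G z"
 using subset_UNIV by (induction z rule: frag_induction) (simp_all add: frag_extend_diff)

lemma (in presentation) frag_extend_rspan:
 "supp z \<subseteq> Y ==> (\<And>y. y \<in> Y ==> F y \<in> rel_span X R) ==> frag_extend F z \<in> rel_span X R"
 by (induction z rule: keys_induct) (simp_all add: rspan_zero frag_extend_diff rspan_diff)

locale tensor_words =
 fixes V :: "('k::field, 'v, 'z) module_scheme" and m :: nat
 assumes Vm: "left_module UNIV V" and pos: "0 < m"
begin

sublocale W: presentation "words V m" "multilinear_rel V m" by (rule presentation_words[OF Vm])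

abbreviation "pc \<equiv> power_class V m"

abbreviation "TP \<equiv> power_module V m"

abbreviation "keysW z \<equiv> supp z \<subseteq> words V m"

definition "sfrag r = frag_extend (\<lambda>xs. frag_of (xs[0 := r \<odot>\<^bsub>V\<^esub> (xs ! 0)]))"

lemma slotwise_scale_first: "slotwise V m V m (\<lambda>xs. xs[0 := r \<odot>\<^bsub>V\<^esub> (xs ! 0)])"
 unfolding slotwise_def
proof (intro conjI ballI allI impI)
 have sm: "r \<odot>\<^bsub>V\<^esub> v \<in> carrier V" if "v \<in> carrier V" for v by (rule left_module_smult_closed[OF Vm UNIV_I that])
 show "(\<lambda>xs. xs[0 := r \<odot>\<^bsub>V\<^esub> (xs ! 0)]) \<in> words V m \<rightarrow> words V m"
  using pos by (auto intro!: words_update sm words_nth)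
 fix xs i assume xs: "xs \<in> words V m" and i: "i < m"
 show "\<exists>j<m. \<exists>\<phi>. lin_map UNIV V V \<phi> \<and>
   (\<forall>v\<in>carrier V. xs[i := v, 0 := r \<odot>\<^bsub>V\<^esub> (xs[i := v] ! 0)] = xs[0 := r \<odot>\<^bsub>V\<^esub> (xs ! 0), j := \<phi> v])"
 proof (cases "i = 0")
  case True
  then show ?thesis using smult_linear(1)[OF Vm, of r] words_length[OF xs] i by (intro exI[of _ i] exI[of _ "(\<odot>\<^bsub>V\<^esub>) r"]) auto
 next
  case False
  then show ?thesis using lin_map_id[of UNIV V] i by (intro exI[of _ i] exI[of _ "\<lambda>x. x"]) (auto simp: list_update_swap)
 qed
qed

lemma TP_carrier: "carrier TP = pc ` {z. keysW z}"
 by (simp add: power_module_def tensor_power_def W.carrier_presented power_class_presented)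

lemma pc_closed: "keysW z ==> pc z \<in> carrier TP"
 by (auto simp: TP_carrier)

lemma TP_add: "keysW a ==> keysW b ==> pc a \<oplus>\<^bsub>TP\<^esub> pc b = pc (a + b)"
 by (simp add: power_module_def tensor_power_def W.mult_class power_class_presented)

lemma TP_zero: "\<zero>\<^bsub>TP\<^esub> = pc 0"
 by (simp add: power_module_def tensor_power_def W.one_presented power_class_presented)

lemma TP_smult: "keysW z ==> r \<odot>\<^bsub>TP\<^esub> pc z = pc (sfrag r z)"
 using slotwise_lift_hom[OF Vm Vm slotwise_scale_first] by (simp add: power_module_def sfrag_def)

lemma pc_eq_iff: "pc a = pc b \<longleftrightarrow> a - b \<in> pspan V m"
 unfolding power_class_presented by (rule W.class_eq_iff)

lemma sfrag_keys: "keysW z ==> keysW (sfrag r z)"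
 unfolding sfrag_def
 by (rule presentation_map.extend_keys[OF slotwise_presentation_map[OF Vm Vm slotwise_scale_first]])

lemma TP_group: "abelian_group TP"
proof (rule abelian_groupI)
 fix x assume "x \<in> carrier TP"
 then obtain z where z: "keysW z" "x = pc z" unfolding TP_carrier by blast
 then show "\<exists>y\<in>carrier TP. y \<oplus>\<^bsub>TP\<^esub> x = \<zero>\<^bsub>TP\<^esub>"
  by (intro bexI[of _ "pc (- z)"]) (simp_all add: TP_add TP_zero pc_closed)
qed (auto simp: TP_carrier TP_add TP_zero keys_add_subset add_ac)

lemma left_module_TP: "left_module UNIV TP"
 unfolding left_module_def
proof (intro conjI ballI TP_group)
 fix r :: 'k and x assume "x \<in> carrier TP"
 then obtain a where a: "keysW a" "x = pc a" unfolding TP_carrier by blast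
 show "r \<odot>\<^bsub>TP\<^esub> x \<in> carrier TP" unfolding a TP_smult[OF a(1)] by (rule pc_closed[OF sfrag_keys[OF a(1)]])
 fix y assume "y \<in> carrier TP"
 then obtain b where b: "keysW b" "y = pc b" unfolding TP_carrier by blast
 show "r \<odot>\<^bsub>TP\<^esub> (x \<oplus>\<^bsub>TP\<^esub> y) = r \<odot>\<^bsub>TP\<^esub> x \<oplus>\<^bsub>TP\<^esub> r \<odot>\<^bsub>TP\<^esub> y"
  unfolding a b using a(1) b(1) by (simp add: TP_add TP_smult sfrag_keys keys_add_subset) (simp add: sfrag_def frag_extend_add)
next
 fix r q :: 'k and x assume "x \<in> carrier TP"
 then obtain a where a: "keysW a" "x = pc a" unfolding TP_carrier by blast
 have "(r + q) \<odot>\<^bsub>V\<^esub> v = r \<odot>\<^bsub>V\<^esub> v \<oplus>\<^bsub>V\<^esub> q \<odot>\<^bsub>V\<^esub> v" "(r * q) \<odot>\<^bsub>V\<^esub> v = r \<odot>\<^bsub>V\<^esub> (q \<odot>\<^bsub>V\<^esub> v)" "r \<odot>\<^bsub>V\<^esub> v \<in> carrier V" if "v \<in> carrier V" for v r q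
  using Vm that unfolding left_module_def by blast+
 note sm = this
 have "sfrag (r + q) a - (sfrag r a + sfrag q a) \<in> pspan V m"
  using a(1)
 proof (induction a rule: keys_induct)
  case zero
  show ?case by (simp add: sfrag_def W.rspan_zero)
 next
  case (gen xs)
  have x: "xs ! 0 \<in> carrier V" by (rule words_nth[OF gen pos])
  from word_add_rel[OF gen pos sm(3)[OF x, of r] sm(3)[OF x, of q]]
  show ?case by (simp add: sfrag_def sm(1)[OF x] diff_diff_eq)
 next
  case (diff a b)
  from W.rspan_diff[OF diff(3,4)] show ?case by (simp add: sfrag_def frag_extend_diff algebra_simps)
 qed
 then show "(r + q) \<odot>\<^bsub>TP\<^esub> x = r \<odot>\<^bsub>TP\<^esub> x \<oplus>\<^bsub>TP\<^esub> q \<odot>\<^bsub>TP\<^esub> x"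
  unfolding a using a(1) by (simp add: TP_smult TP_add sfrag_keys pc_eq_iff)
 have "sfrag (r * q) a = sfrag r (sfrag q a)"
  using a(1)
 proof (induction a rule: keys_induct)
  case (gen xs)
  then show ?case using words_nth[OF gen pos] words_length[OF gen] pos by (simp add: sfrag_def sm)
 qed (simp_all add: sfrag_def frag_extend_diff)
 then show "(r * q) \<odot>\<^bsub>TP\<^esub> x = r \<odot>\<^bsub>TP\<^esub> (q \<odot>\<^bsub>TP\<^esub> x)"
  unfolding a using a(1) by (simp add: TP_smult sfrag_keys)
next
 fix x assume "x \<in> carrier TP"
 then obtain a where a: "keysW a" "x = pc a" unfolding TP_carrier by blast
 have "sfrag 1 a = a" using a(1)
 proof (induction a rule: keys_induct)
  case (gen xs)
  have "1 \<odot>\<^bsub>V\<^esub> (xs ! 0) = xs ! 0" using words_nth[OF gen pos] Vm unfolding left_module_def by blast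
  then show ?case by (simp add: sfrag_def)
 qed (simp_all add: sfrag_def frag_extend_diff)
 then show "1 \<odot>\<^bsub>TP\<^esub> x = x" unfolding a using a(1) by (simp add: TP_smult)
qed

lemma smult_word:
 assumes "xs \<in> words V m" "i < m"
 shows "r \<odot>\<^bsub>TP\<^esub> pc (frag_of xs) = pc (frag_of (xs[i := r \<odot>\<^bsub>V\<^esub> (xs ! i)]))"
 using word_scale_rel[OF assms(1) pos assms(2)] assms by (simp add: TP_smult pc_eq_iff sfrag_def)

lemma slot_linear:
 assumes xs: "xs \<in> words V m" and i: "i < m"
 shows "lin_map UNIV V TP (\<lambda>v. pc (frag_of (xs[i := v])))"
 unfolding lin_map_def
proof (intro conjI ballI)
 show "(\<lambda>v. pc (frag_of (xs[i := v]))) \<in> carrier V \<rightarrow> carrier TP"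
  using words_update[OF xs] by (auto intro!: pc_closed)
 fix v assume v: "v \<in> carrier V"
 show "pc (frag_of (xs[i := v \<oplus>\<^bsub>V\<^esub> w])) = pc (frag_of (xs[i := v])) \<oplus>\<^bsub>TP\<^esub> pc (frag_of (xs[i := w]))" if w: "w \<in> carrier V" for w
  using word_add_rel[OF xs i v w] words_update[OF xs] v w by (simp add: TP_add pc_eq_iff algebra_simps)
 show "pc (frag_of (xs[i := r \<odot>\<^bsub>V\<^esub> v])) = r \<odot>\<^bsub>TP\<^esub> pc (frag_of (xs[i := v]))" for r
  using smult_word[OF words_update[OF xs v] i, of r i] words_length[OF xs] i by simp
qed

end

lemma slotwise_linear:
 fixes V :: "('k::field, 'v, 'y) module_scheme" and W :: "('k, 'w, 'z) module_scheme"
 assumes V: "left_module UNIV V" and W: "left_module UNIV W" and F: "slotwise V m W n F" and pos: "0 < m" "0 < n"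
 shows "lin_map UNIV (power_module V m) (power_module W n) (lift_hom (tensor_power W n) (\<lambda>xs. power_class W n (frag_of (F xs))))"
proof -
 interpret V: tensor_words V m by unfold_locales (rule V pos)+
 interpret W: tensor_words W n by unfold_locales (rule W pos)+
 note l = slotwise_lift_hom[OF V W F]
 note k = presentation_map.extend_keys[OF slotwise_presentation_map[OF V W F]]
 have Fw: "F xs \<in> words W n" if "xs \<in> words V m" for xs using F that unfolding slotwise_def by blast
 let ?F = "frag_extend (\<lambda>xs. frag_of (F xs))"
 have s: "?F (V.sfrag r z) - W.sfrag r (?F z) \<in> pspan W n" if "V.keysW z" for r z
  using that
 proof (induction z rule: keys_induct)
  case zero
  show ?case by (simp add: V.sfrag_def W.sfrag_def W.W.rspan_zero)
 next
  case (gen xs)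
  obtain q where q: "q < n" "F (xs[0 := r \<odot>\<^bsub>V\<^esub> (xs ! 0)]) = (F xs)[q := r \<odot>\<^bsub>W\<^esub> (F xs ! q)]"
   by (rule slotwise_scale[OF V F gen pos(1)])
  show ?case using word_scale_rel[OF Fw[OF gen] q(1) pos(2), of r] by (simp add: V.sfrag_def W.sfrag_def q(2))
 next
  case (diff a b)
  from W.W.rspan_diff[OF diff(3,4)] show ?case by (simp add: V.sfrag_def W.sfrag_def frag_extend_diff algebra_simps)
 qed
 show ?thesis unfolding lin_map_def
 proof (intro conjI ballI Pi_I)
  fix x assume "x \<in> carrier (power_module V m)"
  then obtain a where a: "V.keysW a" "x = power_class V m a" unfolding V.TP_carrier by blast
  show "lift_hom (tensor_power W n) (\<lambda>xs. power_class W n (frag_of (F xs))) x \<in> carrier (power_module W n)"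
   unfolding a l[OF a(1)] by (rule W.pc_closed[OF k[OF a(1)]])
  show "lift_hom (tensor_power W n) (\<lambda>xs. power_class W n (frag_of (F xs))) (r \<odot>\<^bsub>power_module V m\<^esub> x) =
   r \<odot>\<^bsub>power_module W n\<^esub> lift_hom (tensor_power W n) (\<lambda>xs. power_class W n (frag_of (F xs))) x" for r
   unfolding a V.TP_smult[OF a(1)] l[OF a(1)] l[OF V.sfrag_keys[OF a(1)]] W.TP_smult[OF k[OF a(1)]] W.pc_eq_iff
   by (rule s[OF a(1)])
  fix y assume "y \<in> carrier (power_module V m)"
  then obtain b where b: "V.keysW b" "y = power_class V m b" unfolding V.TP_carrier by blast
  show "lift_hom (tensor_power W n) (\<lambda>xs. power_class W n (frag_of (F xs))) (x \<oplus>\<^bsub>power_module V m\<^esub> y) =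
   lift_hom (tensor_power W n) (\<lambda>xs. power_class W n (frag_of (F xs))) x \<oplus>\<^bsub>power_module W n\<^esub>
   lift_hom (tensor_power W n) (\<lambda>xs. power_class W n (frag_of (F xs))) y"
   unfolding a b V.TP_add[OF a(1) b(1)] l[OF a(1)] l[OF b(1)] l[OF keys_add_subset[OF a(1) b(1)]]
    W.TP_add[OF k[OF a(1)] k[OF b(1)]] by (simp add: frag_extend_add)
 qed
qed

section \<open>The iterated coproduct of the character\<close>

lemma Cons_idx: "(i # is) \<in> idx N (Suc m) \<longleftrightarrow> i < N \<and> is \<in> idx N m"
 by (auto simp: idx_def)

lemma sum_idx_Suc: "(\<Sum>is\<in>idx N (Suc m). F is) = (\<Sum>i<N. \<Sum>is\<in>idx N m. F (i # is))"
proof -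
 have b: "bij_betw (\<lambda>(i, is). i # is) ({..<N} \<times> idx N m) (idx N (Suc m))"
 proof (rule bij_betwI')
  fix y assume "y \<in> idx N (Suc m)"
  then show "\<exists>x\<in>{..<N} \<times> idx N m. y = (case x of (i, is) => i # is)"
   by (cases y) (auto simp: Cons_idx, simp add: idx_def)
 qed (auto simp: Cons_idx)
 have "(\<Sum>i<N. \<Sum>is\<in>idx N m. F (i # is)) = (\<Sum>x\<in>{..<N} \<times> idx N m. F (case x of (i, is) => i # is))"
  by (simp add: sum.cartesian_product case_prod_beta)
 also have "\<dots> = (\<Sum>is\<in>idx N (Suc m). F is)" by (rule sum.reindex_bij_betw[OF b])
 finally show ?thesis by simp
qed

lemma idx_zero: "idx N 0 = {[]}"
 by (auto simp: idx_def)

text \<open>Iterating \<open>\<Delta> e\<^sub>i\<^sub>j = \<Sum>\<^sub>k e\<^sub>i\<^sub>k \<otimes> e\<^sub>k\<^sub>j\<close> produces the words along the paths from \<open>i\<close> to \<open>j\<close>; closed paths give the cyclic words of the trace.\<close>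

primrec path_word :: "(nat => nat => 'c) => nat => nat list => nat => 'c list" where
 "path_word E i [] j = [E i j]"
| "path_word E i (k # ks) j = E i k # path_word E k ks j"

lemma length_path_word: "length (path_word E i is j) = Suc (length is)"
 by (induction "is" arbitrary: i) auto

lemma path_word_nth: "p \<le> length is ==> path_word E i is j ! p = E ((i # is) ! p) ((is @ [j]) ! p)"
proof (induction "is" arbitrary: i p)
 case (Cons k ks)
 then show ?case by (cases p) auto
qed simp

lemma path_word_cword: "path_word E i is i = cword (replicate (Suc (length is)) E) (i # is)"
 by (rule nth_equalityI) (auto simp: length_path_word path_word_nth cword_nth nth_append simp del: replicate.simps)

context field_coalgebra
begin

lemma tensor_words_S: "0 < m ==> tensor_words S m"
 by unfold_locales (rule S_module)

lemma slotwise_Cons: "slotwise S (Suc m) S (Suc (Suc m)) ((#) a)"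
 unfolding slotwise_def
proof (intro conjI ballI allI impI)
 show "(#) a \<in> words S (Suc m) \<rightarrow> words S (Suc (Suc m))" by (auto simp: words_def)
 show "\<exists>j<Suc (Suc m). \<exists>\<phi>. lin_map UNIV S S \<phi> \<and> (\<forall>v\<in>carrier S. a # xs[i := v] = (a # xs)[j := \<phi> v])"
  if "i < Suc m" for xs i
  using that lin_map_id[of UNIV S] by (intro exI[of _ "Suc i"]) (auto intro!: exI[of _ "\<lambda>x. x"])
qed

definition "prepend m a = lift_hom (tensor_power S (Suc (Suc m))) (\<lambda>cs. power_class S (Suc (Suc m)) (frag_of (a # cs)))"

lemma prepend_class:
 "supp z \<subseteq> words S (Suc m) ==>
  prepend m a (power_class S (Suc m) z) = power_class S (Suc (Suc m)) (frag_extend (\<lambda>cs. frag_of (a # cs)) z)"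
 unfolding prepend_def by (rule slotwise_lift_hom[OF S_module S_module slotwise_Cons])

lemma prepend_keys:
 "supp z \<subseteq> words S (Suc m) ==> supp (frag_extend (\<lambda>cs. frag_of (a # cs)) z) \<subseteq> words S (Suc (Suc m))"
 by (rule keys_frag_extend_subset) (auto simp: words_def)

lemma prepend_linear_right: "lin_map UNIV (power_module S (Suc m)) (power_module S (Suc (Suc m))) (prepend m a)"
 unfolding prepend_def by (rule slotwise_linear[OF S_module S_module slotwise_Cons]) simp_all

lemma prepend_linear_left:
 assumes X: "X \<in> carrier (power_module S (Suc m))"
 shows "lin_map UNIV S (power_module S (Suc (Suc m))) (\<lambda>a. prepend m a X)"
proof -
 interpret T1: tensor_words S "Suc m" by (rule tensor_words_S) simp
 interpret T2: tensor_words S "Suc (Suc m)" by (rule tensor_words_S) simp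
 obtain z where z: "T1.keysW z" "X = T1.pc z" using X unfolding T1.TP_carrier by blast
 let ?F = "\<lambda>a. frag_extend (\<lambda>cs. frag_of (a # cs)) z"
 have cs: "a # cs \<in> words S (Suc (Suc m))" if "cs \<in> words S (Suc m)" for a cs using that by (auto simp: words_def)
 show ?thesis unfolding lin_map_def z(2) prepend_class[OF z(1)]
 proof (intro conjI ballI Pi_I)
  show "T2.pc (?F a) \<in> carrier T2.TP" for a by (rule T2.pc_closed[OF prepend_keys[OF z(1)]])
  fix a b
  have "?F (a + b) - ?F a - ?F b = frag_extend (\<lambda>cs. frag_of ((a + b) # cs) - frag_of (a # cs) - frag_of (b # cs)) z"
   unfolding frag_extend_fun_diff ..
  also have "\<dots> \<in> pspan S (Suc (Suc m))"
  proof (rule T2.W.frag_extend_rspan[OF z(1)])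
   fix cs assume "cs \<in> words S (Suc m)"
   from word_add_rel[OF cs[OF this, of 0], of 0 a b]
   show "frag_of ((a + b) # cs) - frag_of (a # cs) - frag_of (b # cs) \<in> pspan S (Suc (Suc m))" by simp
  qed
  finally show "T2.pc (?F (a \<oplus>\<^bsub>S\<^esub> b)) = T2.pc (?F a) \<oplus>\<^bsub>T2.TP\<^esub> T2.pc (?F b)"
   by (simp add: T2.TP_add[OF prepend_keys[OF z(1)] prepend_keys[OF z(1)]] T2.pc_eq_iff diff_diff_eq)
 next
  fix r a
  have "T2.sfrag r (?F a) = ?F (coalg_scale C r a)"
   using z(1) by (induction z rule: keys_induct) (simp_all add: T2.sfrag_def frag_extend_diff)
  then show "T2.pc (?F (r \<odot>\<^bsub>S\<^esub> a)) = r \<odot>\<^bsub>T2.TP\<^esub> T2.pc (?F a)"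
   by (simp add: T2.TP_smult[OF prepend_keys[OF z(1)]])
 qed
qed

lemma lift_hom_power_module: "lift_hom (tensor_power V m) f X = tensor_lift (power_module V m) f X"
 by (rule lift_hom_cong_group) (simp_all add: power_module_def)

lemma iter_comult_linear: "lin_map UNIV S (power_module S (Suc m)) (iter_comult C m)"
 and iter_comult_Suc: "iter_comult C (Suc m) c =
  tensor_lift (power_module S (Suc (Suc m))) (\<lambda>(a, b). prepend m a (iter_comult C m b)) (comult C c)"
proof -
 have eq: "iter_comult C (Suc m) c =
  tensor_lift (power_module S (Suc (Suc m))) (\<lambda>(a, b). prepend m a (iter_comult C m b)) (comult C c)" for m c
  unfolding iter_comult.simps prepend_def lift_hom_power_module[symmetric] add_2_eq_Suc' ..
 then show "iter_comult C (Suc m) c =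
  tensor_lift (power_module S (Suc (Suc m))) (\<lambda>(a, b). prepend m a (iter_comult C m b)) (comult C c)" .
 show "lin_map UNIV S (power_module S (Suc m)) (iter_comult C m)"
 proof (induction m)
  case 0
  interpret T1: tensor_words S "Suc 0" by (rule tensor_words_S) simp
  have "[0] \<in> words S (Suc 0)" by (simp add: words_def)
  from T1.slot_linear[OF this, of 0] show ?case by (simp add: fun_eq_iff)
 next
  case (Suc m)
  interpret T2: tensor_words S "Suc (Suc m)" by (rule tensor_words_S) simp
  have "bilinear S S T2.TP (\<lambda>a b. prepend m a (iter_comult C m b))"
   unfolding bilinear_def
   using prepend_linear_left[OF lin_map_closed[OF Suc]] lin_map_comp[OF Suc prepend_linear_right] by blast
  from lin_map_comp[OF comult_linear SS.tensor_lift_linear[OF T2.left_module_TP this]]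
  show ?case unfolding eq .
 qed
qed

lemma finsum_pc:
 assumes "tensor_words V m" "finite I" "\<And>i. i \<in> I ==> supp (f i) \<subseteq> words V m"
 shows "(\<Oplus>\<^bsub>power_module V m\<^esub>i\<in>I. power_class V m (f i)) = power_class V m (\<Sum>i\<in>I. f i)"
proof -
 interpret T: tensor_words V m by fact
 interpret abelian_group T.TP by (rule T.TP_group)
 show ?thesis using assms(2,3)
 proof (induction I rule: finite_induct)
  case (insert i I)
  then show ?case by (subst finsum_insert) (auto simp: T.pc_closed T.TP_add keys_sum_subset)
 qed (simp add: T.TP_zero)
qed

lemma path_word_words: "path_word ec i is j \<in> words S (Suc (length is))"
 by (induction "is" arbitrary: i) (auto simp: words_def)

lemma iter_comult_matrix:
 assumes m: "matrix_corep C d ec" and i: "i < d" and j: "j < d"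
 shows "iter_comult C m (ec i j) = power_class S (Suc m) (\<Sum>is\<in>idx d m. frag_of (path_word ec i is j))"
 using i
proof (induction m arbitrary: i)
 case 0
 show ?case by (simp add: idx_zero)
next
 case (Suc m)
 interpret T1: tensor_words S "Suc m" by (rule tensor_words_S) simp
 interpret T2: tensor_words S "Suc (Suc m)" by (rule tensor_words_S) simp
 let ?z = "\<lambda>i m. \<Sum>is\<in>idx d m. frag_of (path_word ec i is j)"
 have zk: "supp (?z i m) \<subseteq> words S (Suc m)" for i m
  by (rule keys_sum_subset) (use path_word_words[of ec i _ j] in \<open>auto simp: idx_def\<close>)
 have b: "bilinear S S T2.TP (\<lambda>a b. prepend m a (iter_comult C m b))"
  unfolding bilinear_def
  using prepend_linear_left[OF lin_map_closed[OF iter_comult_linear]] lin_map_comp[OF iter_comult_linear prepend_linear_right] by blast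
 let ?l = "tensor_lift T2.TP (\<lambda>(a, b). prepend m a (iter_comult C m b))"
 have "iter_comult C (Suc m) (ec i j) = ?l (\<Oplus>\<^bsub>SS.T\<^esub>k\<in>{..<d}. SS.pr (ec i k) (ec k j))"
  unfolding iter_comult_Suc using assms(1) Suc.prems j by (simp add: matrix_corep_def)
 also have "\<dots> = (\<Oplus>\<^bsub>T2.TP\<^esub>k\<in>{..<d}. ?l (SS.pr (ec i k) (ec k j)))"
  by (rule lin_map_finsum[OF SS.abelian_T T2.TP_group SS.tensor_lift_linear[OF T2.left_module_TP b]]) (use SS.pure_closed in auto)
 also have "\<dots> = (\<Oplus>\<^bsub>T2.TP\<^esub>k\<in>{..<d}. T2.pc (frag_extend (\<lambda>cs. frag_of (ec i k # cs)) (?z k m)))"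
 proof (rule abelian_monoid.finsum_cong'[OF _ refl])
  show "abelian_monoid T2.TP" using T2.TP_group by (rule abelian_group.axioms(1))
  show "(\<lambda>k. T2.pc (frag_extend (\<lambda>cs. frag_of (ec i k # cs)) (?z k m))) \<in> {..<d} \<rightarrow> carrier T2.TP"
   by (auto intro!: T2.pc_closed prepend_keys zk)
  show "?l (SS.pr (ec i k) (ec k j)) = T2.pc (frag_extend (\<lambda>cs. frag_of (ec i k # cs)) (?z k m))" if "k \<in> {..<d}" for k
   using SS.lift_pure[OF T2.left_module_TP b, of "ec i k" "ec k j"] Suc.IH[of k] that prepend_class[OF zk] by simp
 qed
 also have "\<dots> = T2.pc (\<Sum>k<d. frag_extend (\<lambda>cs. frag_of (ec i k # cs)) (?z k m))"
  by (rule finsum_pc) (use T2.tensor_words_axioms prepend_keys zk in auto)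
 also have "(\<Sum>k<d. frag_extend (\<lambda>cs. frag_of (ec i k # cs)) (?z k m)) = ?z i (Suc m)"
  unfolding sum_idx_Suc by (simp add: frag_extend_sum)
 finally show ?case .
qed

lemma iter_comult_character:
 assumes "matrix_corep C d ec"
 shows "iter_comult C m (\<Sum>i<d. ec i i) = power_class S (Suc m) (trace_chain d ec m)"
proof -
 interpret T1: tensor_words S "Suc m" by (rule tensor_words_S) simp
 have "(\<Sum>i<d. ec i i) = (\<Oplus>\<^bsub>S\<^esub>i\<in>{..<d}. ec i i)"
  by (rule finsum_module_of[OF SS.V, symmetric]) auto
 then have "iter_comult C m (\<Sum>i<d. ec i i) = (\<Oplus>\<^bsub>T1.TP\<^esub>i\<in>{..<d}. iter_comult C m (ec i i))"
  using lin_map_finsum[OF SS.V T1.TP_group iter_comult_linear, of "\<lambda>i. ec i i" "{..<d}"] by simp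
 also have "\<dots> = (\<Oplus>\<^bsub>T1.TP\<^esub>i\<in>{..<d}. T1.pc (\<Sum>is\<in>idx d m. frag_of (path_word ec i is i)))"
 proof (rule abelian_monoid.finsum_cong'[OF _ refl])
  show "abelian_monoid T1.TP" using T1.TP_group by (rule abelian_group.axioms(1))
  show "(\<lambda>i. T1.pc (\<Sum>is\<in>idx d m. frag_of (path_word ec i is i))) \<in> {..<d} \<rightarrow> carrier T1.TP"
   using path_word_words[of ec] by (auto intro!: T1.pc_closed keys_sum_subset simp: idx_def)
 qed (simp add: iter_comult_matrix[OF assms])
 also have "\<dots> = T1.pc (\<Sum>i<d. \<Sum>is\<in>idx d m. frag_of (path_word ec i is i))"
  by (rule finsum_pc) (use T1.tensor_words_axioms path_word_words[of ec] in \<open>auto intro!: keys_sum_subset simp: idx_def\<close>)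
 also have "(\<Sum>i<d. \<Sum>is\<in>idx d m. frag_of (path_word ec i is i)) = trace_chain d ec m"
  unfolding trace_chain_eq tr_def length_replicate sum_idx_Suc path_word_cword
  by (intro sum.cong refl) (auto simp: idx_def simp del: replicate.simps)
 finally show ?thesis .
qed

end

section \<open>The connection map\<close>

lemma frag_extend_extend: "frag_extend F (frag_extend H z) = frag_extend (\<lambda>x. frag_extend F (H x)) z"
 using subset_UNIV by (induction z rule: frag_induction) (simp_all add: frag_extend_diff)

lemma frag_extend_swap:
 "frag_extend (\<lambda>a. frag_extend (\<lambda>b. K a b) z) y = frag_extend (\<lambda>b. frag_extend (\<lambda>a. K a b) y) z"
 using subset_UNIV
proof (induction z rule: frag_induction)
 case (diff a b)
 then show ?case by (simp add: frag_extend_diff frag_extend_fun_diff)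
qed (simp_all add: frag_extend_eq_0)

lemma frag_extend_of: "frag_extend frag_of z = z"
 using subset_UNIV by (induction z rule: frag_induction) (simp_all add: frag_extend_diff)

lemma expand_slot:
 "i < length zs ==> expand (zs[i := z]) = frag_extend (\<lambda>w. expand (zs[i := frag_of w])) z"
proof (induction zs arbitrary: i)
 case (Cons y ys)
 show ?case
 proof (cases i)
  case (Suc j)
  have "expand (ys[j := z]) = frag_extend (\<lambda>w. expand (ys[j := frag_of w])) z" using Cons Suc by simp
  then show ?thesis
   by (simp add: Suc frag_extend_extend frag_extend_swap[of _ _ y])
 qed simp
qed simp

text \<open>An expansion into words depends on a single generator in a slot only by overwriting that letter.\<close>

lemma expand_word_slot:
 "i < length zs ==> expand (zs[i := frag_of w]) = frag_extend (\<lambda>ws. frag_of (ws[i := w])) (expand (zs[i := frag_of w0]))"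
proof (induction zs arbitrary: i)
 case (Cons y ys)
 show ?case
 proof (cases i)
  case 0
  then show ?thesis by (simp add: frag_extend_extend)
 next
  case (Suc j)
  have "expand (ys[j := frag_of w]) = frag_extend (\<lambda>ws. frag_of (ws[j := w])) (expand (ys[j := frag_of w0]))"
   using Cons Suc by simp
  then show ?thesis by (simp add: Suc frag_extend_extend)
 qed
qed simp

lemma expand_keys: "supp (expand zs) \<subseteq> {ws. length ws = length zs}"
proof (induction zs)
 case (Cons y ys)
 show ?case unfolding expand.simps
  by (rule keys_frag_extend_subset[OF subset_UNIV], rule keys_frag_extend_subset[OF Cons]) simp
qed simp

lemma expand_sums:
 "expand (map (\<lambda>g. \<Sum>\<mu><M. frag_of (g \<mu>)) gs) = (\<Sum>\<mu>s\<in>idx M (length gs). frag_of (map2 (\<lambda>g \<mu>. g \<mu>) gs \<mu>s))"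
proof (induction gs)
 case (Cons g gs)
 show ?case by (simp add: Cons sum_idx_Suc frag_extend_sum)
qed (simp add: idx_zero)

lemma cyclic_mult_rot: "cyclic_mult ws = map2 (\<lambda>u w. snd u * fst w) (rot ws) ws"
 by (simp add: cyclic_mult_def rot_def)

lemma length_cyclic_mult [simp]: "length ws = Suc m ==> length (cyclic_mult ws) = Suc m"
 by (cases ws) (auto simp: cyclic_mult_rot rot_def)

lemma cyclic_mult_nth:
 "length ws = Suc m ==> p < Suc m ==> cyclic_mult ws ! p = snd (ws ! (if p = 0 then m else p - 1)) * fst (ws ! p)"
 using rot_nth[of p ws] length_rot[of ws] by (cases ws) (auto simp: cyclic_mult_rot)

text \<open>Changing the left component of one letter changes one product only. For a word of length one the other factor of that product is the right component of the same letter, which is why it is read off after the update.\<close>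

lemma cyclic_mult_left_slot:
 assumes "length ws = Suc m" "i < Suc m"
 shows "cyclic_mult (ws[i := (x, y)]) = (cyclic_mult (ws[i := (0, y)]))[i := snd (ws[i := (0, y)] ! (if i = 0 then m else i - 1)) * (x :: 'p::{ring,monoid_mult})]"
proof (rule nth_equalityI)
 fix p assume "p < length (cyclic_mult (ws[i := (x, y)]))"
 then have "p < Suc m" using assms by simp
 then show "cyclic_mult (ws[i := (x, y)]) ! p = (cyclic_mult (ws[i := (0, y)]))[i := snd (ws[i := (0, y)] ! (if i = 0 then m else i - 1)) * x] ! p"
  using assms by (cases "p = i") (auto simp: cyclic_mult_nth nth_list_update)
qed (use assms in simp)

lemma cyclic_mult_right_slot:
 assumes "length ws = Suc m" "i < Suc m"
 shows "cyclic_mult (ws[i := (x, y)]) = (cyclic_mult (ws[i := (x, 0)]))[(if i = m then 0 else Suc i) :=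
  (y :: 'p::{ring,monoid_mult}) * fst (ws[i := (x, 0)] ! (if i = m then 0 else Suc i))]"
proof (rule nth_equalityI)
 fix p assume "p < length (cyclic_mult (ws[i := (x, y)]))"
 then have "p < Suc m" using assms by simp
 then show "cyclic_mult (ws[i := (x, y)]) ! p = (cyclic_mult (ws[i := (x, 0)]))[(if i = m then 0 else Suc i) :=
   y * fst (ws[i := (x, 0)] ! (if i = m then 0 else Suc i))] ! p"
  using assms by (cases "p = (if i = m then 0 else Suc i)") (auto simp: cyclic_mult_nth nth_list_update split: if_splits)
qed (use assms in simp)

definition connection_frag :: "(('p \<times> 'p::times) \<Rightarrow>\<^sub>0 int) list => ('p list \<Rightarrow>\<^sub>0 int)" where
 "connection_frag zs = frag_extend (\<lambda>ws. frag_of (cyclic_mult ws)) (expand zs)"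

lemma connection_frag_diff:
 "i < length zs ==> connection_frag (zs[i := a - b]) = connection_frag (zs[i := a]) - connection_frag (zs[i := b])"
 unfolding connection_frag_def expand_slot[of i zs "a - b"] expand_slot[of i zs a] expand_slot[of i zs b]
 by (simp add: frag_extend_diff)

lemma connection_frag_zero: "i < length zs ==> connection_frag (zs[i := 0]) = 0"
 unfolding connection_frag_def by (subst expand_slot) simp_all

lemma connection_frag_slot:
 assumes "i < length zs"
 shows "connection_frag (zs[i := frag_of w]) =
  frag_extend (\<lambda>ws. frag_of (cyclic_mult (ws[i := w]))) (expand (zs[i := frag_of w0]))"
 unfolding connection_frag_def by (subst expand_word_slot[OF assms, of w w0]) (simp add: frag_extend_extend)

lemma lin_map_neg:
 assumes N: "left_module R N" and f: "lin_map R M N f"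
 shows "lin_map R M N (\<lambda>x. \<ominus>\<^bsub>N\<^esub> f x)"
proof -
 interpret abelian_group N by (rule left_module_group[OF N])
 have sm: "r \<odot>\<^bsub>N\<^esub> \<ominus>\<^bsub>N\<^esub> x = \<ominus>\<^bsub>N\<^esub> (r \<odot>\<^bsub>N\<^esub> x)" if r: "r \<in> R" and x: "x \<in> carrier N" for r x
 proof -
  have c: "r \<odot>\<^bsub>N\<^esub> y \<in> carrier N" if "y \<in> carrier N" for y by (rule left_module_smult_closed[OF N r that])
  have l: "lin_map {} N N ((\<odot>\<^bsub>N\<^esub>) r)" using N r by (auto simp: lin_map_def left_module_def)
  have "r \<odot>\<^bsub>N\<^esub> \<zero>\<^bsub>N\<^esub> = \<zero>\<^bsub>N\<^esub>"
  proof -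
   have "r \<odot>\<^bsub>N\<^esub> \<zero>\<^bsub>N\<^esub> \<oplus>\<^bsub>N\<^esub> r \<odot>\<^bsub>N\<^esub> \<zero>\<^bsub>N\<^esub> = r \<odot>\<^bsub>N\<^esub> \<zero>\<^bsub>N\<^esub>" using lin_map_add[OF l zero_closed zero_closed] by simp
   then show ?thesis using c[OF zero_closed] by (simp add: add.r_cancel_one')
  qed
  then have "r \<odot>\<^bsub>N\<^esub> \<ominus>\<^bsub>N\<^esub> x \<oplus>\<^bsub>N\<^esub> r \<odot>\<^bsub>N\<^esub> x = \<zero>\<^bsub>N\<^esub>"
   using lin_map_add[OF l a_inv_closed[OF x] x] x by (simp add: l_neg)
  then show ?thesis using minus_equality[of "r \<odot>\<^bsub>N\<^esub> \<ominus>\<^bsub>N\<^esub> x" "r \<odot>\<^bsub>N\<^esub> x"] c x by simp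
 qed
 show ?thesis
  using lin_map_closed[OF f] lin_map_add[OF f] lin_map_smult[OF f]
  unfolding lin_map_def by (auto simp: minus_add sm)
qed

context tensor_words
begin

lemma pc_diff: "keysW a ==> keysW b ==> pc (a - b) = pc a \<oplus>\<^bsub>TP\<^esub> \<ominus>\<^bsub>TP\<^esub> pc b"
proof -
 interpret G: abelian_group TP by (rule TP_group)
 assume a: "keysW a" and b: "keysW b"
 have "\<ominus>\<^bsub>TP\<^esub> pc b = pc (- b)"
  using b by (intro G.minus_equality) (simp_all add: pc_closed TP_add TP_zero)
 then show ?thesis using a b by (simp add: TP_add)
qed

lemma frag_extend_linear:
 assumes z: "supp z \<subseteq> Y" and k: "\<And>y v. y \<in> Y ==> keysW (F v y)"
  and l: "\<And>y. y \<in> Y ==> lin_map UNIV U TP (\<lambda>v. pc (F v y))"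
 shows "lin_map UNIV U TP (\<lambda>v. pc (frag_extend (F v) z))"
 using z
proof (induction z rule: keys_induct)
 case zero
 interpret G: abelian_group TP by (rule TP_group)
 have "r \<odot>\<^bsub>TP\<^esub> \<zero>\<^bsub>TP\<^esub> = \<zero>\<^bsub>TP\<^esub>" for r by (simp add: TP_zero TP_smult sfrag_def)
 then show ?case by (simp add: lin_map_def TP_zero[symmetric])
next
 case (gen y)
 then show ?case by (simp add: l)
next
 case (diff a b)
 have kk: "keysW (frag_extend (F v) a)" "keysW (frag_extend (F v) b)" for v
  using keys_frag_extend_subset[OF diff(1) k] keys_frag_extend_subset[OF diff(2) k] by auto
 have "pc (frag_extend (F v) (a - b)) = pc (frag_extend (F v) a) \<oplus>\<^bsub>TP\<^esub> \<ominus>\<^bsub>TP\<^esub> pc (frag_extend (F v) b)" for v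
  by (simp add: frag_extend_diff pc_diff kk)
 then show ?case using lin_map_plus[OF left_module_TP diff(3) lin_map_neg[OF left_module_TP diff(4)]] by simp
qed

end

lemma (in tensor_data) finsum_class:
 assumes "finite I" "\<And>i. i \<in> I ==> supp (f i) \<subseteq> carrier V \<times> carrier W"
 shows "(\<Oplus>\<^bsub>T\<^esub>i\<in>I. presented_class (carrier V \<times> carrier W) (balanced_rel R V \<rho> W lam) (f i)) =
  presented_class (carrier V \<times> carrier W) (balanced_rel R V \<rho> W lam) (\<Sum>i\<in>I. f i)"
 using assms
proof (induction I rule: finite_induct)
 case empty
 show ?case by (simp add: T_fields pres.one_presented)
next
 case (insert i I)
 have "presented_class (carrier V \<times> carrier W) (balanced_rel R V \<rho> W lam) (f k) \<in> carrier T" if "k \<in> insert i I" for k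
  unfolding T_fields by (rule pres.class_closed) (use insert that in auto)
 then show ?case using insert by (subst T.finsum_insert) (auto simp: add_class keys_sum_subset)
qed

context galois_extension
begin

interpretation U: subalgebra sc UNIV
 by unfold_locales (fact scl | fact scr | simp)+

lemma tensor_words_A: "0 < m ==> tensor_words A m"
 by unfold_locales (rule A_module)

lemma mult_right_linear: "lin_map UNIV A A (\<lambda>x. x * b)"
 by (simp add: lin_map_def distrib_right scl)

definition "AAclass = presented_class (carrier A \<times> carrier A) (balanced_rel UNIV A (\<lambda>x r. r \<odot>\<^bsub>A\<^esub> x) A (\<lambda>r y. r \<odot>\<^bsub>A\<^esub> y))"

lemma AA_keys: "supp z \<subseteq> carrier A \<times> carrier A"
 by simp

lemma AAclass_closed: "AAclass z \<in> carrier AA.T"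
 unfolding AAclass_def AA.T_fields by (rule AA.pres.class_closed[OF AA_keys])

lemma AAclass_zero: "AAclass 0 = \<zero>\<^bsub>AA.T\<^esub>"
 unfolding AAclass_def AA.T_fields by (rule AA.pres.one_presented[symmetric])

lemma AAclass_pure: "AAclass (frag_of (x, y)) = AA.pr x y"
 unfolding AAclass_def pure_over_def ..

lemma AAclass_add: "AAclass a \<oplus>\<^bsub>AA.T\<^esub> AAclass b = AAclass (a + b)"
 unfolding AAclass_def by (rule AA.add_class[OF AA_keys AA_keys])

lemma AAclass_sum: "finite I ==> (\<Oplus>\<^bsub>AA.T\<^esub>i\<in>I. AAclass (f i)) = AAclass (\<Sum>i\<in>I. f i)"
 unfolding AAclass_def by (rule AA.finsum_class[OF _ AA_keys])

lemma class_rep_l: "AAclass (rep (l c)) = l c"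
proof -
 obtain z where z: "l c = AAclass z" using l_closed[of c] unfolding AA.T_fields AAclass_def by (rule AA.pres.presentedE)
 show ?thesis unfolding z unfolding AAclass_def by (rule AA.pres.class_rep)
qed

lemma cyclic_mult_words: "length ws = Suc m ==> cyclic_mult ws \<in> words A (Suc m)"
 by (simp add: words_def)

lemma connection_frag_keys: "length zs = Suc m ==> supp (connection_frag zs) \<subseteq> words A (Suc m)"
 unfolding connection_frag_def
 by (rule keys_frag_extend_subset[OF expand_keys]) (simp add: cyclic_mult_words)

text \<open>Left and right components of a letter enter different products, except in words of length one, where they enter the two sides of the same product.\<close>

lemma connection_bilinear:
 assumes zs: "length zs = Suc m" and i: "i < Suc m"
 shows "bilinear A A (power_module A (Suc m)) (\<lambda>x y. power_class A (Suc m) (connection_frag (zs[i := frag_of (x, y)])))"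
proof -
 interpret T: tensor_words A "Suc m" by (rule tensor_words_A) simp
 let ?y = "expand (zs[i := frag_of (0, 0)])"
 have k: "supp ?y \<subseteq> {ws. length ws = Suc m}" using expand_keys[of "zs[i := frag_of (0, 0)]"] zs by simp
 have e: "connection_frag (zs[i := frag_of w]) = frag_extend (\<lambda>ws. frag_of (cyclic_mult (ws[i := w]))) ?y" for w
  by (rule connection_frag_slot) (use zs i in simp)
 show ?thesis unfolding bilinear_def e
 proof (intro conjI ballI)
  fix x
  show "lin_map UNIV A T.TP (\<lambda>y. T.pc (frag_extend (\<lambda>ws. frag_of (cyclic_mult (ws[i := (x, y)]))) ?y))"
  proof (rule T.frag_extend_linear[OF k])
   fix ws :: "('p \<times> 'p) list" assume ws: "ws \<in> {ws. length ws = Suc m}"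
   then show "T.keysW (frag_of (cyclic_mult (ws[i := (x, y)])))" for y by (simp add: cyclic_mult_words)
   let ?j = "if i = m then 0 else Suc i"
   have w: "cyclic_mult (ws[i := (x, 0)]) \<in> words A (Suc m)" by (rule cyclic_mult_words) (use ws in simp)
   define G where "G y = (cyclic_mult (ws[i := (x, 0)]))[?j := y * fst (ws[i := (x, 0)] ! ?j)]" for y
   have eq: "cyclic_mult (ws[i := (x, y)]) = G y" for y
    unfolding G_def by (rule cyclic_mult_right_slot) (use ws i in auto)
   show "lin_map UNIV A T.TP (\<lambda>y. T.pc (frag_of (cyclic_mult (ws[i := (x, y)]))))"
    unfolding eq unfolding G_def by (rule lin_map_comp[OF mult_right_linear T.slot_linear[OF w]]) (use i in auto)
  qed
 next
  fix y
  show "lin_map UNIV A T.TP (\<lambda>x. T.pc (frag_extend (\<lambda>ws. frag_of (cyclic_mult (ws[i := (x, y)]))) ?y))"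
  proof (rule T.frag_extend_linear[OF k])
   fix ws :: "('p \<times> 'p) list" assume ws: "ws \<in> {ws. length ws = Suc m}"
   then show "T.keysW (frag_of (cyclic_mult (ws[i := (x, y)])))" for x by (simp add: cyclic_mult_words)
   let ?j = "if i = 0 then m else i - 1"
   have w: "cyclic_mult (ws[i := (0, y)]) \<in> words A (Suc m)" by (rule cyclic_mult_words) (use ws in simp)
   define G where "G x = (cyclic_mult (ws[i := (0, y)]))[i := snd (ws[i := (0, y)] ! ?j) * x]" for x
   have eq: "cyclic_mult (ws[i := (x, y)]) = G x" for x
    unfolding G_def by (rule cyclic_mult_left_slot) (use ws i in auto)
   show "lin_map UNIV A T.TP (\<lambda>x. T.pc (frag_of (cyclic_mult (ws[i := (x, y)]))))"
    unfolding eq unfolding G_def by (rule lin_map_comp[OF mult_linear T.slot_linear[OF w i]])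
  qed
 qed
qed

text \<open>The value of the connection map as a function of the class in one slot, which makes the choice of representatives in \<open>expand\<close> immaterial.\<close>

definition "slot_map m zs i = tensor_lift (power_module A (Suc m))
 (\<lambda>(x, y). power_class A (Suc m) (connection_frag (zs[i := frag_of (x, y)])))"

lemma
 assumes zs: "length zs = Suc m" and i: "i < Suc m"
 shows slot_map_linear: "lin_map UNIV AA.T (power_module A (Suc m)) (slot_map m zs i)"
  and slot_map_class: "slot_map m zs i (AAclass z) = power_class A (Suc m) (connection_frag (zs[i := z]))"
proof -
 interpret T: tensor_words A "Suc m" by (rule tensor_words_A) simp
 interpret G: abelian_group T.TP by (rule T.TP_group)
 let ?s = "slot_map m zs i"
 show lin: "lin_map UNIV AA.T T.TP ?s"
  unfolding slot_map_def by (rule AA.tensor_lift_linear[OF T.left_module_TP connection_bilinear[OF zs i]])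
 have k: "T.keysW (connection_frag (zs[i := z]))" for z by (rule connection_frag_keys) (use zs in simp)
 have "supp z \<subseteq> carrier A \<times> carrier A" by simp
 then show "?s (AAclass z) = T.pc (connection_frag (zs[i := z]))"
 proof (induction z rule: keys_induct)
  case zero
  show ?case
   using lin_map_zero[OF AA.left_module_T T.left_module_TP lin] connection_frag_zero[of i zs] zs i by (simp add: T.TP_zero AAclass_zero)
 next
  case (gen w)
  obtain x y where w: "w = (x, y)" by (cases w)
  show ?case unfolding w slot_map_def AAclass_pure
   by (rule AA.lift_pure[OF T.left_module_TP connection_bilinear[OF zs i]]) simp_all
 next
  case (diff a b)
  note c = AAclass_closed
  have "?s (AAclass (a - b)) \<oplus>\<^bsub>T.TP\<^esub> ?s (AAclass b) = ?s (AAclass a)"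
   using lin_map_add[OF lin c c, of "a - b" b] by (simp add: AAclass_add)
  moreover have "T.pc (connection_frag (zs[i := a - b])) \<oplus>\<^bsub>T.TP\<^esub> T.pc (connection_frag (zs[i := b])) = T.pc (connection_frag (zs[i := a]))"
   unfolding T.TP_add[OF k k] using connection_frag_diff[of i zs a b] zs i by simp
  ultimately show ?case
   using diff(3,4) lin_map_closed[OF lin c] T.pc_closed[OF k] by (metis G.add.right_cancel)
 qed
qed

lemma connection_frag_class_cong:
 assumes "length zs = Suc m" "length zs' = Suc m" "\<And>i. i < Suc m ==> AAclass (zs ! i) = AAclass (zs' ! i)"
 shows "power_class A (Suc m) (connection_frag zs) = power_class A (Suc m) (connection_frag zs')"
proof -
 have "k \<le> Suc m ==> power_class A (Suc m) (connection_frag (take k zs' @ drop k zs)) = power_class A (Suc m) (connection_frag zs)" for k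
 proof (induction k)
  case (Suc k)
  let ?w = "take k zs' @ drop k zs"
  have w: "length ?w = Suc m" and k: "k < Suc m" using Suc.prems assms by auto
  have "take (Suc k) zs' @ drop (Suc k) zs = ?w[k := zs' ! k]"
   using Suc.prems assms by (intro nth_equalityI) (auto simp: nth_append nth_list_update min_def)
  moreover have "?w = ?w[k := zs ! k]"
   using Suc.prems assms by (intro nth_equalityI) (auto simp: nth_append nth_list_update min_def)
  ultimately show ?case
   using slot_map_class[OF w k, of "zs ! k"] slot_map_class[OF w k, of "zs' ! k"] assms(3)[OF k] Suc by simp
 qed simp
 from this[of "Suc m"] assms show ?thesis by simp
qed

lemma connection_map_class:
 assumes z: "z = (\<Sum>i\<in>I. frag_of (w i))" and I: "finite I" and w: "\<And>i. i \<in> I ==> length (w i) = Suc m"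
 shows "connection_map P l m (power_class S (Suc m) z) =
  power_class A (Suc m) (\<Sum>i\<in>I. connection_frag (map (\<lambda>c. rep (l c)) (w i)))"
proof -
 interpret T: tensor_words A "Suc m" by (rule tensor_words_A) simp
 interpret TS: tensor_words S "Suc m" by unfold_locales (rule S_module, simp)
 let ?G = "tensor_power A (Suc m)"
 let ?K = "\<lambda>cs. T.pc (connection_frag (map (\<lambda>c. rep (l c)) cs))"
 have G: "comm_group ?G" unfolding tensor_power_def by (rule U.T.comm_group_presented)
 have kk: "T.keysW (connection_frag (map (\<lambda>c. rep (l c)) cs))" if "length cs = Suc m" for cs
  by (rule connection_frag_keys) (use that in simp)
 have K: "?K \<in> words S (Suc m) \<rightarrow> carrier ?G"
  using T.pc_closed[OF kk] by (auto simp: words_def power_module_def)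
 have lin: "lin_map UNIV S T.TP (\<lambda>c. ?K (cs[i := c]))" if "length cs = Suc m" "i < Suc m" for cs i
 proof -
  have "?K (cs[i := c]) = slot_map m (map (\<lambda>c. rep (l c)) cs) i (l c)" for c
   using slot_map_class[of "map (\<lambda>c. rep (l c)) cs" m i "rep (l c)"] that by (simp add: map_update class_rep_l)
  then show ?thesis using lin_map_comp[OF l_linear slot_map_linear[of "map (\<lambda>c. rep (l c)) cs" m i]] that by simp
 qed
 have kills: "frag_eval ?G ?K r = \<one>\<^bsub>?G\<^esub>" if "r \<in> multilinear_rel S (Suc m)" for r
 proof -
  from that consider xs i x y where "xs \<in> words S (Suc m)" "i < Suc m"
    "r = frag_of (xs[i := x + y]) - frag_of (xs[i := x]) - frag_of (xs[i := y])"
   | xs i j a where "xs \<in> words S (Suc m)" "i < Suc m" "j < Suc m"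
    "r = frag_of (xs[i := a \<odot>\<^bsub>S\<^esub> (xs ! i)]) - frag_of (xs[j := a \<odot>\<^bsub>S\<^esub> (xs ! j)])"
   unfolding multilinear_rel_def by auto
  then show ?thesis
  proof cases
   case 1
   have len: "length xs = Suc m" using 1(1) by (rule words_length)
   have c: "?K (xs[i := v]) \<in> carrier ?G" for v
    using K words_update[OF 1(1), of v i] by auto
   have "?K (xs[i := x + y]) = ?K (xs[i := x]) \<otimes>\<^bsub>?G\<^esub> ?K (xs[i := y])"
    using lin_map_add[OF lin[OF len 1(2)], of x y] by (simp add: power_module_def)
   then show ?thesis unfolding 1(3) by (intro comm_group.frag_eval_triple_one[OF G] c)
  next
   case 2
   have len: "length xs = Suc m" using 2(1) by (rule words_length)
   have c: "?K (xs[i := v]) \<in> carrier ?G" for i v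
    using K words_update[OF 2(1), of v i] by auto
   have s: "?K (xs[i := a \<odot>\<^bsub>S\<^esub> (xs ! i)]) = a \<odot>\<^bsub>T.TP\<^esub> ?K xs" if "i < Suc m" for i
    using lin_map_smult[OF lin[OF len that] UNIV_I, of "xs ! i" a] by simp
   show ?thesis unfolding 2(4) by (intro comm_group.frag_eval_pair_one[OF G] c) (simp only: s[OF 2(2)] s[OF 2(3)])
  qed
 qed
 have kz: "TS.keysW z" unfolding z by (rule keys_sum_subset) (use w in \<open>simp add: words_def\<close>)
 have "connection_map P l m (power_class S (Suc m) z) = lift_hom ?G ?K (power_class S (Suc m) z)"
  unfolding connection_map_def connection_frag_def Suc_eq_plus1 ..
 also have "\<dots> = frag_eval ?G ?K z"
  unfolding power_class_presented[of S] by (rule TS.W.lift_hom_class[OF G K kills kz])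
 also have "\<dots> = finprod ?G (\<lambda>i. ?K (w i)) I"
  unfolding z by (rule comm_group.frag_eval_sum_of[OF G K I]) (use w in \<open>simp add: words_def\<close>)
 also have "\<dots> = T.pc (\<Sum>i\<in>I. connection_frag (map (\<lambda>c. rep (l c)) (w i)))"
  unfolding tensor_power_def power_class_presented by (rule U.T.finprod_class[OF I kk[OF w]])
 finally show ?thesis .
qed

lemma multilinear_sum:
 "(\<Sum>is\<in>idx d (length fs). frag_of (pre @ map2 (\<lambda>f i. f i) fs is)) - frag_of (pre @ map (\<lambda>f. \<Sum>i<d. f i) fs)
  \<in> pspan A (length pre + length fs)"
proof (induction fs arbitrary: pre)
 case Nil
 show ?case by (simp add: idx_zero U.T.rspan_zero)
next
 case (Cons f fs)
 let ?n = "length pre + length (f # fs)"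
 let ?t = "map (\<lambda>f. \<Sum>i<d. f i) fs"
 have "(\<Sum>i<d. (\<Sum>is\<in>idx d (length fs). frag_of ((pre @ [f i]) @ map2 (\<lambda>f i. f i) fs is)) - frag_of ((pre @ [f i]) @ ?t)) \<in> pspan A ?n"
  by (rule U.T.rspan_sum) (use Cons[of "pre @ [f _]"] in simp)
 moreover have "(\<Sum>i<d. frag_of ((pre @ [f i]) @ ?t)) - frag_of ((pre @ [\<Sum>i<d. f i]) @ ?t) \<in> pspan A ?n"
  using U.word_sum_rel[of "pre @ [0] @ ?t" ?n "length pre" "{..<d}" f] by (simp add: words_def)
 ultimately have "(\<Sum>i<d. \<Sum>is\<in>idx d (length fs). frag_of ((pre @ [f i]) @ map2 (\<lambda>f i. f i) fs is)) - frag_of ((pre @ [\<Sum>i<d. f i]) @ ?t) \<in> pspan A ?n"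
  unfolding sum_subtractf by (rule U.T.rspan_trans)
 then show ?case by (simp add: sum_idx_Suc)
qed

end

context galois_corep
begin

interpretation U: subalgebra sc UNIV
 by unfold_locales (fact scl | fact scr | simp)+

text \<open>Both index sums run over cycles; the product across letters \<open>p - 1\<close> and \<open>p\<close> pairs \<open>h\<close> and \<open>a\<close> at the same \<open>e\<close>-index, so the sum over that index can be taken inside the entry. The remaining word is read one step earlier, hence the rotation.\<close>

lemma connection_map_trace:
 assumes l: "\<And>i j. i < d ==> j < d ==> l (ec i j) = (\<Oplus>\<^bsub>AA.T\<^esub>\<mu>\<in>{..<M}. pure A A (a i \<mu>) (h \<mu> j))"
 shows "connection_map P l m (power_class S (Suc m) (trace_chain d ec m)) =
  power_class A (Suc m) (trace_chain M (\<lambda>\<mu> \<nu>. \<Sum>i<d. h \<mu> i * a i \<nu>) m)"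
proof -
 let ?n = "Suc m" and ?E = "\<lambda>\<mu> \<nu>. \<Sum>i<d. h \<mu> i * a i \<nu>"
 interpret T: tensor_words A ?n by (rule tensor_words_A) simp
 define nx where "nx p = (if Suc p = ?n then 0 else Suc p)" for p
 let ?w = "\<lambda>is. cword (replicate ?n ec) is"
 let ?g = "\<lambda>is. map (\<lambda>p \<mu>. (a (is ! p) \<mu>, h \<mu> (is ! nx p))) [0..<?n]"
 let ?word = "\<lambda>\<mu>s is. map2 (\<lambda>f i. f i) (map (\<lambda>p i. h (rot \<mu>s ! p) i * a i (\<mu>s ! p)) [0..<?n]) is"
 have len: "length is = ?n" if "is \<in> idx N ?n" for N "is" using idx_length[OF that] .
 have nxt: "is ! nx p < N" if "is \<in> idx N ?n" "p < ?n" for N "is" p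
  using idx_nth[OF that(1)] that(2) by (auto simp: nx_def)
 have "power_class A ?n (connection_frag (map (\<lambda>c. rep (l c)) (?w is))) =
   power_class A ?n (connection_frag (map (\<lambda>g. \<Sum>\<mu><M. frag_of (g \<mu>)) (?g is)))" if "is": "is \<in> idx d ?n" for "is"
 proof (rule connection_frag_class_cong)
  fix p assume p: "p < ?n"
  have "AAclass (\<Sum>\<mu><M. frag_of (a (is ! p) \<mu>, h \<mu> (is ! nx p))) = l (ec (is ! p) (is ! nx p))"
   unfolding l[OF idx_nth[OF "is" p] nxt[OF "is" p]] AAclass_pure[symmetric] by (rule AAclass_sum[symmetric]) simp
  moreover have "?w is ! p = ec (is ! p) (is ! nx p)" using p by (subst cword_nth) (auto simp: nx_def simp del: replicate.simps)
  ultimately show "AAclass (map (\<lambda>c. rep (l c)) (?w is) ! p) = AAclass (map (\<lambda>g. \<Sum>\<mu><M. frag_of (g \<mu>)) (?g is) ! p)"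
   using p by (simp add: class_rep_l del: upt_Suc replicate.simps)
 qed (simp_all del: replicate.simps upt_Suc)
 then have reps: "connection_frag (map (\<lambda>c. rep (l c)) (?w is)) - connection_frag (map (\<lambda>g. \<Sum>\<mu><M. frag_of (g \<mu>)) (?g is)) \<in> pspan A ?n"
  if "is \<in> idx d ?n" for "is"
  using that unfolding T.pc_eq_iff by blast
 have cyc: "cyclic_mult (map2 (\<lambda>g \<mu>. g \<mu>) (?g is) \<mu>s) = ?word \<mu>s is" if "is \<in> idx d ?n" "\<mu>s \<in> idx M ?n" for "is" \<mu>s
 proof (rule nth_equalityI)
  note L = len[OF that(1)] len[OF that(2)]
  show "length (cyclic_mult (map2 (\<lambda>g \<mu>. g \<mu>) (?g is) \<mu>s)) = length (?word \<mu>s is)"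
   using L by (subst length_cyclic_mult[of _ m]) (simp_all del: upt_Suc)
  fix p assume "p < length (cyclic_mult (map2 (\<lambda>g \<mu>. g \<mu>) (?g is) \<mu>s))"
  then have p: "p < ?n" using L by (subst (asm) length_cyclic_mult[of _ m]) (simp_all del: upt_Suc)
  have "\<mu>s \<noteq> []" using L by auto
  then have "rot \<mu>s ! p = \<mu>s ! (if p = 0 then m else p - 1)" using L p by (simp add: rot_nth)
  moreover have "nx (if p = 0 then m else p - 1) = p" using p by (auto simp: nx_def)
  ultimately show "cyclic_mult (map2 (\<lambda>g \<mu>. g \<mu>) (?g is) \<mu>s) ! p = ?word \<mu>s is ! p"
   using L p by (subst cyclic_mult_nth[of _ m]) (auto simp del: upt_Suc)
 qed
 have word: "map (\<lambda>f. \<Sum>i<d. f i) (map (\<lambda>p i. h (rot \<mu>s ! p) i * a i (\<mu>s ! p)) [0..<?n]) = cword (replicate ?n ?E) (rot \<mu>s)"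
  if "\<mu>s \<in> idx M ?n" for \<mu>s
 proof (rule nth_equalityI)
  note L = len[OF that]
  fix p assume "p < length (map (\<lambda>f. \<Sum>i<d. f i) (map (\<lambda>p i. h (rot \<mu>s ! p) i * a i (\<mu>s ! p)) [0..<?n]))"
  then have p: "p < ?n" by (simp del: upt_Suc)
  have "rot \<mu>s ! (if Suc p = ?n then 0 else Suc p) = \<mu>s ! p" using L p by (auto simp: rot_nth)
  then show "map (\<lambda>f. \<Sum>i<d. f i) (map (\<lambda>p i. h (rot \<mu>s ! p) i * a i (\<mu>s ! p)) [0..<?n]) ! p = cword (replicate ?n ?E) (rot \<mu>s) ! p"
   using p by (subst cword_nth) (simp_all del: upt_Suc replicate.simps)
 qed (simp del: upt_Suc replicate.simps)
 have step: "(\<Sum>is\<in>idx d ?n. frag_of (?word \<mu>s is)) - frag_of (cword (replicate ?n ?E) (rot \<mu>s)) \<in> pspan A ?n"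
  if "\<mu>s \<in> idx M ?n" for \<mu>s
  using multilinear_sum[where pre = "[]" and d = d and fs = "map (\<lambda>p i. h (rot \<mu>s ! p) i * a i (\<mu>s ! p)) [0..<?n]"]
  unfolding word[OF that] by (simp del: upt_Suc replicate.simps)
 have "connection_map P l m (power_class S ?n (trace_chain d ec m)) =
   T.pc (\<Sum>is\<in>idx d ?n. connection_frag (map (\<lambda>c. rep (l c)) (?w is)))"
  by (rule connection_map_class[OF _ finite_idx]) (simp_all add: trace_chain_eq tr_def del: replicate.simps)
 also have "\<dots> = T.pc (\<Sum>is\<in>idx d ?n. connection_frag (map (\<lambda>g. \<Sum>\<mu><M. frag_of (g \<mu>)) (?g is)))"
  unfolding T.pc_eq_iff sum_subtractf[symmetric] by (rule U.T.rspan_sum) (rule reps)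
 also have "(\<Sum>is\<in>idx d ?n. connection_frag (map (\<lambda>g. \<Sum>\<mu><M. frag_of (g \<mu>)) (?g is))) =
   (\<Sum>is\<in>idx d ?n. \<Sum>\<mu>s\<in>idx M ?n. frag_of (?word \<mu>s is))"
 proof (rule sum.cong[OF refl])
  fix "is" assume "is": "is \<in> idx d ?n"
  have "connection_frag (map (\<lambda>g. \<Sum>\<mu><M. frag_of (g \<mu>)) (?g is)) =
    (\<Sum>\<mu>s\<in>idx M ?n. frag_of (cyclic_mult (map2 (\<lambda>g \<mu>. g \<mu>) (?g is) \<mu>s)))"
   unfolding connection_frag_def expand_sums by (simp add: frag_extend_sum del: upt_Suc)
  also have "\<dots> = (\<Sum>\<mu>s\<in>idx M ?n. frag_of (?word \<mu>s is))"
   by (rule sum.cong[OF refl]) (simp only: cyc[OF "is"])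
  finally show "connection_frag (map (\<lambda>g. \<Sum>\<mu><M. frag_of (g \<mu>)) (?g is)) = (\<Sum>\<mu>s\<in>idx M ?n. frag_of (?word \<mu>s is))" .
 qed
 also have "\<dots> = (\<Sum>\<mu>s\<in>idx M ?n. \<Sum>is\<in>idx d ?n. frag_of (?word \<mu>s is))" by (rule sum.swap)
 also have "T.pc \<dots> = T.pc (\<Sum>\<mu>s\<in>idx M ?n. frag_of (cword (replicate ?n ?E) (rot \<mu>s)))"
  unfolding T.pc_eq_iff sum_subtractf[symmetric] by (rule U.T.rspan_sum) (rule step)
 also have "(\<Sum>\<mu>s\<in>idx M ?n. frag_of (cword (replicate ?n ?E) (rot \<mu>s))) = trace_chain M ?E m"
  unfolding trace_chain_eq tr_def length_replicate
  by (rule sum.reindex_bij_betw[OF rot_bij_idx]) simp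
 finally show ?thesis .
qed

end

section \<open>The Chern-Galois character\<close>

lemma slotwise_map:
 assumes f: "lin_map UNIV V W f"
 shows "slotwise V m W m (map f)"
 unfolding slotwise_def
proof (intro conjI ballI allI impI)
 show "map f \<in> words V m \<rightarrow> words W m"
  by (auto simp: words_iff_nth lin_map_closed[OF f])
 show "\<exists>j<m. \<exists>\<phi>. lin_map UNIV V W \<phi> \<and> (\<forall>v\<in>carrier V. map f (xs[i := v]) = (map f xs)[j := \<phi> v])"
  if "i < m" for xs i
  using that f by (intro exI[of _ i] exI[of _ f] conjI) (auto simp: map_update)
qed

context galois_extension
begin

interpretation U: subalgebra sc UNIV
 by unfold_locales (fact scl | fact scr | simp)+

lemma inclusion_linear: "lin_map UNIV SB.M A (\<lambda>x. x)"
 by (simp add: lin_map_def)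

lemma power_incl_class:
 assumes "supp z \<subseteq> words SB.M m"
 shows "power_incl P m (power_class SB.M m z) = power_class A m z"
 using slotwise_lift_hom[OF SB.left_module_M A_module slotwise_map[OF inclusion_linear] assms]
 unfolding power_incl_def list.map_ident frag_extend_of .

lemma base_retraction:
 "\<exists>\<pi>. lin_map UNIV A SB.M \<pi> \<and> (\<forall>b\<in>Bc. \<pi> b = b)"
proof -
 interpret PP: vector_space_pair sc sc by unfold_locales
 have "P.subspace Bc"
  by (simp add: P.subspace_def SB.zero_mem SB.add_mem SB.scale_mem)
 moreover have "Vector_Spaces.linear sc sc (\<lambda>x. x)"
  by unfold_locales simp_all
 ultimately obtain \<pi> where \<pi>: "\<pi> ` UNIV \<subseteq> Bc" "Vector_Spaces.linear sc sc \<pi>" "\<forall>b\<in>Bc. \<pi> b = b"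
  using PP.linear_exists_left_inverse_on[of "\<lambda>x. x" Bc] by (auto simp: inj_on_def)
 have "\<pi> (x + y) = \<pi> x + \<pi> y" "\<pi> (sc r x) = sc r (\<pi> x)" for x y r
  using module_hom.add[OF Vector_Spaces.linear.axioms(3)[OF \<pi>(2)]] module_hom.scale[OF Vector_Spaces.linear.axioms(3)[OF \<pi>(2)]] by auto
 then have "lin_map UNIV A SB.M \<pi>"
  using \<pi>(1) by (auto simp: lin_map_def)
 then show ?thesis using \<pi>(3) by (intro exI conjI)
qed

text \<open>A linear projection of \<open>P\<close> onto \<open>B\<close>, applied to each letter, is a left inverse.\<close>

lemma power_incl_inj: "inj_on (power_incl P m) (carrier (tensor_power SB.M m))"
proof (rule inj_onI)
 from base_retraction obtain \<pi> where \<pi>: "lin_map UNIV A SB.M \<pi>" "\<forall>b\<in>Bc. \<pi> b = b" by (elim exE conjE)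
 fix x y assume x: "x \<in> carrier (tensor_power SB.M m)" and y: "y \<in> carrier (tensor_power SB.M m)"
  and eq: "power_incl P m x = power_incl P m y"
 obtain a where a: "supp a \<subseteq> words SB.M m" "x = power_class SB.M m a" using SB.tensor_powerE[OF x] .
 obtain b where b: "supp b \<subseteq> words SB.M m" "y = power_class SB.M m b" using SB.tensor_powerE[OF y] .
 have "a - b \<in> pspan A m"
 proof -
  have "power_class A m a = power_class A m b"
   using eq unfolding a(2) b(2) power_incl_class[OF a(1)] power_incl_class[OF b(1)] .
  then show ?thesis unfolding power_class_presented by (simp only: U.T.class_eq_iff)
 qed
 then have "frag_extend (\<lambda>xs. frag_of (map \<pi> xs)) (a - b) \<in> pspan SB.M m"
  by (rule presentation_map.rspan_to_span[OF slotwise_presentation_map[OF A_module SB.left_module_M slotwise_map[OF \<pi>(1)]]])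
 moreover have "frag_extend (\<lambda>xs. frag_of (map \<pi> xs)) z = z" if "supp z \<subseteq> words SB.M m" for z
  using that
 proof (induction z rule: keys_induct)
  case (gen xs)
  then have "map \<pi> xs = xs" by (intro map_idI) (use \<pi>(2) in \<open>auto simp: words_def\<close>)
  then show ?case by simp
 qed (simp_all add: frag_extend_diff)
 ultimately have "a - b \<in> pspan SB.M m" using keys_diff_subset[OF a(1) b(1)] by simp
 then show "x = y"
  unfolding a(2) b(2) power_class_presented by (simp only: SB.T.class_eq_iff)
qed

end

context galois_corep
begin

lemma chern_galois_formula:
 assumes V: "comodule C V" "comodule_basis C V d e ec"
 shows "\<exists>z\<in>carrier (tensor_power SB.M (Suc (2 * n))).
  power_incl P (Suc (2 * n)) z = connection_map P l (2 * n) (iter_comult C (2 * n) (\<Sum>i<d. ec i i)) \<and>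
  connes_class sc Bc (2 * n) z \<in> connes_cycles sc Bc (2 * n) \<and>
  chern_galois C P n (Rf_class C V) = HC_class sc Bc (2 * n) z [^]\<^bsub>HC sc Bc (2 * n)\<^esub> ((- 1) ^ n :: int)"
proof -
 obtain M :: nat and a h where l: "\<And>i j. i < d ==> j < d ==> l (ec i j) = (\<Oplus>\<^bsub>AA.T\<^esub>\<mu>\<in>{..<M}. pure A A (a i \<mu>) (h \<mu> j))"
  and r: "retract Bc tuple_module M (\<lambda>f \<mu>. if \<mu> < M then \<Sum>j<d. f j * a j \<mu> else 0) (\<lambda>b j. \<Sum>\<mu><M. b \<mu> * h \<mu> j)"
  by (rule tuple_retract) blast
 define E where "E = retract_matrix (\<lambda>f \<mu>. if \<mu> < M then \<Sum>j<d. f j * a j \<mu> else 0) (\<lambda>b j. \<Sum>\<mu><M. b \<mu> * h \<mu> j)"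
 have id: "idempotent_matrix Bc M E" unfolding E_def by (rule SB.retract_idempotent[OF r])
 have E: "E \<mu> \<nu> = (\<Sum>i<d. h \<mu> i * a i \<nu>)" if "\<mu> < M" "\<nu> < M" for \<mu> \<nu>
  using that by (simp add: E_def retract_matrix_def unit_row_def if_distrib[of "\<lambda>x. x * _"] sum.delta cong: if_cong)
 have tr: "trace_chain M (\<lambda>\<mu> \<nu>. \<Sum>i<d. h \<mu> i * a i \<nu>) (2 * n) = trace_chain M E (2 * n)"
  unfolding trace_chain_eq by (rule tr_cong) (simp_all add: E nth_replicate del: replicate.simps)
 have cm: "connection_map P l (2 * n) (power_class S (Suc (2 * n)) (trace_chain d ec (2 * n))) = power_class A (Suc (2 * n)) (trace_chain M E (2 * n))"
  unfolding tr[symmetric] by (rule connection_map_trace) (rule l)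
 note cyc = SB.trace_chain_cycle[OF id, of n]
 note k = SB.cycles_keys[OF cyc]
 let ?z = "power_class SB.M (Suc (2 * n)) (trace_chain M E (2 * n))"
 have "power_incl P (Suc (2 * n)) ?z = connection_map P l (2 * n) (iter_comult C (2 * n) (\<Sum>i<d. ec i i))"
  unfolding power_incl_class[OF k] K.iter_comult_character[OF corep] cm ..
 moreover have "connes_class sc Bc (2 * n) ?z \<in> connes_cycles sc Bc (2 * n)"
  using SB.ccls_cycles_iff[OF k] cyc unfolding SB.ccls_def by simp
 moreover have "chern_galois C P n (Rf_class C V) = HC_class sc Bc (2 * n) ?z [^]\<^bsub>HC sc Bc (2 * n)\<^esub> ((- 1) ^ n :: int)"
 proof -
  have "proj_iso_class Bc tuple_module = proj_iso_class Bc (matrix_module Bc M E)"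
   unfolding E_def by (rule proj_iso_class_cong[OF left_module_tuples SB.retract_iso[OF r]])
  then have "assoc_hom C P (Rf_class C V) = K0_class Bc (matrix_module Bc M E)"
   unfolding assoc_hom_class[OF V] by (simp add: K0_class_def)
  then show ?thesis
   unfolding chern_galois_def comp_def using SB.chern_spec(2)[OF id, of n]
   by (simp add: SB.chern_value_def SB.hcls_def)
 qed
 ultimately show ?thesis using SB.power_class_closed[OF k] by blast
qed

end

theorem mainTheorem6:
  fixes C :: "('k::field_char_0, 'c::ab_group_add) coalg"
    and P :: "('k, 'p::{ring,monoid_mult}, 'c) comod_alg"
    and V :: "('k, 'v, 'c) comod"
    and g :: 'c
    and l :: "'c \<Rightarrow> (('p \<times> 'p) \<Rightarrow>\<^sub>0 int) set"
    and d n :: nat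
    and e :: "nat \<Rightarrow> 'v"
    and ec :: "nat \<Rightarrow> nat \<Rightarrow> 'c"
  assumes "coalgebra C"
    and "algebra_comodule C P"
    and "principal_extension C P g"
    and "strong_connection C P g l"
    and "comodule C V"
    and "is_basis V d e"
    and "\<forall>j<d. coact V (e j)
           = (\<Oplus>\<^bsub>tensor V (coalg_space C)\<^esub>i\<in>{..<d}. pure V (coalg_space C) (e i) (ec i j))"
  shows "let B = coinvariants C P; s = alg_scale P;
             T = carrier (tensor_power (module_of s B) (2 * n + 1));
             c = (\<Sum>i<d. ec i i)
         in inj_on (power_incl P (2 * n + 1)) T \<and>
            (\<exists>z\<in>T. power_incl P (2 * n + 1) z
                     = connection_map P l (2 * n) (iter_comult C (2 * n) c) \<and>
                  connes_class s B (2 * n) z \<in> connes_cycles s B (2 * n) \<and>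
                  chern_galois C P n (Rf_class C V)
                    = HC_class s B (2 * n) z [^]\<^bsub>HC s B (2 * n)\<^esub> ((- 1) ^ n :: int))"
proof -
  interpret galois_extension C P g l by unfold_locales (rule assms)+
  have b: "comodule_basis C V d e ec" using assms(6,7) by (simp add: comodule_basis_def)
  interpret G: galois_corep C P g l d ec by unfold_locales (rule K.comodule_matrix[OF assms(5) b])
  show ?thesis unfolding Let_def Suc_eq_plus1[symmetric]
    by (intro conjI power_incl_inj G.chern_galois_formula[OF assms(5) b])
qed

end
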